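(* Let $M$ and $u$ be subharmonic functions on $\mathbb{C}$, $M\not\equiv-\infty$, $u\not\equiv-\infty$, both of finite type: $\limsup_{z\to\infty}M(z)/|z|<+\infty$ and $\limsup_{z\to\infty}u(z)/|z|<+\infty$. Let $\mu:=\frac{1}{2\pi}\Delta M$ and $\nu:=\frac{1}{2\pi}\Delta u$ be their Riesz measures. Let $q_0\colon\mathbb{R}\to[0,+\infty]$ be locally Lebesgue integrable, and let $q\colon\mathbb{R}\to[0,+\infty)$ be continuous with $\limsup_{|y|\to+\infty}q(y)/|y|<1$. Let $E\subset[0,+\infty)$ be Lebesgue measurable, and for $r>0$ put $E^r:=E\cap[0,r]$ and $$q_E(r):=\mathrm{mes}(E^r)\ln\frac{er}{\mathrm{mes}(E^r)}=:q_E(-r)$$ (with $q_E(r):=0$ if $\mathrm{mes}(E^r)=0$), where $\mathrm{mes}$ is Lebesgue measure on $\mathbb{R}$. Assume that for every $y\in[0,+\infty)\setminus E$ $$u(iy)+u(-iy)\le \mathsf C_M\bigl(iy,q(y)\bigr)+\mathsf C_M\bigl(-iy,q(-y)\bigr)+q_0(y)+q_0(-y).$$ Then for any numbers $r_0>0$ and $N\ge 0$ there exists $C\ge0$ such that for all $r_0\le r<R<+\infty$ $$\max\bigl\{l_\nu(r,R),J_{i\mathbb{R}}(r,R;u)\bigr\}\le \min\bigl\{l^{\mathrm{rh}}_\mu(r,R),l^{\mathrm{lh}}_\mu(r,R),J_{i\mathbb{R}}(r,R;M)\bigr\}+C\,J_{\mathbb{R}}(r,R;q_0+q_E)+C\,I_N(r,R;q)+C,$$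 where $$I_N(r,R;q):=\int_r^R t^N\sup_{s\ge t}\frac{q(s)+q(-s)}{s^{2+N}}\,dt.$$
   Context: For $z\in\mathbb{C}$, $r\ge0$ and a function $v$ on the circle $\{|z'-z|=r\}$: $\mathsf C_v(z,r):=\frac{1}{2\pi}\int_0^{2\pi}v(z+re^{i\theta})\,d\theta$. For a locally integrable $v$ on $\mathbb{R}$: $J_{\mathbb{R}}(r,R;v):=\frac{1}{2\pi}\int_r^R\frac{v(x)+v(-x)}{x^2}\,dx$; for $v$ locally integrable on $i\mathbb{R}$: $J_{i\mathbb{R}}(r,R;v):=\frac{1}{2\pi}\int_r^R\frac{v(-iy)+v(iy)}{y^2}\,dy$ ($0<r<R<+\infty$). For a positive Borel measure $\mu$ on $\mathbb{C}$ and $0<r<R<+\infty$: $l^{\mathrm{rh}}_\mu(r,R):=\int_{r<|z|\le R,\ \mathrm{Re}\,z>0}\mathrm{Re}\frac1z\,d\mu(z)$, $l^{\mathrm{lh}}_\mu(r,R):=\int_{r<|z|\le R,\ \mathrm{Re}\,z<0}\mathrm{Re}\bigl(-\frac1z\bigr)\,d\mu(z)$, and $l_\mu(r,R):=\max\{l^{\mathrm{lh}}_\mu(r,R),l^{\mathrm{rh}}_\mu(r,R)\}$. The Laplacian is taken in the sense of distributions. *)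

theory Defs
  imports "HOL-Analysis.Analysis"
begin

definition ereal_int :: "'a measure \<Rightarrow> 'a set \<Rightarrow> ('a \<Rightarrow> ereal) \<Rightarrow> ereal" where
  "ereal_int M A f =
     enn2ereal (\<integral>\<^sup>+ x. e2ennreal (f x) * indicator A x \<partial>M)
   - enn2ereal (\<integral>\<^sup>+ x. e2ennreal (- f x) * indicator A x \<partial>M)"

definition circ_mean :: "(complex \<Rightarrow> ereal) \<Rightarrow> complex \<Rightarrow> real \<Rightarrow> ereal" where
  "circ_mean v z r =
     ereal_int lebesgue {0..2*pi} (\<lambda>\<theta>. v (z + of_real r * cis \<theta>)) / ereal (2*pi)"

definition subharmonic :: "(complex \<Rightarrow> ereal) \<Rightarrow> bool" where
  "subharmonic u \<longleftrightarrow>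
     (\<forall>z. u z < \<infinity>) \<and>
     (\<forall>z. Limsup (at z) u \<le> u z) \<and>
     (\<forall>z. \<exists>r0>0. \<forall>r. 0 < r \<and> r < r0 \<longrightarrow> u z \<le> circ_mean u z r)"

definition dder :: "complex \<Rightarrow> (complex \<Rightarrow> real) \<Rightarrow> complex \<Rightarrow> real" where
  "dder d f z = deriv (\<lambda>t. f (z + of_real t * d)) 0"

definition iter_dder :: "complex list \<Rightarrow> (complex \<Rightarrow> real) \<Rightarrow> complex \<Rightarrow> real" where
  "iter_dder ds f = foldr dder ds f"

definition smooth_fun :: "(complex \<Rightarrow> real) \<Rightarrow> bool" where
  "smooth_fun f \<longleftrightarrow>
     (\<forall>ds \<in> lists {1, \<i>}. continuous_on UNIV (iter_dder ds f) \<and>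
        (\<forall>d \<in> {1, \<i>}. \<forall>z. (\<lambda>t. iter_dder ds f (z + of_real t * d)) differentiable (at 0)))"

definition test_fun :: "(complex \<Rightarrow> real) \<Rightarrow> bool" where
  "test_fun f \<longleftrightarrow> smooth_fun f \<and> compact (closure {z. f z \<noteq> 0})"

definition laplacian :: "(complex \<Rightarrow> real) \<Rightarrow> complex \<Rightarrow> real" where
  "laplacian f z = dder 1 (dder 1 f) z + dder \<i> (dder \<i> f) z"

definition riesz_measure :: "(complex \<Rightarrow> ereal) \<Rightarrow> complex measure \<Rightarrow> bool" where
  "riesz_measure M \<mu> \<longleftrightarrow>
     sets \<mu> = sets borel \<and>
     (\<forall>R. emeasure \<mu> (cball 0 R) < \<infinity>) \<and>
     (\<forall>\<phi>. test_fun \<phi> \<longrightarrow>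
        (\<integral>z. real_of_ereal (M z) * laplacian \<phi> z \<partial>lborel) = 2 * pi * (\<integral>z. \<phi> z \<partial>\<mu>))"

definition J_R :: "real \<Rightarrow> real \<Rightarrow> (real \<Rightarrow> ereal) \<Rightarrow> ereal" where
  "J_R r R v = ereal_int lebesgue {r..R} (\<lambda>x. (v x + v (- x)) / ereal (x^2)) / ereal (2*pi)"

definition J_iR :: "real \<Rightarrow> real \<Rightarrow> (complex \<Rightarrow> ereal) \<Rightarrow> ereal" where
  "J_iR r R v = ereal_int lebesgue {r..R}
      (\<lambda>y. (v (- \<i> * of_real y) + v (\<i> * of_real y)) / ereal (y^2)) / ereal (2*pi)"

definition l_rh :: "complex measure \<Rightarrow> real \<Rightarrow> real \<Rightarrow> real" where
  "l_rh \<mu> r R = (\<integral>z. indicator {z. r < cmod z \<and> cmod z \<le> R \<and> Re z > 0} z * Re (1 / z) \<partial>\<mu>)"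

definition l_lh :: "complex measure \<Rightarrow> real \<Rightarrow> real \<Rightarrow> real" where
  "l_lh \<mu> r R = (\<integral>z. indicator {z. r < cmod z \<and> cmod z \<le> R \<and> Re z < 0} z * Re (- 1 / z) \<partial>\<mu>)"

definition l_meas :: "complex measure \<Rightarrow> real \<Rightarrow> real \<Rightarrow> real" where
  "l_meas \<mu> r R = max (l_lh \<mu> r R) (l_rh \<mu> r R)"

definition qE :: "real set \<Rightarrow> real \<Rightarrow> real" where
  "qE E x = (let m = measure lebesgue (E \<inter> {0..\<bar>x\<bar>}) in
              if m = 0 then 0 else m * ln (exp 1 * \<bar>x\<bar> / m))"

definition I_N :: "real \<Rightarrow> real \<Rightarrow> real \<Rightarrow> (real \<Rightarrow> real) \<Rightarrow> ereal" where
  "I_N N r R q = enn2ereal (\<integral>\<^sup>+ t. ennreal (t powr N) *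
      e2ennreal (SUP s\<in>{t..}. ereal ((q s + q (- s)) / s powr (2 + N))) * indicator {r..R} t \<partial>lebesgue)"

end

theory Submission
  imports Defs "HOL-Complex_Analysis.Complex_Analysis"
begin

text \<open>Test the Riesz measure against \<open>\<chi>(|z|) max(\<plusminus>Re z, 0) / |z|\<^sup>2\<close>, with \<open>\<chi>\<close> a cutoff to the annulus
  \<open>r \<le> |z| \<le> R\<close> and the positive part smoothed at scale \<open>\<epsilon>\<close>. Since \<open>Re z / |z|\<^sup>2\<close> is harmonic, up to \<open>O(1)\<close> the
  Laplacian of this function only charges the strip \<open>|Re z| = O(\<epsilon>)\<close>, so \<open>2\<pi> l(r, R)\<close> is within \<open>O(1)\<close> of an average of \<open>M\<close>
  over the strip, weighted by \<open>1 / (Im z)\<^sup>2\<close>. For \<open>\<epsilon> \<rightarrow> 0\<close>, upper semicontinuity bounds that average from above by the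
  integral over the imaginary axis; for \<open>\<epsilon> = 1\<close>, the sub-mean value property bounds it from below. Hence \<open>l\<^sup>r\<^sup>h\<close>,
  \<open>l\<^sup>l\<^sup>h\<close> and \<open>J\<close> agree up to \<open>O(1)\<close> for both \<open>M\<close> and \<open>u\<close>, and it remains to compare \<open>J\<close> of \<open>u\<close> with \<open>J\<close> of \<open>M\<close>.

  Off \<open>E\<close>, a circular mean over a radius \<open>t \<le> b\<close> exceeds the value at the centre by at most a constant times the
  potential \<open>\<integral> log\<^sup>+ (2b / |z - w|) d\<mu>(z)\<close>. On a dyadic block one takes for \<open>b\<close> the largest radius admitted by the tail supremum
  in \<open>I\<^sub>N\<close>; over the block \<open>[a, 2a]\<close> the potential integrates to \<open>O(a b)\<close>,
  and \<open>b\<close> is controlled by \<open>I\<^sub>N\<close> over the preceding block. On \<open>E\<close>, the negative part of \<open>M\<close> over a set of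
  measure \<open>s\<close> in the block \<open>[a, 2a]\<close> integrates to \<open>O(a s ln(e a / s))\<close>, which is controlled by \<open>q\<^sub>E\<close> over the following block.\<close>

subsection \<open>Circular means and the maximum principle\<close>

text \<open>The Riesz measure is known only through its pairing with test functions, and
  subharmonicity only through the sub-mean inequality on small circles; so the maximum principle,
  monotone circular means and a Jensen-type inequality are derived here. Since \<open>M\<close> may
  be minus infinity, they are phrased through the nonnegative defect \<open>K - M\<close>, whose
  integrals always exist in \<open>ennreal\<close>. One radial profile, \<open>step1\<close>, ties
  the estimates together. It gives the mollifier on the annulus of radii \<open>b\<close> and
  \<open>2 * b\<close>, whose mean dominates all circular means of radius at most \<open>b\<close>
  and exceeds the value at the centre by at most a logarithmic potential. Its marginal on the real
  axis is \<open>kern\<close>, the second derivative of the smoothed positive part; therefore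
  mollified means of scale 1, averaged along the imaginary axis, reproduce the strip average at
  \<open>\<epsilon> = 1\<close> up to a bounded error. The two half-planes are linked because
  \<open>kern\<close> is even: both yield the same strip average. The error bounds are uniform in
  \<open>r\<close>, \<open>R\<close> and \<open>\<epsilon>\<close> once \<open>r \<ge> r0\<close>,
  so \<open>\<epsilon>\<close> may be chosen after \<open>r\<close> and \<open>R\<close>.\<close>

lemma ereal_int_bounded_above:
  fixes f :: "real \<Rightarrow> ereal"
  assumes [measurable]: "f \<in> borel_measurable borel" and "0 \<le> K" "a \<le> b"
    and le: "\<And>x. x \<in> {a..b} \<Longrightarrow> f x \<le> ereal K"
  shows "ereal_int lebesgue {a..b} f =
    ereal (K * (b - a)) - enn2ereal (\<integral>\<^sup>+x. e2ennreal (ereal K - f x) * indicator {a..b} x \<partial>lborel)"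
proof -
  define P where "P = (\<integral>\<^sup>+x. e2ennreal (f x) * indicator {a..b} x \<partial>lborel)"
  define N where "N = (\<integral>\<^sup>+x. e2ennreal (- f x) * indicator {a..b} x \<partial>lborel)"
  define D where "D = (\<integral>\<^sup>+x. e2ennreal (ereal K - f x) * indicator {a..b} x \<partial>lborel)"
  have "P \<le> (\<integral>\<^sup>+x. ennreal K * indicator {a..b} x \<partial>lborel)"
    unfolding P_def using le
    by (intro nn_integral_mono) (auto simp: indicator_def e2ennreal_mono simp flip: e2ennreal_ereal)
  also have "\<dots> = ennreal (K * (b - a))"
    using assms(2,3) by (simp add: nn_integral_cmult ennreal_mult)
  finally have P: "P \<le> ennreal (K * (b - a))" .
  \<comment> \<open>This is t = t^+ - t^- rearranged so that nothing infinite is subtracted; after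
    integration \<open>P\<close> is finite and cancels even if \<open>N\<close> is infinite.\<close>
  have pt: "e2ennreal (ereal K - t) + e2ennreal t = e2ennreal (- t) + ennreal K" if "t \<le> ereal K" for t
  proof (cases t)
    case (real s)
    then show ?thesis
      using that \<open>0 \<le> K\<close> by (cases "0 \<le> s") (simp_all add: e2ennreal_neg e2ennreal_ereal ennreal_neg flip: ennreal_plus)
  qed (use that \<open>0 \<le> K\<close> in \<open>auto simp: e2ennreal_neg\<close>)
  have "D + P = (\<integral>\<^sup>+x. (e2ennreal (ereal K - f x) + e2ennreal (f x)) * indicator {a..b} x \<partial>lborel)"
    unfolding D_def P_def by (subst nn_integral_add[symmetric]) (auto simp: distrib_right)
  also have "\<dots> = (\<integral>\<^sup>+x. e2ennreal (- f x) * indicator {a..b} x + ennreal K * indicator {a..b} x \<partial>lborel)"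
    using le by (intro nn_integral_cong) (auto simp: indicator_def pt)
  also have "\<dots> = N + ennreal (K * (b - a))"
    unfolding N_def using assms(2,3) by (subst nn_integral_add) (auto simp: nn_integral_cmult ennreal_mult)
  finally have eq: "D + P = N + ennreal (K * (b - a))" .
  have K: "0 \<le> K * (b - a)" using assms by simp
  obtain p where p: "P = ennreal p" "0 \<le> p"
    using P by (cases P) (auto simp: top_unique)
  have "enn2ereal P - enn2ereal N = ereal (K * (b - a)) - enn2ereal D"
  proof (cases "N = top")
    case True
    then have "D = top" using eq p by simp
    then show ?thesis using True p by simp
  next
    case False
    then have "D \<noteq> top" using eq p by (metis ennreal_add_eq_top ennreal_neq_top)
    then obtain d n where dn: "D = ennreal d" "N = ennreal n" "0 \<le> d" "0 \<le> n"
      using False by (cases D; cases N) auto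
    then have "d + p = n + K * (b - a)" using eq p K by (simp flip: ennreal_plus)
    then show ?thesis using dn p by simp
  qed
  then show ?thesis
    unfolding ereal_int_def nn_integral_completion P_def N_def D_def .
qed

text \<open>The offset \<open>\<rho>\<close> is complex rather than a radius, so that the defect can
  serve as the inner integral when a planar integral is averaged over rotations.\<close>

definition circ_defect :: "real \<Rightarrow> (complex \<Rightarrow> ereal) \<Rightarrow> complex \<Rightarrow> complex \<Rightarrow> ennreal" where
  "circ_defect K v z \<rho> =
    (\<integral>\<^sup>+\<theta>. e2ennreal (ereal K - v (z + \<rho> * cis \<theta>)) * indicator {0..2*pi} \<theta> \<partial>lborel)"

lemma borel_measurable_cis[measurable]: "cis \<in> borel_measurable borel"
  by (intro borel_measurable_continuous_onI) (auto simp: continuous_intros)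

lemma circ_mean_eq:
  assumes [measurable]: "v \<in> borel_measurable borel" and K: "0 \<le> K"
    and le: "\<And>\<theta>. v (z + of_real r * cis \<theta>) \<le> ereal K"
  shows "circ_mean v z r = (ereal (K * (2 * pi)) - enn2ereal (circ_defect K v z (of_real r))) / ereal (2 * pi)"
  unfolding circ_mean_def circ_defect_def using K le
  by (subst ereal_int_bounded_above[where K=K]) auto

text \<open>Moves the sub-mean inequality into \<open>ennreal\<close>, where defects can be added
  freely. The value \<open>x = - \<infinity>\<close> is covered, the right-hand side being infinite
  then, and so is an infinite defect.\<close>

lemma le_circ_mean_iff:
  assumes "v \<in> borel_measurable borel" "0 \<le> K"
    and "\<And>\<theta>. v (z + of_real r * cis \<theta>) \<le> ereal K" and x: "x \<le> ereal K"
  shows "x \<le> circ_mean v z r \<longleftrightarrow> circ_defect K v z (of_real r) \<le> ennreal (2 * pi) * e2ennreal (ereal K - x)"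
proof -
  have pi: "0 < 2 * pi" by simp
  obtain D where D: "circ_defect K v z (of_real r) = D" by simp
  have "x \<le> (ereal (K * (2 * pi)) - enn2ereal D) / ereal (2 * pi) \<longleftrightarrow> D \<le> ennreal (2 * pi) * e2ennreal (ereal K - x)"
  proof (cases x)
    case (real s)
    then have "s \<le> K" using x by simp
    show ?thesis
    proof (cases D)
      case (real d)
      have "ennreal (2 * pi) * e2ennreal (ereal K - x) = ennreal (2 * pi * (K - s))"
        using \<open>x = ereal s\<close> \<open>s \<le> K\<close> by (simp add: e2ennreal_ereal ennreal_mult)
      moreover have "(ereal (K * (2 * pi)) - enn2ereal D) / ereal (2 * pi) = ereal ((K * (2 * pi) - d) / (2 * pi))"
        using real by simp
      ultimately show ?thesis
        using real \<open>x = ereal s\<close> \<open>s \<le> K\<close> by (simp add: field_simps)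
    next
      case top
      have "ennreal (2 * pi) * e2ennreal (ereal K - x) = ennreal (2 * pi * (K - s))"
        using \<open>x = ereal s\<close> \<open>s \<le> K\<close> by (simp add: e2ennreal_ereal ennreal_mult)
      then show ?thesis using top \<open>x = ereal s\<close> by (simp add: top_unique)
    qed
  qed (use x in \<open>auto simp: ennreal_mult_eq_top_iff\<close>)
  then show ?thesis using assms D by (subst circ_mean_eq) auto
qed

lemma mean_value_circle_real:
  assumes "f holomorphic_on UNIV" "0 \<le> r"
  shows "((\<lambda>\<theta>. f (z + of_real r * cis \<theta>)) has_integral (of_real (2 * pi) * f z)) {0..2*pi}"
proof (cases "r = 0")
  case True
  then show ?thesis using has_integral_const_real[of "f z" 0 "2*pi"] by (simp add: scaleR_conv_of_real)
next
  case False
  then have r: "0 < r" using assms by simp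
  have "((\<lambda>u. f u / (u - z)) has_contour_integral (2 * of_real pi * \<i> * f z)) (circlepath z r)"
    using r assms(1) by (intro Cauchy_integral_circlepath_simple) (auto intro: holomorphic_on_subset)
  then have "((\<lambda>x. f (circlepath z r x) / (circlepath z r x - z) *
      vector_derivative (circlepath z r) (at x within {0..1})) has_integral 2 * of_real pi * \<i> * f z) {0..1}"
    by (simp add: has_contour_integral_def)
  then have "((\<lambda>x. (2 * of_real pi * \<i>) * f (z + of_real r * cis (2 * pi * x))) has_integral 2 * of_real pi * \<i> * f z) {0..1}"
    using r
    by (elim has_integral_eq[rotated]) (simp add: vector_derivative_circlepath01, simp add: circlepath cis_conv_exp mult_ac)
  from has_integral_mult_right[OF this, of "1 / (2 * of_real pi * \<i>)"]
  have "((\<lambda>x. f (z + of_real r * cis (2 * pi * x))) has_integral f z) {0..1}"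
    by simp
  from has_integral_stretch_real[OF this, of "1 / (2 * pi)"]
  have "((\<lambda>\<theta>. f (z + of_real r * cis \<theta>)) has_integral (of_real (2 * pi) * f z)) ((\<lambda>x. 2 * pi * x) ` {0..1})"
    by (simp add: scaleR_conv_of_real mult.commute[of _ "2 * pi"])
  moreover have "(\<lambda>x. 2 * pi * x) ` {0..1} = {0..2*pi}"
    using image_mult_atLeastAtMost[of "2*pi" 0 1] by simp
  ultimately show ?thesis by simp
qed

text \<open>Rotating the argument of \<open>f\<close> about \<open>z\<close> by
  \<open>Arg \<rho>\<close> reduces the complex offset to a real radius.\<close>

lemma mean_value_circle:
  assumes "f holomorphic_on UNIV"
  shows "((\<lambda>\<theta>. f (z + \<rho> * cis \<theta>)) has_integral (of_real (2 * pi) * f z)) {0..2*pi}"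
proof -
  define g where "g w = f (z + cis (Arg \<rho>) * (w - z))" for w
  have "f \<circ> (\<lambda>w. z + cis (Arg \<rho>) * (w - z)) holomorphic_on UNIV"
    by (intro holomorphic_on_compose holomorphic_intros holomorphic_on_subset[OF assms]) auto
  then have g: "g holomorphic_on UNIV" unfolding g_def[abs_def] o_def .
  have "g (z + of_real (cmod \<rho>) * cis \<theta>) = f (z + \<rho> * cis \<theta>)" for \<theta>
    using rcis_cmod_Arg[of \<rho>] by (simp add: g_def rcis_def mult_ac)
  then show ?thesis using mean_value_circle_real[OF g, of "cmod \<rho>" z] by (simp add: g_def)
qed

lemma continuous_bounded_on_circle:
  fixes p :: "complex \<Rightarrow> complex"
  assumes "continuous_on UNIV p"
  obtains B where "\<And>\<theta>. \<bar>Re (p (z + \<rho> * cis \<theta>))\<bar> \<le> B"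
proof -
  have "compact ((\<lambda>w. Re (p w)) ` sphere z (cmod \<rho>))"
    by (intro compact_continuous_image continuous_intros continuous_on_subset[OF assms]) auto
  then obtain B where B: "\<And>x. x \<in> (\<lambda>w. Re (p w)) ` sphere z (cmod \<rho>) \<Longrightarrow> \<bar>x\<bar> \<le> B"
    using compact_imp_bounded bounded_real by metis
  have "z + \<rho> * cis \<theta> \<in> sphere z (cmod \<rho>)" for \<theta> by (simp add: dist_norm norm_mult)
  then show thesis using B that by blast
qed

text \<open>For a harmonic function the sub-mean inequality is an equality. In this form it can be
  compared with \<open>circ_defect\<close>.\<close>

lemma mean_value_circle_Re:
  assumes "f holomorphic_on UNIV" and le: "\<And>\<theta>. Re (f (z + \<rho> * cis \<theta>)) \<le> K"
  shows "(\<integral>\<^sup>+\<theta>. ennreal (K - Re (f (z + \<rho> * cis \<theta>))) * indicator {0..2*pi} \<theta> \<partial>lborel)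
     = ennreal (2 * pi * (K - Re (f z)))"
proof -
  have c: "continuous_on UNIV f" using assms(1) holomorphic_on_imp_continuous_on by blast
  have m[measurable]: "f \<in> borel_measurable borel" using c by (simp add: borel_measurable_continuous_onI)
  have "((\<lambda>\<theta>. Re (f (z + \<rho> * cis \<theta>))) has_integral Re (of_real (2 * pi) * f z)) {0..2*pi}"
    using has_integral_linear[OF mean_value_circle[OF assms(1)] bounded_linear_Re] by (simp only: o_def)
  then have "((\<lambda>\<theta>. K - Re (f (z + \<rho> * cis \<theta>))) has_integral (2 * pi * (K - Re (f z)))) {0..2*pi}"
    using has_integral_diff[OF has_integral_const_real[of K 0 "2*pi"], of "\<lambda>\<theta>. Re (f (z + \<rho> * cis \<theta>))"] by (simp add: algebra_simps)
  then have *: "((\<lambda>\<theta>. (K - Re (f (z + \<rho> * cis \<theta>))) * indicator {0..2*pi} \<theta>) has_integral (2 * pi * (K - Re (f z)))) UNIV"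
    by (subst (asm) has_integral_restrict_UNIV[symmetric]) (elim has_integral_eq[rotated], auto simp: indicator_def)
  from nn_integral_has_integral_lborel[OF _ _ *] show ?thesis
    using le by (simp add: ennreal_mult ennreal_indicator)
qed

locale subharmonic_fun =
  fixes M :: "complex \<Rightarrow> ereal"
  assumes subharmonic: "subharmonic M"
begin

lemma less_PInf: "M z < \<infinity>"
  using subharmonic by (auto simp: subharmonic_def)

lemma usc_nhds: "M z < c \<Longrightarrow> \<forall>\<^sub>F w in nhds z. M w < c"
proof -
  assume *: "M z < c"
  have "Limsup (at z) M \<le> M z" using subharmonic by (auto simp: subharmonic_def)
  then have "\<forall>\<^sub>F w in at z. M w < c" using * by (intro Limsup_lessD) auto
  then show ?thesis using * by (auto simp: eventually_at_filter elim: eventually_mono)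
qed

lemma open_less: "open {z. M z < c}"
  using usc_nhds by (subst open_subopen) (force simp: eventually_nhds)

lemma measurable_M[measurable]: "M \<in> borel_measurable borel"
  by (rule borel_measurableI_less) (use open_less in \<open>auto simp: space_borel\<close>)

end

text \<open>Without a maximum the open sets of points with value below \<open>v y\<close>, for
  \<open>y\<close> in \<open>K\<close>, would cover \<open>K\<close>; the largest of the finitely
  many values in a finite subcover contradicts this.\<close>

lemma usc_attains_max:
  fixes v :: "complex \<Rightarrow> ereal"
  assumes usc: "\<And>c. open {z. v z < c}" and K: "compact K" "K \<noteq> {}"
  shows "\<exists>x\<in>K. \<forall>y\<in>K. v y \<le> v x"
proof (rule ccontr)
  assume "\<not> ?thesis"
  then have *: "\<exists>y\<in>K. v x < v y" if "x \<in> K" for x using that by (auto simp: not_le)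
  define F where "F y = {z. v z < v y}" for y
  have op: "open (F y)" for y unfolding F_def by (rule usc)
  have "K \<subseteq> (\<Union>y\<in>K. F y)"
  proof
    fix x assume "x \<in> K"
    then show "x \<in> (\<Union>y\<in>K. F y)" using *[of x] by (auto simp: F_def)
  qed
  then obtain T where T: "T \<subseteq> K" "finite T" "K \<subseteq> (\<Union>y\<in>T. F y)"
    using compactE_image[OF K(1), of K F] op by metis
  then have "T \<noteq> {}" using K by auto
  then have "Max (v ` T) \<in> v ` T" using T by (intro Max_in) auto
  then obtain x where x: "x \<in> T" "Max (v ` T) = v x" by auto
  then have le: "v y \<le> v x" if "y \<in> T" for y using T that by (metis Max_ge finite_imageI imageI)
  obtain y where "y \<in> T" "x \<in> F y" using T x by blast
  then show False using le[of y] by (auto simp: F_def)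
qed

context subharmonic_fun begin

lemma bounded_above:
  assumes "compact K" shows "\<exists>B\<ge>0. \<forall>z\<in>K. M z \<le> ereal B"
proof (cases "K = {}")
  case False
  obtain x where x: "\<And>y. y \<in> K \<Longrightarrow> M y \<le> M x"
    using usc_attains_max[OF open_less assms False] by blast
  have "M x < \<infinity>" by (rule less_PInf)
  then have "M x \<le> ereal (max 0 (real_of_ereal (M x)))" "0 \<le> max 0 (real_of_ereal (M x))"
    by (cases "M x"; simp)+
  then obtain B where "M x \<le> ereal B" "0 \<le> B" by blast
  then show ?thesis using x by (meson order_trans)
qed auto

text \<open>Subtracting the harmonic function keeps the sub-mean property. Among the maximum points
  on the disc one takes a point farthest from the centre: a small circle about it leaves the set of
  maximum points along an arc, although the sub-mean inequality forces the maximal value almost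
  everywhere on that circle.\<close>

lemma max_principle:
  assumes p: "p holomorphic_on UNIV" and r: "0 < r"
    and bd: "\<And>z. z \<in> sphere z0 r \<Longrightarrow> M z \<le> ereal (Re (p z))" and z: "z \<in> cball z0 r"
  shows "M z \<le> ereal (Re (p z))"
proof (rule ccontr)
  assume neg: "\<not> ?thesis"
  define v where "v z = M z - ereal (Re (p z))" for z
  have cp: "continuous_on UNIV p" using p holomorphic_on_imp_continuous_on by blast
  have usc: "open {z. v z < c}" for c
  proof (subst open_subopen, intro ballI)
    show "\<exists>T. open T \<and> z \<in> T \<and> T \<subseteq> {z. v z < c}" if "z \<in> {z. v z < c}" for z
    proof -
      have "v z < c" using that by simp
      then obtain c' where c': "M z < ereal c' + ereal (Re (p z))" "ereal c' < c"
      proof -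
        assume a: "\<And>c'. M z < ereal c' + ereal (Re (p z)) \<Longrightarrow> ereal c' < c \<Longrightarrow> thesis"
        obtain e where "v z < ereal e" "ereal e < c" using \<open>v z < c\<close> ereal_dense2 by blast
        then show thesis using a[of e] unfolding v_def by (cases "M z") auto
      qed
      then obtain m where m: "M z < ereal m" "m < c' + Re (p z)"
        using ereal_dense2[of "M z" "ereal (c' + Re (p z))"] by auto
      define T where "T = {w. M w < ereal m} \<inter> {w. m < c' + Re (p w)}"
      have "open {w. m < c' + Re (p w)}"
        by (intro open_Collect_less continuous_intros cp)
      then have "open T" unfolding T_def using open_less by blast
      moreover have "z \<in> T" using m by (simp add: T_def)
      moreover have "v w < c" if "w \<in> T" for w
      proof -
        have "M w < ereal c' + ereal (Re (p w))"
          using that by (auto simp: T_def intro: less_trans)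
        then have "v w < ereal c'" unfolding v_def by (cases "M w") auto
        then show ?thesis using c' by simp
      qed
      ultimately show ?thesis by blast
    qed
  qed
  have "cball z0 r \<noteq> {}" using r by simp
  then obtain x where x: "x \<in> cball z0 r" "\<And>y. y \<in> cball z0 r \<Longrightarrow> v y \<le> v x"
    using usc_attains_max[OF usc compact_cball, of z0 r] by blast
  have "v z > 0" using neg unfolding v_def by (cases "M z") auto
  then have "v x > 0" using x(2)[OF z] by auto
  moreover have "v x < \<infinity>" using less_PInf[of x] unfolding v_def by (cases "M x") auto
  ultimately obtain s where s: "v x = ereal s" "0 < s" by (cases "v x") auto
  \<comment> \<open>The set of maximum points, compact because \<open>v\<close> is upper
    semicontinuous and \<open>s\<close> is its largest value.\<close>
  define K0 where "K0 = cball z0 r \<inter> - {w. v w < ereal s}"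
  have "compact K0" unfolding K0_def using usc by (intro compact_Int_closed) (auto simp: closed_def)
  moreover have "K0 \<noteq> {}" using x s by (auto simp: K0_def)
  ultimately obtain z1 where z1: "z1 \<in> K0" "\<And>w. w \<in> K0 \<Longrightarrow> dist z0 w \<le> dist z0 z1"
    using continuous_attains_sup[of K0 "dist z0"] continuous_on_dist[OF continuous_on_const continuous_on_id, of K0 z0] by blast
  define d where "d = dist z0 z1"
  have v1: "v z1 = ereal s" using z1 x s by (intro antisym) (auto simp: K0_def not_less)
  have dr: "d < r"
  proof (rule ccontr)
    assume "\<not> d < r"
    then have "z1 \<in> sphere z0 r" using z1 by (auto simp: K0_def d_def)
    then have "v z1 \<le> 0" using bd[of z1] unfolding v_def by (cases "M z1") auto
    then show False using v1 s by simp
  qed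
  obtain t0 where t0: "0 < t0" "\<And>t. 0 < t \<Longrightarrow> t < t0 \<Longrightarrow> M z1 \<le> circ_mean M z1 t"
    using subharmonic unfolding subharmonic_def by metis
  define t where "t = min t0 (r - d) / 2"
  have t: "0 < t" "t < t0" "t < r - d" using t0 dr by (auto simp: t_def min_def)
  let ?w = "\<lambda>\<theta>. z1 + of_real t * cis \<theta>"
  have wb: "?w \<theta> \<in> cball z0 r" for \<theta>
  proof -
    have "dist z0 (?w \<theta>) \<le> dist z0 z1 + dist z1 (?w \<theta>)" by (rule dist_triangle)
    also have "dist z1 (?w \<theta>) = t" using t by (simp add: dist_norm norm_mult)
    finally show ?thesis using t by (simp add: d_def)
  qed
  have Mw: "M (?w \<theta>) \<le> ereal (s + Re (p (?w \<theta>)))" for \<theta>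
    using x(2)[OF wb[of \<theta>]] s unfolding v_def by (cases "M (?w \<theta>)") auto
  obtain B where B: "\<And>\<theta>. \<bar>Re (p (?w \<theta>))\<bar> \<le> B"
    using continuous_bounded_on_circle[OF cp] by blast
  define K where "K = s + B"
  have K: "0 \<le> K" using B[of 0] s by (simp add: K_def)
  have MK: "M (?w \<theta>) \<le> ereal K" for \<theta>
    using Mw[of \<theta>] B[of \<theta>] by (auto simp: K_def intro: order_trans)
  have pz1: "Re (p z1) \<le> B"
  proof -
    have "(\<integral>\<^sup>+\<theta>. ennreal (B - Re (p (?w \<theta>))) * indicator {0..2*pi} \<theta> \<partial>lborel) = ennreal (2 * pi * (B - Re (p z1)))"
      using B t by (intro mean_value_circle_Re p) (auto simp: abs_le_iff)
    have "((\<lambda>\<theta>. Re (p (?w \<theta>))) has_integral Re (of_real (2 * pi) * p z1)) {0..2*pi}"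
      using has_integral_linear[OF mean_value_circle[OF p] bounded_linear_Re] by (simp only: o_def)
    from has_integral_le[OF this has_integral_const_real[of B]] B show ?thesis by (simp add: abs_le_iff)
  qed
  have Mz1: "M z1 = ereal (s + Re (p z1))" using v1 unfolding v_def by (cases "M z1") auto
  define f where "f \<theta> = ereal (s + Re (p (?w \<theta>))) - M (?w \<theta>)" for \<theta>
  have pm[measurable]: "p \<in> borel_measurable borel" using cp by (simp add: borel_measurable_continuous_onI)
  have [measurable]: "f \<in> borel_measurable borel" unfolding f_def by measurable
  have f0: "0 \<le> f \<theta>" for \<theta> using Mw[of \<theta>] unfolding f_def by (cases "M (?w \<theta>)") auto
  have "circ_defect K M z1 (of_real t) = (\<integral>\<^sup>+\<theta>. ennreal (B - Re (p (?w \<theta>))) * indicator {0..2*pi} \<theta>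
      + e2ennreal (f \<theta>) * indicator {0..2*pi} \<theta> \<partial>lborel)"
    unfolding circ_defect_def
  proof (intro nn_integral_cong)
    fix \<theta>
    have "e2ennreal (ereal K - M (?w \<theta>)) = ennreal (B - Re (p (?w \<theta>))) + e2ennreal (f \<theta>)"
      using Mw[of \<theta>] B[of \<theta>] f0[of \<theta>] unfolding f_def K_def
      by (cases "M (?w \<theta>)") (auto simp: e2ennreal_ereal abs_le_iff simp flip: ennreal_plus)
    then show "e2ennreal (ereal K - M (?w \<theta>)) * indicator {0..2*pi} \<theta> =
      ennreal (B - Re (p (?w \<theta>))) * indicator {0..2*pi} \<theta> + e2ennreal (f \<theta>) * indicator {0..2*pi} \<theta>"
      by (simp add: distrib_right)
  qed
  also have "\<dots> = ennreal (2 * pi * (B - Re (p z1))) + (\<integral>\<^sup>+\<theta>. e2ennreal (f \<theta>) * indicator {0..2*pi} \<theta> \<partial>lborel)"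
    using B t by (subst nn_integral_add) (auto simp: mean_value_circle_Re p abs_le_iff)
  finally have eq: "circ_defect K M z1 (of_real t) = \<dots>" .
  have "circ_defect K M z1 (of_real t) \<le> ennreal (2 * pi) * e2ennreal (ereal K - M z1)"
    using t0(2)[OF t(1,2)] K MK Mz1 pz1 by (subst le_circ_mean_iff[symmetric]) (auto simp: K_def)
  also have "\<dots> = ennreal (2 * pi * (B - Re (p z1)))"
    using Mz1 pz1 by (simp add: K_def e2ennreal_ereal ennreal_mult)
  finally have "(\<integral>\<^sup>+\<theta>. e2ennreal (f \<theta>) * indicator {0..2*pi} \<theta> \<partial>lborel) \<le> 0"
    using eq by (simp add: ennreal_add_left_cancel_le[of _ _ 0, simplified])
  then have "AE \<theta> in lborel. e2ennreal (f \<theta>) * indicator {0..2*pi} \<theta> = 0"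
    by (simp add: nn_integral_0_iff_AE)
  then have ae: "AE \<theta> in lborel. \<theta> \<in> {0..2*pi} \<longrightarrow> f \<theta> = 0"
  proof eventually_elim
    case (elim \<theta>)
    then have "\<theta> \<in> {0..2*pi} \<Longrightarrow> e2ennreal (f \<theta>) = 0" by simp
    then show ?case using f0[of \<theta>] by (metis enn2ereal_e2ennreal zero_ennreal.rep_eq)
  qed
  \<comment> \<open>The angles at which the circle leaves the disc of radius \<open>d\<close> about
    \<open>z0\<close>; cutting to an open interval keeps \<open>U\<close> open, so it cannot be
    negligible once it is nonempty.\<close>
  define U where "U = {\<theta>. d < dist z0 (?w \<theta>)} \<inter> {0<..<2*pi}"
  have "open U" unfolding U_def by (intro open_Int open_Collect_less continuous_intros)
  have ne: "U \<noteq> {}"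
  proof -
    have "\<exists>\<theta>. d < dist z0 (?w \<theta>)"
    proof -
      have "z1 - z0 = of_real d * cis (Arg (z1 - z0))"
        using rcis_cmod_Arg[of "z1 - z0"] by (simp add: rcis_def d_def dist_norm norm_minus_commute)
      then have "?w (Arg (z1 - z0)) - z0 = of_real (t + d) * cis (Arg (z1 - z0))"
        by (simp add: algebra_simps)
      then have "dist (?w (Arg (z1 - z0))) z0 = t + d"
        using t by (simp add: dist_norm norm_mult d_def flip: of_real_add del: of_real_add)
      then show ?thesis using t by (intro exI[of _ "Arg (z1 - z0)"]) (simp add: dist_commute)
    qed
    then obtain \<theta> where \<theta>: "d < dist z0 (?w \<theta>)" by auto
    obtain \<theta>' where \<theta>': "0 \<le> \<theta>'" "\<theta>' < 2*pi" "cis \<theta>' = cis \<theta>"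
      using sincos_total_2pi[of "cos \<theta>" "sin \<theta>"] by (metis cis.code sin_cos_squared_add2)
    have op: "open {\<theta>. d < dist z0 (?w \<theta>)}" by (intro open_Collect_less continuous_intros)
    have "\<theta>' \<in> {\<theta>. d < dist z0 (?w \<theta>)}" using \<theta> \<theta>' by simp
    then obtain e where e: "0 < e" "\<And>y. dist y \<theta>' < e \<Longrightarrow> d < dist z0 (?w y)"
      using op unfolding open_dist by blast
    \<comment> \<open>The angle \<open>\<theta>'\<close> may be 0, outside the open interval, so it
      is pushed right by less than \<open>e\<close> and by less than its distance to 2 pi.\<close>
    have "\<theta>' + min (e/2) ((2*pi - \<theta>')/2) \<in> U"
      unfolding U_def using e(1) \<theta>' by (auto intro!: e(2) simp: dist_real_def min_def field_simps)
    then show ?thesis by auto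
  qed
  have "f \<theta> \<noteq> 0" if "\<theta> \<in> U" for \<theta>
  proof
    assume "f \<theta> = 0"
    then have "M (?w \<theta>) = ereal (s + Re (p (?w \<theta>)))" unfolding f_def by (cases "M (?w \<theta>)") auto
    then have "?w \<theta> \<in> K0" using wb[of \<theta>] by (simp add: K0_def v_def)
    then show False using z1(2)[of "?w \<theta>"] that by (simp add: U_def d_def)
  qed
  then have nz: "\<And>\<theta>. \<theta> \<in> U \<Longrightarrow> f \<theta> \<noteq> 0" by blast
  have "AE \<theta> in lborel. \<theta> \<notin> U"
  proof (rule eventually_mono[OF ae])
    fix \<theta> assume "\<theta> \<in> {0..2*pi} \<longrightarrow> f \<theta> = 0"
    then show "\<theta> \<notin> U" using nz[of \<theta>] unfolding U_def by auto
  qed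
  then have "negligible U"
    using \<open>open U\<close> by (simp add: AE_iff_null_sets negligible_iff_null_sets null_sets_completionI AE_completion)
  then show False using open_not_negligible[OF \<open>open U\<close> ne] by simp
qed

end

section \<open>Harmonic majorants and monotonicity of circular means\<close>

lemma real_polynomial_function_eq_Re_poly_on_circle:
  fixes g :: "complex \<Rightarrow> real"
  assumes "real_polynomial_function g"
  shows "\<exists>p. \<forall>\<zeta>. cmod \<zeta> = 1 \<longrightarrow> g (a + of_real t * \<zeta>) = Re (poly p \<zeta>)"
proof -
  \<comment> \<open>On the unit circle \<open>cnj \<zeta>\<close> equals 1 / \<open>\<zeta>\<close>,
    so polynomials in the coordinates become real parts of polynomials in \<open>\<zeta>\<close>.
    Closing this class under sums and products solves the Dirichlet problem for polynomial boundary
    data without the Poisson kernel.\<close>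
  define T where "T = {f. \<exists>p. \<forall>\<zeta>. cmod \<zeta> = 1 \<longrightarrow> f \<zeta> = Re (poly p \<zeta>)}"
  have T_sum: "(\<lambda>\<zeta>. \<Sum>i\<in>I. f i \<zeta>) \<in> T" if "finite I" and fT: "\<And>i. i \<in> I \<Longrightarrow> f i \<in> T" for I :: "nat set" and f
  proof -
    obtain p where "\<And>i \<zeta>. i \<in> I \<Longrightarrow> cmod \<zeta> = 1 \<Longrightarrow> f i \<zeta> = Re (poly (p i) \<zeta>)"
      using fT unfolding T_def by (simp, metis)
    then show ?thesis unfolding T_def
      by (auto simp: poly_sum intro!: exI[of _ "\<Sum>i\<in>I. p i"] sum.cong)
  qed
  have T_add: "(\<lambda>\<zeta>. f \<zeta> + g \<zeta>) \<in> T" if "f \<in> T" "g \<in> T" for f g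
    using that unfolding T_def by (auto, metis poly_add plus_complex.sel(1))
  have mono1: "(\<lambda>\<zeta>. Re (c * \<zeta> ^ i)) \<in> T" for c i
    unfolding T_def by (auto intro!: exI[of _ "monom c i"] simp: poly_monom)
  have mono2: "(\<lambda>\<zeta>. Re (c * \<zeta> ^ i * cnj (\<zeta> ^ j))) \<in> T" for c i j
  proof (cases "j \<le> i")
    case True
    have "\<zeta> ^ i * cnj (\<zeta> ^ j) = \<zeta> ^ (i - j)" if "cmod \<zeta> = 1" for \<zeta>
    proof -
      have "\<zeta> ^ i * cnj (\<zeta> ^ j) = \<zeta> ^ (i - j) * (\<zeta> ^ j * cnj (\<zeta> ^ j))"
        using True by (simp flip: power_add)
      also have "\<zeta> ^ j * cnj (\<zeta> ^ j) = 1"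
        using that complex_norm_square[of "\<zeta> ^ j"] by (simp add: norm_power)
      finally show ?thesis by simp
    qed
    then show ?thesis using mono1[of c "i - j"] unfolding T_def by (simp add: mult.assoc del: times_complex.sel)
  next
    case False
    have "\<zeta> ^ i * cnj (\<zeta> ^ j) = cnj (\<zeta> ^ (j - i))" if "cmod \<zeta> = 1" for \<zeta>
    proof -
      have "\<zeta> ^ i * cnj (\<zeta> ^ j) = cnj (\<zeta> ^ (j - i)) * (\<zeta> ^ i * cnj (\<zeta> ^ i))"
        using False by (simp flip: power_add)
      also have "\<zeta> ^ i * cnj (\<zeta> ^ i) = 1"
        using that complex_norm_square[of "\<zeta> ^ i"] by (simp add: norm_power)
      finally show ?thesis by simp
    qed
    then have "c * \<zeta> ^ i * cnj (\<zeta> ^ j) = cnj (cnj c * \<zeta> ^ (j - i))" if "cmod \<zeta> = 1" for \<zeta>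
      using that by (simp add: mult.assoc)
    then have "Re (c * \<zeta> ^ i * cnj (\<zeta> ^ j)) = Re (cnj c * \<zeta> ^ (j - i))" if "cmod \<zeta> = 1" for \<zeta>
      using that by (metis cnj.sel(1))
    then show ?thesis using mono1[of "cnj c" "j - i"] unfolding T_def by (simp del: times_complex.sel)
  qed
  have mono_mult: "(\<lambda>\<zeta>. Re (c * \<zeta> ^ i) * Re (d * \<zeta> ^ j)) \<in> T" for c d i j
  proof -
    have "Re x * Re y = Re (x * y / 2) + Re (x * cnj y / 2)" for x y :: complex
      by (simp add: field_simps)
    then have "(\<lambda>\<zeta>. Re (c * \<zeta> ^ i) * Re (d * \<zeta> ^ j)) =
        (\<lambda>\<zeta>. Re (c * d / 2 * \<zeta> ^ (i + j)) + Re (c * cnj d / 2 * \<zeta> ^ i * cnj (\<zeta> ^ j)))"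
      by (simp add: power_add mult_ac fun_eq_iff del: times_complex.sel)
    then show ?thesis by (simp only: T_add[OF mono1 mono2])
  qed
  have T_mult: "(\<lambda>\<zeta>. f \<zeta> * g \<zeta>) \<in> T" if fg: "f \<in> T" "g \<in> T" for f g
  proof -
    obtain p q where p: "\<And>\<zeta>. cmod \<zeta> = 1 \<Longrightarrow> f \<zeta> = Re (poly p \<zeta>)"
      and q: "\<And>\<zeta>. cmod \<zeta> = 1 \<Longrightarrow> g \<zeta> = Re (poly q \<zeta>)"
      using fg unfolding T_def by auto
    have "(\<lambda>\<zeta>. \<Sum>i\<le>degree p. \<Sum>j\<le>degree q. Re (coeff p i * \<zeta> ^ i) * Re (coeff q j * \<zeta> ^ j)) \<in> T"
      by (intro T_sum mono_mult) auto
    moreover have "f \<zeta> * g \<zeta> = (\<Sum>i\<le>degree p. \<Sum>j\<le>degree q. Re (coeff p i * \<zeta> ^ i) * Re (coeff q j * \<zeta> ^ j))"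
      if "cmod \<zeta> = 1" for \<zeta>
      unfolding p[OF that] q[OF that] poly_altdef Re_sum sum_product ..
    ultimately show ?thesis unfolding T_def by simp
  qed
  from assms have "(\<lambda>\<zeta>. g (a + of_real t * \<zeta>)) \<in> T"
  proof induction
    case (linear f)
    interpret bounded_linear f by fact
    have "f (a + of_real t * \<zeta>) = Re (poly [:of_real (f a), of_real t * (of_real (f 1) - \<i> * of_real (f \<i>)):] \<zeta>)" for \<zeta>
    proof -
      have "a + of_real t * \<zeta> = a + (t * Re \<zeta>) *\<^sub>R 1 + (t * Im \<zeta>) *\<^sub>R \<i>"
        by (simp add: complex_eq_iff)
      then have "f (a + of_real t * \<zeta>) = f a + t * Re \<zeta> * f 1 + t * Im \<zeta> * f \<i>"
        by (simp only: add scale)  simp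
      then show ?thesis by (simp add: algebra_simps)
    qed
    then show ?case unfolding T_def by blast
  next
    case (const c)
    show ?case unfolding T_def by (auto intro!: exI[of _ "[:of_real c:]"])
  qed (auto intro: T_add T_mult)
  then show ?thesis unfolding T_def by simp
qed

context subharmonic_fun begin

text \<open>Sup-convolution: penalising distance with factor \<open>n\<close> makes the supremum
  \<open>n\<close>-Lipschitz, and for large \<open>n\<close> only points close to \<open>w\<close>
  matter, where upper semicontinuity bounds \<open>M\<close>. Truncating \<open>M\<close> at
  \<open>- n\<close> keeps all values real.\<close>

lemma Lipschitz_majorant:
  assumes K: "\<And>w. w \<in> S \<Longrightarrow> M w \<le> ereal K" "0 \<le> K" and S: "S \<noteq> {}"
  obtains f :: "nat \<Rightarrow> complex \<Rightarrow> real"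
  where "\<And>n. continuous_on S (f n)" "\<And>n w. w \<in> S \<Longrightarrow> M w \<le> ereal (f n w)" "\<And>n w. f n w \<le> K"
    "\<And>w a. w \<in> S \<Longrightarrow> M w < ereal a \<Longrightarrow> \<forall>\<^sub>F n in sequentially. f n w \<le> a"
proof
  define g where "g n y = real_of_ereal (max (M y) (ereal (- real n)))" for n y
  have g_le: "g n y \<le> K" if "y \<in> S" for n y
    using K(1)[OF that] K(2) unfolding g_def by (cases "M y") (auto simp: max_def)
  have g_ge: "M y \<le> ereal (g n y)" for n y
    using less_PInf[of y] unfolding g_def by (cases "M y") (auto simp: max_def)
  have g_le': "g n y \<le> max a (- real n)" if "M y < ereal a" for n y a
    using that unfolding g_def by (cases "M y") (auto simp: max_def)
  define f where "f n x = (SUP y\<in>S. g n y - n * dist x y)" for n :: nat and x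
  have bdd: "bdd_above ((\<lambda>y. g n y - n * dist x y) ` S)" for n x
    using g_le by (intro bdd_aboveI2[of _ _ K]) (smt (verit) mult_nonneg_nonneg of_nat_0_le_iff zero_le_dist)
  show fK: "f n w \<le> K" for n w unfolding f_def
    using g_le S by (intro cSUP_least) (auto, smt (verit) mult_nonneg_nonneg of_nat_0_le_iff zero_le_dist)
  have "f n x \<le> f n x' + n * dist x x'" for n x x'
    unfolding f_def
  proof (intro cSUP_least S)
    fix y assume y: "y \<in> S"
    have "g n y - n * dist x y \<le> (g n y - n * dist x' y) + n * dist x x'"
      using dist_triangle[of x' y x] mult_left_mono[of "dist x' y" "dist x' x + dist x y" "real n"]
      by (simp add: distrib_left dist_commute)
    also have "g n y - n * dist x' y \<le> (SUP y\<in>S. g n y - n * dist x' y)"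
      by (rule cSUP_upper[OF y bdd])
    finally show "g n y - n * dist x y \<le> (SUP y\<in>S. g n y - n * dist x' y) + n * dist x x'" by simp
  qed
  then have "\<bar>f n x - f n x'\<bar> \<le> n * dist x x'" for n x x'
    by (smt (verit) dist_commute)
  then have "n-lipschitz_on S (f n)" for n by (intro lipschitz_onI) (auto simp: dist_real_def)
  then show "continuous_on S (f n)" for n by (rule lipschitz_on_continuous_on)
  show "M w \<le> ereal (f n w)" if "w \<in> S" for n w
  proof -
    have "g n w \<le> f n w" unfolding f_def using cSUP_upper[OF that bdd, of n w] by simp
    then show ?thesis using g_ge[of w n] by (meson ereal_less_eq(3) order_trans)
  qed
  show "\<forall>\<^sub>F n in sequentially. f n w \<le> a" if "w \<in> S" and wa: "M w < ereal a" for w a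
  proof -
    obtain d where d: "0 < d" "\<And>y. dist y w < d \<Longrightarrow> M y < ereal a"
      using usc_nhds[OF wa] by (auto simp: eventually_nhds_metric)
    \<comment> \<open>The first threshold brings the truncation level below \<open>a\<close>; the
      second makes the penalty at distance \<open>d\<close> at least \<open>K - a\<close>.\<close>
    have "\<forall>\<^sub>F n::nat in sequentially. - a \<le> real n" "\<forall>\<^sub>F n::nat in sequentially. (K - a) / d \<le> real n"
      by (metis eventually_sequentiallyI le_nat_iff nat_ceiling_le_eq of_nat_mono order_trans real_nat_ceiling_ge)+
    then show ?thesis
    proof eventually_elim
      case (elim n)
      have "g n y - n * dist w y \<le> a" if "y \<in> S" for y
      proof (cases "dist y w < d")
        case True
        then have "g n y \<le> a" using g_le'[OF d(2)[OF True], of n] elim by simp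
        then show ?thesis by (smt (verit) mult_nonneg_nonneg of_nat_0_le_iff zero_le_dist)
      next
        case False
        have "(K - a) \<le> n * d" using elim(2) d(1) by (simp add: field_simps)
        also have "\<dots> \<le> n * dist w y" using False by (intro mult_left_mono) (auto simp: dist_commute)
        finally show ?thesis using g_le[OF that, of n] by simp
      qed
      then show ?case unfolding f_def by (intro cSUP_least S)
    qed
  qed
qed

text \<open>A Lipschitz majorant is raised by 1/(n+1) and approximated within 1/(n+1) by a real
  polynomial, which on the circle is the real part of an entire function. The approximant stays
  above \<open>M\<close> and at most 2/(n+1) above the majorant; this is the 2 in
  \<open>K + 2\<close>.\<close>

lemma harmonic_majorants:
  assumes K: "\<And>w. w \<in> sphere z t \<Longrightarrow> M w \<le> ereal K" "0 \<le> K" and t: "0 < t"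
  obtains p :: "nat \<Rightarrow> complex \<Rightarrow> complex"
  where "\<And>n. p n holomorphic_on UNIV" "\<And>n w. w \<in> sphere z t \<Longrightarrow> M w \<le> ereal (Re (p n w))"
    "\<And>n w. w \<in> sphere z t \<Longrightarrow> Re (p n w) \<le> K + 2"
    "\<And>w a. w \<in> sphere z t \<Longrightarrow> M w < ereal a \<Longrightarrow> \<forall>\<^sub>F n in sequentially. Re (p n w) \<le> a"
proof -
  have ne: "sphere z t \<noteq> {}" using t by simp
  obtain f :: "nat \<Rightarrow> complex \<Rightarrow> real" where
    f: "\<And>n. continuous_on (sphere z t) (f n)" "\<And>n w. w \<in> sphere z t \<Longrightarrow> M w \<le> ereal (f n w)" "\<And>n w. f n w \<le> K"
    "\<And>w a. w \<in> sphere z t \<Longrightarrow> M w < ereal a \<Longrightarrow> \<forall>\<^sub>F n in sequentially. f n w \<le> a"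
    using Lipschitz_majorant[OF K ne] by blast
  have "\<exists>q. q holomorphic_on UNIV \<and> (\<forall>w\<in>sphere z t. f n w \<le> Re (q w) \<and> Re (q w) \<le> f n w + 2 * inverse (Suc n))" for n
  proof -
    have "continuous_on (sphere z t) (\<lambda>w. f n w + inverse (Suc n))" using f(1) by (intro continuous_intros)
    then obtain g where g: "real_polynomial_function g"
      "\<And>w. w \<in> sphere z t \<Longrightarrow> \<bar>f n w + inverse (Suc n) - g w\<bar> < inverse (Suc n)"
      by (rule Stone_Weierstrass_real_polynomial_function[OF compact_sphere, of z t _ "inverse (Suc n)"]) auto
    obtain P where P: "\<And>\<zeta>. cmod \<zeta> = 1 \<Longrightarrow> g (z + of_real t * \<zeta>) = Re (poly P \<zeta>)"
      using real_polynomial_function_eq_Re_poly_on_circle[OF g(1)] by blast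
    define q where "q w = poly P ((w - z) / of_real t)" for w
    have "q holomorphic_on UNIV" unfolding q_def by (intro holomorphic_intros) (use t in auto)
    moreover have "Re (q w) = g w" if "w \<in> sphere z t" for w
      using P[of "(w - z) / of_real t"] that t unfolding q_def
      by (cases "w = z") (auto simp: norm_divide dist_norm norm_minus_commute)
    ultimately show ?thesis using g(2) by (intro exI[of _ q]) (auto simp: abs_less_iff, (smt (verit))+)
  qed
  then obtain p where p: "\<And>n. p n holomorphic_on UNIV"
    "\<And>n w. w \<in> sphere z t \<Longrightarrow> f n w \<le> Re (p n w) \<and> Re (p n w) \<le> f n w + 2 * inverse (Suc n)" by metis
  show thesis
  proof
    show "p n holomorphic_on UNIV" for n by (rule p)
    show "M w \<le> ereal (Re (p n w))" if "w \<in> sphere z t" for n w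
      using f(2)[OF that, of n] p(2)[OF that, of n] by (meson ereal_less_eq(3) order_trans)
    have "inverse (real (Suc n)) \<le> 1" for n by (simp add: field_simps)
    then show "Re (p n w) \<le> K + 2" if "w \<in> sphere z t" for n w
      using p(2)[OF that, of n] f(3)[of n w] by (smt (verit))
    show "\<forall>\<^sub>F n in sequentially. Re (p n w) \<le> a" if "w \<in> sphere z t" and wa: "M w < ereal a" for w a
    proof -
      obtain b where b: "M w < ereal b" "b < a" using ereal_dense2[OF wa] by auto
      have "(\<lambda>n. 2 * inverse (real (Suc n))) \<longlonglongrightarrow> 2 * 0" by (intro tendsto_intros LIMSEQ_inverse_real_of_nat)
      then have "\<forall>\<^sub>F n in sequentially. 2 * inverse (real (Suc n)) < a - b"
        using b by (elim order_tendstoD(2)) simp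
      then show ?thesis using f(4)[OF that(1) b(1)]
      proof eventually_elim
        case (elim n)
        then show ?case using p(2)[OF that(1), of n] by linarith
      qed
    qed
  qed
qed

lemma circ_defect_0: "circ_defect K M z 0 = ennreal (2 * pi) * e2ennreal (ereal K - M z)"
  unfolding circ_defect_def by (simp add: nn_integral_cmult mult.commute)

text \<open>Circular means grow with the radius. Harmonic majorants of \<open>M\<close> on the outer
  circle dominate it inside as well, and their means over both circles equal their value at
  \<open>z\<close>; as they approach \<open>M\<close> from above on the outer circle, Fatou's lemma
  gives the claim. The gap between \<open>K - 2\<close> and \<open>K\<close> is room for the
  overshoot of the majorants.\<close>

lemma circ_defect_antimono:
  assumes \<rho>: "cmod \<rho>1 \<le> cmod \<rho>2" and K: "\<And>w. w \<in> cball z (cmod \<rho>2) \<Longrightarrow> M w \<le> ereal (K - 2)" "2 \<le> K"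
  shows "circ_defect K M z \<rho>2 \<le> circ_defect K M z \<rho>1"
proof (cases "\<rho>2 = 0")
  case True
  then show ?thesis using \<rho> by simp
next
  case False
  define t where "t = cmod \<rho>2"
  have t: "0 < t" using False by (simp add: t_def)
  have s2: "z + \<rho>2 * cis \<theta> \<in> sphere z t" for \<theta> by (simp add: dist_norm norm_mult t_def)
  have K': "\<And>w. w \<in> sphere z t \<Longrightarrow> M w \<le> ereal (K - 2)" "0 \<le> K - 2" using K by (auto simp: t_def)
  obtain p where p: "\<And>n. p n holomorphic_on UNIV" "\<And>n w. w \<in> sphere z t \<Longrightarrow> M w \<le> ereal (Re (p n w))"
    "\<And>n w. w \<in> sphere z t \<Longrightarrow> Re (p n w) \<le> K - 2 + 2"
    "\<And>w a. w \<in> sphere z t \<Longrightarrow> M w < ereal a \<Longrightarrow> \<forall>\<^sub>F n in sequentially. Re (p n w) \<le> a"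
    using harmonic_majorants[OF K' t] by blast
  have pm[measurable]: "p n \<in> borel_measurable borel" for n
    using p(1) holomorphic_on_imp_continuous_on by (blast intro: borel_measurable_continuous_onI)
  have lower: "ennreal (2 * pi * (K - Re (p n z))) \<le> circ_defect K M z \<rho>1" for n
  proof -
    obtain B where B: "\<And>\<theta>. \<bar>Re (p n (z + \<rho>1 * cis \<theta>))\<bar> \<le> B"
      using continuous_bounded_on_circle[OF holomorphic_on_imp_continuous_on[OF p(1)]] by blast
    \<comment> \<open>A level above \<open>K\<close> and above the majorant on the inner circle; the
      surplus \<open>L - K\<close> occurs on both sides and cancels.\<close>
    define L where "L = max K B"
    have L: "Re (p n (z + \<rho>1 * cis \<theta>)) \<le> L" "K \<le> L" for \<theta> using B[of \<theta>] by (auto simp: L_def)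
    have "ennreal (2 * pi * (L - Re (p n z)))
        = (\<integral>\<^sup>+\<theta>. ennreal (L - Re (p n (z + \<rho>1 * cis \<theta>))) * indicator {0..2*pi} \<theta> \<partial>lborel)"
      using L by (intro mean_value_circle_Re[symmetric] p)
    also have "\<dots> \<le> (\<integral>\<^sup>+\<theta>. ennreal (L - K) * indicator {0..2*pi} \<theta>
        + e2ennreal (ereal K - M (z + \<rho>1 * cis \<theta>)) * indicator {0..2*pi} \<theta> \<partial>lborel)"
    proof (intro nn_integral_mono)
      fix \<theta>
      have "z + \<rho>1 * cis \<theta> \<in> cball z t" using \<rho> by (simp add: dist_norm norm_mult t_def)
      then have m: "M (z + \<rho>1 * cis \<theta>) \<le> ereal (Re (p n (z + \<rho>1 * cis \<theta>)))" "M (z + \<rho>1 * cis \<theta>) \<le> ereal (K - 2)"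
        using max_principle[OF p(1) t p(2)] K(1) by (auto simp: t_def)
      then have "ennreal (L - Re (p n (z + \<rho>1 * cis \<theta>))) \<le> ennreal (L - K) + e2ennreal (ereal K - M (z + \<rho>1 * cis \<theta>))"
        using L(2) by (cases "M (z + \<rho>1 * cis \<theta>)") (auto simp: e2ennreal_ereal simp flip: ennreal_plus intro!: ennreal_leI)
      then show "ennreal (L - Re (p n (z + \<rho>1 * cis \<theta>))) * indicator {0..2*pi} \<theta> \<le> ennreal (L - K) * indicator {0..2*pi} \<theta>
        + e2ennreal (ereal K - M (z + \<rho>1 * cis \<theta>)) * indicator {0..2*pi} \<theta>"
        by (auto simp: indicator_def)
    qed
    also have "\<dots> = ennreal (2 * pi * (L - K)) + circ_defect K M z \<rho>1"
      unfolding circ_defect_def using L(2) by (subst nn_integral_add) (auto simp: nn_integral_cmult ennreal_mult mult.commute)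
    finally have le: "ennreal (2 * pi * (L - Re (p n z))) \<le> ennreal (2 * pi * (L - K)) + circ_defect K M z \<rho>1" .
    show ?thesis
    proof (cases "Re (p n z) \<le> K")
      case True
      then have "ennreal (2 * pi * (L - Re (p n z))) = ennreal (2 * pi * (L - K)) + ennreal (2 * pi * (K - Re (p n z)))"
        using L(2) by (simp flip: ennreal_plus add: algebra_simps)
      then show ?thesis using le by simp
    next
      case False
      then have "ennreal (2 * pi * (K - Re (p n z))) = 0"
        by (intro ennreal_neg mult_nonneg_nonpos) auto
      then show ?thesis by simp
    qed
  qed
  \<comment> \<open>Eventual upper bounds on the majorants are lower bounds for the liminf of their
    defects, which is the direction that Fatou's lemma uses.\<close>
  have "circ_defect K M z \<rho>2 \<le> (\<integral>\<^sup>+\<theta>. liminf (\<lambda>n. ennreal (K - Re (p n (z + \<rho>2 * cis \<theta>))) * indicator {0..2*pi} \<theta>) \<partial>lborel)"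
    unfolding circ_defect_def
  proof (intro nn_integral_mono)
    fix \<theta>
    let ?w = "z + \<rho>2 * cis \<theta>"
    have "e2ennreal (ereal K - M ?w) \<le> liminf (\<lambda>n. ennreal (K - Re (p n ?w)))"
      unfolding le_Liminf_iff
    proof (intro allI impI)
      fix y assume y: "y < e2ennreal (ereal K - M ?w)"
      then obtain c where c: "y = ennreal c" "0 \<le> c" by (cases y) auto
      have "M ?w < ereal (K - c)"
        using y c less_PInf[of ?w] by (cases "M ?w") (auto simp: e2ennreal_ereal ennreal_less_iff)
      then obtain a where a: "M ?w < ereal a" "a < K - c" using ereal_dense2 by fastforce
      show "\<forall>\<^sub>F n in sequentially. y < ennreal (K - Re (p n ?w))"
        using p(4)[OF s2 a(1)]
      proof eventually_elim
        case (elim n)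
        then show ?case unfolding c(1) using a(2) c(2) by (intro ennreal_lessI) auto
      qed
    qed
    then show "e2ennreal (ereal K - M ?w) * indicator {0..2*pi} \<theta> \<le> liminf (\<lambda>n. ennreal (K - Re (p n ?w)) * indicator {0..2*pi} \<theta>)"
      by (cases "\<theta> \<in> {0..2*pi}") auto
  qed
  also have "\<dots> \<le> liminf (\<lambda>n. \<integral>\<^sup>+\<theta>. ennreal (K - Re (p n (z + \<rho>2 * cis \<theta>))) * indicator {0..2*pi} \<theta> \<partial>lborel)"
    by (intro nn_integral_liminf) measurable
  also have "\<dots> \<le> circ_defect K M z \<rho>1"
  proof -
    have "(\<integral>\<^sup>+\<theta>. ennreal (K - Re (p n (z + \<rho>2 * cis \<theta>))) * indicator {0..2*pi} \<theta> \<partial>lborel) \<le> circ_defect K M z \<rho>1" for n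
      using p(3)[OF s2, of n] by (subst mean_value_circle_Re[OF p(1)]) (auto intro: lower)
    then show ?thesis by (intro Liminf_le) auto
  qed
  finally show ?thesis .
qed

end

section \<open>Planar Lebesgue measure: Fubini and rotations\<close>

lemma distr_lborel_Complex:
  "distr (lborel \<Otimes>\<^sub>M lborel) borel (\<lambda>(x, y). Complex x y) = (lborel :: complex measure)"
proof (rule lborel_eqI[symmetric])
  have "(\<lambda>p. Complex (fst p) (snd p)) \<in> borel_measurable borel"
    by (intro borel_measurable_continuous_onI)
       (auto simp: Complex_eq intro!: continuous_intros)
  then have m[measurable]: "(\<lambda>(x, y). Complex x y) \<in> borel_measurable (lborel \<Otimes>\<^sub>M lborel)"
    by (simp add: split_beta' lborel_prod)
  fix l u :: complex
  assume le: "\<And>b. b \<in> Basis \<Longrightarrow> l \<bullet> b \<le> u \<bullet> b"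
  have le': "Re l \<le> Re u" "Im l \<le> Im u" using le[of 1] le[of \<i>] by (simp_all add: Basis_complex_def)
  have "(\<lambda>(x, y). Complex x y) -` box l u \<inter> space (lborel \<Otimes>\<^sub>M lborel) = box (Re l) (Re u) \<times> box (Im l) (Im u)"
    by (auto simp: space_pair_measure in_box_complex_iff)
  then have "emeasure (distr (lborel \<Otimes>\<^sub>M lborel) borel (\<lambda>(x, y). Complex x y)) (box l u)
    = emeasure (lborel \<Otimes>\<^sub>M lborel) (box (Re l) (Re u) \<times> box (Im l) (Im u))"
    by (subst emeasure_distr) auto
  also have "\<dots> = ennreal (Re u - Re l) * ennreal (Im u - Im l)"
    using le' by (subst lborel.emeasure_pair_measure_Times) auto
  also have "\<dots> = ennreal (\<Prod>b\<in>Basis. (u - l) \<bullet> b)"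
    using le' by (simp add: Basis_complex_def ennreal_mult)
  finally show "emeasure (distr (lborel \<Otimes>\<^sub>M lborel) borel (\<lambda>(x, y). Complex x y)) (box l u) = ennreal (\<Prod>b\<in>Basis. (u - l) \<bullet> b)" .
qed simp

lemma measurable_Complex[measurable]: "(\<lambda>x. Complex (f x) (g x)) \<in> borel_measurable N"
  if [measurable]: "f \<in> borel_measurable N" "g \<in> borel_measurable N"
  unfolding Complex_eq by measurable

lemma nn_integral_complex:
  assumes [measurable]: "f \<in> borel_measurable borel"
  shows "(\<integral>\<^sup>+z. f z \<partial>lborel) = (\<integral>\<^sup>+x. \<integral>\<^sup>+y. f (Complex x y) \<partial>lborel \<partial>lborel)"
    and "(\<integral>\<^sup>+z. f z \<partial>lborel) = (\<integral>\<^sup>+y. \<integral>\<^sup>+x. f (Complex x y) \<partial>lborel \<partial>lborel)"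
proof -
  have "(\<integral>\<^sup>+z. f z \<partial>lborel) = (\<integral>\<^sup>+p. f (Complex (fst p) (snd p)) \<partial>(lborel \<Otimes>\<^sub>M lborel))"
    by (subst distr_lborel_Complex[symmetric], subst nn_integral_distr) (auto simp: split_beta')
  also have "\<dots> = (\<integral>\<^sup>+x. \<integral>\<^sup>+y. f (Complex x y) \<partial>lborel \<partial>lborel)"
    by (subst lborel.nn_integral_fst[symmetric]) auto
  finally show 1: "(\<integral>\<^sup>+z. f z \<partial>lborel) = \<dots>" .
  show "(\<integral>\<^sup>+z. f z \<partial>lborel) = (\<integral>\<^sup>+y. \<integral>\<^sup>+x. f (Complex x y) \<partial>lborel \<partial>lborel)"
    unfolding 1 by (rule lborel_pair.Fubini') measurable
qed

lemma nn_integral_shift: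
  fixes g :: "real \<Rightarrow> ennreal"
  assumes "g \<in> borel_measurable borel"
  shows "(\<integral>\<^sup>+x. g (c + x) \<partial>lborel) = (\<integral>\<^sup>+x. g x \<partial>lborel)"
  using nn_integral_real_affine[OF assms, of 1 c] by simp

text \<open>A rotation is a product of three shears (horizontal, vertical, horizontal), and each
  shear preserves integrals by Fubini and translation invariance on lines. The coefficient tan
  (\<open>\<alpha>\<close> / 2) rules out half turns.\<close>

lemma nn_integral_rotate_generic:
  fixes f :: "complex \<Rightarrow> ennreal"
  assumes [measurable]: "f \<in> borel_measurable borel" and c: "cos (\<alpha> / 2) \<noteq> 0"
  shows "(\<integral>\<^sup>+z. f (cis \<alpha> * z) \<partial>lborel) = (\<integral>\<^sup>+z. f z \<partial>lborel)"
proof -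
  define a where "a = - tan (\<alpha> / 2)"
  define b where "b = sin \<alpha>"
  have H: "(\<integral>\<^sup>+z. g (Complex (Re z + a * Im z) (Im z)) \<partial>lborel) = (\<integral>\<^sup>+z. g z \<partial>lborel)"
    if [measurable]: "g \<in> borel_measurable borel" for g :: "complex \<Rightarrow> ennreal"
  proof -
    have "(\<integral>\<^sup>+z. g (Complex (Re z + a * Im z) (Im z)) \<partial>lborel) = (\<integral>\<^sup>+y. \<integral>\<^sup>+x. g (Complex (a * y + x) y) \<partial>lborel \<partial>lborel)"
      by (subst nn_integral_complex(2)) (auto simp: add.commute)
    also have "\<dots> = (\<integral>\<^sup>+y. \<integral>\<^sup>+x. g (Complex x y) \<partial>lborel \<partial>lborel)"
      by (intro nn_integral_cong nn_integral_shift[of "\<lambda>x. g (Complex x _)"]) measurable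
    finally show ?thesis by (simp add: nn_integral_complex(2))
  qed
  have V: "(\<integral>\<^sup>+z. g (Complex (Re z) (Im z + b * Re z)) \<partial>lborel) = (\<integral>\<^sup>+z. g z \<partial>lborel)"
    if [measurable]: "g \<in> borel_measurable borel" for g :: "complex \<Rightarrow> ennreal"
  proof -
    have "(\<integral>\<^sup>+z. g (Complex (Re z) (Im z + b * Re z)) \<partial>lborel) = (\<integral>\<^sup>+x. \<integral>\<^sup>+y. g (Complex x (b * x + y)) \<partial>lborel \<partial>lborel)"
      by (subst nn_integral_complex(1)) (auto simp: add.commute)
    also have "\<dots> = (\<integral>\<^sup>+x. \<integral>\<^sup>+y. g (Complex x y) \<partial>lborel \<partial>lborel)"
      by (intro nn_integral_cong nn_integral_shift[of "\<lambda>y. g (Complex _ y)"]) measurable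
    finally show ?thesis by (simp add: nn_integral_complex(1))
  qed
  define h where "h z = Complex (Re z + a * Im z) (Im z)" for z
  define v where "v z = Complex (Re z) (Im z + b * Re z)" for z
  have [measurable]: "h \<in> borel_measurable borel" "v \<in> borel_measurable borel"
    unfolding h_def v_def by measurable
  have ab: "1 + a * b = cos \<alpha>" "a + a * (1 + a * b) = - sin \<alpha>"
  proof -
    define s k where "s = sin (\<alpha>/2)" and "k = cos (\<alpha>/2)"
    have sk: "s\<^sup>2 + k\<^sup>2 = 1" "k \<noteq> 0" using c by (auto simp: s_def k_def)
    have *: "sin \<alpha> = 2 * s * k" "cos \<alpha> = k\<^sup>2 - s\<^sup>2" "a = - s / k"
      using sin_double[of "\<alpha>/2"] cos_double[of "\<alpha>/2"] by (simp_all add: s_def k_def a_def tan_def)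
    show ab1: "1 + a * b = cos \<alpha>" unfolding b_def * using sk by (simp add: field_simps power2_eq_square)
    have "a + a * (1 + a * b) = - (s / k) * (1 + k\<^sup>2 - s\<^sup>2)"
      unfolding ab1 unfolding * by (simp add: distrib_left diff_divide_distrib algebra_simps)
    also have "1 + k\<^sup>2 - s\<^sup>2 = 2 * k\<^sup>2" using sk(1) by simp
    also have "- (s / k) * (2 * k\<^sup>2) = - sin \<alpha>" unfolding * using sk by (simp add: field_simps power2_eq_square)
    finally show "a + a * (1 + a * b) = - sin \<alpha>" .
  qed
  have "cis \<alpha> * z = h (v (h z))" for z
  proof -
    have 1: "Re (h (v (h z))) = (1 + a * b) * Re z + (a + a * (1 + a * b)) * Im z"
      by (simp add: h_def v_def algebra_simps)
    have 2: "Im (h (v (h z))) = b * Re z + (1 + a * b) * Im z"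
      by (simp add: h_def v_def algebra_simps)
    have "Re (h (v (h z))) = cos \<alpha> * Re z + (- sin \<alpha>) * Im z"
      unfolding 1 ab(2) by (simp only: ab(1))
    then show ?thesis using 2 ab(1) by (simp add: complex_eq_iff b_def)
  qed
  then have "(\<integral>\<^sup>+z. f (cis \<alpha> * z) \<partial>lborel) = (\<integral>\<^sup>+z. f (h (v (h z))) \<partial>lborel)" by simp
  also have "\<dots> = (\<integral>\<^sup>+z. f z \<partial>lborel)"
    using H[of "\<lambda>z. f (h (v z))"] V[of "\<lambda>z. f (h z)"] H[of f] by (simp add: h_def[symmetric] v_def[symmetric])
  finally show ?thesis .
qed

text \<open>A half turn is done in two steps of angle \<open>\<alpha> / 2\<close>, for which the
  cosine of the half angle does not vanish.\<close>

lemma nn_integral_rotate: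
  fixes f :: "complex \<Rightarrow> ennreal"
  assumes [measurable]: "f \<in> borel_measurable borel"
  shows "(\<integral>\<^sup>+z. f (cis \<alpha> * z) \<partial>lborel) = (\<integral>\<^sup>+z. f z \<partial>lborel)"
proof (cases "cos (\<alpha> / 2) = 0")
  case True
  then have "cos (\<alpha> / 2 / 2) \<noteq> 0" using cos_double_cos[of "\<alpha>/2/2"] by auto
  then have "(\<integral>\<^sup>+z. f (cis (\<alpha>/2) * (cis (\<alpha>/2) * z)) \<partial>lborel) = (\<integral>\<^sup>+z. f z \<partial>lborel)"
    by (subst nn_integral_rotate_generic[of "\<lambda>z. f (cis (\<alpha>/2) * z)"]) (auto intro: nn_integral_rotate_generic)
  then show ?thesis by (simp add: cis_mult flip: mult.assoc)
qed (auto intro: nn_integral_rotate_generic)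

text \<open>Takes the place of polar coordinates: the planar integral is invariant under each
  rotation, hence equals its average over all rotations, and Fubini moves that average
  inside.\<close>

lemma nn_integral_radial_weight:
  fixes f :: "complex \<Rightarrow> ennreal" and w :: "real \<Rightarrow> ennreal"
  assumes [measurable]: "f \<in> borel_measurable borel" "w \<in> borel_measurable borel"
  shows "ennreal (2 * pi) * (\<integral>\<^sup>+\<zeta>. f \<zeta> * w (cmod \<zeta>) \<partial>lborel)
    = (\<integral>\<^sup>+\<zeta>. (\<integral>\<^sup>+\<theta>. f (\<zeta> * cis \<theta>) * indicator {0..2*pi} \<theta> \<partial>lborel) * w (cmod \<zeta>) \<partial>lborel)"
proof -
  have "ennreal (2 * pi) * (\<integral>\<^sup>+\<zeta>. f \<zeta> * w (cmod \<zeta>) \<partial>lborel)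
    = (\<integral>\<^sup>+\<theta>. (\<integral>\<^sup>+\<zeta>. f \<zeta> * w (cmod \<zeta>) \<partial>lborel) * indicator {0..2*pi} \<theta> \<partial>lborel)"
    by (subst nn_integral_cmult) (auto simp: mult.commute)
  also have "\<dots> = (\<integral>\<^sup>+\<theta>. (\<integral>\<^sup>+\<zeta>. f (cis \<theta> * \<zeta>) * w (cmod \<zeta>) \<partial>lborel) * indicator {0..2*pi} \<theta> \<partial>lborel)"
  proof -
    have "(\<integral>\<^sup>+\<zeta>. f (cis \<theta> * \<zeta>) * w (cmod \<zeta>) \<partial>lborel) = (\<integral>\<^sup>+\<zeta>. f \<zeta> * w (cmod \<zeta>) \<partial>lborel)" for \<theta>
      using nn_integral_rotate[of "\<lambda>\<zeta>. f \<zeta> * w (cmod \<zeta>)" \<theta>] by (simp add: norm_mult)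
    then show ?thesis by simp
  qed
  also have "\<dots> = (\<integral>\<^sup>+\<theta>. \<integral>\<^sup>+\<zeta>. f (cis \<theta> * \<zeta>) * w (cmod \<zeta>) * indicator {0..2*pi} \<theta> \<partial>lborel \<partial>lborel)"
    by (intro nn_integral_cong nn_integral_multc[symmetric]) measurable
  also have "\<dots> = (\<integral>\<^sup>+\<zeta>. \<integral>\<^sup>+\<theta>. f (cis \<theta> * \<zeta>) * w (cmod \<zeta>) * indicator {0..2*pi} \<theta> \<partial>lborel \<partial>lborel)"
    by (rule lborel_pair.Fubini') measurable
  also have "\<dots> = (\<integral>\<^sup>+\<zeta>. (\<integral>\<^sup>+\<theta>. f (\<zeta> * cis \<theta>) * indicator {0..2*pi} \<theta> \<partial>lborel) * w (cmod \<zeta>) \<partial>lborel)"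
    by (intro nn_integral_cong, subst nn_integral_multc[symmetric]) (auto simp: mult_ac)
  finally show ?thesis .
qed

subsection \<open>Smooth test functions\<close>

text \<open>The closure operations in \<open>smooth_gen\<close> form a post-fixed point of the coinductive rule, so \<open>smooth_gen\<close> is
  contained in \<open>smooth_real\<close>.\<close>

coinductive smooth_real :: "(real \<Rightarrow> real) \<Rightarrow> bool" where
  smooth_realI: "(\<And>x. (f has_real_derivative f' x) (at x)) \<Longrightarrow> smooth_real f' \<Longrightarrow> smooth_real f"

inductive smooth_gen :: "(real \<Rightarrow> real) \<Rightarrow> bool" where
  base: "smooth_real f \<Longrightarrow> smooth_gen f"
| const: "smooth_gen (\<lambda>x. c)"
| id: "smooth_gen (\<lambda>x. x)"
| add: "smooth_gen f \<Longrightarrow> smooth_gen g \<Longrightarrow> smooth_gen (\<lambda>x. f x + g x)"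
| mult: "smooth_gen f \<Longrightarrow> smooth_gen g \<Longrightarrow> smooth_gen (\<lambda>x. f x * g x)"
| comp: "smooth_gen f \<Longrightarrow> smooth_gen g \<Longrightarrow> smooth_gen (\<lambda>x. f (g x))"
| divide: "smooth_gen f \<Longrightarrow> 0 < a \<Longrightarrow> (\<And>x. x \<le> a \<Longrightarrow> f x = 0) \<Longrightarrow> smooth_gen (\<lambda>x. f x / x)"
| exp_inverse: "smooth_gen (\<lambda>x. if x \<le> 0 then 0 else exp (- (1 / x)) / x ^ n)"

text \<open>The index \<open>n\<close> makes the family of flat functions closed under
  differentiation up to linear combinations.\<close>

lemma exp_inverse_has_derivative:
  fixes n :: nat and x :: real
  defines "e \<equiv> \<lambda>n x::real. if x \<le> 0 then 0 else exp (- (1 / x)) / x ^ n"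
  shows "(e n has_real_derivative (e (n + 2) x + (- real n) * e (n + 1) x)) (at x)"
proof -
  consider "x < 0" | "x = 0" | "0 < x" by linarith
  then show ?thesis
  proof cases
    case 1
    have "((\<lambda>x. 0) has_real_derivative 0) (at x)" by simp
    then have "(e n has_real_derivative 0) (at x)"
      by (rule has_field_derivative_transform_within_open[where S="{..<0}"]) (use 1 in \<open>auto simp: e_def\<close>)
    then show ?thesis using 1 by (simp add: e_def)
  next
    case 2
    \<comment> \<open>With y = 1/h the right difference quotient at 0 becomes y^(n+1) / exp
      y.\<close>
    have "((\<lambda>y. y ^ (n + 1) / exp y) \<longlongrightarrow> (0::real)) at_top" by (rule tendsto_power_div_exp_0)
    moreover have "\<forall>\<^sub>F y::real in at_top. y ^ (n + 1) / exp y = e n (inverse y) / inverse y"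
      using eventually_gt_at_top[of 0]
      by eventually_elim (auto simp: e_def exp_minus field_simps)
    ultimately have "((\<lambda>y. e n (inverse y) / inverse y) \<longlongrightarrow> 0) at_top"
      by (rule Lim_transform_eventually)
    then have r: "((\<lambda>h. e n h / h) \<longlongrightarrow> 0) (at_right 0)"
      by (simp add: at_right_to_top filterlim_filtermap)
    have "\<forall>\<^sub>F h in at_left (0::real). 0 = e n h / h"
      by (auto simp: eventually_at_filter e_def)
    then have "((\<lambda>h. e n h / h) \<longlongrightarrow> 0) (at_left 0)"
      by (rule Lim_transform_eventually[OF tendsto_const])
    with r have *: "((\<lambda>h. e n h / h) \<longlongrightarrow> 0) (at 0)" by (simp add: filterlim_at_split)
    have E: "e n (0 + h) - e n 0 = e n h" for h by (simp add: e_def)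
    have z: "e (n + 2) 0 + - real n * e (n + 1) 0 = 0" by (simp add: e_def)
    show ?thesis unfolding 2 DERIV_def E z by (rule *)
  next
    case 3
    have "((\<lambda>x. exp (- (1 / x)) / x ^ n) has_real_derivative
        (exp (- (1 / x)) * (1 / x\<^sup>2) * x ^ n - exp (- (1 / x)) * (n * x ^ (n - 1))) / (x ^ n * x ^ n)) (at x)"
    proof -
      have "((\<lambda>x. - (1 / x)) has_real_derivative 1 / x\<^sup>2) (at x)"
        using 3 by (auto intro!: derivative_eq_intros simp: power2_eq_square)
      then have "((\<lambda>x. exp (- (1 / x))) has_real_derivative exp (- (1 / x)) * (1 / x\<^sup>2)) (at x)"
        by (rule DERIV_chain2[OF DERIV_exp])
      from DERIV_divide[OF this DERIV_pow[of n x]] 3 show ?thesis by simp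
    qed
    also have "(exp (- (1 / x)) * (1 / x\<^sup>2) * x ^ n - exp (- (1 / x)) * (n * x ^ (n - 1))) / (x ^ n * x ^ n)
       = exp (- (1 / x)) / x ^ (n + 2) + (- real n) * (exp (- (1 / x)) / x ^ (n + 1))"
    proof -
      have "n * x ^ (n - 1) = n * x ^ n / x" using 3 by (cases n) auto
      then show ?thesis using 3 by (simp add: divide_simps power2_eq_square) (auto simp: algebra_simps)
    qed
    finally have "(e n has_real_derivative \<dots>) (at x)"
      by (rule has_field_derivative_transform_within_open[where S="{0<..}"]) (use 3 in \<open>auto simp: e_def\<close>)
    then show ?thesis using 3 by (simp add: e_def)
  qed
qed

text \<open>This is the post-fixed-point property behind the coinduction. In the quotient case,
  vanishing to the left of a positive \<open>a\<close> keeps the denominator away from 0 wherever it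
  matters.\<close>

lemma smooth_gen_has_derivative:
  "smooth_gen f \<Longrightarrow> \<exists>f'. smooth_gen f' \<and> (\<forall>x. (f has_real_derivative f' x) (at x))"
proof (induction rule: smooth_gen.induct)
  case (base f)
  then show ?case using smooth_real.simps[of f] by (auto intro: smooth_gen.base)
next
  case (const c)
  show ?case by (intro exI[of _ "\<lambda>_. 0"]) (auto intro: smooth_gen.const)
next
  case id
  show ?case by (intro exI[of _ "\<lambda>_. 1"]) (auto intro: smooth_gen.const)
next
  case (add f g)
  then obtain f' g' where "smooth_gen f'" "smooth_gen g'" "\<And>x. (f has_real_derivative f' x) (at x)"
    "\<And>x. (g has_real_derivative g' x) (at x)" by blast
  then show ?case by (intro exI[of _ "\<lambda>x. f' x + g' x"]) (auto intro!: smooth_gen.add derivative_intros)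
next
  case (mult f g)
  then obtain f' g' where *: "smooth_gen f'" "smooth_gen g'" "\<And>x. (f has_real_derivative f' x) (at x)"
    "\<And>x. (g has_real_derivative g' x) (at x)" by blast
  then show ?case using mult.hyps
    by (intro exI[of _ "\<lambda>x. f' x * g x + g' x * f x"]) (auto intro!: smooth_gen.add smooth_gen.mult DERIV_mult)
next
  case (comp f g)
  then obtain f' g' where *: "smooth_gen f'" "smooth_gen g'" "\<And>x. (f has_real_derivative f' x) (at x)"
    "\<And>x. (g has_real_derivative g' x) (at x)" by blast
  have "((\<lambda>x. f (g x)) has_real_derivative f' (g x) * g' x) (at x)" for x
    by (rule DERIV_chain2[OF *(3) *(4)])
  then show ?case using comp.hyps *
    by (intro exI[of _ "\<lambda>x. f' (g x) * g' x"]) (auto intro!: smooth_gen.mult smooth_gen.comp[of f'])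
next
  case (divide f a)
  then obtain f' where f': "smooth_gen f'" "\<And>x. (f has_real_derivative f' x) (at x)" by blast
  \<comment> \<open>Below \<open>a / 2\<close> there is an open neighbourhood on which
    \<open>f\<close> vanishes, so \<open>f'\<close> vanishes too and \<open>f' x / x\<close> is
    again an admissible quotient, with \<open>a / 2\<close> in place of \<open>a\<close>.\<close>
  have f'0: "f' x = 0" if "x \<le> a / 2" for x
  proof -
    have "((\<lambda>x. 0) has_real_derivative 0) (at x)" by simp
    then have "(f has_real_derivative 0) (at x)"
      by (rule has_field_derivative_transform_within_open[where S="{..<a}"]) (use divide.hyps that in auto)
    then show ?thesis using DERIV_unique[OF f'(2)] by blast
  qed
  have s1: "smooth_gen (\<lambda>x. f x / x)" by (rule smooth_gen.divide) (use divide.hyps in auto)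
  have s2: "smooth_gen (\<lambda>x. f x / x / x)" by (rule smooth_gen.divide[OF s1]) (use divide.hyps in auto)
  have s3: "smooth_gen (\<lambda>x. f' x / x)" by (rule smooth_gen.divide[OF f'(1), of "a/2"]) (use divide.hyps f'0 in auto)
  have "((\<lambda>x. f x / x) has_real_derivative (f' x / x + (-1) * (f x / x / x))) (at x)" for x
  proof (cases "x < a / 2")
    case True
    have "((\<lambda>x. 0) has_real_derivative 0) (at x)" by simp
    then have "((\<lambda>x. f x / x) has_real_derivative 0) (at x)"
      by (rule has_field_derivative_transform_within_open[where S="{..<a}"]) (use divide.hyps True in auto)
    then show ?thesis using True f'0[of x] divide.hyps by auto
  next
    case False
    then have "x \<noteq> 0" using divide.hyps by auto
    then show ?thesis by (auto intro!: derivative_eq_intros f'(2) simp: field_simps)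
  qed
  moreover have "smooth_gen (\<lambda>x. f' x / x + (-1) * (f x / x / x))"
    by (intro smooth_gen.add smooth_gen.mult smooth_gen.const s2 s3)
  ultimately show ?case by blast
next
  case (exp_inverse n)
  show ?case
    using exp_inverse_has_derivative[of n]
    by (intro exI[of _ "\<lambda>x. (if x \<le> 0 then 0 else exp (- (1 / x)) / x ^ (n + 2)) + (- real n) * (if x \<le> 0 then 0 else exp (- (1 / x)) / x ^ (n + 1))"] conjI allI)
       (intro smooth_gen.add smooth_gen.mult smooth_gen.const smooth_gen.exp_inverse)
qed

lemma smooth_gen_imp_smooth_real: "smooth_gen f \<Longrightarrow> smooth_real f"
proof (coinduction arbitrary: f)
  case smooth_real
  from smooth_gen_has_derivative[OF this] show ?case by metis
qed

lemma smooth_real_cong_gen: "smooth_gen f \<longleftrightarrow> smooth_real f"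
  using smooth_gen_imp_smooth_real smooth_gen.base by blast

lemmas smooth_real_intros =
  smooth_gen.const[unfolded smooth_real_cong_gen]
  smooth_gen.id[unfolded smooth_real_cong_gen]
  smooth_gen.add[unfolded smooth_real_cong_gen]
  smooth_gen.mult[unfolded smooth_real_cong_gen]

lemmas smooth_real_comp = smooth_gen.comp[unfolded smooth_real_cong_gen]
lemmas smooth_real_divide = smooth_gen.divide[unfolded smooth_real_cong_gen]
lemmas smooth_real_exp_inverse = smooth_gen.exp_inverse[unfolded smooth_real_cong_gen]

lemma smooth_real_diff: "smooth_real f \<Longrightarrow> smooth_real g \<Longrightarrow> smooth_real (\<lambda>x. f x - g x)"
  using smooth_real_intros(3)[OF _ smooth_real_intros(4)[OF smooth_real_intros(1)[of "-1"]], of f g] by simp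

lemma smooth_real_deriv:
  assumes "smooth_real f"
  shows "smooth_real (deriv f)" and "(f has_real_derivative deriv f x) (at x)"
proof -
  obtain f' where f': "\<And>x. (f has_real_derivative f' x) (at x)" "smooth_real f'"
    using assms smooth_real.simps[of f] by auto
  then have "deriv f = f'" by (auto intro: DERIV_imp_deriv)
  then show "smooth_real (deriv f)" "(f has_real_derivative deriv f x) (at x)" using f' by auto
qed

lemma smooth_real_continuous: "smooth_real f \<Longrightarrow> continuous_on A f"
  by (meson DERIV_continuous_on has_field_derivative_at_within smooth_real_deriv(2))

lemma smooth_real_scale: "smooth_real f \<Longrightarrow> smooth_real (\<lambda>x. f (x / c))"
  using smooth_real_comp[OF _ smooth_real_intros(4)[OF smooth_real_intros(1)[of "1/c"] smooth_real_intros(2)], of f] by simp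

lemma primitive_exists:
  fixes f :: "real \<Rightarrow> real"
  assumes f: "continuous_on UNIV f" and 0: "\<And>x. x \<le> a \<Longrightarrow> f x = 0"
  obtains F where "\<And>x. (F has_real_derivative f x) (at x)" "\<And>x. x \<le> a \<Longrightarrow> F x = 0"
proof
  \<comment> \<open>Starting at \<open>a - 1\<close>, inside the zero region, puts every
    \<open>x \<ge> a\<close> in the interior of an interval to which the fundamental theorem
    applies.\<close>
  define F where "F x = integral {a - 1..x} f" for x
  show F0: "F x = 0" if "x \<le> a" for x
    unfolding F_def using that by (intro integral_unique has_integral_is_0) (auto intro: 0)
  show "(F has_real_derivative f x) (at x)" for x
  proof (cases "x < a")
    case True
    have "((\<lambda>x. 0) has_real_derivative 0) (at x)" by simp
    then have "(F has_real_derivative 0) (at x)"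
      by (rule has_field_derivative_transform_within_open[where S="{..<a}"]) (use F0 True in auto)
    then show ?thesis using 0 True by simp
  next
    case False
    have "(F has_real_derivative f x) (at x within {a - 1..x + 1})"
      unfolding F_def using False by (intro integral_has_real_derivative continuous_on_subset[OF f]) auto
    moreover have "at x within {a - 1..x + 1} = at x" using False by (intro at_within_Icc_at) auto
    ultimately show ?thesis by simp
  qed
qed

lemma smooth_real_primitive:
  assumes "smooth_real f" "\<And>x. (F has_real_derivative f x) (at x)"
  shows "smooth_real F"
  using assms by (intro smooth_realI[of F f])

text \<open>The integral of a bump on the interval from 1 to 4, normalised. The step is applied to
  |z|^2 / b^2, so 1 and 4 stand for the radii \<open>b\<close> and \<open>2 * b\<close>; strict
  positivity of the derivative in between will give the mollifier positive mass.\<close>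

lemma step_exists:
  "\<exists>H. smooth_real H \<and> (\<forall>x\<le>1. H x = 0) \<and> (\<forall>x\<ge>4. H x = 1) \<and> (\<forall>x. 0 \<le> deriv H x) \<and>
    (\<forall>x. 1 < x \<and> x < 4 \<longrightarrow> 0 < deriv H x)"
proof -
  define e where "e x = (if x \<le> 0 then 0 else exp (- (1 / x)) / x ^ 0)" for x :: real
  have e: "smooth_real e" unfolding e_def[abs_def] by (rule smooth_real_exp_inverse)
  have e0: "0 \<le> e x" "x \<le> 0 \<Longrightarrow> e x = 0" "0 < x \<Longrightarrow> 0 < e x" for x by (auto simp: e_def)
  define h where "h x = e (x - 1) * e (4 - x)" for x
  have h: "smooth_real h" unfolding h_def[abs_def]
    by (intro smooth_real_intros smooth_real_diff smooth_real_comp[OF e])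
  obtain F where F: "\<And>x. (F has_real_derivative h x) (at x)" "\<And>x. x \<le> 1 \<Longrightarrow> F x = 0"
    using primitive_exists[OF smooth_real_continuous[OF h], of 1] e0 by (auto simp: h_def)
  have h0: "0 \<le> h x" "1 < x \<Longrightarrow> x < 4 \<Longrightarrow> 0 < h x" "4 \<le> x \<Longrightarrow> h x = 0" for x using e0 by (auto simp: h_def)
  have Fs: "smooth_real F" by (rule smooth_real_primitive[OF h F(1)])
  have "F 1 < F 4"
  proof (rule DERIV_pos_imp_increasing_open[where f=F and a=1 and b=4])
    show "\<exists>y. (F has_real_derivative y) (at x) \<and> 0 < y" if "1 < x" "x < 4" for x
      using F(1)[of x] h0(2)[OF that] by blast
  qed (simp, rule smooth_real_continuous[OF Fs])
  then have F4: "0 < F 4" using F(2)[of 1] by simp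
  have F4': "F x = F 4" if "4 \<le> x" for x
  proof (cases "x = 4")
    case False
    have "(F has_real_derivative 0) (at y)" if "4 < y" for y using F(1)[of y] h0(3)[of y] that by simp
    moreover have "4 < x" using that False by simp
    ultimately show ?thesis
      using DERIV_isconst_end[OF _ smooth_real_continuous[OF Fs], of 4 x] by blast
  qed simp
  have "smooth_real (\<lambda>x. 1 / F 4 * F x)" by (intro smooth_real_intros Fs)
  moreover have "deriv (\<lambda>x. 1 / F 4 * F x) x = 1 / F 4 * h x" for x
    by (intro DERIV_imp_deriv DERIV_cmult F)
  moreover have "1 / F 4 * F x = 0" if "x \<le> 1" for x using F(2)[OF that] by simp
  moreover have "1 / F 4 * F x = 1" if "4 \<le> x" for x using F4 F4'[OF that] by simp
  moreover have "0 \<le> 1 / F 4 * h x" for x using F4 h0(1)[of x] by simp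
  moreover have "0 < 1 / F 4 * h x" if "1 < x" "x < 4" for x using F4 h0(2)[OF that] by simp
  ultimately show ?thesis
    by (intro exI[of _ "\<lambda>x. 1 / F 4 * F x"] conjI allI impI) (auto simp only:)
qed

definition step :: "real \<Rightarrow> real" where
  "step = (SOME H. smooth_real H \<and> (\<forall>x\<le>1. H x = 0) \<and> (\<forall>x\<ge>4. H x = 1) \<and> (\<forall>x. 0 \<le> deriv H x) \<and>
    (\<forall>x. 1 < x \<and> x < 4 \<longrightarrow> 0 < deriv H x))"

definition step1 :: "real \<Rightarrow> real" where "step1 = deriv step"
definition step2 :: "real \<Rightarrow> real" where "step2 = deriv step1"

lemma step_props: "smooth_real step" "x \<le> 1 \<Longrightarrow> step x = 0" "4 \<le> x \<Longrightarrow> step x = 1" "0 \<le> step1 x"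
    "1 < x \<Longrightarrow> x < 4 \<Longrightarrow> 0 < step1 x"
  using someI_ex[OF step_exists] unfolding step_def[symmetric] step1_def by auto

lemma smooth_step[intro, simp]: "smooth_real step" "smooth_real step1" "smooth_real step2"
  unfolding step2_def step1_def by (auto intro: smooth_real_deriv step_props)

lemma step_deriv: "(step has_real_derivative step1 x) (at x)" "(step1 has_real_derivative step2 x) (at x)"
  unfolding step2_def step1_def by (auto intro!: smooth_real_deriv step_props)

lemma step_continuous[continuous_intros]:
  "continuous_on A f \<Longrightarrow> continuous_on A (\<lambda>x. step (f x))"
  "continuous_on A f \<Longrightarrow> continuous_on A (\<lambda>x. step1 (f x))"
  "continuous_on A f \<Longrightarrow> continuous_on A (\<lambda>x. step2 (f x))"
  by (auto intro: continuous_on_compose2[OF smooth_real_continuous[of _ UNIV]])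

lemma step_measurable[measurable]: "step \<in> borel_measurable borel" "step1 \<in> borel_measurable borel" "step2 \<in> borel_measurable borel"
  by (auto intro!: borel_measurable_continuous_onI smooth_real_continuous)

lemma step1_0: "x \<le> 1 \<or> 4 \<le> x \<Longrightarrow> step1 x = 0"
proof -
  have z: "step1 x = 0" if "x < 1 \<or> 4 < x" for x
  proof -
    have "((\<lambda>x. step x) has_real_derivative 0) (at x)"
    proof (cases "x < 1")
      case True
      show ?thesis
        by (rule has_field_derivative_transform_within_open[where S="{..<1}" and f="\<lambda>x. 0"]) (use True in \<open>simp_all add: step_props\<close>)
    next
      case False
      then have "4 < x" using that by simp
      then show ?thesis
        by (rule_tac has_field_derivative_transform_within_open[where S="{4<..}" and f="\<lambda>x. 1"]) (simp_all add: step_props)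
    qed
    then show ?thesis using DERIV_unique step_deriv(1) by blast
  qed
  have c: "isCont step1 x" for x using step_deriv(2) DERIV_isCont by blast
  assume "x \<le> 1 \<or> 4 \<le> x"
  moreover have "step1 1 = 0"
  proof -
    have "(step1 \<longlongrightarrow> step1 1) (at_left 1)" using c[of 1] by (simp add: isCont_def filterlim_at_split)
    moreover have "(step1 \<longlongrightarrow> 0) (at_left 1)"
      by (rule Lim_transform_eventually[OF tendsto_const]) (auto simp: eventually_at_filter z)
    ultimately show ?thesis using tendsto_unique trivial_limit_at_left_real by blast
  qed
  moreover have "step1 4 = 0"
  proof -
    have "(step1 \<longlongrightarrow> step1 4) (at_right 4)" using c[of 4] by (simp add: isCont_def filterlim_at_split)
    moreover have "(step1 \<longlongrightarrow> 0) (at_right 4)"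
      by (rule Lim_transform_eventually[OF tendsto_const]) (auto simp: eventually_at_filter z)
    ultimately show ?thesis using tendsto_unique trivial_limit_at_right_real by blast
  qed
  ultimately show ?thesis using z[of x] by (cases "x = 1"; cases "x = 4") auto
qed

lemma step2_0: "x < 1 \<or> 4 < x \<Longrightarrow> step2 x = 0"
proof -
  assume "x < 1 \<or> 4 < x"
  then have "(step1 has_real_derivative 0) (at x)"
    by (rule_tac has_field_derivative_transform_within_open[where S="{..<1} \<union> {4<..}" and f="\<lambda>x. 0" and g=step1])
       (auto simp: step1_0)
  then show ?thesis using DERIV_unique step_deriv(2) by blast
qed

lemma step_bounds: "0 \<le> step x" "step x \<le> 1"
proof -
  have mono: "step x \<le> step y" if "x \<le> y" for x y
    by (rule DERIV_nonneg_imp_nondecreasing[OF that]) (use step_deriv step_props in blast)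
  show "0 \<le> step x" using mono[of "min x 1" x] step_props(2)[of "min x 1"] by simp
  show "step x \<le> 1" using mono[of x "max x 4"] step_props(3)[of "max x 4"] by simp
qed

lemma step_deriv_bounded: "\<exists>B>0. \<forall>x. step1 x \<le> B \<and> \<bar>step2 x\<bar> \<le> B"
proof -
  have "compact (step1 ` {1..4})" "compact (step2 ` {1..4})"
    by (intro compact_continuous_image smooth_real_continuous smooth_step compact_Icc)+
  then obtain B1 B2 where B: "\<And>x. x \<in> {1..4} \<Longrightarrow> \<bar>step1 x\<bar> \<le> B1" "\<And>x. x \<in> {1..4} \<Longrightarrow> \<bar>step2 x\<bar> \<le> B2"
    using compact_imp_bounded bounded_real by (metis imageI)
  have "step1 x \<le> max 1 (max B1 B2)" for x
    using B(1)[of x] step1_0[of x] by (cases "x \<in> {1..4}") auto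
  moreover have "\<bar>step2 x\<bar> \<le> max 1 (max B1 B2)" for x
    using B(2)[of x] step2_0[of x] by (cases "x \<in> {1..4}") auto
  ultimately show ?thesis by (intro exI[of _ "max 1 (max B1 B2)"]) auto
qed

section \<open>Smooth functions of a complex variable and their Laplacians\<close>

inductive smooth_plane :: "(complex \<Rightarrow> real) \<Rightarrow> bool" where
  const: "smooth_plane (\<lambda>z. c)"
| Re: "smooth_plane Re"
| Im: "smooth_plane Im"
| add: "smooth_plane f \<Longrightarrow> smooth_plane g \<Longrightarrow> smooth_plane (\<lambda>z. f z + g z)"
| mult: "smooth_plane f \<Longrightarrow> smooth_plane g \<Longrightarrow> smooth_plane (\<lambda>z. f z * g z)"
| comp: "smooth_real h \<Longrightarrow> smooth_plane f \<Longrightarrow> smooth_plane (\<lambda>z. h (f z))"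

lemma smooth_plane_continuous: "smooth_plane f \<Longrightarrow> continuous_on A f"
proof (induction rule: smooth_plane.induct)
  case (comp h f)
  then show ?case by (intro continuous_on_compose2[OF smooth_real_continuous[OF comp(1), of UNIV]]) auto
qed (auto intro!: continuous_intros)

lemma smooth_plane_has_derivative:
  "smooth_plane f \<Longrightarrow> \<exists>f'. smooth_plane f' \<and>
    (\<forall>z t. ((\<lambda>t. f (z + of_real t * d)) has_real_derivative f' (z + of_real t * d)) (at t))"
proof (induction rule: smooth_plane.induct)
  case (const c)
  show ?case by (intro exI[of _ "\<lambda>_. 0"]) (auto intro: smooth_plane.const)
next
  case Re
  show ?case by (intro exI[of _ "\<lambda>_. Re d"]) (auto intro!: smooth_plane.const derivative_eq_intros)
next
  case Im
  show ?case by (intro exI[of _ "\<lambda>_. Im d"]) (auto intro!: smooth_plane.const derivative_eq_intros)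
next
  case (add f g)
  then obtain f' g' where "smooth_plane f'" "smooth_plane g'"
    "\<And>z t. ((\<lambda>t. f (z + of_real t * d)) has_real_derivative f' (z + of_real t * d)) (at t)"
    "\<And>z t. ((\<lambda>t. g (z + of_real t * d)) has_real_derivative g' (z + of_real t * d)) (at t)" by blast
  then show ?case by (intro exI[of _ "\<lambda>z. f' z + g' z"]) (auto intro!: smooth_plane.add derivative_intros)
next
  case (mult f g)
  then obtain f' g' where "smooth_plane f'" "smooth_plane g'"
    "\<And>z t. ((\<lambda>t. f (z + of_real t * d)) has_real_derivative f' (z + of_real t * d)) (at t)"
    "\<And>z t. ((\<lambda>t. g (z + of_real t * d)) has_real_derivative g' (z + of_real t * d)) (at t)" by blast
  then show ?case using mult.hyps
    by (intro exI[of _ "\<lambda>z. f' z * g z + g' z * f z"]) (auto intro!: smooth_plane.add smooth_plane.mult DERIV_mult)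
next
  case (comp h f)
  then obtain f' where f': "smooth_plane f'"
    "\<And>z t. ((\<lambda>t. f (z + of_real t * d)) has_real_derivative f' (z + of_real t * d)) (at t)" by blast
  have h: "smooth_real (deriv h)" "\<And>x. (h has_real_derivative deriv h x) (at x)"
    using smooth_real_deriv[OF comp(1)] by auto
  have "((\<lambda>t. h (f (z + of_real t * d))) has_real_derivative deriv h (f (z + of_real t * d)) * f' (z + of_real t * d)) (at t)" for z t
    by (rule DERIV_chain2[OF h(2) f'(2)])
  then show ?case using smooth_plane.mult[OF smooth_plane.comp[OF h(1) comp.hyps(2)] f'(1)] by blast
qed

lemma smooth_plane_dder:
  assumes "smooth_plane f"
  shows "smooth_plane (dder d f)"
    and "((\<lambda>t. f (z + of_real t * d)) has_real_derivative dder d f (z + of_real t * d)) (at t)"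
proof -
  obtain f' where f': "smooth_plane f'"
    "\<And>z t. ((\<lambda>t. f (z + of_real t * d)) has_real_derivative f' (z + of_real t * d)) (at t)"
    using smooth_plane_has_derivative[OF assms] by blast
  have "dder d f = f'"
    unfolding dder_def fun_eq_iff using f'(2)[of _ 0] by (auto intro!: DERIV_imp_deriv)
  then show "smooth_plane (dder d f)"
    and "((\<lambda>t. f (z + of_real t * d)) has_real_derivative dder d f (z + of_real t * d)) (at t)" using f' by auto
qed

text \<open>The generated class contains the directional derivatives of its members, so iterated
  derivatives of every order exist and are continuous.\<close>

lemma smooth_plane_imp_smooth_fun:
  assumes "smooth_plane f" shows "smooth_fun f"
proof -
  have *: "smooth_plane (iter_dder ds f)" for ds
    unfolding iter_dder_def by (induction ds) (auto intro: assms smooth_plane_dder)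
  have **: "(\<lambda>t. iter_dder ds f (z + of_real t * d)) differentiable (at 0)" for ds z d
    unfolding real_differentiable_def using smooth_plane_dder(2)[OF *, of ds z d 0] by blast
  show ?thesis unfolding smooth_fun_def
    by (intro ballI conjI allI smooth_plane_continuous[OF *] **)
qed

lemma smooth_plane_test_fun:
  assumes "smooth_plane f" "\<And>z. R < cmod z \<Longrightarrow> f z = 0"
  shows "test_fun f"
proof -
  have "closure {z. f z \<noteq> 0} \<subseteq> cball 0 R"
    using assms(2) by (intro closure_minimal) (auto simp: not_less[symmetric])
  then have "compact (closure {z. f z \<noteq> 0})"
    by (metis bounded_cball bounded_subset closed_closure compact_eq_bounded_closed)
  then show ?thesis unfolding test_fun_def using smooth_plane_imp_smooth_fun[OF assms(1)] by simp
qed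

lemma laplacian_eqI:
  assumes "\<And>z. ((\<lambda>t. f (z + of_real t)) has_real_derivative fx z) (at 0)"
    and "\<And>z. ((\<lambda>t. fx (z + of_real t)) has_real_derivative fxx z) (at 0)"
    and "\<And>z. ((\<lambda>t. f (z + of_real t * \<i>)) has_real_derivative fy z) (at 0)"
    and "\<And>z. ((\<lambda>t. fy (z + of_real t * \<i>)) has_real_derivative fyy z) (at 0)"
  shows "laplacian f z = fxx z + fyy z"
proof -
  have "dder 1 f = fx" "dder \<i> f = fy" unfolding dder_def using assms by (auto intro!: DERIV_imp_deriv)
  moreover have "dder 1 fx = fxx" "dder \<i> fy = fyy" unfolding dder_def using assms by (auto intro!: DERIV_imp_deriv)
  ultimately show ?thesis by (simp add: laplacian_def)
qed

text \<open>Differentiating under the integral replaces \<open>f\<close> by \<open>dder 1 f\<close>,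
  which is again in the class, so coinduction closes. This provides the smoothness of
  \<open>kern\<close>.\<close>

lemma smooth_real_integral:
  assumes "smooth_plane f"
  shows "smooth_real (\<lambda>x. integral {a..b} (\<lambda>y. f (Complex x y)))"
  using assms
proof (coinduction arbitrary: f)
  case (smooth_real f)
  have "((\<lambda>x. integral (cbox a b) (\<lambda>y. f (Complex x y))) has_field_derivative integral (cbox a b) (\<lambda>y. dder 1 f (Complex x y))) (at x within UNIV)" for x
  proof (rule leibniz_rule_field_derivative)
    fix x t :: real
    have "((\<lambda>s. f (Complex x t + of_real s * 1)) has_real_derivative dder 1 f (Complex x t + of_real 0 * 1)) (at (x - x))"
      using smooth_plane_dder(2)[OF smooth_real, of "Complex x t" 1 0] by simp
    then have "((\<lambda>s. f (Complex x t + of_real s * 1)) has_real_derivative dder 1 f (Complex x t)) (at (x - x))" by simp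
    then have "((\<lambda>s. f (Complex x t + of_real (s - x) * 1)) has_real_derivative dder 1 f (Complex x t) * 1) (at x)"
      by (rule DERIV_chain2) (auto intro!: derivative_eq_intros)
    moreover have "Complex x t + of_real (s - x) * 1 = Complex s t" for s by (simp add: complex_eq_iff)
    ultimately show "((\<lambda>x. f (Complex x t)) has_field_derivative dder 1 f (Complex x t)) (at x within UNIV)" by simp
  next
    have [continuous_intros]: "continuous_on A (\<lambda>t. Complex (g t) (h t))" if "continuous_on A g" "continuous_on A h" for A and g h :: "_ \<Rightarrow> real"
      unfolding Complex_eq using that by (intro continuous_intros)
    show "(\<lambda>t. f (Complex x t)) integrable_on cbox a b" for x
      by (intro integrable_continuous continuous_on_compose2[OF smooth_plane_continuous[OF smooth_real, of UNIV]] continuous_intros) auto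
    show "continuous_on (UNIV \<times> cbox a b) (\<lambda>(x, t). dder 1 f (Complex x t))"
      unfolding split_beta
      by (intro continuous_on_compose2[OF smooth_plane_continuous[OF smooth_plane_dder(1)[OF smooth_real], of UNIV]] continuous_intros) auto
  qed auto
  then show ?case using smooth_plane_dder(1)[OF smooth_real, of 1]
    by (intro exI[of _ "\<lambda>x. integral {a..b} (\<lambda>y. dder 1 f (Complex x y))"] exI[of _ "\<lambda>x. integral {a..b} (\<lambda>y. f (Complex x y))"]) auto
qed

lemma pred_cball[measurable]: "Measurable.pred borel (\<lambda>x. x \<in> cball c r)"
  using borel_closed[OF closed_cball, of c r] by (simp add: pred_def del: mem_cball)

lemma nn_integral_translate:
  fixes f :: "complex \<Rightarrow> ennreal"
  assumes [measurable]: "f \<in> borel_measurable borel"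
  shows "(\<integral>\<^sup>+z. f (c + z) \<partial>lborel) = (\<integral>\<^sup>+z. f z \<partial>lborel)"
  by (subst lborel_distr_plus[symmetric, of c], subst nn_integral_distr) auto

lemma emeasure_cball_complex: "0 \<le> r \<Longrightarrow> emeasure lborel (cball (c::complex) r) = ennreal (pi * r\<^sup>2)"
  by (simp add: emeasure_cball unit_ball_vol_2)

lemma cmod_diff_squared: "(cmod (z - w))\<^sup>2 = (Re z - Re w) * (Re z - Re w) + (Im z - Im w) * (Im z - Im w)"
  unfolding cmod_power2 by (simp add: power2_eq_square)

text \<open>The squared modulus is a polynomial in the coordinates, unlike the modulus; for this
  reason radial profiles are functions of |z|^2 throughout.\<close>

lemma smooth_plane_radial:
  assumes "smooth_real \<Phi>"
  shows "smooth_plane (\<lambda>z. \<Phi> ((cmod (z - w))\<^sup>2))"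
proof -
  have "smooth_plane (\<lambda>z. \<Phi> ((Re z + - Re w) * (Re z + - Re w) + (Im z + - Im w) * (Im z + - Im w)))"
    by (intro smooth_plane.comp[OF assms] smooth_plane.add smooth_plane.mult smooth_plane.Re smooth_plane.Im smooth_plane.const)
  then show ?thesis by (simp add: cmod_diff_squared)
qed

text \<open>Chain rule for \<open>\<sigma>\<close> = |z - w|^2, whose squared gradient is 4
  \<open>\<sigma>\<close> and whose Laplacian is 4.\<close>

lemma laplacian_radial:
  assumes D: "\<And>s. (\<Phi> has_real_derivative \<Phi>1 s) (at s)" "\<And>s. (\<Phi>1 has_real_derivative \<Phi>2 s) (at s)"
  shows "laplacian (\<lambda>z. \<Phi> ((cmod (z - w))\<^sup>2)) z = 4 * ((cmod (z - w))\<^sup>2 * \<Phi>2 ((cmod (z - w))\<^sup>2) + \<Phi>1 ((cmod (z - w))\<^sup>2))"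
proof -
  define \<sigma> where "\<sigma> z = (cmod (z - w))\<^sup>2" for z
  have sx: "((\<lambda>t. \<sigma> (z + of_real t)) has_real_derivative 2 * (Re z - Re w)) (at 0)" for z
    unfolding \<sigma>_def cmod_diff_squared by (auto intro!: derivative_eq_intros)
  have sy: "((\<lambda>t. \<sigma> (z + of_real t * \<i>)) has_real_derivative 2 * (Im z - Im w)) (at 0)" for z
    unfolding \<sigma>_def cmod_diff_squared by (auto intro!: derivative_eq_intros)
  have c: "((\<lambda>t. F (\<sigma> (z + of_real t))) has_real_derivative F' (\<sigma> z) * (2 * (Re z - Re w))) (at 0)"
    "((\<lambda>t. F (\<sigma> (z + of_real t * \<i>))) has_real_derivative F' (\<sigma> z) * (2 * (Im z - Im w))) (at 0)"
    if "\<And>s. (F has_real_derivative F' s) (at s)" for F F' z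
    using DERIV_chain2[OF that sx[of z]] DERIV_chain2[OF that sy[of z]] by simp_all
  have "laplacian (\<lambda>z. \<Phi> (\<sigma> z)) z
    = (\<Phi>2 (\<sigma> z) * (2 * (Re z - Re w)) * (2 * (Re z - Re w)) + 2 * \<Phi>1 (\<sigma> z))
      + (\<Phi>2 (\<sigma> z) * (2 * (Im z - Im w)) * (2 * (Im z - Im w)) + 2 * \<Phi>1 (\<sigma> z))"
  proof (rule laplacian_eqI)
    fix z
    show "((\<lambda>t. \<Phi> (\<sigma> (z + of_real t))) has_real_derivative \<Phi>1 (\<sigma> z) * (2 * (Re z - Re w))) (at 0)" by (rule c[OF D(1)])
    show "((\<lambda>t. \<Phi> (\<sigma> (z + of_real t * \<i>))) has_real_derivative \<Phi>1 (\<sigma> z) * (2 * (Im z - Im w))) (at 0)" by (rule c[OF D(1)])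
    have "((\<lambda>t. 2 * (Re (z + of_real t) - Re w)) has_real_derivative 2) (at 0)" by (auto intro!: derivative_eq_intros)
    from DERIV_mult[OF c(1)[OF D(2), of z] this]
    show "((\<lambda>t. \<Phi>1 (\<sigma> (z + of_real t)) * (2 * (Re (z + of_real t) - Re w))) has_real_derivative
        \<Phi>2 (\<sigma> z) * (2 * (Re z - Re w)) * (2 * (Re z - Re w)) + 2 * \<Phi>1 (\<sigma> z)) (at 0)" by simp
    have "((\<lambda>t. 2 * (Im (z + of_real t * \<i>) - Im w)) has_real_derivative 2) (at 0)" by (auto intro!: derivative_eq_intros)
    from DERIV_mult[OF c(2)[OF D(2), of z] this]
    show "((\<lambda>t. \<Phi>1 (\<sigma> (z + of_real t * \<i>)) * (2 * (Im (z + of_real t * \<i>) - Im w))) has_real_derivative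
        \<Phi>2 (\<sigma> z) * (2 * (Im z - Im w)) * (2 * (Im z - Im w)) + 2 * \<Phi>1 (\<sigma> z)) (at 0)" by simp
  qed
  also have "\<dots> = 4 * (\<sigma> z * \<Phi>2 (\<sigma> z) + \<Phi>1 (\<sigma> z))"
    by (simp add: \<sigma>_def cmod_diff_squared algebra_simps)
  finally show ?thesis unfolding \<sigma>_def .
qed

lemma step_mono: "x \<le> y \<Longrightarrow> step x \<le> step y"
  by (rule DERIV_nonneg_imp_nondecreasing) (use step_deriv(1) step_props(4) in blast)+

subsection \<open>Logarithmic kernel and mollified means\<close>

text \<open>The value off \<open>0\<close> is \<open>log\<^sup>+ (b / |\<zeta>|)\<close>, since \<open>ennreal\<close> truncates negative reals to \<open>0\<close>.\<close>

definition log_kernel :: "real \<Rightarrow> complex \<Rightarrow> ennreal" where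
  "log_kernel b \<zeta> = (if \<zeta> = 0 then top else ennreal (ln (b / cmod \<zeta>)))"

lemma measurable_log_kernel[measurable]: "log_kernel b \<in> borel_measurable borel"
  unfolding log_kernel_def by measurable

lemma log_kernel_mono: "b \<le> b' \<Longrightarrow> 0 \<le> b \<Longrightarrow> log_kernel b \<zeta> \<le> log_kernel b' \<zeta>"
  unfolding log_kernel_def by (cases "b = 0") (auto intro!: ennreal_leI divide_right_mono)

text \<open>The radial test function is \<open>\<Phi>(|z - w|\<^sup>2)\<close> with \<open>\<Phi>'(s) = -(step(s/\<delta>\<^sup>2) - step(s/b\<^sup>2))/s\<close>; its Laplacian is the
  difference of two mollifiers of radii \<open>b\<close> and \<open>\<delta>\<close>, and \<open>\<Phi>\<close> is dominated by the logarithmic kernel.\<close>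

lemma radial_test_function_exists:
  assumes "0 < \<delta>" "\<delta> < b"
  obtains \<Phi> where "smooth_real \<Phi>" "\<And>s. 4 * b\<^sup>2 \<le> s \<Longrightarrow> \<Phi> s = 0" "\<And>s. 0 \<le> \<Phi> s"
    "\<And>\<zeta>. ennreal (\<Phi> ((cmod \<zeta>)\<^sup>2)) \<le> 2 * log_kernel (2 * b) \<zeta>"
    "\<And>z w. laplacian (\<lambda>z. \<Phi> ((cmod (z - w))\<^sup>2)) z
      = 4 * (step1 ((cmod (z - w))\<^sup>2 / b\<^sup>2) / b\<^sup>2 - step1 ((cmod (z - w))\<^sup>2 / \<delta>\<^sup>2) / \<delta>\<^sup>2)"
proof -
  define G where "G s = step (s / \<delta>\<^sup>2) - step (s / b\<^sup>2)" for s
  define G' where "G' s = step1 (s / \<delta>\<^sup>2) / \<delta>\<^sup>2 - step1 (s / b\<^sup>2) / b\<^sup>2" for s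
  have b: "0 < b" "0 < \<delta>\<^sup>2" "\<delta>\<^sup>2 < b\<^sup>2" using assms by (auto intro: power_strict_mono)
  have Gs: "smooth_real G" unfolding G_def[abs_def]
    by (intro smooth_real_diff smooth_real_scale smooth_step)
  have G0: "G s = 0" if "s \<le> \<delta>\<^sup>2" for s
    unfolding G_def using that b by (subst (1 2) step_props(2)) (auto simp: field_simps)
  have G4: "G s = 0" if "4 * b\<^sup>2 \<le> s" for s
    unfolding G_def using that b by (subst (1 2) step_props(3)) (auto simp: field_simps)
  have Gpos: "0 \<le> G s" for s
  proof (cases "s \<le> 0")
    case False
    then have "s / b\<^sup>2 \<le> s / \<delta>\<^sup>2" using b by (intro divide_left_mono) auto
    then show ?thesis unfolding G_def using step_mono by simp
  qed (use G0[of s] b in auto)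
  have G1: "G s \<le> 1" for s using step_bounds[of "s / \<delta>\<^sup>2"] step_bounds[of "s / b\<^sup>2"] unfolding G_def by linarith
  define D where "D s = G s / s" for s
  have Ds: "smooth_real D" unfolding D_def[abs_def] by (rule smooth_real_divide[OF Gs b(2) G0])
  have D0: "D s = 0" if "s \<le> \<delta>\<^sup>2" for s using G0[OF that] by (simp add: D_def)
  have Dpos: "0 \<le> D s" for s
  proof (cases "s \<le> \<delta>\<^sup>2")
    case False
    then have "0 < s" using b(2) by linarith
    then show ?thesis using Gpos[of s] by (simp add: D_def)
  qed (simp add: D0)
  obtain F where F: "\<And>s. (F has_real_derivative D s) (at s)" "\<And>s. s \<le> \<delta>\<^sup>2 \<Longrightarrow> F s = 0"
    using primitive_exists[OF smooth_real_continuous[OF Ds] D0] by blast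
  have Fs: "smooth_real F" by (rule smooth_real_primitive[OF Ds F(1)])
  \<comment> \<open>The primitive is measured from the far end, so that the test function vanishes
    outside the disc of radius \<open>2 * b\<close>.\<close>
  define \<Phi> where "\<Phi> s = F (4 * b\<^sup>2) - F s" for s
  have \<Phi>s: "smooth_real \<Phi>" unfolding \<Phi>_def[abs_def] by (intro smooth_real_diff smooth_real_intros Fs)
  have Fmono: "F x \<le> F y" if "x \<le> y" for x y
    by (rule DERIV_nonneg_imp_nondecreasing[OF that]) (use F(1) Dpos in blast)
  have \<Phi>0: "\<Phi> s = 0" if "4 * b\<^sup>2 \<le> s" for s
  proof (cases "s = 4 * b\<^sup>2")
    case False
    then have less: "4 * b\<^sup>2 < s" using that by simp
    have "(F has_real_derivative 0) (at x)" if "4 * b\<^sup>2 < x" for x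
      using F(1)[of x] G4[of x] that by (simp add: D_def)
    then show ?thesis
      using DERIV_isconst_end[OF less smooth_real_continuous[OF Fs]] by (simp add: \<Phi>_def)
  qed (simp add: \<Phi>_def)
  have \<Phi>pos: "0 \<le> \<Phi> s" for s using Fmono[of s "4 * b\<^sup>2"] \<Phi>0[of s] unfolding \<Phi>_def by (cases "s \<le> 4 * b\<^sup>2") auto
  have \<Phi>ln: "\<Phi> s \<le> ln (4 * b\<^sup>2 / s)" if "0 < s" "s \<le> 4 * b\<^sup>2" for s
  proof -
    \<comment> \<open>The derivative of ln - \<open>F\<close> at \<open>x\<close> is (1 -
      \<open>G x\<close>) / x, nonnegative because \<open>G \<le> 1\<close>.\<close>
    have "ln s - F s \<le> ln (4 * b\<^sup>2) - F (4 * b\<^sup>2)"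
    proof (rule DERIV_nonneg_imp_nondecreasing[OF that(2)])
      fix x assume "s \<le> x" "x \<le> 4 * b\<^sup>2"
      then have x: "0 < x" using that by simp
      have "((\<lambda>x. ln x - F x) has_real_derivative 1 / x - D x) (at x)"
        using x by (auto intro!: derivative_eq_intros F(1) simp: divide_inverse)
      moreover have "0 \<le> 1 / x - D x" using G1[of x] x by (simp add: D_def field_simps)
      ultimately show "\<exists>y. ((\<lambda>x. ln x - F x) has_real_derivative y) (at x) \<and> 0 \<le> y" by blast
    qed
    then show ?thesis using that b by (simp add: \<Phi>_def ln_div)
  qed
  have \<Phi>k: "ennreal (\<Phi> ((cmod \<zeta>)\<^sup>2)) \<le> 2 * log_kernel (2 * b) \<zeta>" for \<zeta>
  proof (cases "\<zeta> = 0")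
    case False
    show ?thesis
    proof (cases "(cmod \<zeta>)\<^sup>2 \<le> 4 * b\<^sup>2")
      case True
      have "4 * b\<^sup>2 / (cmod \<zeta>)\<^sup>2 = (2 * b / cmod \<zeta>)\<^sup>2" by (simp add: power_divide power_mult_distrib)
      then have "\<Phi> ((cmod \<zeta>)\<^sup>2) \<le> 2 * ln (2 * b / cmod \<zeta>)"
        using \<Phi>ln[of "(cmod \<zeta>)\<^sup>2"] True False b by (simp add: ln_realpow)
      then have "ennreal (\<Phi> ((cmod \<zeta>)\<^sup>2)) \<le> ennreal (2 * ln (2 * b / cmod \<zeta>))" by (rule ennreal_leI)
      then show ?thesis using False by (simp add: log_kernel_def ennreal_mult')
    qed (use \<Phi>0[of "(cmod \<zeta>)\<^sup>2"] in auto)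
  qed (simp add: log_kernel_def ennreal_mult_top)
  have lap: "laplacian (\<lambda>z. \<Phi> ((cmod (z - w))\<^sup>2)) z
      = 4 * (step1 ((cmod (z - w))\<^sup>2 / b\<^sup>2) / b\<^sup>2 - step1 ((cmod (z - w))\<^sup>2 / \<delta>\<^sup>2) / \<delta>\<^sup>2)" for z w
  proof -
    have d1: "(\<Phi> has_real_derivative - D s) (at s)" for s
      unfolding \<Phi>_def[abs_def] by (auto intro!: derivative_eq_intros F(1))
    have d2: "((\<lambda>s. - D s) has_real_derivative - deriv D s) (at s)" for s
      by (intro DERIV_minus smooth_real_deriv Ds)
    have "(G has_real_derivative G' s) (at s)" for s
    proof -
      have 1: "((\<lambda>s. s / c) has_real_derivative 1 / c) (at s)" for c :: real
        using DERIV_cdivide[OF DERIV_ident] .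
      show ?thesis unfolding G_def[abs_def] G'_def
        using DERIV_diff[OF DERIV_chain2[OF step_deriv(1) 1[of "\<delta>\<^sup>2"]] DERIV_chain2[OF step_deriv(1) 1[of "b\<^sup>2"]]]
        by simp
    qed
    moreover have "(G has_real_derivative s * deriv D s + D s) (at s)" for s
    proof -
      have "((\<lambda>s. s * D s) has_real_derivative 1 * D s + deriv D s * s) (at s)"
        by (intro DERIV_mult DERIV_ident smooth_real_deriv Ds)
      moreover have "(\<lambda>s. s * D s) = G" using G0[of 0] b by (auto simp: D_def fun_eq_iff)
      ultimately show ?thesis by (simp add: mult.commute add.commute)
    qed
    \<comment> \<open>The radial Laplacian is 4 times the derivative of s \<open>\<Phi>\<close>'(s)
      = - \<open>G s\<close>; it is identified by differentiating \<open>s * D s = G s\<close> in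
      two ways.\<close>
    ultimately have "s * deriv D s + D s = G' s" for s using DERIV_unique by blast
    then have "s * (- deriv D s) + (- D s) = - G' s" for s by (simp add: algebra_simps)
    then show ?thesis unfolding laplacian_radial[OF d1 d2] by (simp add: G'_def)
  qed
  show thesis using that[OF \<Phi>s \<Phi>0 \<Phi>pos \<Phi>k lap] .
qed

section \<open>Local mass of a subharmonic function of finite type\<close>

locale finite_type_subharmonic = subharmonic_fun +
  fixes \<mu> :: "complex measure"
  assumes nontrivial: "\<exists>z. M z \<noteq> - \<infinity>"
    and finite_type: "Limsup at_infinity (\<lambda>z. M z / ereal (cmod z)) < \<infinity>"
    and riesz: "riesz_measure M \<mu>"
begin

abbreviation m :: "complex \<Rightarrow> real" where "m z \<equiv> real_of_ereal (M z)"

lemma sets_mu[simp, measurable_cong]: "sets \<mu> = sets borel"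
  using riesz by (simp add: riesz_measure_def)

lemma emeasure_mu_cball: "emeasure \<mu> (cball 0 R) < \<infinity>"
  using riesz by (simp add: riesz_measure_def)

lemma space_mu[simp]: "space \<mu> = UNIV"
  using sets_eq_imp_space_eq[OF sets_mu] by simp

lemma riesz_identity:
  assumes "test_fun \<phi>"
  shows "(\<integral>z. m z * laplacian \<phi> z \<partial>lborel) = 2 * pi * (\<integral>z. \<phi> z \<partial>\<mu>)"
  using riesz assms by (simp add: riesz_measure_def)

lemma upper_growth: "\<exists>A\<ge>0. \<forall>z. M z \<le> ereal (A * (1 + cmod z))"
proof -
  obtain c where c: "Limsup at_infinity (\<lambda>z. M z / ereal (cmod z)) < ereal c"
    using finite_type by (metis ereal_dense2)
  then have "\<forall>\<^sub>F z in at_infinity. M z / ereal (cmod z) < ereal c" by (rule Limsup_lessD)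
  then obtain b where b: "\<And>z. b \<le> cmod z \<Longrightarrow> M z / ereal (cmod z) < ereal c"
    by (auto simp: eventually_at_infinity)
  obtain B where B: "0 \<le> B" "\<And>z. z \<in> cball 0 (max b 1) \<Longrightarrow> M z \<le> ereal B"
    using bounded_above[OF compact_cball] by blast
  have "M z \<le> ereal (max \<bar>c\<bar> B * (1 + cmod z))" for z
  proof (cases "cmod z \<le> max b 1")
    case True
    then have "M z \<le> ereal B" using B by simp
    also have "ereal B \<le> ereal (max \<bar>c\<bar> B * (1 + cmod z))"
      using B mult_mono[of B "max \<bar>c\<bar> B" 1 "1 + cmod z"] by simp
    finally show ?thesis .
  next
    case False
    then have z: "0 < cmod z" "b \<le> cmod z" by auto
    then have "M z \<le> ereal (c * cmod z)"
      using b[OF z(2)] by (cases "M z") (auto simp: field_simps)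
    also have "ereal (c * cmod z) \<le> ereal (max \<bar>c\<bar> B * (1 + cmod z))"
      using mult_mono[of c "max \<bar>c\<bar> B" "cmod z" "1 + cmod z"] by simp
    finally show ?thesis .
  qed
  then show ?thesis using B(1) by (intro exI[of _ "max \<bar>c\<bar> B"]) auto
qed

text \<open>Every circle in the disc has at most the defect of the degenerate circle at its centre,
  and averaging over rotations assembles the circles into the disc.\<close>

lemma disc_defect:
  assumes K: "\<And>w. w \<in> cball z R \<Longrightarrow> M w \<le> ereal (K - 2)" "2 \<le> K" and R: "0 \<le> R"
  shows "(\<integral>\<^sup>+w. e2ennreal (ereal K - M w) * indicator (cball z R) w \<partial>lborel)
    \<le> e2ennreal (ereal K - M z) * ennreal (pi * R\<^sup>2)"
proof -
  have "(\<integral>\<^sup>+w. e2ennreal (ereal K - M w) * indicator (cball z R) w \<partial>lborel)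
    = (\<integral>\<^sup>+\<zeta>. e2ennreal (ereal K - M (z + \<zeta>)) * indicator {..R} (cmod \<zeta>) \<partial>lborel)"
    by (subst nn_integral_translate[symmetric, of _ z]) (auto intro!: nn_integral_cong simp: indicator_def dist_norm)
  moreover have "ennreal (2 * pi) * \<dots> \<le> ennreal (2 * pi) * (e2ennreal (ereal K - M z) * ennreal (pi * R\<^sup>2))"
  proof -
    have "ennreal (2 * pi) * (\<integral>\<^sup>+\<zeta>. e2ennreal (ereal K - M (z + \<zeta>)) * indicator {..R} (cmod \<zeta>) \<partial>lborel)
      = (\<integral>\<^sup>+\<zeta>. circ_defect K M z \<zeta> * indicator {..R} (cmod \<zeta>) \<partial>lborel)"
      unfolding circ_defect_def by (rule nn_integral_radial_weight) measurable
    also have "\<dots> \<le> (\<integral>\<^sup>+\<zeta>. circ_defect K M z 0 * indicator (cball (0::complex) R) \<zeta> \<partial>lborel)"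
    proof (intro nn_integral_mono)
      fix \<zeta>
      show "circ_defect K M z \<zeta> * indicator {..R} (cmod \<zeta>) \<le> circ_defect K M z 0 * indicator (cball (0::complex) R) \<zeta>"
      proof (cases "cmod \<zeta> \<le> R")
        case True
        then have "circ_defect K M z \<zeta> \<le> circ_defect K M z 0"
          by (intro circ_defect_antimono K) auto
        then show ?thesis using True by simp
      qed simp
    qed
    also have "\<dots> = ennreal (2 * pi) * (e2ennreal (ereal K - M z) * ennreal (pi * R\<^sup>2))"
      using R by (subst nn_integral_cmult_indicator) (auto simp: circ_defect_0 emeasure_cball_complex mult.assoc)
    finally show ?thesis .
  qed
  ultimately show ?thesis by (simp add: ennreal_mult_le_mult_iff)
qed

text \<open>Discs about 0 are enclosed in discs about a point \<open>z0\<close> where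
  \<open>M\<close> is finite. There the defect is at most its central value times the area, hence of
  order (1 + \<open>\<rho>\<close>)^3 under linear growth.\<close>

lemma local_defect_bound:
  obtains C where "0 \<le> C" "\<And>\<rho>. 0 \<le> \<rho> \<Longrightarrow> (\<integral>\<^sup>+z. e2ennreal \<bar>M z\<bar> * indicator (cball 0 \<rho>) z \<partial>lborel) \<le> ennreal (C * (1 + \<rho>) ^ 3)"
proof -
  obtain A where A: "0 \<le> A" "\<And>z. M z \<le> ereal (A * (1 + cmod z))" using upper_growth by blast
  obtain z0 where z0: "M z0 \<noteq> -\<infinity>" using nontrivial by blast
  then obtain s where s: "M z0 = ereal s" using less_PInf[of z0] by (cases "M z0") auto
  define T where "T = 1 + cmod z0"
  define C where "C = 2 * pi * T ^ 3 * (2 * (A + 2 + \<bar>s\<bar>))"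
  have T: "1 \<le> T" by (simp add: T_def)
  have C: "0 \<le> C" using T A by (simp add: C_def)
  have "(\<integral>\<^sup>+z. e2ennreal \<bar>M z\<bar> * indicator (cball 0 \<rho>) z \<partial>lborel) \<le> ennreal (C * (1 + \<rho>) ^ 3)" if \<rho>: "0 \<le> \<rho>" for \<rho>
  proof -
    define R where "R = \<rho> + cmod z0"
    \<comment> \<open>The linear bound for \<open>M\<close> on the enclosing disc, plus the margin 2
      required for monotone circular means, plus \<open>\<bar>s\<bar>\<close> to ensure
      \<open>s \<le> K\<close>.\<close>
    define K where "K = A * (1 + cmod z0 + R) + 2 + \<bar>s\<bar>"
    have R: "0 \<le> R" using \<rho> by (simp add: R_def)
    have K: "2 \<le> K" "s \<le> K" "0 \<le> K" using A R by (auto simp: K_def intro!: add_nonneg_nonneg add_increasing)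
    have MK: "M w \<le> ereal (K - 2)" if "w \<in> cball z0 R" for w
    proof -
      have "cmod w \<le> cmod z0 + cmod (w - z0)" by (metis add.commute diff_add_cancel norm_triangle_ineq)
      then have "cmod w \<le> cmod z0 + R" using that by (simp add: dist_norm norm_minus_commute)
      then have "A * (1 + cmod w) \<le> K - 2" unfolding K_def using A by (smt (verit) mult_left_mono)
      then show ?thesis using A(2)[of w] by (meson ereal_less_eq(3) order_trans)
    qed
    have sub: "cball 0 \<rho> \<subseteq> cball z0 R"
      unfolding R_def by (auto simp: dist_norm) (metis norm_minus_commute add.commute add_mono norm_triangle_ineq4 order_refl order_trans)
    have "(\<integral>\<^sup>+z. e2ennreal \<bar>M z\<bar> * indicator (cball 0 \<rho>) z \<partial>lborel)
      \<le> (\<integral>\<^sup>+z. e2ennreal (ereal K - M z) * indicator (cball z0 R) z + ennreal K * indicator (cball z0 R) z \<partial>lborel)"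
    proof (intro nn_integral_mono)
      fix z
      show "e2ennreal \<bar>M z\<bar> * indicator (cball 0 \<rho>) z \<le> e2ennreal (ereal K - M z) * indicator (cball z0 R) z + ennreal K * indicator (cball z0 R) z"
      proof (cases "z \<in> cball 0 \<rho>")
        case True
        then have z: "z \<in> cball z0 R" using sub by blast
        have "M z \<le> ereal K" using MK[OF z] by (rule order_trans) simp
        then have "e2ennreal \<bar>M z\<bar> \<le> e2ennreal (ereal K - M z) + ennreal K"
          using K by (cases "M z") (auto simp: e2ennreal_ereal simp flip: ennreal_plus intro!: ennreal_leI)
        then show ?thesis using True z by simp
      qed simp
    qed
    also have "\<dots> = (\<integral>\<^sup>+z. e2ennreal (ereal K - M z) * indicator (cball z0 R) z \<partial>lborel) + ennreal K * ennreal (pi * R\<^sup>2)"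
      using R by (subst nn_integral_add, measurable) (simp add: nn_integral_cmult_indicator emeasure_cball_complex)
    also have "\<dots> \<le> e2ennreal (ereal K - M z0) * ennreal (pi * R\<^sup>2) + ennreal K * ennreal (pi * R\<^sup>2)"
      by (intro add_right_mono disc_defect MK K R)
    also have "\<dots> = ennreal ((2 * K - s) * (pi * R\<^sup>2))"
    proof -
      have "e2ennreal (ereal K - M z0) * ennreal (pi * R\<^sup>2) + ennreal K * ennreal (pi * R\<^sup>2)
        = ennreal ((K - s) * (pi * R\<^sup>2)) + ennreal (K * (pi * R\<^sup>2))"
        using s K by (simp add: e2ennreal_ereal ennreal_mult)
      also have "\<dots> = ennreal ((K - s) * (pi * R\<^sup>2) + K * (pi * R\<^sup>2))"
        using K by (intro ennreal_plus[symmetric]) auto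
      finally show ?thesis by (simp add: algebra_simps)
    qed
    also have "\<dots> \<le> ennreal (C * (1 + \<rho>) ^ 3)"
    proof (intro ennreal_leI)
      have 1: "R \<le> T * (1 + \<rho>)" using \<rho> by (simp add: R_def T_def algebra_simps)
      then have R2: "R\<^sup>2 \<le> (T * (1 + \<rho>))\<^sup>2" using R by (intro power_mono)
      have "1 + cmod z0 + R \<le> 2 * (T * (1 + \<rho>))" using 1 \<rho> T
        by (smt (verit) T_def mult_left_le_one_le mult_le_cancel_left1)
      then have "K \<le> 2 * (T * (1 + \<rho>)) * (A + 2 + \<bar>s\<bar>) - \<bar>s\<bar>"
      proof -
        assume a: "1 + cmod z0 + R \<le> 2 * (T * (1 + \<rho>))"
        have b: "1 \<le> T * (1 + \<rho>)" using T \<rho> by (simp add: mult_ge1_I)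
        have "A * (1 + cmod z0 + R) \<le> A * (2 * (T * (1 + \<rho>)))" using a A by (intro mult_left_mono) auto
        moreover have "2 * 2 + 2 * \<bar>s\<bar> \<le> 2 * (T * (1 + \<rho>)) * (2 + \<bar>s\<bar>)"
          using b mult_right_mono[of 1 "T * (1 + \<rho>)" "2 * (2 + \<bar>s\<bar>)"] by (simp add: algebra_simps)
        ultimately show ?thesis unfolding K_def by (simp add: algebra_simps)
      qed
      then have "2 * K - s \<le> T * (1 + \<rho>) * (4 * (A + 2 + \<bar>s\<bar>))" by (simp add: algebra_simps)
      then have "(2 * K - s) * (pi * R\<^sup>2) \<le> T * (1 + \<rho>) * (4 * (A + 2 + \<bar>s\<bar>)) * (pi * (T * (1 + \<rho>))\<^sup>2)"
        using R2 K A T \<rho> by (intro mult_mono) auto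
      also have "\<dots> = C * (1 + \<rho>) ^ 3" by (simp add: C_def power2_eq_square power3_eq_cube algebra_simps)
      finally show "(2 * K - s) * (pi * R\<^sup>2) \<le> C * (1 + \<rho>) ^ 3" .
    qed
    finally show ?thesis .
  qed
  with C show thesis by (rule that)
qed

lemma AE_M_finite: "AE z in lborel. M z = ereal (m z)"
proof -
  obtain C where C: "0 \<le> C" "\<And>\<rho>. 0 \<le> \<rho> \<Longrightarrow> (\<integral>\<^sup>+z. e2ennreal \<bar>M z\<bar> * indicator (cball 0 \<rho>) z \<partial>lborel) \<le> ennreal (C * (1 + \<rho>) ^ 3)"
    using local_defect_bound by blast
  have "AE z in lborel. e2ennreal \<bar>M z\<bar> * indicator (cball 0 (real n)) z \<noteq> \<infinity>" for n
  proof (rule nn_integral_noteq_infinite)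
    show "(\<lambda>z. e2ennreal \<bar>M z\<bar> * indicator (cball 0 (real n)) z) \<in> borel_measurable lborel" by measurable
    show "(\<integral>\<^sup>+z. e2ennreal \<bar>M z\<bar> * indicator (cball 0 (real n)) z \<partial>lborel) \<noteq> \<infinity>"
      using C(2)[of "real n"] by (auto simp: top_unique)
  qed
  then have "AE z in lborel. \<forall>n. e2ennreal \<bar>M z\<bar> * indicator (cball 0 (real n)) z \<noteq> \<infinity>"
    by (simp add: AE_all_countable)
  then show ?thesis
  proof (rule eventually_mono)
    fix z assume *: "\<forall>n. e2ennreal \<bar>M z\<bar> * indicator (cball 0 (real n)) z \<noteq> \<infinity>"
    obtain n where "cmod z \<le> real n" using real_arch_simple by blast
    then have "e2ennreal \<bar>M z\<bar> \<noteq> \<infinity>" using *[rule_format, of n] by simp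
    then show "M z = ereal (m z)" by (cases "M z") auto
  qed
qed

lemma abs_mass:
  obtains C where "0 \<le> C" "\<And>\<rho>. 0 \<le> \<rho> \<Longrightarrow> (\<integral>\<^sup>+z. ennreal \<bar>m z\<bar> * indicator (cball 0 \<rho>) z \<partial>lborel) \<le> ennreal (C * (1 + \<rho>) ^ 3)"
proof -
  obtain C where C: "0 \<le> C" "\<And>\<rho>. 0 \<le> \<rho> \<Longrightarrow> (\<integral>\<^sup>+z. e2ennreal \<bar>M z\<bar> * indicator (cball 0 \<rho>) z \<partial>lborel) \<le> ennreal (C * (1 + \<rho>) ^ 3)"
    using local_defect_bound by blast
  have "ennreal \<bar>m z\<bar> \<le> e2ennreal \<bar>M z\<bar>" for z by (cases "M z") (auto simp: e2ennreal_ereal)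
  then have "(\<integral>\<^sup>+z. ennreal \<bar>m z\<bar> * indicator (cball 0 \<rho>) z \<partial>lborel) \<le> (\<integral>\<^sup>+z. e2ennreal \<bar>M z\<bar> * indicator (cball 0 \<rho>) z \<partial>lborel)" for \<rho>
    by (intro nn_integral_mono mult_right_mono) auto
  then show thesis using C order_trans by (intro that[of C]) blast+
qed

end

section \<open>Mollified means against circular means and point values\<close>

lemma nn_integral_complex_affine:
  fixes f :: "complex \<Rightarrow> ennreal"
  assumes [measurable]: "f \<in> borel_measurable borel" and b: "0 < b"
  shows "(\<integral>\<^sup>+z. f z \<partial>lborel) = ennreal (b\<^sup>2) * (\<integral>\<^sup>+\<zeta>. f (w + b *\<^sub>R \<zeta>) \<partial>lborel)"
  using b by (subst lborel_affine[of b w]) (simp_all add: nn_integral_density nn_integral_distr nn_integral_cmult)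

text \<open>It lives on an annulus rather than a disc, so that all circles it averages over have
  radius at least \<open>b\<close>. Its mass is \<open>c0\<close>, not 1, since it arises directly
  as a piece of a Laplacian.\<close>

definition mollifier :: "complex \<Rightarrow> real \<Rightarrow> complex \<Rightarrow> real" where
  "mollifier w b z = step1 ((cmod (z - w))\<^sup>2 / b\<^sup>2) / b\<^sup>2"

lemma measurable_mollifier[measurable]: "mollifier w b \<in> borel_measurable borel"
  unfolding mollifier_def[abs_def] by measurable

lemma mollifier_nonneg: "0 \<le> mollifier w b z"
  unfolding mollifier_def by (simp add: step_props(4))

lemma mollifier_eq_0:
  assumes "0 < b" "cmod (z - w) \<le> b \<or> 2 * b \<le> cmod (z - w)"
  shows "mollifier w b z = 0"
proof -
  have "(cmod (z - w))\<^sup>2 / b\<^sup>2 \<le> 1 \<or> 4 \<le> (cmod (z - w))\<^sup>2 / b\<^sup>2"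
  proof -
    have "(cmod (z - w))\<^sup>2 \<le> b\<^sup>2 \<or> (2 * b)\<^sup>2 \<le> (cmod (z - w))\<^sup>2"
      using assms(2)
    proof
      assume "2 * b \<le> cmod (z - w)"
      then have "(2 * b)\<^sup>2 \<le> (cmod (z - w))\<^sup>2" using assms(1) by (intro power_mono) auto
      then show ?thesis by blast
    qed (simp add: power_mono)
    then show ?thesis using assms(1) by (simp add: field_simps)
  qed
  then show ?thesis using step1_0 by (simp add: mollifier_def)
qed

definition c0 :: real where "c0 = enn2real (\<integral>\<^sup>+\<zeta>. ennreal (step1 ((cmod \<zeta>)\<^sup>2)) \<partial>lborel)"

lemma c0: "(\<integral>\<^sup>+\<zeta>. ennreal (step1 ((cmod \<zeta>)\<^sup>2)) \<partial>lborel) = ennreal c0" "0 < c0"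
proof -
  obtain B where B: "0 < B" "\<And>x. step1 x \<le> B" using step_deriv_bounded by blast
  have "(\<integral>\<^sup>+\<zeta>. ennreal (step1 ((cmod \<zeta>)\<^sup>2)) \<partial>lborel) \<le> (\<integral>\<^sup>+\<zeta>. ennreal B * indicator (cball (0::complex) 2) \<zeta> \<partial>lborel)"
  proof (intro nn_integral_mono)
    fix \<zeta> :: complex
    show "ennreal (step1 ((cmod \<zeta>)\<^sup>2)) \<le> ennreal B * indicator (cball 0 2) \<zeta>"
      using B mollifier_eq_0[of 1 \<zeta> 0] by (auto simp: indicator_def mollifier_def intro!: ennreal_leI)
  qed
  also have "\<dots> = ennreal B * ennreal (pi * 2\<^sup>2)" by (simp add: nn_integral_cmult_indicator emeasure_cball_complex)
  also have "\<dots> < \<infinity>" by (simp add: ennreal_mult_less_top)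
  finally have fin: "(\<integral>\<^sup>+\<zeta>. ennreal (step1 ((cmod \<zeta>)\<^sup>2)) \<partial>lborel) < \<infinity>" .
  then show eq: "(\<integral>\<^sup>+\<zeta>. ennreal (step1 ((cmod \<zeta>)\<^sup>2)) \<partial>lborel) = ennreal c0" by (simp add: c0_def)
  have "(\<integral>\<^sup>+\<zeta>. ennreal (step1 ((cmod \<zeta>)\<^sup>2)) \<partial>lborel) \<noteq> 0"
  proof
    assume "(\<integral>\<^sup>+\<zeta>. ennreal (step1 ((cmod \<zeta>)\<^sup>2)) \<partial>lborel) = 0"
    then have "AE \<zeta> in lborel. ennreal (step1 ((cmod \<zeta>)\<^sup>2)) = 0" by (simp add: nn_integral_0_iff_AE)
    \<comment> \<open>The small disc about 3/2 lies inside the annulus 1 < |\<open>\<zeta>\<close>|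
      < 2, where the profile is strictly positive.\<close>
    then have "AE \<zeta> in lborel. \<zeta> \<notin> cball (3/2::complex) (1/4)"
    proof (rule eventually_mono)
      fix \<zeta> assume z: "ennreal (step1 ((cmod \<zeta>)\<^sup>2)) = 0"
      show "\<zeta> \<notin> cball (3/2::complex) (1/4)"
      proof
        assume "\<zeta> \<in> cball (3/2::complex) (1/4)"
        then have "1 < cmod \<zeta>" "cmod \<zeta> < 2"
          using norm_triangle_ineq2[of "3/2::complex" \<zeta>] norm_triangle_ineq2[of \<zeta> "3/2::complex"]
          by (auto simp: dist_norm norm_minus_commute)
        then have "1\<^sup>2 < (cmod \<zeta>)\<^sup>2" "(cmod \<zeta>)\<^sup>2 < 2\<^sup>2" by (intro power_strict_mono; simp)+
        then show False using z step_props(5)[of "(cmod \<zeta>)\<^sup>2"] by (simp add: ennreal_eq_0_iff)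
      qed
    qed
    then have "cball (3/2::complex) (1/4) \<in> null_sets lborel"
      using AE_iff_null_sets[of "cball (3/2::complex) (1/4)" lborel] by (simp del: mem_cball)
    then have "emeasure lborel (cball (3/2::complex) (1/4)) = 0" by (rule null_setsD1)
    then show False by (simp add: emeasure_cball_complex)
  qed
  then show "0 < c0" using eq by (metis ennreal_neg not_le)
qed

lemma nn_integral_mollifier:
  assumes "0 < b" shows "(\<integral>\<^sup>+z. ennreal (mollifier w b z) \<partial>lborel) = ennreal c0"
proof -
  have pt: "ennreal (mollifier w b (w + b *\<^sub>R \<zeta>)) = ennreal (step1 ((cmod \<zeta>)\<^sup>2)) * ennreal (1 / b\<^sup>2)" for \<zeta>
    using assms by (subst ennreal_mult''[symmetric]) (auto simp: mollifier_def power_mult_distrib)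
  have "(\<integral>\<^sup>+z. ennreal (mollifier w b z) \<partial>lborel) = ennreal (b\<^sup>2) * (\<integral>\<^sup>+\<zeta>. ennreal (step1 ((cmod \<zeta>)\<^sup>2)) * ennreal (1 / b\<^sup>2) \<partial>lborel)"
    using assms
    by (subst nn_integral_complex_affine[of _ b w]) (simp_all add: pt)
  also have "\<dots> = ennreal (b\<^sup>2) * ennreal (1 / b\<^sup>2) * ennreal c0"
    by (subst nn_integral_multc) (simp_all add: c0 mult_ac)
  also have "ennreal (b\<^sup>2) * ennreal (1 / b\<^sup>2) = 1" using assms by (simp add: ennreal_mult[symmetric])
  finally show ?thesis by simp
qed

lemma integral_mollifier:
  assumes "0 < b" shows "integrable lborel (mollifier w b)" "(\<integral>z. mollifier w b z \<partial>lborel) = c0"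
proof -
  have "has_bochner_integral lborel (mollifier w b) c0"
    using c0(2) by (intro has_bochner_integral_nn_integral) (auto simp: mollifier_nonneg nn_integral_mollifier assms)
  then show "integrable lborel (mollifier w b)" "(\<integral>z. mollifier w b z \<partial>lborel) = c0"
    by (auto simp: has_bochner_integral_iff)
qed

context finite_type_subharmonic begin

definition Cm :: real where
  "Cm = (SOME C. 0 \<le> C \<and> (\<forall>\<rho>\<ge>0. (\<integral>\<^sup>+z. ennreal \<bar>m z\<bar> * indicator (cball 0 \<rho>) z \<partial>lborel) \<le> ennreal (C * (1 + \<rho>) ^ 3)))"

lemma Cm: "0 \<le> Cm" "0 \<le> \<rho> \<Longrightarrow> (\<integral>\<^sup>+z. ennreal \<bar>m z\<bar> * indicator (cball 0 \<rho>) z \<partial>lborel) \<le> ennreal (Cm * (1 + \<rho>) ^ 3)"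
proof -
  have "\<exists>C. 0 \<le> C \<and> (\<forall>\<rho>\<ge>0. (\<integral>\<^sup>+z. ennreal \<bar>m z\<bar> * indicator (cball 0 \<rho>) z \<partial>lborel) \<le> ennreal (C * (1 + \<rho>) ^ 3))"
    using abs_mass by metis
  from someI_ex[OF this] show "0 \<le> Cm" "0 \<le> \<rho> \<Longrightarrow> (\<integral>\<^sup>+z. ennreal \<bar>m z\<bar> * indicator (cball 0 \<rho>) z \<partial>lborel) \<le> ennreal (Cm * (1 + \<rho>) ^ 3)"
    unfolding Cm_def[symmetric] by auto
qed

lemma m_times_bounded:
  assumes [measurable]: "g \<in> borel_measurable borel" and g: "\<And>z. \<bar>g z\<bar> \<le> B" "\<And>z. \<rho> < cmod z \<Longrightarrow> g z = 0" and \<rho>: "0 \<le> \<rho>"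
  shows "integrable lborel (\<lambda>z. m z * g z)" "\<bar>\<integral>z. m z * g z \<partial>lborel\<bar> \<le> B * (Cm * (1 + \<rho>) ^ 3)"
proof -
  have B: "0 \<le> B" using g(1)[of 0] by linarith
  have "(\<integral>\<^sup>+z. ennreal (norm (m z * g z)) \<partial>lborel) \<le> (\<integral>\<^sup>+z. ennreal B * (ennreal \<bar>m z\<bar> * indicator (cball 0 \<rho>) z) \<partial>lborel)"
  proof (intro nn_integral_mono)
    fix z
    show "ennreal (norm (m z * g z)) \<le> ennreal B * (ennreal \<bar>m z\<bar> * indicator (cball 0 \<rho>) z)"
    proof (cases "\<rho> < cmod z")
      case False
      define x where "x = m z"
      have "\<bar>x\<bar> * \<bar>g z\<bar> \<le> \<bar>x\<bar> * B" by (intro mult_left_mono g) auto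
      then show ?thesis unfolding x_def[symmetric] using False B by (simp add: abs_mult ennreal_mult[symmetric] mult.commute[of B] ennreal_leI)
    qed (simp add: g(2))
  qed
  also have "\<dots> = ennreal B * (\<integral>\<^sup>+z. ennreal \<bar>m z\<bar> * indicator (cball 0 \<rho>) z \<partial>lborel)"
    by (rule nn_integral_cmult) measurable
  also have "\<dots> \<le> ennreal B * ennreal (Cm * (1 + \<rho>) ^ 3)" by (intro mult_left_mono Cm \<rho>) auto
  also have "\<dots> = ennreal (B * (Cm * (1 + \<rho>) ^ 3))" using B Cm \<rho> by (simp add: ennreal_mult)
  finally have le: "(\<integral>\<^sup>+z. ennreal (norm (m z * g z)) \<partial>lborel) \<le> ennreal (B * (Cm * (1 + \<rho>) ^ 3))" .
  show int: "integrable lborel (\<lambda>z. m z * g z)"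
  proof (rule integrableI_bounded)
    show "(\<integral>\<^sup>+z. ennreal (norm (m z * g z)) \<partial>lborel) < \<infinity>" using le by (rule le_less_trans) simp
  qed measurable
  have "ennreal (norm (\<integral>z. m z * g z \<partial>lborel)) \<le> ennreal (B * (Cm * (1 + \<rho>) ^ 3))"
    using integral_norm_bound_ennreal[OF int] le by (rule order_trans)
  then show "\<bar>\<integral>z. m z * g z \<partial>lborel\<bar> \<le> B * (Cm * (1 + \<rho>) ^ 3)" using B Cm(1) \<rho> by simp
qed

lemma integrable_compact_support_mu:
  fixes g :: "complex \<Rightarrow> real"
  assumes [measurable]: "g \<in> borel_measurable borel" and g: "\<And>z. \<bar>g z\<bar> \<le> B" "\<And>z. \<rho> < cmod z \<Longrightarrow> g z = 0"
  shows "integrable \<mu> g"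
proof (rule integrableI_bounded)
  have "(\<integral>\<^sup>+z. ennreal (norm (g z)) \<partial>\<mu>) \<le> (\<integral>\<^sup>+z. ennreal B * indicator (cball 0 \<rho>) z \<partial>\<mu>)"
    using g by (intro nn_integral_mono) (auto simp: indicator_def ennreal_leI not_le[symmetric])
  also have "\<dots> < \<infinity>" using emeasure_mu_cball by (simp add: nn_integral_cmult_indicator ennreal_mult_less_top)
  finally show "(\<integral>\<^sup>+z. ennreal (norm (g z)) \<partial>\<mu>) < \<infinity>" .
qed measurable

text \<open>Tested against a cutoff at radius \<open>\<rho>\<close>: its Laplacian is
  O(1/\<open>\<rho>\<close>^2) on a disc where |M| has mass O(\<open>\<rho>\<close>^3), so the Riesz
  mass grows at most linearly.\<close>

lemma mu_mass_exists: "\<exists>C\<ge>0. \<forall>\<rho>\<ge>0. emeasure \<mu> (cball 0 \<rho>) \<le> ennreal (C * (1 + \<rho>))"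
proof -
  obtain B where B: "0 < B" "\<And>x. step1 x \<le> B" "\<And>x. \<bar>step2 x\<bar> \<le> B" using step_deriv_bounded by blast
  \<comment> \<open>20 B = 4 (4 B + B) bounds the Laplacian up to the factor
    1/\<open>\<rho>\<close>^2, the scaled variable being at most 4 on its support; 3^3 stems from 1
    + 2 \<open>\<rho>\<close> \<open>\<le>\<close> 3 \<open>\<rho>\<close> for
    \<open>\<rho> \<ge> 1\<close>.\<close>
  define C where "C = 20 * B * Cm * 3 ^ 3"
  have *: "emeasure \<mu> (cball 0 \<rho>) \<le> ennreal (C * \<rho>)" if \<rho>: "1 \<le> \<rho>" for \<rho>
  proof -
    define \<Phi> where "\<Phi> s = 1 - step (s / \<rho>\<^sup>2)" for s
    define \<Phi>1 where "\<Phi>1 s = - (step1 (s / \<rho>\<^sup>2) / \<rho>\<^sup>2)" for s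
    define \<Phi>2 where "\<Phi>2 s = - (step2 (s / \<rho>\<^sup>2) / \<rho>\<^sup>2 / \<rho>\<^sup>2)" for s
    have 1: "((\<lambda>s. s / \<rho>\<^sup>2) has_real_derivative 1 / \<rho>\<^sup>2) (at s)" for s
      using DERIV_cdivide[OF DERIV_ident] .
    have d1: "(\<Phi> has_real_derivative \<Phi>1 s) (at s)" for s
      unfolding \<Phi>_def[abs_def] \<Phi>1_def using DERIV_diff[OF DERIV_const DERIV_chain2[OF step_deriv(1) 1]] by simp
    have d2: "(\<Phi>1 has_real_derivative \<Phi>2 s) (at s)" for s
    proof -
      have "((\<lambda>s. step1 (s / \<rho>\<^sup>2) / \<rho>\<^sup>2) has_real_derivative step2 (s / \<rho>\<^sup>2) * (1 / \<rho>\<^sup>2) / \<rho>\<^sup>2) (at s)"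
        by (rule DERIV_cdivide[OF DERIV_chain2[OF step_deriv(2) 1]])
      from DERIV_minus[OF this] show ?thesis unfolding \<Phi>1_def[abs_def] \<Phi>2_def by simp
    qed
    have s\<Phi>: "smooth_real \<Phi>" unfolding \<Phi>_def[abs_def]
      by (intro smooth_real_diff smooth_real_intros smooth_real_scale smooth_step)
    define \<phi> where "\<phi> z = \<Phi> ((cmod (z - 0))\<^sup>2)" for z
    have sp: "smooth_plane \<phi>" unfolding \<phi>_def[abs_def] by (rule smooth_plane_radial[OF s\<Phi>])
    have m\<phi>[measurable]: "\<phi> \<in> borel_measurable borel"
      using smooth_plane_continuous[OF sp] by (rule borel_measurable_continuous_onI)
    have far: "4 < (cmod z)\<^sup>2 / \<rho>\<^sup>2" if "2 * \<rho> < cmod z" for z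
    proof -
      have "(2 * \<rho>)\<^sup>2 < (cmod z)\<^sup>2" using that \<rho> by (intro power_strict_mono) auto
      then show ?thesis using \<rho> by (simp add: field_simps)
    qed
    have \<phi>0: "\<phi> z = 0" if "2 * \<rho> < cmod z" for z
      using far[OF that] step_props(3) by (simp add: \<phi>_def \<Phi>_def)
    have \<phi>b: "0 \<le> \<phi> z" "\<phi> z \<le> 1" for z using step_bounds by (auto simp: \<phi>_def \<Phi>_def)
    have \<phi>1: "\<phi> z = 1" if "cmod z \<le> \<rho>" for z
    proof -
      have "(cmod z)\<^sup>2 / \<rho>\<^sup>2 \<le> 1" using that \<rho> by (simp add: field_simps power_mono)
      then show ?thesis by (simp add: \<phi>_def \<Phi>_def step_props(2))
    qed
    have int: "integrable \<mu> \<phi>" 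
    proof (rule integrable_compact_support_mu[of \<phi> 1 "2 * \<rho>"])
      show "\<bar>\<phi> z\<bar> \<le> 1" for z using \<phi>b[of z] by simp
    qed (use \<phi>0 in auto)
    define L where "L z = laplacian \<phi> z" for z
    have Leq: "L z = 4 * ((cmod z)\<^sup>2 * \<Phi>2 ((cmod z)\<^sup>2) + \<Phi>1 ((cmod z)\<^sup>2))" for z
      unfolding L_def \<phi>_def[abs_def] using laplacian_radial[OF d1 d2, of 0 z] by simp
    have [measurable]: "L \<in> borel_measurable borel" unfolding Leq[abs_def] \<Phi>1_def \<Phi>2_def by measurable
    have L0: "L z = 0" if "2 * \<rho> < cmod z" for z
      using far[OF that] step1_0 step2_0 by (simp add: Leq \<Phi>1_def \<Phi>2_def)
    have Lb: "\<bar>L z\<bar> \<le> 20 * B / \<rho>\<^sup>2" for z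
    proof (cases "2 * \<rho> < cmod z")
      case True
      then show ?thesis using L0[OF True] B by simp
    next
      case False
      define s where "s = (cmod z)\<^sup>2 / \<rho>\<^sup>2"
      have "(cmod z)\<^sup>2 \<le> (2 * \<rho>)\<^sup>2" using False by (intro power_mono) auto
      then have s: "0 \<le> s" "s \<le> 4" using \<rho> by (auto simp: s_def field_simps)
      have "L z = - (4 / \<rho>\<^sup>2) * (s * step2 s + step1 s)"
        using \<rho> by (simp add: Leq \<Phi>1_def \<Phi>2_def s_def field_simps)
      then have "\<bar>L z\<bar> = \<bar>- (4 / \<rho>\<^sup>2)\<bar> * \<bar>s * step2 s + step1 s\<bar>" by (simp only: abs_mult)
      also have "\<bar>- (4 / \<rho>\<^sup>2)\<bar> = 4 / \<rho>\<^sup>2" by simp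
      also have "\<bar>s * step2 s + step1 s\<bar> \<le> 4 * B + B"
      proof -
        have "\<bar>s * step2 s\<bar> \<le> 4 * B" unfolding abs_mult using s B(3)[of s] by (intro mult_mono) auto
        then show ?thesis using B(2)[of s] step_props(4)[of s] by linarith
      qed
      finally show ?thesis using \<rho> by (simp add: field_simps)
    qed
    have "ennreal (2 * pi) * emeasure \<mu> (cball 0 \<rho>) = ennreal (2 * pi) * (\<integral>\<^sup>+z. indicator (cball 0 \<rho>) z \<partial>\<mu>)" by simp
    also have "\<dots> \<le> ennreal (2 * pi) * (\<integral>\<^sup>+z. ennreal (\<phi> z) \<partial>\<mu>)"
      by (intro mult_left_mono nn_integral_mono) (auto simp: indicator_def \<phi>1)
    also have "\<dots> = ennreal (2 * pi * (\<integral>z. \<phi> z \<partial>\<mu>))"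
      using int \<phi>b by (simp add: nn_integral_eq_integral ennreal_mult)
    also have "2 * pi * (\<integral>z. \<phi> z \<partial>\<mu>) = (\<integral>z. m z * L z \<partial>lborel)"
      unfolding L_def by (rule riesz_identity[symmetric], rule smooth_plane_test_fun[OF sp \<phi>0])
    also have "\<dots> \<le> 20 * B / \<rho>\<^sup>2 * (Cm * (1 + 2 * \<rho>) ^ 3)"
      using m_times_bounded(2)[of L "20 * B / \<rho>\<^sup>2" "2 * \<rho>"] Lb L0 \<rho> by auto
    also have "\<dots> \<le> 20 * B / \<rho>\<^sup>2 * (Cm * (3 * \<rho>) ^ 3)"
      using \<rho> B Cm(1) by (intro mult_left_mono power_mono) auto
    also have "\<dots> = C * \<rho>" using \<rho> by (simp add: C_def power2_eq_square power3_eq_cube field_simps)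
    finally have "ennreal (2 * pi) * emeasure \<mu> (cball 0 \<rho>) \<le> ennreal (C * \<rho>)"
      by (simp add: ennreal_leI)
    moreover have "1 * emeasure \<mu> (cball 0 \<rho>) \<le> ennreal (2 * pi) * emeasure \<mu> (cball 0 \<rho>)"
      using pi_ge_two by (intro mult_right_mono) (auto simp: ennreal_1[symmetric] simp del: ennreal_1 intro!: ennreal_leI)
    ultimately show ?thesis by simp
  qed
  have "emeasure \<mu> (cball 0 \<rho>) \<le> ennreal (C * (1 + \<rho>))" if "0 \<le> \<rho>" for \<rho>
  proof -
    have "emeasure \<mu> (cball 0 \<rho>) \<le> emeasure \<mu> (cball 0 (1 + \<rho>))" by (intro emeasure_mono) auto
    also have "\<dots> \<le> ennreal (C * (1 + \<rho>))" using * that by simp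
    finally show ?thesis .
  qed
  moreover have "0 \<le> C" using B Cm(1) by (simp add: C_def)
  ultimately show ?thesis by blast
qed

definition Cmu :: real where
  "Cmu = (SOME C. 0 \<le> C \<and> (\<forall>\<rho>\<ge>0. emeasure \<mu> (cball 0 \<rho>) \<le> ennreal (C * (1 + \<rho>))))"

lemma Cmu: "0 \<le> Cmu" "0 \<le> \<rho> \<Longrightarrow> emeasure \<mu> (cball 0 \<rho>) \<le> ennreal (Cmu * (1 + \<rho>))"
  using someI_ex[OF mu_mass_exists[unfolded Bex_def]] unfolding Cmu_def[symmetric] by auto

definition moll_mean :: "complex \<Rightarrow> real \<Rightarrow> real" where
  "moll_mean w b = (\<integral>z. m z * mollifier w b z \<partial>lborel)"

text \<open>A truncated logarithmic potential: it bounds how far a mollified mean can exceed the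
  value of \<open>M\<close> at \<open>w\<close>.\<close>

definition log_potential :: "real \<Rightarrow> complex \<Rightarrow> ennreal" where
  "log_potential b w = (\<integral>\<^sup>+z. log_kernel b (z - w) \<partial>\<mu>)"

lemma m_times_mollifier:
  assumes "0 < b" shows "integrable lborel (\<lambda>z. m z * mollifier w b z)"
proof -
  obtain B where B: "0 < B" "\<And>x. step1 x \<le> B" using step_deriv_bounded by blast
  show ?thesis
  proof (rule m_times_bounded(1))
    show "\<bar>mollifier w b z\<bar> \<le> B / b\<^sup>2" for z
      unfolding abs_of_nonneg[OF mollifier_nonneg] unfolding mollifier_def using B(2) by (intro divide_right_mono) auto
    show "mollifier w b z = 0" if "cmod w + 2 * b < cmod z" for z
      using that norm_triangle_ineq2[of z w] assms by (intro mollifier_eq_0) auto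
  qed (use assms in auto)
qed

lemma moll_mean_bound: "\<exists>C\<ge>0. \<forall>w b. 0 < b \<longrightarrow> \<bar>moll_mean w b\<bar> \<le> C * (1 + cmod w + 2 * b) ^ 3 / b\<^sup>2"
proof -
  obtain B where B: "0 < B" "\<And>x. step1 x \<le> B" using step_deriv_bounded by blast
  have "\<bar>moll_mean w b\<bar> \<le> B / b\<^sup>2 * (Cm * (1 + (cmod w + 2 * b)) ^ 3)" if b: "0 < b" for w b
    unfolding moll_mean_def
  proof (rule m_times_bounded(2))
    show "\<bar>mollifier w b z\<bar> \<le> B / b\<^sup>2" for z
      unfolding abs_of_nonneg[OF mollifier_nonneg] unfolding mollifier_def using B(2) by (intro divide_right_mono) auto
    show "mollifier w b z = 0" if "cmod w + 2 * b < cmod z" for z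
      using that norm_triangle_ineq2[of z w] b by (intro mollifier_eq_0) auto
  qed (use b in auto)
  then show ?thesis using B Cm(1) by (intro exI[of _ "B * Cm"]) (auto simp: algebra_simps)
qed

text \<open>A Jensen-type inequality. The test function has as Laplacian 4 times the difference of
  the mollifiers of scales \<open>b\<close> and \<open>\<delta>\<close>, so the Riesz identity turns
  a difference of mollified means into an integral against \<open>\<mu>\<close>. The logarithmic
  bound on the test function does not depend on \<open>\<delta>\<close>, so one small
  \<open>\<delta>\<close> suffices and no limit is taken.\<close>

lemma moll_mean_le:
  assumes w: "M w < ereal a" and b: "0 < b"
  shows "ennreal (moll_mean w b - c0 * a) \<le> ennreal pi * log_potential (2 * b) w"
proof -
  obtain d where d: "0 < d" "\<And>y. dist y w < d \<Longrightarrow> M y < ereal a"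
    using usc_nhds[OF w] by (auto simp: eventually_nhds_metric)
  \<comment> \<open>\<open>2 * \<delta> \<le> d\<close> places the support of the small mollifier
    where \<open>M < a\<close>, and \<open>\<delta> < b\<close> is required by the test
    function.\<close>
  define \<delta> where "\<delta> = min (b / 2) (d / 2)"
  have \<delta>: "0 < \<delta>" "\<delta> < b" "2 * \<delta> \<le> d" using d b by (auto simp: \<delta>_def min_def)
  have "moll_mean w \<delta> \<le> (\<integral>z. a * mollifier w \<delta> z \<partial>lborel)"
    unfolding moll_mean_def
  proof (rule integral_mono_AE)
    show "integrable lborel (\<lambda>z. a * mollifier w \<delta> z)"
      using integral_mollifier(1)[OF \<delta>(1)] by simp
    show "AE z in lborel. m z * mollifier w \<delta> z \<le> a * mollifier w \<delta> z"
      using AE_M_finite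
    proof (rule eventually_mono)
      fix z assume z: "M z = ereal (m z)"
      show "m z * mollifier w \<delta> z \<le> a * mollifier w \<delta> z"
      proof (cases "cmod (z - w) < 2 * \<delta>")
        case True
        then have "M z < ereal a" using d(2)[of z] \<delta> by (simp add: dist_norm)
        then have "m z \<le> a" using z by (metis ereal_less_eq(3) less_imp_le)
        then show ?thesis using mollifier_nonneg by (intro mult_right_mono)
      qed (use mollifier_eq_0[of \<delta> z w] \<delta> in auto)
    qed
  qed (rule m_times_mollifier[OF \<delta>(1)])
  then have A\<delta>: "moll_mean w \<delta> \<le> c0 * a" using integral_mollifier[OF \<delta>(1)] by (simp add: mult.commute)
  obtain \<Phi> where \<Phi>: "smooth_real \<Phi>" "\<And>s. 4 * b\<^sup>2 \<le> s \<Longrightarrow> \<Phi> s = 0" "\<And>s. 0 \<le> \<Phi> s"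
    "\<And>\<zeta>. ennreal (\<Phi> ((cmod \<zeta>)\<^sup>2)) \<le> 2 * log_kernel (2 * b) \<zeta>"
    "\<And>z w. laplacian (\<lambda>z. \<Phi> ((cmod (z - w))\<^sup>2)) z
      = 4 * (step1 ((cmod (z - w))\<^sup>2 / b\<^sup>2) / b\<^sup>2 - step1 ((cmod (z - w))\<^sup>2 / \<delta>\<^sup>2) / \<delta>\<^sup>2)"
    using radial_test_function_exists[OF \<delta>(1,2)] by metis
  define \<phi> where "\<phi> z = \<Phi> ((cmod (z - w))\<^sup>2)" for z
  have sp: "smooth_plane \<phi>" unfolding \<phi>_def[abs_def] by (rule smooth_plane_radial[OF \<Phi>(1)])
  have [measurable]: "\<phi> \<in> borel_measurable borel"
    using smooth_plane_continuous[OF sp] by (rule borel_measurable_continuous_onI)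
  have \<phi>0: "\<phi> z = 0" if "cmod w + 2 * b < cmod z" for z
  proof -
    have "2 * b \<le> cmod (z - w)" using that norm_triangle_ineq2[of z w] by auto
    then have "(2 * b)\<^sup>2 \<le> (cmod (z - w))\<^sup>2" using b by (intro power_mono) auto
    then show ?thesis unfolding \<phi>_def by (intro \<Phi>(2)) (simp add: power_mult_distrib)
  qed
  have tf: "test_fun \<phi>" by (rule smooth_plane_test_fun[OF sp \<phi>0])
  have "compact (\<phi> ` cball 0 (cmod w + 2 * b))"
    by (intro compact_continuous_image smooth_plane_continuous[OF sp] compact_cball)
  then obtain B where B: "\<And>z. z \<in> cball 0 (cmod w + 2 * b) \<Longrightarrow> \<bar>\<phi> z\<bar> \<le> B"
    using compact_imp_bounded bounded_real by (metis imageI)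
  have "\<bar>\<phi> z\<bar> \<le> max 0 B" for z using B[of z] \<phi>0[of z] by (cases "cmod w + 2 * b < cmod z") auto
  then have int: "integrable \<mu> \<phi>" using \<phi>0 by (intro integrable_compact_support_mu[of \<phi> "max 0 B" "cmod w + 2 * b"]) auto
  have "2 * pi * (\<integral>z. \<phi> z \<partial>\<mu>) = (\<integral>z. m z * laplacian \<phi> z \<partial>lborel)" by (rule riesz_identity[OF tf, symmetric])
  also have "\<dots> = (\<integral>z. 4 * (m z * mollifier w b z) - 4 * (m z * mollifier w \<delta> z) \<partial>lborel)"
    unfolding \<phi>_def[abs_def] \<Phi>(5) mollifier_def by (simp add: algebra_simps)
  also have "\<dots> = 4 * moll_mean w b - 4 * moll_mean w \<delta>"
    unfolding moll_mean_def using m_times_mollifier[OF b, of w] m_times_mollifier[OF \<delta>(1), of w] by simp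
  \<comment> \<open>pi / 2 is 2 pi from the Riesz normalisation over the 4 of the Laplacian; the
    factor 2 in front of the logarithmic kernel will turn it into pi.\<close>
  finally have "moll_mean w b - c0 * a \<le> pi / 2 * (\<integral>z. \<phi> z \<partial>\<mu>)" using A\<delta> by simp
  then have "ennreal (moll_mean w b - c0 * a) \<le> ennreal (pi / 2 * (\<integral>z. \<phi> z \<partial>\<mu>))" by (rule ennreal_leI)
  also have "\<dots> = ennreal (pi / 2) * (\<integral>\<^sup>+z. ennreal (\<phi> z) \<partial>\<mu>)"
  proof -
    have "(\<integral>\<^sup>+z. ennreal (\<phi> z) \<partial>\<mu>) = ennreal (\<integral>z. \<phi> z \<partial>\<mu>)"
      using \<Phi>(3) by (intro nn_integral_eq_integral int) (auto simp: \<phi>_def)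
    then show ?thesis by (simp add: ennreal_mult'[symmetric])
  qed
  also have "\<dots> \<le> ennreal (pi / 2) * (\<integral>\<^sup>+z. 2 * log_kernel (2 * b) (z - w) \<partial>\<mu>)"
    unfolding \<phi>_def by (intro mult_left_mono nn_integral_mono \<Phi>(4)) auto
  also have "\<dots> = ennreal (pi / 2) * 2 * log_potential (2 * b) w"
    unfolding log_potential_def by (subst nn_integral_cmult) (auto simp: mult.assoc)
  also have "ennreal (pi / 2) * 2 = ennreal pi"
    by (metis ennreal_mult'' ennreal_numeral mult.commute nonzero_mult_div_cancel_left times_divide_eq_right zero_le_numeral zero_neq_numeral)
  finally show ?thesis .
qed

text \<open>Let \<open>a\<close> decrease to \<open>M w\<close> in the preceding bound. If
  \<open>M w\<close> is minus infinity, that bound for all \<open>a\<close> forces the potential to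
  be infinite.\<close>

lemma moll_mean_defect:
  assumes b: "0 < b"
  shows "e2ennreal (ereal (moll_mean w b / c0) - M w) \<le> ennreal (pi / c0) * log_potential (2 * b) w"
proof -
  have *: "ennreal (moll_mean w b / c0 - a) \<le> ennreal (pi / c0) * log_potential (2 * b) w" if "M w < ereal a" for a
  proof -
    have "ennreal (moll_mean w b / c0 - a) = ennreal (1 / c0) * ennreal (moll_mean w b - c0 * a)"
      using c0(2) by (subst ennreal_mult'[symmetric]) (auto simp: field_simps)
    also have "\<dots> \<le> ennreal (1 / c0) * (ennreal pi * log_potential (2 * b) w)"
      by (intro mult_left_mono moll_mean_le that b) auto
    also have "\<dots> = ennreal (pi / c0) * log_potential (2 * b) w"
      using c0(2) by (simp add: mult.assoc[symmetric] ennreal_mult'[symmetric])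
    finally show ?thesis .
  qed
  show ?thesis
  proof (cases "ennreal (pi / c0) * log_potential (2 * b) w")
    case (real x)
    have **: "moll_mean w b / c0 - a \<le> x" if "M w < ereal a" for a
      using *[OF that] real by (metis ennreal_le_iff)
    have "ereal (moll_mean w b / c0) - M w \<le> ereal x"
    proof (cases "M w")
      case (real t)
      have "moll_mean w b / c0 - t \<le> x"
      proof (rule field_le_epsilon)
        fix e :: real assume "0 < e"
        then show "moll_mean w b / c0 - t \<le> x + e" using **[of "t + e"] real by simp
      qed
      then show ?thesis using real by simp
    next
      case MInf
      then show ?thesis using **[of "moll_mean w b / c0 - x - 1"] by simp
    qed (use less_PInf[of w] in auto)
    then have "e2ennreal (ereal (moll_mean w b / c0) - M w) \<le> e2ennreal (ereal x)" by (rule e2ennreal_mono)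
    then show ?thesis using real by (simp add: e2ennreal_ereal)
  qed simp
qed

text \<open>The mollifier averages circles of radii between \<open>b\<close> and
  \<open>2 * b\<close>, and each of these has at most the defect of the circle of radius
  \<open>t \<le> b\<close>.\<close>

lemma circ_mean_le_moll_mean:
  assumes t: "0 \<le> t" "t \<le> b" and b: "0 < b"
  shows "circ_mean M z t \<le> ereal (moll_mean z b / c0)"
proof -
  obtain K0 where K0: "0 \<le> K0" "\<And>w. w \<in> cball z (2 * b) \<Longrightarrow> M w \<le> ereal K0"
    using bounded_above[OF compact_cball] by blast
  define K where "K = K0 + 2"
  have K: "2 \<le> K" "\<And>w. w \<in> cball z (2 * b) \<Longrightarrow> M w \<le> ereal (K - 2)" using K0 by (auto simp: K_def)
  have MK: "M w \<le> ereal K" if "w \<in> cball z (2 * b)" for w using K(2)[OF that] by (rule order_trans) simp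
  have AE: "AE w in lborel. e2ennreal (ereal K - M w) * ennreal (mollifier z b w) = ennreal ((K - m w) * mollifier z b w)"
    using AE_M_finite
  proof (rule eventually_mono)
    fix w assume w: "M w = ereal (m w)"
    show "e2ennreal (ereal K - M w) * ennreal (mollifier z b w) = ennreal ((K - m w) * mollifier z b w)"
      by (subst w) (simp add: e2ennreal_ereal ennreal_mult''[OF mollifier_nonneg])
  qed
  have intK: "integrable lborel (\<lambda>w. (K - m w) * mollifier z b w)"
    using integral_mollifier(1)[OF b, of z] m_times_mollifier[OF b, of z] by (simp add: left_diff_distrib)
  have nn: "AE w in lborel. 0 \<le> (K - m w) * mollifier z b w"
    using AE_M_finite
  proof (rule eventually_mono)
    fix w assume w: "M w = ereal (m w)"
    show "0 \<le> (K - m w) * mollifier z b w"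
    proof (cases "w \<in> cball z (2 * b)")
      case True
      then have "m w \<le> K" using MK[OF True] w by (metis ereal_less_eq(3))
      then show ?thesis using mollifier_nonneg by simp
    qed (use mollifier_eq_0[OF b, of w z] in \<open>auto simp: dist_norm norm_minus_commute\<close>)
  qed
  have "ennreal (2 * pi * (K * c0 - moll_mean z b)) = ennreal (2 * pi) * ennreal (\<integral>w. (K - m w) * mollifier z b w \<partial>lborel)"
    using integral_mollifier[OF b, of z] m_times_mollifier[OF b, of z]
    by (simp add: left_diff_distrib moll_mean_def ennreal_mult')
  also have "ennreal (\<integral>w. (K - m w) * mollifier z b w \<partial>lborel) = (\<integral>\<^sup>+w. e2ennreal (ereal K - M w) * ennreal (mollifier z b w) \<partial>lborel)"
    using nn_integral_eq_integral[OF intK nn] nn_integral_cong_AE[OF AE] by simp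
  also have "\<dots> = (\<integral>\<^sup>+\<zeta>. e2ennreal (ereal K - M (z + \<zeta>)) * ennreal (step1 ((cmod \<zeta>)\<^sup>2 / b\<^sup>2) / b\<^sup>2) \<partial>lborel)"
    by (subst nn_integral_translate[symmetric, of _ z]) (auto simp: mollifier_def)
  also have "ennreal (2 * pi) * \<dots> = (\<integral>\<^sup>+\<zeta>. circ_defect K M z \<zeta> * ennreal (step1 ((cmod \<zeta>)\<^sup>2 / b\<^sup>2) / b\<^sup>2) \<partial>lborel)"
    unfolding circ_defect_def by (rule nn_integral_radial_weight[where w="\<lambda>t. ennreal (step1 (t\<^sup>2 / b\<^sup>2) / b\<^sup>2)"]) measurable
  also have "\<dots> \<le> (\<integral>\<^sup>+\<zeta>. circ_defect K M z (of_real t) * ennreal (mollifier 0 b \<zeta>) \<partial>lborel)"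
  proof (intro nn_integral_mono)
    fix \<zeta> :: complex
    show "circ_defect K M z \<zeta> * ennreal (step1 ((cmod \<zeta>)\<^sup>2 / b\<^sup>2) / b\<^sup>2) \<le> circ_defect K M z (of_real t) * ennreal (mollifier 0 b \<zeta>)"
    proof (cases "cmod \<zeta> \<le> b \<or> 2 * b \<le> cmod \<zeta>")
      case True
      then have "mollifier 0 b \<zeta> = 0" using mollifier_eq_0[OF b, of \<zeta> 0] by simp
      moreover have "step1 ((cmod \<zeta>)\<^sup>2 / b\<^sup>2) / b\<^sup>2 = mollifier 0 b \<zeta>" by (simp add: mollifier_def)
      ultimately show ?thesis by (simp only: ennreal_0 mult_zero_right order_refl)
    next
      case False
      then have "circ_defect K M z \<zeta> \<le> circ_defect K M z (of_real t)"
        using t K by (intro circ_defect_antimono) auto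
      then show ?thesis by (simp add: mollifier_def mult_right_mono)
    qed
  qed
  also have "\<dots> = circ_defect K M z (of_real t) * ennreal c0"
    by (simp add: nn_integral_cmult nn_integral_mollifier[OF b])
  finally have le: "ennreal (2 * pi * (K * c0 - moll_mean z b)) \<le> circ_defect K M z (of_real t) * ennreal c0" .
  have "circ_mean M z t = (ereal (K * (2 * pi)) - enn2ereal (circ_defect K M z (of_real t))) / ereal (2 * pi)"
    using K(1) t b by (intro circ_mean_eq MK) (auto simp: dist_norm norm_mult)
  also have "\<dots> \<le> ereal (moll_mean z b / c0)"
  proof (cases "circ_defect K M z (of_real t)")
    case (real d)
    then have "2 * pi * (K * c0 - moll_mean z b) \<le> d * c0"
      using le c0(2) by (simp add: ennreal_mult[symmetric])
    then show ?thesis using real c0(2) by (simp add: field_simps)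
  qed (use pi_gt_zero in simp)
  finally show ?thesis .
qed

end

subsection \<open>Vertical lines\<close>

definition log_line :: "real \<Rightarrow> real \<Rightarrow> ennreal" where
  "log_line b t = (if t = 0 then top else ennreal (ln (b / \<bar>t\<bar>)))"

lemma measurable_log_line[measurable]: "log_line b \<in> borel_measurable borel"
  unfolding log_line_def by measurable

lemma log_kernel_le_log_line: "0 < b \<Longrightarrow> log_kernel b \<zeta> \<le> log_line b (Im \<zeta>)"
proof (cases "Im \<zeta> = 0")
  case False
  assume b: "0 < b"
  have z0: "0 < cmod \<zeta>" using False by auto
  then have "b / cmod \<zeta> \<le> b / \<bar>Im \<zeta>\<bar>" using b z0 False abs_Im_le_cmod[of \<zeta>] by (intro divide_left_mono) auto
  moreover have "0 < b / cmod \<zeta>" using b z0 by simp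
  ultimately have "ln (b / cmod \<zeta>) \<le> ln (b / \<bar>Im \<zeta>\<bar>)" by simp
  then show ?thesis using False by (auto simp: log_kernel_def log_line_def intro: ennreal_leI)
qed (simp add: log_line_def)

lemma log_kernel_eq_0: "0 < b \<Longrightarrow> b \<le> cmod \<zeta> \<Longrightarrow> log_kernel b \<zeta> = 0"
  by (auto simp: log_kernel_def intro!: ennreal_neg ln_le_zero_iff[THEN iffD2])

text \<open>The exact value is 2 b. The inequality ln x \<open>\<le>\<close> 2 sqrt x gives a power
  with an explicit primitive instead, at the price of the constant 8.\<close>

lemma nn_integral_log_line:
  assumes b: "0 < b" shows "(\<integral>\<^sup>+t. log_line b t \<partial>lborel) \<le> ennreal (8 * b)"
proof -
  define f where "f t = ennreal (2 * sqrt b * t powr (-1/2)) * indicator {0..b} t" for t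
  have fm[measurable]: "f \<in> borel_measurable borel" unfolding f_def by measurable
  have "((\<lambda>t. t powr (-1/2)) has_integral (b powr (-1/2 + 1) / (-1/2 + 1))) {0..b}"
    using b by (intro has_integral_powr_from_0) auto
  then have "((\<lambda>t. 2 * sqrt b * t powr (-1/2)) has_integral 2 * sqrt b * (b powr (1/2) * 2)) {0..b}"
    by (intro has_integral_mult_right) simp
  then have "((\<lambda>t. 2 * sqrt b * t powr (-1/2)) has_integral 4 * b) {0..b}"
    using b by (simp add: powr_half_sqrt)
  then have "((\<lambda>t. 2 * sqrt b * t powr (-1/2) * indicator {0..b} t) has_integral 4 * b) UNIV"
    by (subst (asm) has_integral_restrict_UNIV[symmetric]) (elim has_integral_eq[rotated], auto simp: indicator_def)
  from nn_integral_has_integral_lborel[OF _ _ this] have f: "(\<integral>\<^sup>+t. f t \<partial>lborel) = ennreal (4 * b)"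
    using b by (simp add: f_def ennreal_mult'' ennreal_indicator)
  have pt: "log_line b t \<le> f t" if t: "0 < t" for t
  proof (cases "t \<le> b")
    case True
    have "ln (b / t) = 2 * ln (sqrt (b / t))" using b t by (simp add: ln_sqrt)
    also have "ln (sqrt (b / t)) \<le> sqrt (b / t)" using b t by (intro order_trans[OF ln_le_minus_one]) auto
    also have "sqrt (b / t) = sqrt b * t powr (-1/2)"
      using t by (simp add: real_sqrt_divide powr_minus_divide powr_half_sqrt)
    finally have "ln (b / t) \<le> 2 * sqrt b * t powr (-1/2)" by simp
    then show ?thesis using t True by (simp add: log_line_def f_def ennreal_leI)
  next
    case False
    then have "ln (b / t) \<le> 0" using b t by simp
    then show ?thesis using t by (simp add: log_line_def ennreal_neg)
  qed
  have "(\<integral>\<^sup>+t. log_line b t \<partial>lborel) \<le> (\<integral>\<^sup>+t. f t + f (- t) \<partial>lborel)"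
  proof (intro nn_integral_mono_AE)
    show "AE t in lborel. log_line b t \<le> f t + f (- t)"
      using AE_lborel_singleton[of 0]
    proof (rule eventually_mono)
      fix t :: real assume "t \<noteq> 0"
      then consider "0 < t" | "0 < - t" by linarith
      then show "log_line b t \<le> f t + f (- t)"
      proof cases
        case 1
        then show ?thesis using pt[of t] by (simp add: add_increasing2)
      next
        case 2
        have "log_line b t = log_line b (- t)" by (simp add: log_line_def)
        then show ?thesis using pt[OF 2] by (simp add: add_increasing)
      qed
    qed
  qed
  also have "\<dots> = (\<integral>\<^sup>+t. f t \<partial>lborel) + (\<integral>\<^sup>+t. f (- t) \<partial>lborel)" by (rule nn_integral_add) measurable
  also have "(\<integral>\<^sup>+t. f (- t) \<partial>lborel) = (\<integral>\<^sup>+t. f t \<partial>lborel)"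
    using nn_integral_real_affine[OF fm, of "-1" 0] by simp
  also have "(\<integral>\<^sup>+t. f t \<partial>lborel) + (\<integral>\<^sup>+t. f t \<partial>lborel) = ennreal (8 * b)"
    unfolding f using b by (simp flip: ennreal_plus)
  finally show ?thesis .
qed

lemma ennreal_add_le: "ennreal (x + y) \<le> ennreal x + ennreal y"
proof (cases "0 \<le> x"; cases "0 \<le> y")
  assume "0 \<le> x" "\<not> 0 \<le> y"
  then have "ennreal (x + y) \<le> ennreal x" by (intro ennreal_leI) simp
  then show ?thesis by (simp add: add_increasing2)
next
  assume "\<not> 0 \<le> x" "0 \<le> y"
  then have "ennreal (x + y) \<le> ennreal y" by (intro ennreal_leI) simp
  then show ?thesis by (simp add: add_increasing)
qed (auto simp: ennreal_neg)

text \<open>Splits ln (b / |t|) into ln (b / \<open>\<tau>\<close>) + ln (\<open>\<tau>\<close> /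
  |t|): the first part is paid by the measure of \<open>S\<close>, the second is an integrable
  singularity of total size O(\<open>\<tau>\<close>). Choosing \<open>\<tau>\<close> as the measure
  of \<open>S\<close> later produces the entropy bound.\<close>

lemma nn_integral_log_line_set:
  assumes \<tau>: "0 < \<tau>" "\<tau> \<le> b" and [measurable]: "S \<in> sets borel"
  shows "(\<integral>\<^sup>+t. log_line b (v - t) * indicator S t \<partial>lborel) \<le> ennreal (ln (b / \<tau>)) * emeasure lborel S + ennreal (8 * \<tau>)"
proof -
  have pt: "log_line b t \<le> ennreal (ln (b / \<tau>)) + log_line \<tau> t" for t
  proof (cases "t = 0")
    case False
    then have "ln (b / \<bar>t\<bar>) = ln (b / \<tau>) + ln (\<tau> / \<bar>t\<bar>)" using \<tau> by (simp add: ln_div)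
    then show ?thesis using False ennreal_add_le by (simp add: log_line_def)
  qed (simp add: log_line_def)
  have "(\<integral>\<^sup>+t. log_line b (v - t) * indicator S t \<partial>lborel)
    \<le> (\<integral>\<^sup>+t. ennreal (ln (b / \<tau>)) * indicator S t + log_line \<tau> (v - t) \<partial>lborel)"
    by (intro nn_integral_mono) (auto simp: indicator_def pt)
  also have "\<dots> = ennreal (ln (b / \<tau>)) * emeasure lborel S + (\<integral>\<^sup>+t. log_line \<tau> (v - t) \<partial>lborel)"
    by (subst nn_integral_add) (auto simp: nn_integral_cmult_indicator)
  also have "(\<integral>\<^sup>+t. log_line \<tau> (v - t) \<partial>lborel) = (\<integral>\<^sup>+t. log_line \<tau> t \<partial>lborel)"
    using nn_integral_real_affine[of "log_line \<tau>" "-1" v] by simp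
  finally show ?thesis using nn_integral_log_line[OF \<tau>(1)] by (meson add_left_mono order_trans)
qed

text \<open>A mass of order (1 + \<open>\<rho>\<close>)^a on discs meets a weight with one more
  power of decay, so dyadic discs contribute a geometric series.\<close>

lemma dyadic_tail:
  fixes F :: "complex \<Rightarrow> ennreal"
  assumes F[measurable]: "F \<in> borel_measurable N" and N: "sets N = sets borel" and C: "0 \<le> C"
    and le: "\<And>\<rho>. 0 \<le> \<rho> \<Longrightarrow> (\<integral>\<^sup>+z. F z * indicator (cball 0 \<rho>) z \<partial>N) \<le> ennreal (C * (1 + \<rho>) ^ a)"
  shows "(\<integral>\<^sup>+z. F z * ennreal (1 / (1 + cmod z) ^ (a + 1)) \<partial>N) \<le> ennreal (C * 4 ^ (a + 1))"
proof -
  note [measurable_cong] = N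
  let ?c = "\<lambda>k::nat. 2 ^ (a + 1) / (2 ^ k) ^ (a + 1) :: real"
  have pt: "ennreal (1 / (1 + cmod z) ^ (a + 1)) \<le> (\<Sum>k. ennreal (?c k) * indicator (cball 0 (2 ^ k)) z)" for z
  proof -
    \<comment> \<open>The first dyadic disc containing \<open>z\<close>: either
      \<open>k = 0\<close>, or the failure at \<open>k - 1\<close> bounds |z| from below and hence
      the weight by \<open>?c k\<close>.\<close>
    obtain k where k: "cmod z \<le> 2 ^ k" "\<And>j. j < k \<Longrightarrow> \<not> cmod z \<le> 2 ^ j"
    proof -
      obtain n where "cmod z < 2 ^ n" using real_arch_pow[of 2 "cmod z"] by auto
      then have ex: "\<exists>n. cmod z \<le> 2 ^ n" using less_imp_le by blast
      show thesis using that[of "LEAST n. cmod z \<le> 2 ^ n"] LeastI_ex[OF ex] not_less_Least by blast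
    qed
    have "1 / (1 + cmod z) ^ (a + 1) \<le> ?c k"
    proof (cases k)
      case 0
      have "1 \<le> (1 + cmod z) ^ (a + 1)" by (rule one_le_power) simp
      from le_imp_inverse_le[OF this zero_less_one]
      have "1 / (1 + cmod z) ^ (a + 1) \<le> 1" by (simp only: inverse_eq_divide div_by_1)
      also have "(1::real) \<le> ?c k" using one_le_power[of "2::real" "a+1"] 0 by simp
      finally show ?thesis .
    next
      case (Suc j)
      have "2 ^ j \<le> 1 + cmod z" using k(2)[of j] Suc by simp
      then have "(2 ^ j) ^ (a + 1) \<le> (1 + cmod z) ^ (a + 1)" by (intro power_mono) auto
      then have "1 / (1 + cmod z) ^ (a + 1) \<le> 1 / (2 ^ j) ^ (a + 1)"
        by (intro divide_left_mono mult_pos_pos zero_less_power) (auto intro: add_pos_nonneg)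
      also have "\<dots> = ?c k" using Suc by (simp add: power_mult_distrib)
      finally show ?thesis .
    qed
    then have "ennreal (1 / (1 + cmod z) ^ (a + 1)) \<le> ennreal (?c k) * indicator (cball 0 (2 ^ k)) z"
      using k(1) by (simp add: ennreal_leI)
    also have "\<dots> \<le> (\<Sum>k. ennreal (?c k) * indicator (cball 0 (2 ^ k)) z)"
    proof -
      have "f k \<le> suminf f" for f :: "nat \<Rightarrow> ennreal" using sum_le_suminf[of f "{k}"] by simp
      then show ?thesis .
    qed
    finally show ?thesis .
  qed
  have "(\<integral>\<^sup>+z. F z * ennreal (1 / (1 + cmod z) ^ (a + 1)) \<partial>N)
    \<le> (\<integral>\<^sup>+z. (\<Sum>k. ennreal (?c k) * (F z * indicator (cball 0 (2 ^ k)) z)) \<partial>N)"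
  proof (intro nn_integral_mono)
    fix z
    have "F z * ennreal (1 / (1 + cmod z) ^ (a + 1)) \<le> F z * (\<Sum>k. ennreal (?c k) * indicator (cball 0 (2 ^ k)) z)"
      by (intro mult_left_mono pt) auto
    also have "\<dots> = (\<Sum>k. ennreal (?c k) * (F z * indicator (cball 0 (2 ^ k)) z))"
      by (subst ennreal_suminf_cmult[symmetric]) (simp add: mult_ac)
    finally show "F z * ennreal (1 / (1 + cmod z) ^ (a + 1)) \<le> (\<Sum>k. ennreal (?c k) * (F z * indicator (cball 0 (2 ^ k)) z))" .
  qed
  also have "\<dots> = (\<Sum>k. \<integral>\<^sup>+z. ennreal (?c k) * (F z * indicator (cball 0 (2 ^ k)) z) \<partial>N)"
    by (rule nn_integral_suminf) measurable
  also have "\<dots> \<le> (\<Sum>k. ennreal (C * 2 ^ (2 * a + 1) * (1 / 2) ^ k))"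
  proof (intro suminf_le allI)
    fix k
    have "(\<integral>\<^sup>+z. ennreal (?c k) * (F z * indicator (cball 0 (2 ^ k)) z) \<partial>N) = ennreal (?c k) * (\<integral>\<^sup>+z. F z * indicator (cball 0 (2 ^ k)) z \<partial>N)"
      by (rule nn_integral_cmult) measurable
    also have "\<dots> \<le> ennreal (?c k) * ennreal (C * (1 + 2 ^ k) ^ a)" by (intro mult_left_mono le) auto
    also have "\<dots> = ennreal (?c k * (C * (1 + 2 ^ k) ^ a))"
      by (rule ennreal_mult[symmetric]) (use C in auto)
    also have "\<dots> \<le> ennreal (?c k * (C * (2 * 2 ^ k) ^ a))"
      using C by (intro ennreal_leI mult_left_mono power_mono) auto
    also have "?c k * (C * (2 * 2 ^ k) ^ a) = C * 2 ^ (2 * a + 1) * (1 / 2) ^ k"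
      by (simp add: power_mult_distrib power_add power_mult power2_eq_square field_simps)
    finally show "(\<integral>\<^sup>+z. ennreal (?c k) * (F z * indicator (cball 0 (2 ^ k)) z) \<partial>N) \<le> ennreal (C * 2 ^ (2 * a + 1) * (1 / 2) ^ k)" .
  qed auto
  also have "\<dots> = ennreal (\<Sum>k. C * 2 ^ (2 * a + 1) * (1 / 2) ^ k)"
    using C by (intro suminf_ennreal2 summable_mult summable_geometric) auto
  also have "(\<Sum>k. C * 2 ^ (2 * a + 1) * (1 / 2) ^ k) = C * 2 ^ (2 * a + 1) * 2"
    by (subst suminf_mult) (auto simp: suminf_geometric)
  also have "\<dots> = C * 4 ^ (a + 1)"
    by (simp add: power_mult flip: power_Suc2) 
  finally show ?thesis .
qed

context finite_type_subharmonic begin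

lemma sigma_finite_mu: "sigma_finite_measure \<mu>"
proof
  show "\<exists>A. countable A \<and> A \<subseteq> sets \<mu> \<and> \<Union> A = space \<mu> \<and> (\<forall>a\<in>A. emeasure \<mu> a \<noteq> \<infinity>)"
  proof (intro exI[of _ "range (\<lambda>n::nat. cball (0::complex) (real n))"] conjI ballI)
    show "\<Union> (range (\<lambda>n::nat. cball (0::complex) (real n))) = space \<mu>"
      using real_arch_simple by (auto simp: mem_cball)
    show "emeasure \<mu> a \<noteq> \<infinity>" if "a \<in> range (\<lambda>n::nat. cball (0::complex) (real n))" for a
      using that emeasure_mu_cball by (auto simp: less_top)
  qed auto
qed

lemma measurable_log_potential[measurable]: "log_potential b \<in> borel_measurable borel"
proof -
  interpret sigma_finite_measure \<mu> by (rule sigma_finite_mu)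
  show ?thesis unfolding log_potential_def[abs_def] by measurable
qed

text \<open>Integrating the kernel along the line first removes its singularity uniformly in
  \<open>z\<close>; only points within \<open>b\<close> of the set contribute, and their Riesz mass
  is linear in the radius. Abscissae up to 2 are those on which \<open>kern\<close> is
  supported.\<close>

lemma line_log_potential:
  assumes S[measurable]: "S \<in> sets borel" and S\<rho>: "S \<subseteq> {-\<rho>..\<rho>}" and x0: "\<bar>x0\<bar> \<le> 2" and \<tau>: "0 < \<tau>" "\<tau> \<le> b" and \<rho>: "0 \<le> \<rho>"
  shows "(\<integral>\<^sup>+y. log_potential b (Complex x0 y) * indicator S y \<partial>lborel)
    \<le> (ennreal (ln (b / \<tau>)) * emeasure lborel S + ennreal (8 * \<tau>)) * ennreal (Cmu * (3 + \<rho> + b))"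
proof -
  interpret mu: sigma_finite_measure \<mu> by (rule sigma_finite_mu)
  interpret pair_sigma_finite lborel \<mu> by (intro pair_sigma_finite.intro sigma_finite_mu sigma_finite_lborel)
  have b: "0 < b" using \<tau> by simp
  define X where "X = ennreal (ln (b / \<tau>)) * emeasure lborel S + ennreal (8 * \<tau>)"
  have "(\<integral>\<^sup>+y. log_potential b (Complex x0 y) * indicator S y \<partial>lborel)
    = (\<integral>\<^sup>+y. \<integral>\<^sup>+z. log_kernel b (z - Complex x0 y) * indicator S y \<partial>\<mu> \<partial>lborel)"
    unfolding log_potential_def by (intro nn_integral_cong nn_integral_multc[symmetric]) measurable
  also have "\<dots> = (\<integral>\<^sup>+z. \<integral>\<^sup>+y. log_kernel b (z - Complex x0 y) * indicator S y \<partial>lborel \<partial>\<mu>)"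
    by (rule Fubini'[symmetric]) measurable
  also have "\<dots> \<le> (\<integral>\<^sup>+z. X * indicator (cball 0 (2 + \<rho> + b)) z \<partial>\<mu>)"
  proof (intro nn_integral_mono)
    fix z
    show "(\<integral>\<^sup>+y. log_kernel b (z - Complex x0 y) * indicator S y \<partial>lborel) \<le> X * indicator (cball 0 (2 + \<rho> + b)) z"
    proof (cases "z \<in> cball 0 (2 + \<rho> + b)")
      case True
      have "(\<integral>\<^sup>+y. log_kernel b (z - Complex x0 y) * indicator S y \<partial>lborel)
          \<le> (\<integral>\<^sup>+y. log_line b (Im z - y) * indicator S y \<partial>lborel)"
        using log_kernel_le_log_line[OF b, of "z - Complex x0 _"] by (intro nn_integral_mono mult_right_mono) auto
      also have "\<dots> \<le> X" unfolding X_def by (rule nn_integral_log_line_set[OF \<tau> S])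
      finally show ?thesis using True by simp
    next
      case False
      have "log_kernel b (z - Complex x0 y) * indicator S y = 0" for y
      proof (cases "y \<in> S")
        case True
        then have "y \<in> {-\<rho>..\<rho>}" using S\<rho> by blast
        then have "cmod (Complex x0 y) \<le> 2 + \<rho>"
          using x0 cmod_le[of "Complex x0 y"] by auto
        then have "b \<le> cmod (z - Complex x0 y)" using False norm_triangle_ineq2[of z "Complex x0 y"] by auto
        then show ?thesis using log_kernel_eq_0[OF b] by simp
      qed simp
      then show ?thesis by (simp only: nn_integral_const mult_zero_left zero_le)
    qed
  qed
  also have "\<dots> = X * emeasure \<mu> (cball 0 (2 + \<rho> + b))" by (simp add: nn_integral_cmult_indicator)
  also have "\<dots> \<le> X * ennreal (Cmu * (1 + (2 + \<rho> + b)))" using \<rho> b by (intro mult_left_mono Cmu) auto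
  finally show ?thesis unfolding X_def by (simp add: algebra_simps)
qed

text \<open>At scale \<open>b = 1 + \<rho>\<close> the mollified mean is O(b), and \<open>M\<close>
  lies below it by at most a multiple of a potential whose integral over \<open>S\<close> is
  controlled. Both \<open>S\<close> and \<open>\<tau>\<close> stay free because the exceptional set
  calls for the exact dependence on the measure of \<open>S\<close>.\<close>

lemma line_negative_part:
  obtains C where "0 \<le> C" "\<And>\<rho> x0 S \<tau>. 0 \<le> \<rho> \<Longrightarrow> \<bar>x0\<bar> \<le> 2 \<Longrightarrow> S \<in> sets borel \<Longrightarrow> S \<subseteq> {-\<rho>..\<rho>} \<Longrightarrow> 0 < \<tau> \<Longrightarrow> \<tau> \<le> 2 * (1 + \<rho>) \<Longrightarrow>
    (\<integral>\<^sup>+y. e2ennreal (- M (Complex x0 y)) * indicator S y \<partial>lborel)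
      \<le> ennreal (C * (1 + \<rho>) * (measure lborel S + measure lborel S * ln (2 * (1 + \<rho>) / \<tau>) + \<tau>))"
proof -
  obtain C1 where C1: "0 \<le> C1" "\<And>w b. 0 < b \<Longrightarrow> \<bar>moll_mean w b\<bar> \<le> C1 * (1 + cmod w + 2 * b) ^ 3 / b\<^sup>2"
    using moll_mean_bound by blast
  \<comment> \<open>125 = 5^3 comes from 1 + |w| + 2 b \<open>\<le>\<close> 5 b, and 40 = 8 * 5 from
    the 8 in the logarithmic integral together with 3 + \<open>\<rho>\<close> + 2 b
    \<open>\<le>\<close> 5 b.\<close>
  define C where "C = 125 * C1 / c0 + pi / c0 * Cmu * 40"
  have C: "0 \<le> C" using C1 Cmu(1) c0(2) by (simp add: C_def)
  have "(\<integral>\<^sup>+y. e2ennreal (- M (Complex x0 y)) * indicator S y \<partial>lborel)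
      \<le> ennreal (C * (1 + \<rho>) * (measure lborel S + measure lborel S * ln (2 * (1 + \<rho>) / \<tau>) + \<tau>))"
    if \<rho>: "0 \<le> \<rho>" and x0: "\<bar>x0\<bar> \<le> 2" and S[measurable]: "S \<in> sets borel" and S\<rho>: "S \<subseteq> {-\<rho>..\<rho>}" and \<tau>: "0 < \<tau>" "\<tau> \<le> 2 * (1 + \<rho>)" for \<rho> x0 S \<tau>
  proof -
    define b where "b = 1 + \<rho>"
    define s where "s = measure lborel S"
    have "emeasure lborel S \<le> emeasure lborel {-\<rho>..\<rho>}" by (rule emeasure_mono[OF S\<rho>]) simp
    then have "emeasure lborel S \<noteq> \<infinity>" using \<rho> by (auto simp: top_unique)
    then have s: "emeasure lborel S = ennreal s" "0 \<le> s" by (auto simp: s_def emeasure_eq_ennreal_measure)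
    have b: "1 \<le> b" using \<rho> by (simp add: b_def)
    have L: "0 \<le> ln (2 * b / \<tau>)" using \<tau> by (simp add: b_def)
    have pt: "e2ennreal (- M (Complex x0 y)) \<le> ennreal (125 * C1 / c0 * b) + ennreal (pi / c0) * log_potential (2 * b) (Complex x0 y)"
      if y: "y \<in> S" for y
    proof -
      let ?w = "Complex x0 y"
      have "y \<in> {-\<rho>..\<rho>}" using S\<rho> y by blast
      then have "cmod ?w \<le> 2 + \<rho>" using x0 cmod_le[of ?w] by auto
      then have "(1 + cmod ?w + 2 * b) ^ 3 \<le> (5 * b) ^ 3" using \<rho> by (intro power_mono) (auto simp: b_def)
      then have "C1 * (1 + cmod ?w + 2 * b) ^ 3 / b\<^sup>2 \<le> C1 * (5 * b) ^ 3 / b\<^sup>2"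
        using C1 by (intro divide_right_mono mult_left_mono) auto
      also have "\<dots> = 125 * C1 * b" using b by (simp add: power3_eq_cube power2_eq_square)
      finally have "\<bar>moll_mean ?w b\<bar> \<le> 125 * C1 * b" using C1(2)[of b ?w] b by simp
      then have A: "- (moll_mean ?w b / c0) \<le> 125 * C1 / c0 * b" using c0(2) by (simp add: field_simps abs_le_iff)
      have "e2ennreal (- M ?w) \<le> ennreal (125 * C1 / c0 * b) + e2ennreal (ereal (moll_mean ?w b / c0) - M ?w)"
      proof (cases "M ?w")
        case (real t)
        have "ennreal (- t) \<le> ennreal (125 * C1 / c0 * b + (moll_mean ?w b / c0 - t))" using A by (intro ennreal_leI) simp
        also have "\<dots> \<le> ennreal (125 * C1 / c0 * b) + ennreal (moll_mean ?w b / c0 - t)" by (rule ennreal_add_le)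
        finally show ?thesis using real by (simp add: e2ennreal_ereal)
      qed (use less_PInf[of ?w] in auto)
      also have "\<dots> \<le> ennreal (125 * C1 / c0 * b) + ennreal (pi / c0) * log_potential (2 * b) ?w"
        using b by (intro add_left_mono moll_mean_defect) auto
      finally show ?thesis .
    qed
    have "(\<integral>\<^sup>+y. e2ennreal (- M (Complex x0 y)) * indicator S y \<partial>lborel)
      \<le> (\<integral>\<^sup>+y. ennreal (125 * C1 / c0 * b) * indicator S y + ennreal (pi / c0) * (log_potential (2 * b) (Complex x0 y) * indicator S y) \<partial>lborel)"
    proof (intro nn_integral_mono)
      fix y
      show "e2ennreal (- M (Complex x0 y)) * indicator S y \<le> ennreal (125 * C1 / c0 * b) * indicator S y
        + ennreal (pi / c0) * (log_potential (2 * b) (Complex x0 y) * indicator S y)"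
        using pt[of y] by (cases "y \<in> S") simp_all
    qed
    also have "\<dots> = ennreal (125 * C1 / c0 * b) * ennreal s + ennreal (pi / c0) * (\<integral>\<^sup>+y. log_potential (2 * b) (Complex x0 y) * indicator S y \<partial>lborel)"
      by (subst nn_integral_add) (auto simp: nn_integral_cmult_indicator nn_integral_cmult s)
    also have "\<dots> \<le> ennreal (125 * C1 / c0 * b) * ennreal s + ennreal (pi / c0) * ((ennreal (ln (2 * b / \<tau>)) * ennreal s + ennreal (8 * \<tau>)) * ennreal (Cmu * (3 + \<rho> + 2 * b)))"
      using line_log_potential[OF S S\<rho> x0 \<tau>(1) _ \<rho>, of "2 * b"] \<tau> unfolding s(1)
      by (intro add_left_mono mult_left_mono) (auto simp: b_def)
    also have "\<dots> = ennreal (125 * C1 / c0 * b * s + pi / c0 * ((ln (2 * b / \<tau>) * s + 8 * \<tau>) * (Cmu * (3 + \<rho> + 2 * b))))"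
    proof -
      have "ennreal x * ennreal s + ennreal p * ((ennreal l * ennreal s + ennreal t) * ennreal k) = ennreal (x * s + p * ((l * s + t) * k))"
        if "0 \<le> x" "0 \<le> p" "0 \<le> l" "0 \<le> t" "0 \<le> k" for x p l t k
        using that s(2) by (simp add: ennreal_mult)
      then show ?thesis using C1 c0(2) b Cmu(1) \<rho> \<tau> L by simp
    qed
    also have "\<dots> \<le> ennreal (C * b * (s + s * ln (2 * b / \<tau>) + \<tau>))"
    proof (intro ennreal_leI)
      have "3 + \<rho> + 2 * b \<le> 5 * b" using \<rho> by (simp add: b_def)
      then have k: "Cmu * (3 + \<rho> + 2 * b) \<le> Cmu * (5 * b)" using Cmu(1) by (intro mult_left_mono) auto
      have k0: "0 \<le> Cmu * (3 + \<rho> + 2 * b)" using Cmu(1) \<rho> b by simp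
      have "ln (2 * b / \<tau>) * s + 8 * \<tau> \<le> 8 * (s + s * ln (2 * b / \<tau>) + \<tau>)"
        using mult_nonneg_nonneg[OF L s(2)] s(2) by (simp add: mult.commute)
      moreover have "0 \<le> 8 * (s + s * ln (2 * b / \<tau>) + \<tau>)" using L s(2) \<tau> by simp
      ultimately have "(ln (2 * b / \<tau>) * s + 8 * \<tau>) * (Cmu * (3 + \<rho> + 2 * b)) \<le> (8 * (s + s * ln (2 * b / \<tau>) + \<tau>)) * (Cmu * (5 * b))"
        using k k0 by (rule_tac mult_mono)
      then have "pi / c0 * ((ln (2 * b / \<tau>) * s + 8 * \<tau>) * (Cmu * (3 + \<rho> + 2 * b))) \<le> pi / c0 * ((8 * (s + s * ln (2 * b / \<tau>) + \<tau>)) * (Cmu * (5 * b)))"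
        using c0(2) by (intro mult_left_mono) auto
      moreover have "125 * C1 / c0 * b * s \<le> 125 * C1 / c0 * b * (s + s * ln (2 * b / \<tau>) + \<tau>)"
        using C1 c0(2) b L s(2) \<tau> by (intro mult_left_mono) auto
      moreover have "C * b * T = 125 * C1 / c0 * b * T + pi / c0 * ((8 * T) * (Cmu * (5 * b)))" for T
        by (simp add: C_def distrib_right)
      ultimately show "125 * C1 / c0 * b * s + pi / c0 * ((ln (2 * b / \<tau>) * s + 8 * \<tau>) * (Cmu * (3 + \<rho> + 2 * b)))
        \<le> C * b * (s + s * ln (2 * b / \<tau>) + \<tau>)"
        by (simp only: add_mono)
    qed
    finally show ?thesis by (simp add: b_def s_def)
  qed
  then show thesis by (rule that[OF C])
qed

text \<open>With the whole interval as \<open>S\<close> and the largest admissible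
  \<open>\<tau>\<close> the logarithm in the preceding bound vanishes.\<close>

lemma line_abs:
  obtains C where "0 \<le> C" "\<And>\<rho> x0. 0 \<le> \<rho> \<Longrightarrow> \<bar>x0\<bar> \<le> 2 \<Longrightarrow>
    (\<integral>\<^sup>+y. e2ennreal \<bar>M (Complex x0 y)\<bar> * indicator {-\<rho>..\<rho>} y \<partial>lborel) \<le> ennreal (C * (1 + \<rho>)\<^sup>2)"
proof -
  obtain A where A: "0 \<le> A" "\<And>z. M z \<le> ereal (A * (1 + cmod z))" using upper_growth by blast
  obtain C where C: "0 \<le> C" and le: "\<And>\<rho> x0 S \<tau>. 0 \<le> \<rho> \<Longrightarrow> \<bar>x0\<bar> \<le> 2 \<Longrightarrow> S \<in> sets borel \<Longrightarrow> S \<subseteq> {-\<rho>..\<rho>} \<Longrightarrow> 0 < \<tau> \<Longrightarrow> \<tau> \<le> 2 * (1 + \<rho>) \<Longrightarrow>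
    (\<integral>\<^sup>+y. e2ennreal (- M (Complex x0 y)) * indicator S y \<partial>lborel)
      \<le> ennreal (C * (1 + \<rho>) * (measure lborel S + measure lborel S * ln (2 * (1 + \<rho>) / \<tau>) + \<tau>))"
    by (rule line_negative_part) (rule that)
  have "(\<integral>\<^sup>+y. e2ennreal \<bar>M (Complex x0 y)\<bar> * indicator {-\<rho>..\<rho>} y \<partial>lborel) \<le> ennreal ((6 * A + 4 * C) * (1 + \<rho>)\<^sup>2)"
    if \<rho>: "0 \<le> \<rho>" and x0: "\<bar>x0\<bar> \<le> 2" for \<rho> x0
  proof -
    have "(\<integral>\<^sup>+y. e2ennreal \<bar>M (Complex x0 y)\<bar> * indicator {-\<rho>..\<rho>} y \<partial>lborel)
      \<le> (\<integral>\<^sup>+y. ennreal (A * (3 + \<rho>)) * indicator {-\<rho>..\<rho>} y + e2ennreal (- M (Complex x0 y)) * indicator {-\<rho>..\<rho>} y \<partial>lborel)"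
    proof (intro nn_integral_mono)
      fix y
      show "e2ennreal \<bar>M (Complex x0 y)\<bar> * indicator {-\<rho>..\<rho>} y
        \<le> ennreal (A * (3 + \<rho>)) * indicator {-\<rho>..\<rho>} y + e2ennreal (- M (Complex x0 y)) * indicator {-\<rho>..\<rho>} y"
      proof (cases "y \<in> {-\<rho>..\<rho>}")
        case True
        let ?w = "Complex x0 y"
        have "cmod ?w \<le> 2 + \<rho>" using x0 True cmod_le[of ?w] by auto
        then have "A * (1 + cmod ?w) \<le> A * (3 + \<rho>)" using A by (intro mult_left_mono) auto
        then have Mw: "M ?w \<le> ereal (A * (3 + \<rho>))" using A(2)[of ?w] by (meson ereal_less_eq(3) order_trans)
        have "e2ennreal \<bar>M ?w\<bar> \<le> ennreal (A * (3 + \<rho>)) + e2ennreal (- M ?w)"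
        proof (cases "M ?w")
          case (real t)
          then have "t \<le> A * (3 + \<rho>)" using Mw by simp
          moreover have "0 \<le> A * (3 + \<rho>)" using A \<rho> by simp
          ultimately show ?thesis using real
            by (cases "0 \<le> t") (auto simp: e2ennreal_ereal ennreal_neg ennreal_leI intro: add_increasing)
        qed (use less_PInf[of ?w] in auto)
        then show ?thesis using True by simp
      qed simp
    qed
    also have "\<dots> = ennreal (A * (3 + \<rho>)) * ennreal (2 * \<rho>) + (\<integral>\<^sup>+y. e2ennreal (- M (Complex x0 y)) * indicator {-\<rho>..\<rho>} y \<partial>lborel)"
      using \<rho> by (subst nn_integral_add) (auto simp: nn_integral_cmult_indicator)
    also have "\<dots> \<le> ennreal (A * (3 + \<rho>)) * ennreal (2 * \<rho>) + ennreal (C * (1 + \<rho>) * (2 * \<rho> + 2 * (1 + \<rho>)))"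
      using le[OF \<rho> x0, of "{-\<rho>..\<rho>}" "2 * (1 + \<rho>)"] \<rho> by (intro add_left_mono) auto
    also have "\<dots> = ennreal (A * (3 + \<rho>) * (2 * \<rho>) + C * (1 + \<rho>) * (2 * \<rho> + 2 * (1 + \<rho>)))"
      using A C \<rho> by (simp add: ennreal_mult[symmetric] ennreal_plus[symmetric] del: ennreal_plus)
    also have "\<dots> \<le> ennreal ((6 * A + 4 * C) * (1 + \<rho>)\<^sup>2)"
    proof (intro ennreal_leI)
      have "(3 + \<rho>) * (2 * \<rho>) \<le> 6 * (1 + \<rho>)\<^sup>2" using \<rho> by (simp add: power2_eq_square algebra_simps)
      from mult_left_mono[OF this A(1)]
      have 1: "A * (3 + \<rho>) * (2 * \<rho>) \<le> 6 * A * (1 + \<rho>)\<^sup>2" by (simp add: mult_ac)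
      have "(1 + \<rho>) * (2 * \<rho> + 2 * (1 + \<rho>)) \<le> 4 * (1 + \<rho>)\<^sup>2" using \<rho> by (simp add: power2_eq_square algebra_simps)
      from mult_left_mono[OF this C]
      have 2: "C * (1 + \<rho>) * (2 * \<rho> + 2 * (1 + \<rho>)) \<le> 4 * C * (1 + \<rho>)\<^sup>2" by (simp add: mult_ac)
      show "A * (3 + \<rho>) * (2 * \<rho>) + C * (1 + \<rho>) * (2 * \<rho> + 2 * (1 + \<rho>)) \<le> (6 * A + 4 * C) * (1 + \<rho>)\<^sup>2"
        using add_mono[OF 1 2] by (simp add: distrib_right)
    qed
    finally show ?thesis .
  qed
  then show thesis using A C by (intro that[of "6 * A + 4 * C"]) auto
qed

lemma AE_line_finite: "\<bar>x0\<bar> \<le> 2 \<Longrightarrow> AE y in lborel. M (Complex x0 y) = ereal (m (Complex x0 y))"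
proof -
  assume x0: "\<bar>x0\<bar> \<le> 2"
  obtain C where C0: "0 \<le> C" "\<And>\<rho> x0. 0 \<le> \<rho> \<Longrightarrow> \<bar>x0\<bar> \<le> 2 \<Longrightarrow>
    (\<integral>\<^sup>+y. e2ennreal \<bar>M (Complex x0 y)\<bar> * indicator {-\<rho>..\<rho>} y \<partial>lborel) \<le> ennreal (C * (1 + \<rho>)\<^sup>2)"
    by (rule line_abs) (rule that)
  note C = C0(2)[OF _ x0]
  have "AE y in lborel. e2ennreal \<bar>M (Complex x0 y)\<bar> * indicator {-real n..real n} y \<noteq> \<infinity>" for n
  proof (rule nn_integral_noteq_infinite)
    show "(\<lambda>y. e2ennreal \<bar>M (Complex x0 y)\<bar> * indicator {-real n..real n} y) \<in> borel_measurable lborel" by measurable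
    show "(\<integral>\<^sup>+y. e2ennreal \<bar>M (Complex x0 y)\<bar> * indicator {-real n..real n} y \<partial>lborel) \<noteq> \<infinity>"
      using C[of "real n"] by (auto simp: top_unique)
  qed
  then have "AE y in lborel. \<forall>n. e2ennreal \<bar>M (Complex x0 y)\<bar> * indicator {-real n..real n} y \<noteq> \<infinity>"
    by (simp add: AE_all_countable)
  then show ?thesis
  proof (rule eventually_mono)
    fix y assume *: "\<forall>n. e2ennreal \<bar>M (Complex x0 y)\<bar> * indicator {-real n..real n} y \<noteq> \<infinity>"
    obtain n where "\<bar>y\<bar> \<le> real n" using real_arch_simple by blast
    then have "y \<in> {-real n..real n}" by auto
    then have "e2ennreal \<bar>M (Complex x0 y)\<bar> \<noteq> \<infinity>" using *[rule_format, of n] by simp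
    then show "M (Complex x0 y) = ereal (m (Complex x0 y))" by (cases "M (Complex x0 y)") auto
  qed
qed

lemma abs_m_le: "ennreal \<bar>m z\<bar> \<le> e2ennreal \<bar>M z\<bar>"
  by (cases "M z") (auto simp: e2ennreal_ereal)

lemma tail_m: "\<exists>T\<ge>0. (\<integral>\<^sup>+z. ennreal \<bar>m z\<bar> * ennreal (1 / (1 + cmod z) ^ 4) \<partial>lborel) \<le> ennreal T"
  using dyadic_tail[of "\<lambda>z. ennreal \<bar>m z\<bar>" lborel Cm 3] Cm by (intro exI[of _ "Cm * 4 ^ 4"]) simp

lemma tail_mu: "\<exists>T\<ge>0. (\<integral>\<^sup>+z. ennreal (1 / (1 + cmod z)\<^sup>2) \<partial>\<mu>) \<le> ennreal T"
  using dyadic_tail[of "\<lambda>z. 1" \<mu> Cmu 1] Cmu by (intro exI[of _ "Cmu * 4 ^ 2"]) (simp add: numeral_2_eq_2)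

text \<open>Within a strip the mass of |M| grows one power more slowly than in the plane, so cubic
  decay suffices. That is the decay available when the weight is displaced along the axis.\<close>

lemma tail_strip: "\<exists>T\<ge>0. (\<integral>\<^sup>+z. ennreal \<bar>m z\<bar> * indicator {z. \<bar>Re z\<bar> \<le> 2} z * ennreal (1 / (1 + cmod z) ^ 3) \<partial>lborel) \<le> ennreal T"
proof -
  obtain C where C: "0 \<le> C" "\<And>\<rho> x0. 0 \<le> \<rho> \<Longrightarrow> \<bar>x0\<bar> \<le> 2 \<Longrightarrow>
    (\<integral>\<^sup>+y. e2ennreal \<bar>M (Complex x0 y)\<bar> * indicator {-\<rho>..\<rho>} y \<partial>lborel) \<le> ennreal (C * (1 + \<rho>)\<^sup>2)"
    by (rule line_abs) (rule that)
  have "(\<integral>\<^sup>+z. ennreal \<bar>m z\<bar> * indicator {z. \<bar>Re z\<bar> \<le> 2} z * indicator (cball 0 \<rho>) z \<partial>lborel) \<le> ennreal (4 * C * (1 + \<rho>)\<^sup>2)"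
    if \<rho>: "0 \<le> \<rho>" for \<rho>
  proof -
    have "(\<integral>\<^sup>+z. ennreal \<bar>m z\<bar> * indicator {z. \<bar>Re z\<bar> \<le> 2} z * indicator (cball 0 \<rho>) z \<partial>lborel)
      \<le> (\<integral>\<^sup>+z. e2ennreal \<bar>M z\<bar> * indicator {-2..2} (Re z) * indicator {-\<rho>..\<rho>} (Im z) \<partial>lborel)"
    proof (intro nn_integral_mono)
      fix z
      show "ennreal \<bar>m z\<bar> * indicator {z. \<bar>Re z\<bar> \<le> 2} z * indicator (cball 0 \<rho>) z
        \<le> e2ennreal \<bar>M z\<bar> * indicator {-2..2} (Re z) * indicator {-\<rho>..\<rho>} (Im z)"
      proof (cases "\<bar>Re z\<bar> \<le> 2 \<and> cmod z \<le> \<rho>")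
        case True
        then have "Re z \<in> {-2..2}" "Im z \<in> {-\<rho>..\<rho>}" using abs_Im_le_cmod[of z] by auto
        then show ?thesis using True abs_m_le[of z] by simp
      qed auto
    qed
    also have "\<dots> = (\<integral>\<^sup>+x. \<integral>\<^sup>+y. e2ennreal \<bar>M (Complex x y)\<bar> * indicator {-2..2} x * indicator {-\<rho>..\<rho>} y \<partial>lborel \<partial>lborel)"
      by (subst nn_integral_complex(1)) simp_all
    also have "\<dots> \<le> (\<integral>\<^sup>+x. ennreal (C * (1 + \<rho>)\<^sup>2) * indicator {-2..2::real} x \<partial>lborel)"
    proof (intro nn_integral_mono)
      fix x :: real
      show "(\<integral>\<^sup>+y. e2ennreal \<bar>M (Complex x y)\<bar> * indicator {-2..2} x * indicator {-\<rho>..\<rho>} y \<partial>lborel) \<le> ennreal (C * (1 + \<rho>)\<^sup>2) * indicator {-2..2} x"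
        using C(2)[OF \<rho>, of x] by (cases "x \<in> {-2..2}") auto
    qed
    also have "\<dots> = ennreal (C * (1 + \<rho>)\<^sup>2) * ennreal 4" by (simp add: nn_integral_cmult_indicator)
    also have "\<dots> = ennreal (4 * C * (1 + \<rho>)\<^sup>2)" using C by (subst ennreal_mult[symmetric]) (auto simp: mult_ac)
    finally show ?thesis .
  qed
  then show ?thesis
    using dyadic_tail[of "\<lambda>z. ennreal \<bar>m z\<bar> * indicator {z. \<bar>Re z\<bar> \<le> 2} z" lborel "4 * C" 2] C(1)
    by (intro exI[of _ "4 * C * 4 ^ 3"]) simp
qed

end

subsection \<open>Carleman test functions\<close>

text \<open>The marginal on the real axis of the normalised radial mollifier of scale 1; the slice
  is supported in |y| \<open>\<le>\<close> 2, so the finite interval loses nothing.\<close>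

definition kern :: "real \<Rightarrow> real" where
  "kern x = 1 / c0 * integral {-2..2} (\<lambda>y. step1 (x * x + y * y))"

lemma smooth_kern: "smooth_real kern"
proof -
  have "smooth_plane (\<lambda>z. step1 (Re z * Re z + Im z * Im z))"
    by (intro smooth_plane.comp[of step1] smooth_step smooth_plane.add smooth_plane.mult smooth_plane.Re smooth_plane.Im)
  from smooth_real_integral[OF this, of "-2" 2] show ?thesis
    unfolding kern_def[abs_def] by (intro smooth_real_intros) simp_all
qed

lemma measurable_kern[measurable]: "kern \<in> borel_measurable borel"
  by (intro borel_measurable_continuous_onI smooth_real_continuous smooth_kern)

lemma kern_nonneg: "0 \<le> kern x"
  unfolding kern_def using c0(2)
  by (intro mult_nonneg_nonneg integral_nonneg integrable_continuous_real continuous_intros) (auto simp: step_props(4))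

lemma nn_integral_kern_slice: "(\<integral>\<^sup>+y. ennreal (step1 (x * x + y * y)) \<partial>lborel) = ennreal (c0 * kern x)"
proof -
  have "(\<lambda>y. step1 (x * x + y * y)) integrable_on {-2..2}"
    by (intro integrable_continuous_real continuous_intros)
  then have "((\<lambda>y. step1 (x * x + y * y)) has_integral (c0 * kern x)) {-2..2}"
    using c0(2) by (simp add: kern_def has_integral_integral)
  then have "((\<lambda>y. step1 (x * x + y * y)) has_integral (c0 * kern x)) UNIV"
  proof (rule has_integral_on_superset)
    show "step1 (x * x + y * y) = 0" if "y \<notin> {-2..2}" for y
    proof (rule step1_0)
      have "2\<^sup>2 \<le> \<bar>y\<bar>\<^sup>2" using that by (intro power_mono) auto
      then have "4 \<le> y * y" by (simp add: power2_eq_square)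
      then show "x * x + y * y \<le> 1 \<or> 4 \<le> x * x + y * y" using zero_le_square[of x] by linarith
    qed
  qed auto
  from nn_integral_has_integral_lborel[OF _ _ this] show ?thesis by (simp add: step_props(4))
qed

lemma kern_eq_0: "2 \<le> \<bar>x\<bar> \<Longrightarrow> kern x = 0"
proof -
  assume "2 \<le> \<bar>x\<bar>"
  then have "2\<^sup>2 \<le> \<bar>x\<bar>\<^sup>2" by (intro power_mono) auto
  then have x: "4 \<le> x * x" by (simp add: power2_eq_square)
  have "step1 (x * x + y * y) = 0" for y
    by (rule step1_0) (use x zero_le_square[of y] in linarith)
  then show ?thesis by (simp add: kern_def)
qed

lemma kern_even: "kern (- x) = kern x"
  by (simp add: kern_def)

lemma nn_integral_kern: "(\<integral>\<^sup>+x. ennreal (kern x) \<partial>lborel) = 1"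
proof -
  have "ennreal c0 * (\<integral>\<^sup>+x. ennreal (kern x) \<partial>lborel) = (\<integral>\<^sup>+x. ennreal (c0 * kern x) \<partial>lborel)"
    using c0(2) by (simp add: nn_integral_cmult[symmetric] ennreal_mult')
  also have "\<dots> = (\<integral>\<^sup>+x. \<integral>\<^sup>+y. ennreal (step1 (x * x + y * y)) \<partial>lborel \<partial>lborel)"
    by (simp add: nn_integral_kern_slice)
  also have "\<dots> = (\<integral>\<^sup>+\<zeta>. ennreal (step1 ((cmod \<zeta>)\<^sup>2)) \<partial>lborel)"
    by (subst nn_integral_complex(1)) (simp_all add: cmod_power2 flip: power2_eq_square)
  also have "\<dots> = ennreal c0" by (rule c0)
  finally have "ennreal c0 * (\<integral>\<^sup>+x. ennreal (kern x) \<partial>lborel) = ennreal c0 * 1" by simp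
  then show ?thesis using c0(2) by (subst (asm) ennreal_mult_cancel_left) auto
qed

lemma kern_bounded: "\<exists>B>0. \<forall>x. kern x \<le> B"
proof -
  have "compact (kern ` {-2..2})" by (intro compact_continuous_image smooth_real_continuous smooth_kern compact_Icc)
  then obtain B where B: "\<And>x. x \<in> {-2..2} \<Longrightarrow> \<bar>kern x\<bar> \<le> B"
    using compact_imp_bounded bounded_real by (metis imageI)
  have "kern x \<le> max 1 B" for x
    using B[of x] kern_eq_0[of x] by (cases "x \<in> {-2..2}") auto
  then show ?thesis by (intro exI[of _ "max 1 B"]) auto
qed

text \<open>The ramp is a smooth version of \<open>x \<mapsto> max x 0\<close> with the marginal of the radial mollifier as second derivative.\<close>

lemma ramp_exists:
  "\<exists>s s1. smooth_real s \<and> (\<forall>x. (s has_real_derivative s1 x) (at x)) \<and> (\<forall>x. (s1 has_real_derivative kern x) (at x))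
    \<and> (\<forall>x. \<bar>s x - max x 0\<bar> \<le> 2) \<and> (\<forall>x. \<bar>x * s1 x - s x\<bar> \<le> 4)"
proof -
  have k0: "kern x = 0" if "x \<le> -2" for x using kern_eq_0[of x] that by simp
  obtain s1 where s1: "\<And>x. (s1 has_real_derivative kern x) (at x)" "\<And>x. x \<le> -2 \<Longrightarrow> s1 x = 0"
    using primitive_exists[OF smooth_real_continuous[OF smooth_kern] k0] by blast
  have s1s: "smooth_real s1" by (rule smooth_real_primitive[OF smooth_kern s1(1)])
  obtain s where s: "\<And>x. (s has_real_derivative s1 x) (at x)" "\<And>x. x \<le> -2 \<Longrightarrow> s x = 0"
    using primitive_exists[OF smooth_real_continuous[OF s1s] s1(2)] by blast
  have ss: "smooth_real s" by (rule smooth_real_primitive[OF s1s s(1)])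
  have s1_mono: "s1 x \<le> s1 y" if "x \<le> y" for x y
    by (rule DERIV_nonneg_imp_nondecreasing[OF that]) (use s1(1) kern_nonneg in blast)
  have s1_pos: "0 \<le> s1 x" for x using s1_mono[of "min x (-2)" x] s1(2)[of "min x (-2)"] by simp
  have s_mono: "s x \<le> s y" if "x \<le> y" for x y
    by (rule DERIV_nonneg_imp_nondecreasing[OF that]) (use s(1) s1_pos in blast)
  have "(\<integral>\<^sup>+x. ennreal (kern x) * indicator {-2..2} x \<partial>lborel) = ennreal (s1 2 - s1 (-2))"
    by (rule nn_integral_FTC_Icc) (use s1(1) kern_nonneg in auto)
  moreover have "(\<integral>\<^sup>+x. ennreal (kern x) * indicator {-2..2} x \<partial>lborel) = (\<integral>\<^sup>+x. ennreal (kern x) \<partial>lborel)"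
    by (intro nn_integral_cong) (auto simp: indicator_def kern_eq_0)
  ultimately have "s1 2 = 1" using nn_integral_kern s1(2)[of "-2"] s1_pos[of 2] by simp
  have s1_1: "s1 x = 1" if "2 \<le> x" for x
  proof (cases "x = 2")
    case False
    have "(s1 has_real_derivative 0) (at y)" if "2 < y" for y using s1(1)[of y] kern_eq_0[of y] that by simp
    moreover have "2 < x" using that False by simp
    ultimately show ?thesis
      using DERIV_isconst_end[OF _ smooth_real_continuous[OF s1s], of 2 x] \<open>s1 2 = 1\<close> by metis
  qed (simp add: \<open>s1 2 = 1\<close>)
  have refl: "((\<lambda>x. f (- x)) has_real_derivative - f' (- x)) (at x)" if "\<And>x. (f has_real_derivative f' x) (at x)" for f f' and x :: real
    using DERIV_chain2[OF that DERIV_minus[OF DERIV_ident]] by simp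
  \<comment> \<open>As \<open>kern\<close> is even, \<open>s1\<close> - 1/2 is odd; one more
    integration gives \<open>s x - s (- x) = x\<close>, so that \<open>s\<close> is exactly the
    identity to the right of 2, without an additive constant.\<close>
  have "((\<lambda>x. s1 x + s1 (- x)) has_real_derivative 0) (at x)" for x
    using DERIV_add[OF s1(1) refl[OF s1(1)], of x] by (simp add: kern_even)
  from DERIV_const_ratio_const2[of 2, OF _ this] 
  have sym1: "s1 x + s1 (- x) = 1" for x
    using DERIV_isconst_all[of "\<lambda>x. s1 x + s1 (- x)" x 2] \<open>\<And>x. ((\<lambda>x. s1 x + s1 (- x)) has_real_derivative 0) (at x)\<close> s1(2)[of "-2"] \<open>s1 2 = 1\<close> by simp
  have "((\<lambda>x. s x - s (- x) - x) has_real_derivative 0) (at x)" for x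
    using DERIV_diff[OF DERIV_diff[OF s(1) refl[OF s(1)]] DERIV_ident, of x] sym1[of x] by simp
  then have sym: "s x - s (- x) - x = 0" for x
    using DERIV_isconst_all[of "\<lambda>x. s x - s (- x) - x" x 0] by simp
  have s2: "s x = x" if "2 \<le> x" for x using sym[of x] s(2)[of "- x"] that by simp
  have sb: "0 \<le> s x" "x \<le> 2 \<Longrightarrow> s x \<le> 2" for x
    using s_mono[of "min x (-2)" x] s(2)[of "min x (-2)"] s_mono[of x 2] s2[of 2] by auto
  have s1b: "s1 x \<le> 1" for x using sym1[of x] s1_pos[of "- x"] by simp
  have b1: "\<bar>s x - max x 0\<bar> \<le> 2" for x
  proof -
    consider "2 \<le> x" | "x \<le> -2" | "-2 < x" "x < 2" by linarith
    then show ?thesis by cases (use s2[of x] s(2)[of x] sb[of x] in auto)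
  qed
  have b2: "\<bar>x * s1 x - s x\<bar> \<le> 4" for x
  proof -
    consider "2 \<le> x" | "x \<le> -2" | "-2 < x" "x < 2" by linarith
    then show ?thesis
    proof cases
      case 3
      have "\<bar>x * s1 x\<bar> \<le> 2 * 1" unfolding abs_mult using 3 s1b[of x] s1_pos[of x] by (intro mult_mono) auto
      then show ?thesis using sb[of x] 3 by linarith
    qed (use s2[of x] s(2)[of x] s1(2)[of x] s1_1[of x] in auto)
  qed
  show ?thesis using ss s(1) s1(1) b1 b2 by blast
qed

text \<open>Chosen as a pair, so that \<open>ramp1\<close> is the derivative of that very
  \<open>ramp\<close>.\<close>

definition ramps :: "(real \<Rightarrow> real) \<times> (real \<Rightarrow> real)" where
  "ramps = (SOME p. smooth_real (fst p) \<and> (\<forall>x. (fst p has_real_derivative snd p x) (at x)) \<and> (\<forall>x. (snd p has_real_derivative kern x) (at x))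
    \<and> (\<forall>x. \<bar>fst p x - max x 0\<bar> \<le> 2) \<and> (\<forall>x. \<bar>x * snd p x - fst p x\<bar> \<le> 4))"

abbreviation "ramp \<equiv> fst ramps"
abbreviation "ramp1 \<equiv> snd ramps"

lemma ramp: "smooth_real ramp" "(ramp has_real_derivative ramp1 x) (at x)" "(ramp1 has_real_derivative kern x) (at x)"
    "\<bar>ramp x - max x 0\<bar> \<le> 2" "\<bar>x * ramp1 x - ramp x\<bar> \<le> 4"
proof -
  obtain s s1 where "smooth_real s \<and> (\<forall>x. (s has_real_derivative s1 x) (at x)) \<and> (\<forall>x. (s1 has_real_derivative kern x) (at x))
    \<and> (\<forall>x. \<bar>s x - max x 0\<bar> \<le> 2) \<and> (\<forall>x. \<bar>x * s1 x - s x\<bar> \<le> 4)"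
    using ramp_exists by blast
  then have "\<exists>p. smooth_real (fst p) \<and> (\<forall>x. (fst p has_real_derivative snd p x) (at x)) \<and> (\<forall>x. (snd p has_real_derivative kern x) (at x))
    \<and> (\<forall>x. \<bar>fst p x - max x 0\<bar> \<le> 2) \<and> (\<forall>x. \<bar>x * snd p x - fst p x\<bar> \<le> 4)"
    by (intro exI[of _ "(s, s1)"]) simp
  from someI_ex[OF this, folded ramps_def]
  show "smooth_real ramp" "(ramp has_real_derivative ramp1 x) (at x)" "(ramp1 has_real_derivative kern x) (at x)"
    "\<bar>ramp x - max x 0\<bar> \<le> 2" "\<bar>x * ramp1 x - ramp x\<bar> \<le> 4" by blast+
qed

text \<open>In terms of \<open>\<sigma>\<close> = |z|^2 it vanishes outside r < |z| < 2 R and equals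
  1 for 2 r \<open>\<le>\<close> |z| \<open>\<le>\<close> R. If R < 2 r there is no plateau, and the
  comparisons with the sharp annulus allow for that.\<close>

definition cutoff :: "real \<Rightarrow> real \<Rightarrow> real \<Rightarrow> real" where
  "cutoff r R \<sigma> = step (\<sigma> / r\<^sup>2) * (1 - step (\<sigma> / R\<^sup>2))"

definition cutoff1 :: "real \<Rightarrow> real \<Rightarrow> real \<Rightarrow> real" where
  "cutoff1 r R \<sigma> = step1 (\<sigma> / r\<^sup>2) / r\<^sup>2 * (1 - step (\<sigma> / R\<^sup>2)) - step (\<sigma> / r\<^sup>2) * (step1 (\<sigma> / R\<^sup>2) / R\<^sup>2)"

definition cutoff2 :: "real \<Rightarrow> real \<Rightarrow> real \<Rightarrow> real" where
  "cutoff2 r R \<sigma> = step2 (\<sigma> / r\<^sup>2) / r\<^sup>2 / r\<^sup>2 * (1 - step (\<sigma> / R\<^sup>2))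
     - 2 * (step1 (\<sigma> / r\<^sup>2) / r\<^sup>2) * (step1 (\<sigma> / R\<^sup>2) / R\<^sup>2) - step (\<sigma> / r\<^sup>2) * (step2 (\<sigma> / R\<^sup>2) / R\<^sup>2 / R\<^sup>2)"

text \<open>With \<open>\<sigma>\<close> = |z|^2, multiplication by Re z gives the harmonic function
  Re (1 / z), cut off to the annulus.\<close>

definition weight :: "real \<Rightarrow> real \<Rightarrow> real \<Rightarrow> real" where
  "weight r R \<sigma> = cutoff r R \<sigma> / \<sigma>"

lemma step_scaled_deriv:
  "((\<lambda>s. step (s / c)) has_real_derivative step1 (s / c) / c) (at s)"
  "((\<lambda>s. step1 (s / c) / d) has_real_derivative step2 (s / c) / c / d) (at s)"
proof -
  have 1: "((\<lambda>s. s / c) has_real_derivative 1 / c) (at s)" using DERIV_cdivide[OF DERIV_ident] .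
  show "((\<lambda>s. step (s / c)) has_real_derivative step1 (s / c) / c) (at s)"
    using DERIV_chain2[OF step_deriv(1) 1] by simp
  have "((\<lambda>s. step1 (s / c) / d) has_real_derivative step2 (s / c) * (1 / c) / d) (at s)"
    by (rule DERIV_cdivide[OF DERIV_chain2[OF step_deriv(2) 1]])
  then show "((\<lambda>s. step1 (s / c) / d) has_real_derivative step2 (s / c) / c / d) (at s)" by simp
qed

lemma cutoff_deriv:
  "(cutoff r R has_real_derivative cutoff1 r R s) (at s)"
  "(cutoff1 r R has_real_derivative cutoff2 r R s) (at s)"
proof -
  note d = step_scaled_deriv
  have 0: "((\<lambda>s. 1 - step (s / R\<^sup>2)) has_real_derivative - (step1 (s / R\<^sup>2) / R\<^sup>2)) (at s)" for s
    using DERIV_diff[OF DERIV_const d(1)] by simp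
  show "(cutoff r R has_real_derivative cutoff1 r R s) (at s)"
    unfolding cutoff_def[abs_def] cutoff1_def using DERIV_mult[OF d(1) 0] by (simp add: mult.commute)
  show "(cutoff1 r R has_real_derivative cutoff2 r R s) (at s)"
    unfolding cutoff1_def[abs_def] cutoff2_def
    using DERIV_diff[OF DERIV_mult[OF d(2)[where c="r\<^sup>2" and d="r\<^sup>2"] 0[of s]]
        DERIV_mult[OF d(1)[where c="r\<^sup>2"] d(2)[where c="R\<^sup>2" and d="R\<^sup>2"]]]
    by (rule DERIV_cong) (simp add: algebra_simps)
qed

context
  fixes r R :: real
  assumes rR: "0 < r" "r < R"
begin

lemma cutoff_bounds: "0 \<le> cutoff r R \<sigma>" "cutoff r R \<sigma> \<le> 1"
  unfolding cutoff_def using step_bounds by (auto intro: mult_le_one)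

lemma cutoff_eq_0: "\<sigma> \<le> r\<^sup>2 \<or> 4 * R\<^sup>2 \<le> \<sigma> \<Longrightarrow> cutoff r R \<sigma> = 0"
proof (elim disjE)
  assume "\<sigma> \<le> r\<^sup>2"
  then have "\<sigma> / r\<^sup>2 \<le> 1" using rR by simp
  then show ?thesis by (simp add: cutoff_def step_props(2))
next
  assume "4 * R\<^sup>2 \<le> \<sigma>"
  then have "4 \<le> \<sigma> / R\<^sup>2" using rR by (simp add: field_simps)
  then show ?thesis by (simp add: cutoff_def step_props(3))
qed

lemma cutoff_eq_1: "4 * r\<^sup>2 \<le> \<sigma> \<Longrightarrow> \<sigma> \<le> R\<^sup>2 \<Longrightarrow> cutoff r R \<sigma> = 1"
proof -
  assume "4 * r\<^sup>2 \<le> \<sigma>" "\<sigma> \<le> R\<^sup>2"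
  then have "4 \<le> \<sigma> / r\<^sup>2" "\<sigma> / R\<^sup>2 \<le> 1" using rR by (simp_all add: field_simps)
  then show ?thesis by (simp add: cutoff_def step_props)
qed

lemma smooth_weight: "smooth_real (weight r R)"
proof -
  have "smooth_real (cutoff r R)" unfolding cutoff_def[abs_def]
    by (intro smooth_real_intros smooth_real_diff smooth_real_scale smooth_step)
  then show ?thesis unfolding weight_def[abs_def]
    by (rule smooth_real_divide[where a="r\<^sup>2"]) (use rR cutoff_eq_0 in auto)
qed

lemma measurable_weight[measurable]: "weight r R \<in> borel_measurable borel"
  by (intro borel_measurable_continuous_onI smooth_real_continuous smooth_weight)

lemma weight_eq_0: "\<sigma> \<le> r\<^sup>2 \<or> 4 * R\<^sup>2 \<le> \<sigma> \<Longrightarrow> weight r R \<sigma> = 0"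
  using cutoff_eq_0 by (simp add: weight_def)

lemma weight_nonneg: "0 \<le> weight r R \<sigma>"
proof (cases "\<sigma> \<le> r\<^sup>2")
  case False
  moreover have "0 \<le> r\<^sup>2" by simp
  ultimately have "0 \<le> \<sigma>" by linarith
  then show ?thesis unfolding weight_def using cutoff_bounds by simp
qed (simp add: weight_eq_0)

lemma weight_le: "0 \<le> \<sigma> \<Longrightarrow> weight r R \<sigma> \<le> 1 / \<sigma>"
  unfolding weight_def using cutoff_bounds by (intro divide_right_mono)

lemma weight_deriv: "(weight r R has_real_derivative deriv (weight r R) s) (at s)"
    "(deriv (weight r R) has_real_derivative deriv (deriv (weight r R)) s) (at s)"
  using smooth_real_deriv smooth_weight by blast+

text \<open>Obtained by differentiating \<open>\<sigma>\<close> * weight = cutoff twice. The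
  Laplacian of weight (|z|^2) * Re z is 4 Re z times the second combination; that it reduces to
  \<open>cutoff2\<close>, a term of the transition annuli only, is the harmonicity of Re (1 /
  z).\<close>

lemma weight_deriv_identities:
  "weight r R \<sigma> + \<sigma> * deriv (weight r R) \<sigma> = cutoff1 r R \<sigma>"
  "2 * deriv (weight r R) \<sigma> + \<sigma> * deriv (deriv (weight r R)) \<sigma> = cutoff2 r R \<sigma>"
proof -
  have eq: "(\<lambda>s. s * weight r R s) = cutoff r R"
    using cutoff_eq_0[of 0] by (auto simp: weight_def fun_eq_iff)
  have 1: "((\<lambda>s. s * weight r R s) has_real_derivative weight r R s + s * deriv (weight r R) s) (at s)" for s
    using DERIV_mult[OF DERIV_ident weight_deriv(1), of s] by (simp add: algebra_simps)
  have eq1: "weight r R s + s * deriv (weight r R) s = cutoff1 r R s" for s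
    using DERIV_unique[OF 1[of s]] cutoff_deriv(1) unfolding eq by blast
  then show "weight r R \<sigma> + \<sigma> * deriv (weight r R) \<sigma> = cutoff1 r R \<sigma>" .
  have "((\<lambda>s. weight r R s + s * deriv (weight r R) s) has_real_derivative
      2 * deriv (weight r R) \<sigma> + \<sigma> * deriv (deriv (weight r R)) \<sigma>) (at \<sigma>)"
    using DERIV_add[OF weight_deriv(1)[of \<sigma>] DERIV_mult[OF DERIV_ident weight_deriv(2)[of \<sigma>]]]
    by (rule DERIV_cong) (simp add: algebra_simps)
  then show "2 * deriv (weight r R) \<sigma> + \<sigma> * deriv (deriv (weight r R)) \<sigma> = cutoff2 r R \<sigma>"
    unfolding eq1 using DERIV_unique cutoff_deriv(2) by blast
qed

end

text \<open>By the first identity, \<open>\<sigma>\<close> times the derivative is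
  \<open>cutoff1 - weight\<close>, and both terms are O(1/\<open>\<sigma>\<close>) uniformly in
  \<open>r\<close> and \<open>R\<close>.\<close>

lemma weight_deriv_bound:
  assumes r0: "0 < r0"
  obtains C where "0 \<le> C" "\<And>r R \<sigma>. r0 \<le> r \<Longrightarrow> r < R \<Longrightarrow> 0 \<le> \<sigma> \<Longrightarrow> \<bar>deriv (weight r R) \<sigma>\<bar> \<le> C / (1 + \<sigma>)\<^sup>2"
proof -
  obtain B where B: "0 < B" "\<And>x. step1 x \<le> B" using step_deriv_bounded by blast
  have s1: "step1 (\<sigma> / \<rho>\<^sup>2) / \<rho>\<^sup>2 \<le> 4 * B / \<sigma>" if "0 < \<rho>" "0 < \<sigma>" for \<rho> \<sigma>
  proof (cases "\<sigma> / \<rho>\<^sup>2 < 4")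
    case True
    then have "\<sigma> < 4 * \<rho>\<^sup>2" using that by (simp add: field_simps)
    then have "1 / \<rho>\<^sup>2 \<le> 4 / \<sigma>" using that by (simp add: field_simps)
    from mult_mono[OF B(2)[of "\<sigma> / \<rho>\<^sup>2"] this] B(1) that show ?thesis by (simp add: mult.commute)
  next
    case False
    then show ?thesis using step1_0[of "\<sigma> / \<rho>\<^sup>2"] B that by simp
  qed
  \<comment> \<open>\<open>1 + \<sigma> \<le> \<kappa> * \<sigma>\<close> holds for
    \<open>\<sigma>\<close> at least r0^2, and below r^2 the weight vanishes identically.\<close>
  define \<kappa> where "\<kappa> = 1 + 1 / r0\<^sup>2"
  define C where "C = (8 * B + 1) * \<kappa>\<^sup>2"
  have "\<bar>deriv (weight r R) \<sigma>\<bar> \<le> C / (1 + \<sigma>)\<^sup>2" if rR: "r0 \<le> r" "r < R" and \<sigma>: "0 \<le> \<sigma>" for r R \<sigma>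
  proof (cases "\<sigma> < r\<^sup>2")
    case True
    have "((\<lambda>x. 0) has_real_derivative 0) (at \<sigma>)" by simp
    then have "(weight r R has_real_derivative 0) (at \<sigma>)"
      by (rule has_field_derivative_transform_within_open[where S="{..<r\<^sup>2}"]) (use True rR r0 weight_eq_0 in auto)
    then have "deriv (weight r R) \<sigma> = 0" by (rule DERIV_imp_deriv)
    then show ?thesis using B \<sigma> by (simp add: C_def)
  next
    case False
    have r: "0 < r" using rR r0 by simp
    have r2: "0 < r\<^sup>2" "r0\<^sup>2 \<le> r\<^sup>2" using r r0 rR by (auto intro: power_mono)
    have "r\<^sup>2 \<le> \<sigma>" using False by simp
    then have pos: "0 < \<sigma>" "r0\<^sup>2 \<le> \<sigma>" using r2 by linarith+
    have "\<bar>cutoff1 r R \<sigma>\<bar> \<le> \<bar>step1 (\<sigma> / r\<^sup>2) / r\<^sup>2 * (1 - step (\<sigma> / R\<^sup>2))\<bar> + \<bar>step (\<sigma> / r\<^sup>2) * (step1 (\<sigma> / R\<^sup>2) / R\<^sup>2)\<bar>"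
      unfolding cutoff1_def by (rule abs_triangle_ineq4)
    also have "\<dots> \<le> (4 * B / \<sigma>) * 1 + 1 * (4 * B / \<sigma>)"
      unfolding abs_mult using s1[OF r pos(1)] s1[OF _ pos(1), of R] r rR step_bounds step_props(4) B(1) pos(1)
      by (intro add_mono mult_mono) (auto simp: abs_le_iff)
    finally have c1: "\<bar>cutoff1 r R \<sigma>\<bar> \<le> 8 * B / \<sigma>" by simp
    have "cutoff1 r R \<sigma> - weight r R \<sigma> = \<sigma> * deriv (weight r R) \<sigma>"
      using weight_deriv_identities(1)[OF r rR(2), of \<sigma>] by simp
    then have "\<sigma> * \<bar>deriv (weight r R) \<sigma>\<bar> = \<bar>cutoff1 r R \<sigma> - weight r R \<sigma>\<bar>"
      using pos by (simp add: abs_mult)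
    also have "\<dots> \<le> 8 * B / \<sigma> + 1 / \<sigma>"
      using c1 weight_le[OF r rR(2), of \<sigma>] weight_nonneg[OF r rR(2), of \<sigma>] pos by linarith
    finally have "\<bar>deriv (weight r R) \<sigma>\<bar> \<le> (8 * B + 1) / \<sigma>\<^sup>2"
      using pos by (simp add: field_simps power2_eq_square)
    also have "\<dots> \<le> C / (1 + \<sigma>)\<^sup>2"
    proof -
      have "1 + \<sigma> \<le> \<kappa> * \<sigma>" using pos r0 by (simp add: \<kappa>_def field_simps)
      then have "(1 + \<sigma>)\<^sup>2 \<le> (\<kappa> * \<sigma>)\<^sup>2" using pos by (intro power_mono) auto
      then have "(8 * B + 1) * (1 + \<sigma>)\<^sup>2 \<le> (8 * B + 1) * (\<kappa> * \<sigma>)\<^sup>2" using B by (intro mult_left_mono) auto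
      then show ?thesis using pos by (simp add: C_def field_simps power_mult_distrib)
    qed
    finally show ?thesis .
  qed
  moreover have "0 \<le> C" using B by (simp add: C_def)
  ultimately show thesis using that by blast
qed

text \<open>Second derivatives live on the transition annuli and scale like the inverse fourth power
  of the radius. The mixed term is charged to the inner disc, using \<open>r < R\<close>.\<close>

lemma cutoff2_bound:
  obtains C where "0 \<le> C" "\<And>r R z. 0 < r \<Longrightarrow> r < R \<Longrightarrow> \<bar>cutoff2 r R ((cmod z)\<^sup>2)\<bar>
    \<le> C / r ^ 4 * indicator (cball 0 (2 * r)) z + C / R ^ 4 * indicator (cball 0 (2 * R)) z"
proof -
  obtain B where B: "0 < B" "\<And>x. step1 x \<le> B" "\<And>x. \<bar>step2 x\<bar> \<le> B" using step_deriv_bounded by blast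
  define C where "C = B + 2 * B * B"
  have "\<bar>cutoff2 r R ((cmod z)\<^sup>2)\<bar>
    \<le> C / r ^ 4 * indicator (cball 0 (2 * r)) z + C / R ^ 4 * indicator (cball 0 (2 * R)) z" if rR: "0 < r" "r < R" for r R z
  proof -
    define \<sigma> where "\<sigma> = (cmod z)\<^sup>2"
    have z0: "step1 (\<sigma> / \<rho>\<^sup>2) = 0 \<and> step2 (\<sigma> / \<rho>\<^sup>2) = 0" if "0 < \<rho>" "z \<notin> cball 0 (2 * \<rho>)" for \<rho>
    proof -
      have "(2 * \<rho>)\<^sup>2 < (cmod z)\<^sup>2" using that by (intro power_strict_mono) auto
      then have "4 < \<sigma> / \<rho>\<^sup>2" using that by (simp add: \<sigma>_def field_simps)
      then show ?thesis using step1_0 step2_0 by simp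
    qed
    have t1: "\<bar>step2 (\<sigma> / r\<^sup>2) / r\<^sup>2 / r\<^sup>2 * (1 - step (\<sigma> / R\<^sup>2))\<bar> \<le> B / r ^ 4 * indicator (cball 0 (2 * r)) z"
    proof (cases "z \<in> cball 0 (2 * r)")
      case True
      have "\<bar>step2 (\<sigma> / r\<^sup>2)\<bar> / r ^ 4 * \<bar>1 - step (\<sigma> / R\<^sup>2)\<bar> \<le> B / r ^ 4 * 1"
        using B step_bounds[of "\<sigma> / R\<^sup>2"] by (intro mult_mono divide_right_mono) auto
      then show ?thesis using True by (simp add: abs_mult)
    qed (use z0[of r] rR in simp)
    have t3: "\<bar>step (\<sigma> / r\<^sup>2) * (step2 (\<sigma> / R\<^sup>2) / R\<^sup>2 / R\<^sup>2)\<bar> \<le> B / R ^ 4 * indicator (cball 0 (2 * R)) z"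
    proof (cases "z \<in> cball 0 (2 * R)")
      case True
      have "\<bar>step (\<sigma> / r\<^sup>2)\<bar> * (\<bar>step2 (\<sigma> / R\<^sup>2)\<bar> / R ^ 4) \<le> 1 * (B / R ^ 4)"
        using B step_bounds[of "\<sigma> / r\<^sup>2"] by (intro mult_mono divide_right_mono) auto
      then show ?thesis using True by (simp add: abs_mult)
    qed (use z0[of R] rR in simp)
    have t2: "\<bar>2 * (step1 (\<sigma> / r\<^sup>2) / r\<^sup>2) * (step1 (\<sigma> / R\<^sup>2) / R\<^sup>2)\<bar> \<le> 2 * B * B / r ^ 4 * indicator (cball 0 (2 * r)) z"
    proof (cases "z \<in> cball 0 (2 * r)")
      case True
      have "r\<^sup>2 \<le> R\<^sup>2" using rR by (intro power_mono) auto
      then have "step1 (\<sigma> / R\<^sup>2) / R\<^sup>2 \<le> B / r\<^sup>2" using B rR step_props(4) by (intro frac_le) auto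
      moreover have "step1 (\<sigma> / r\<^sup>2) / r\<^sup>2 \<le> B / r\<^sup>2" using B by (intro divide_right_mono) auto
      ultimately have "(step1 (\<sigma> / r\<^sup>2) / r\<^sup>2) * (step1 (\<sigma> / R\<^sup>2) / R\<^sup>2) \<le> (B / r\<^sup>2) * (B / r\<^sup>2)"
        using step_props(4) B by (intro mult_mono) auto
      moreover have "0 \<le> (step1 (\<sigma> / r\<^sup>2) / r\<^sup>2) * (step1 (\<sigma> / R\<^sup>2) / R\<^sup>2)"
        using step_props(4) by simp
      moreover have "(B / r\<^sup>2) * (B / r\<^sup>2) = B * B / r ^ 4" by (simp add: power2_eq_square power4_eq_xxxx)
      ultimately show ?thesis using True by simp
    qed (use z0[of r] rR in simp)
    have "\<bar>cutoff2 r R \<sigma>\<bar> \<le> \<bar>step2 (\<sigma> / r\<^sup>2) / r\<^sup>2 / r\<^sup>2 * (1 - step (\<sigma> / R\<^sup>2))\<bar>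
      + \<bar>2 * (step1 (\<sigma> / r\<^sup>2) / r\<^sup>2) * (step1 (\<sigma> / R\<^sup>2) / R\<^sup>2)\<bar> + \<bar>step (\<sigma> / r\<^sup>2) * (step2 (\<sigma> / R\<^sup>2) / R\<^sup>2 / R\<^sup>2)\<bar>"
      unfolding cutoff2_def by linarith
    also have "\<dots> \<le> B / r ^ 4 * indicator (cball 0 (2 * r)) z + 2 * B * B / r ^ 4 * indicator (cball 0 (2 * r)) z + B / R ^ 4 * indicator (cball 0 (2 * R)) z"
      using t1 t2 t3 by linarith
    also have "\<dots> \<le> C / r ^ 4 * indicator (cball 0 (2 * r)) z + C / R ^ 4 * indicator (cball 0 (2 * R)) z"
    proof -
      have "B / R ^ 4 \<le> C / R ^ 4" unfolding C_def using B by (intro divide_right_mono) auto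
      then have "B / R ^ 4 * indicator (cball 0 (2 * R)) z \<le> C / R ^ 4 * indicator (cball 0 (2 * R)) z"
        by (intro mult_right_mono) auto
      then show ?thesis by (simp add: C_def add_divide_distrib distrib_right)
    qed
    finally show ?thesis by (simp add: \<sigma>_def)
  qed
  moreover have "0 \<le> C" using B by (simp add: C_def)
  ultimately show thesis using that by blast
qed

section \<open>The test functions and their Laplacian\<close>

definition half_mass :: "complex measure \<Rightarrow> real \<Rightarrow> real \<Rightarrow> real \<Rightarrow> real" where
  "half_mass \<mu> \<eta> r R = (\<integral>z. indicator {z. r < cmod z \<and> cmod z \<le> R \<and> 0 < \<eta> * Re z} z * (\<eta> * Re z / (cmod z)\<^sup>2) \<partial>\<mu>)"

text \<open>The sign \<open>\<eta>\<close> selects the half-plane. The scaling keeps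
  \<open>\<epsilon> * ramp (x / \<epsilon>)\<close> within 2 \<open>\<epsilon>\<close> of the
  positive part of \<open>x\<close>, while its second derivative is the approximate identity
  \<open>kern (x / \<epsilon>) / \<epsilon>\<close>.\<close>

definition carleman_test :: "real \<Rightarrow> real \<Rightarrow> real \<Rightarrow> real \<Rightarrow> complex \<Rightarrow> real" where
  "carleman_test \<epsilon> \<eta> r R z = weight r R ((cmod z)\<^sup>2) * (\<epsilon> * ramp (\<eta> * Re z / \<epsilon>))"

lemma smooth_carleman_test: "0 < r \<Longrightarrow> r < R \<Longrightarrow> smooth_plane (carleman_test \<epsilon> \<eta> r R)"
proof -
  assume rR: "0 < r" "r < R"
  have "smooth_real (\<lambda>x. \<epsilon> * ramp (x / \<epsilon>))" by (intro smooth_real_intros smooth_real_scale ramp(1))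
  then have 1: "smooth_plane (\<lambda>z. \<epsilon> * ramp (\<eta> * Re z / \<epsilon>))"
    using smooth_plane.comp[of "\<lambda>x. \<epsilon> * ramp (x / \<epsilon>)" "\<lambda>z. \<eta> * Re z"] smooth_plane.mult[OF smooth_plane.const smooth_plane.Re] by blast
  have 2: "smooth_plane (\<lambda>z. weight r R ((cmod z)\<^sup>2))"
    using smooth_plane_radial[OF smooth_weight[OF rR], of 0] by simp
  show ?thesis unfolding carleman_test_def[abs_def] by (rule smooth_plane.mult[OF 2 1])
qed

text \<open>The first term is the strip average; it does not involve \<open>\<eta>\<close> because
  \<open>kern\<close> is even, so both half-planes see the same one. In the second term
  \<open>x * ramp1 x - ramp x\<close> measures how far the ramp is from being homogeneous of degree
  1, and it is bounded. The third term comes from the cutoff alone, by the harmonicity of Re (1 /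
  z).\<close>

lemma laplacian_carleman_test:
  assumes rR: "0 < r" "r < R" and \<epsilon>: "0 < \<epsilon>" and \<eta>: "\<eta> = 1 \<or> \<eta> = -1"
  shows "laplacian (carleman_test \<epsilon> \<eta> r R) z = weight r R ((cmod z)\<^sup>2) * (kern (Re z / \<epsilon>) / \<epsilon>)
    + 4 * deriv (weight r R) ((cmod z)\<^sup>2) * (\<epsilon> * ((\<eta> * Re z / \<epsilon>) * ramp1 (\<eta> * Re z / \<epsilon>) - ramp (\<eta> * Re z / \<epsilon>)))
    + 4 * (\<epsilon> * ramp (\<eta> * Re z / \<epsilon>)) * cutoff2 r R ((cmod z)\<^sup>2)"
proof -
  define X1 where "X1 = deriv (weight r R)"
  define X2 where "X2 = deriv X1"
  define \<sigma> where "\<sigma> z = (cmod z)\<^sup>2" for z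
  define s where "s z = \<epsilon> * ramp (\<eta> * Re z / \<epsilon>)" for z
  define s1 where "s1 z = \<eta> * ramp1 (\<eta> * Re z / \<epsilon>)" for z
  define s2 where "s2 z = kern (Re z / \<epsilon>) / \<epsilon>" for z
  have X: "(weight r R has_real_derivative X1 x) (at x)" "(X1 has_real_derivative X2 x) (at x)" for x
    unfolding X1_def X2_def by (rule weight_deriv[OF rR])+
  have \<sigma>e: "\<sigma> z = Re z * Re z + Im z * Im z" for z unfolding \<sigma>_def cmod_power2 by (simp add: power2_eq_square)
  have sx: "((\<lambda>t. \<sigma> (z + of_real t)) has_real_derivative 2 * Re z) (at 0)" for z
    unfolding \<sigma>e by (auto intro!: derivative_eq_intros)
  have sy: "((\<lambda>t. \<sigma> (z + of_real t * \<i>)) has_real_derivative 2 * Im z) (at 0)" for z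
    unfolding \<sigma>e by (auto intro!: derivative_eq_intros)
  have c: "((\<lambda>t. F (\<sigma> (z + of_real t))) has_real_derivative F' (\<sigma> z) * (2 * Re z)) (at 0)"
    "((\<lambda>t. F (\<sigma> (z + of_real t * \<i>))) has_real_derivative F' (\<sigma> z) * (2 * Im z)) (at 0)"
    if "\<And>x. (F has_real_derivative F' x) (at x)" for F F' z
    using DERIV_chain2[OF that sx[of z]] DERIV_chain2[OF that sy[of z]] by simp_all
  have lin: "((\<lambda>t. \<eta> * Re (z + of_real t) / \<epsilon>) has_real_derivative \<eta> / \<epsilon>) (at 0)" for z
    using \<epsilon> by (auto intro!: derivative_eq_intros)
  have ds: "((\<lambda>t. s (z + of_real t)) has_real_derivative s1 z) (at 0)" for z
  proof -
    have "((\<lambda>t. \<epsilon> * ramp (\<eta> * Re (z + of_real t) / \<epsilon>)) has_real_derivative \<epsilon> * (ramp1 (\<eta> * Re (z + of_real 0) / \<epsilon>) * (\<eta> / \<epsilon>))) (at 0)"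
      by (rule DERIV_cmult[OF DERIV_chain2[OF ramp(2) lin]])
    then show ?thesis unfolding s_def s1_def by (rule DERIV_cong) (use \<epsilon> in simp)
  qed
  have ds1: "((\<lambda>t. s1 (z + of_real t)) has_real_derivative s2 z) (at 0)" for z
  proof -
    have "((\<lambda>t. \<eta> * ramp1 (\<eta> * Re (z + of_real t) / \<epsilon>)) has_real_derivative \<eta> * (kern (\<eta> * Re (z + of_real 0) / \<epsilon>) * (\<eta> / \<epsilon>))) (at 0)"
      by (rule DERIV_cmult[OF DERIV_chain2[OF ramp(3) lin]])
    then show ?thesis unfolding s1_def s2_def by (rule DERIV_cong) (use \<eta> kern_even[of "Re z / \<epsilon>"] in auto)
  qed
  have dsy: "((\<lambda>t. s (z + of_real t * \<i>)) has_real_derivative 0) (at 0)" for z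
    by (simp add: s_def)
  have "laplacian (\<lambda>z. weight r R (\<sigma> z) * s z) z =
      ((X2 (\<sigma> z) * (2 * Re z) * (2 * Re z) + 2 * X1 (\<sigma> z)) * s z + s1 z * (X1 (\<sigma> z) * (2 * Re z))
        + (X1 (\<sigma> z) * (2 * Re z) * s1 z + s2 z * weight r R (\<sigma> z)))
      + (X2 (\<sigma> z) * (2 * Im z) * (2 * Im z) + 2 * X1 (\<sigma> z)) * s z"
  proof (rule laplacian_eqI)
    fix z
    show "((\<lambda>t. weight r R (\<sigma> (z + of_real t)) * s (z + of_real t)) has_real_derivative
        X1 (\<sigma> z) * (2 * Re z) * s z + s1 z * weight r R (\<sigma> z)) (at 0)"
      using DERIV_mult[OF c(1)[OF X(1), of z] ds[of z]] by simp
    have "((\<lambda>t. 2 * Re (z + of_real t)) has_real_derivative 2) (at 0)" by (auto intro!: derivative_eq_intros)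
    from DERIV_mult[OF c(1)[OF X(2), of z] this]
    have dX1x: "((\<lambda>t. X1 (\<sigma> (z + of_real t)) * (2 * Re (z + of_real t))) has_real_derivative
        X2 (\<sigma> z) * (2 * Re z) * (2 * Re z) + 2 * X1 (\<sigma> z)) (at 0)" by simp
    show "((\<lambda>t. X1 (\<sigma> (z + of_real t)) * (2 * Re (z + of_real t)) * s (z + of_real t) + s1 (z + of_real t) * weight r R (\<sigma> (z + of_real t)))
      has_real_derivative (X2 (\<sigma> z) * (2 * Re z) * (2 * Re z) + 2 * X1 (\<sigma> z)) * s z + s1 z * (X1 (\<sigma> z) * (2 * Re z))
        + (X1 (\<sigma> z) * (2 * Re z) * s1 z + s2 z * weight r R (\<sigma> z))) (at 0)"
      using DERIV_add[OF DERIV_mult[OF dX1x ds[of z]] DERIV_mult[OF ds1[of z] c(1)[OF X(1), of z]]]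
      by (rule DERIV_cong) simp
    show "((\<lambda>t. weight r R (\<sigma> (z + of_real t * \<i>)) * s (z + of_real t * \<i>)) has_real_derivative
        X1 (\<sigma> z) * (2 * Im z) * s z) (at 0)"
      using DERIV_mult[OF c(2)[OF X(1), of z] dsy[of z]] by simp
    have "((\<lambda>t. 2 * Im (z + of_real t * \<i>)) has_real_derivative 2) (at 0)" by (auto intro!: derivative_eq_intros)
    from DERIV_mult[OF DERIV_mult[OF c(2)[OF X(2), of z] this] dsy[of z]]
    show "((\<lambda>t. X1 (\<sigma> (z + of_real t * \<i>)) * (2 * Im (z + of_real t * \<i>)) * s (z + of_real t * \<i>)) has_real_derivative
        (X2 (\<sigma> z) * (2 * Im z) * (2 * Im z) + 2 * X1 (\<sigma> z)) * s z) (at 0)" by simp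
  qed
  also have "\<dots> = 4 * (\<sigma> z * X2 (\<sigma> z)) * s z + 4 * X1 (\<sigma> z) * s z + 4 * X1 (\<sigma> z) * (Re z * s1 z) + weight r R (\<sigma> z) * s2 z"
    by (simp add: \<sigma>e algebra_simps)
  also have "\<sigma> z * X2 (\<sigma> z) = cutoff2 r R (\<sigma> z) - 2 * X1 (\<sigma> z)"
    using weight_deriv_identities(2)[OF rR, of "\<sigma> z"] by (simp add: X1_def X2_def)
  also have "Re z * s1 z = \<epsilon> * ((\<eta> * Re z / \<epsilon>) * ramp1 (\<eta> * Re z / \<epsilon>))" using \<epsilon> by (simp add: s1_def)
  finally have "laplacian (\<lambda>z. weight r R (\<sigma> z) * s z) z = weight r R (\<sigma> z) * s2 z
    + 4 * X1 (\<sigma> z) * (\<epsilon> * ((\<eta> * Re z / \<epsilon>) * ramp1 (\<eta> * Re z / \<epsilon>) - ramp (\<eta> * Re z / \<epsilon>))) + 4 * s z * cutoff2 r R (\<sigma> z)"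
    by (simp add: algebra_simps s_def)
  then show ?thesis by (simp add: carleman_test_def[abs_def] \<sigma>_def s_def s2_def X1_def)
qed

lemma one_plus_square_le: "(1 + t) ^ 4 \<le> 4 * (1 + t\<^sup>2)\<^sup>2" if "0 \<le> t" for t :: real
proof -
  have "(1 + t)\<^sup>2 \<le> 2 * (1 + t\<^sup>2)" using sum_squares_bound[of 1 t] by (simp add: power2_eq_square algebra_simps)
  then have "((1 + t)\<^sup>2)\<^sup>2 \<le> (2 * (1 + t\<^sup>2))\<^sup>2" by (intro power_mono) auto
  moreover have "(2 * (1 + t\<^sup>2))\<^sup>2 = 4 * (1 + t\<^sup>2)\<^sup>2" by (simp only: power_mult_distrib) simp
  moreover have "((1 + t)\<^sup>2)\<^sup>2 = (1 + t) ^ 4" by (simp flip: power_mult)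
  ultimately show ?thesis by simp
qed

section \<open>Testing the Riesz measure\<close>

context finite_type_subharmonic begin

lemma measurable_m[measurable]: "m \<in> borel_measurable borel"
  by measurable

definition Tm :: real where
  "Tm = (SOME T. 0 \<le> T \<and> (\<integral>\<^sup>+z. ennreal \<bar>m z\<bar> * ennreal (1 / (1 + cmod z) ^ 4) \<partial>lborel) \<le> ennreal T)"

lemma Tm: "0 \<le> Tm" "(\<integral>\<^sup>+z. ennreal \<bar>m z\<bar> * ennreal (1 / (1 + cmod z) ^ 4) \<partial>lborel) \<le> ennreal Tm"
  using someI_ex[OF tail_m] unfolding Tm_def[symmetric] by auto

text \<open>The shape of the errors met below: a tail of order |z|^(-4), against which |M| is
  integrable, and one term for each edge of the annulus.\<close>

lemma m_error:
  assumes g[measurable]: "g \<in> borel_measurable borel" and nn: "0 \<le> P" "0 \<le> Q1" "0 \<le> Q2" "0 \<le> \<rho>1" "0 \<le> \<rho>2"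
    and le: "\<And>z. \<bar>g z\<bar> \<le> P / (1 + cmod z) ^ 4 + Q1 * indicator (cball 0 \<rho>1) z + Q2 * indicator (cball 0 \<rho>2) z"
  shows "integrable lborel (\<lambda>z. m z * g z)"
    and "\<bar>\<integral>z. m z * g z \<partial>lborel\<bar> \<le> P * Tm + Q1 * (Cm * (1 + \<rho>1) ^ 3) + Q2 * (Cm * (1 + \<rho>2) ^ 3)"
proof -
    have "(\<integral>\<^sup>+z. ennreal (norm (m z * g z)) \<partial>lborel)
      \<le> (\<integral>\<^sup>+z. ennreal P * (ennreal \<bar>m z\<bar> * ennreal (1 / (1 + cmod z) ^ 4)) + ennreal Q1 * (ennreal \<bar>m z\<bar> * indicator (cball 0 \<rho>1) z)
          + ennreal Q2 * (ennreal \<bar>m z\<bar> * indicator (cball 0 \<rho>2) z) \<partial>lborel)"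
    proof (intro nn_integral_mono)
      fix z
      define x where "x = m z"
      have "ennreal (norm (x * g z)) = ennreal (\<bar>x\<bar> * \<bar>g z\<bar>)" by (simp add: abs_mult)
      also have "\<dots> \<le> ennreal (\<bar>x\<bar> * (P * (1 / (1 + cmod z) ^ 4) + Q1 * indicator (cball 0 \<rho>1) z + Q2 * indicator (cball 0 \<rho>2) z))"
        using le[of z] by (intro ennreal_leI mult_left_mono) auto
      also have "\<dots> = ennreal P * (ennreal \<bar>x\<bar> * ennreal (1 / (1 + cmod z) ^ 4)) + ennreal Q1 * (ennreal \<bar>x\<bar> * indicator (cball 0 \<rho>1) z)
          + ennreal Q2 * (ennreal \<bar>x\<bar> * indicator (cball 0 \<rho>2) z)"
      proof -
        have "ennreal (a * (P * b + Q1 * indicator (cball 0 \<rho>1) z + Q2 * indicator (cball 0 \<rho>2) z))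
          = ennreal P * (ennreal a * ennreal b) + ennreal Q1 * (ennreal a * indicator (cball 0 \<rho>1) z) + ennreal Q2 * (ennreal a * indicator (cball 0 \<rho>2) z)"
          if "0 \<le> a" "0 \<le> b" for a b
          using nn that by (auto simp: indicator_def ennreal_mult distrib_left mult_ac)
        from this[of "\<bar>x\<bar>" "1 / (1 + cmod z) ^ 4"] show ?thesis by simp
      qed
      finally show "ennreal (norm (m z * g z)) \<le> ennreal P * (ennreal \<bar>m z\<bar> * ennreal (1 / (1 + cmod z) ^ 4)) + ennreal Q1 * (ennreal \<bar>m z\<bar> * indicator (cball 0 \<rho>1) z)
          + ennreal Q2 * (ennreal \<bar>m z\<bar> * indicator (cball 0 \<rho>2) z)" unfolding x_def .
    qed
    also have "\<dots> = ennreal P * (\<integral>\<^sup>+z. ennreal \<bar>m z\<bar> * ennreal (1 / (1 + cmod z) ^ 4) \<partial>lborel) + ennreal Q1 * (\<integral>\<^sup>+z. ennreal \<bar>m z\<bar> * indicator (cball 0 \<rho>1) z \<partial>lborel)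
          + ennreal Q2 * (\<integral>\<^sup>+z. ennreal \<bar>m z\<bar> * indicator (cball 0 \<rho>2) z \<partial>lborel)"
      by (subst nn_integral_add, measurable)+ (simp add: nn_integral_cmult)
    also have "\<dots> \<le> ennreal P * ennreal Tm + ennreal Q1 * ennreal (Cm * (1 + \<rho>1) ^ 3) + ennreal Q2 * ennreal (Cm * (1 + \<rho>2) ^ 3)"
      by (intro add_mono mult_left_mono Tm Cm nn) auto
    also have "\<dots> = ennreal (P * Tm + Q1 * (Cm * (1 + \<rho>1) ^ 3) + Q2 * (Cm * (1 + \<rho>2) ^ 3))"
    proof -
      have "0 \<le> Cm * (1 + \<rho>1) ^ 3" "0 \<le> Cm * (1 + \<rho>2) ^ 3" using Cm(1) nn by auto
      then show ?thesis using nn Tm(1) by (simp only: ennreal_mult[symmetric] ennreal_plus[symmetric] mult_nonneg_nonneg add_nonneg_nonneg)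
    qed
    finally have b: "(\<integral>\<^sup>+z. ennreal (norm (m z * g z)) \<partial>lborel) \<le> ennreal (P * Tm + Q1 * (Cm * (1 + \<rho>1) ^ 3) + Q2 * (Cm * (1 + \<rho>2) ^ 3))" .
    show int: "integrable lborel (\<lambda>z. m z * g z)"
    proof (rule integrableI_bounded)
      show "(\<integral>\<^sup>+z. ennreal (norm (m z * g z)) \<partial>lborel) < \<infinity>" using b by (rule le_less_trans) simp
    qed measurable
    have "ennreal (norm (\<integral>z. m z * g z \<partial>lborel)) \<le> ennreal (P * Tm + Q1 * (Cm * (1 + \<rho>1) ^ 3) + Q2 * (Cm * (1 + \<rho>2) ^ 3))"
      using integral_norm_bound_ennreal[OF int] b by (rule order_trans)
    moreover have "0 \<le> P * Tm + Q1 * (Cm * (1 + \<rho>1) ^ 3) + Q2 * (Cm * (1 + \<rho>2) ^ 3)"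
      using nn Tm(1) Cm(1) by (intro add_nonneg_nonneg mult_nonneg_nonneg) auto
    ultimately show "\<bar>\<integral>z. m z * g z \<partial>lborel\<bar> \<le> P * Tm + Q1 * (Cm * (1 + \<rho>1) ^ 3) + Q2 * (Cm * (1 + \<rho>2) ^ 3)"
      by (simp add: ennreal_le_iff)
qed

text \<open>The weight is taken at (Im z)^2 instead of |z|^2, so that the integrand separates into a
  horizontal kernel and a vertical weight and Fubini can be applied line by line.\<close>

definition smoothed :: "real \<Rightarrow> real \<Rightarrow> real \<Rightarrow> real" where
  "smoothed \<epsilon> r R = (\<integral>z. m z * (weight r R ((Im z)\<^sup>2) * (kern (Re z / \<epsilon>) / \<epsilon>)) \<partial>lborel)"

text \<open>The Laplacian deviates from the strip average by terms of order (1 + |z|)^(-4), and by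
  edge terms of size O(\<open>\<rho>\<close>^(-3)) on discs of radius 2 \<open>\<rho>\<close>, where
  |M| has mass O(\<open>\<rho>\<close>^3), for \<open>\<rho>\<close> equal to \<open>r\<close> and
  \<open>R\<close>.\<close>

lemma carleman_test_mean:
  assumes r0: "0 < r0"
  obtains C where "0 \<le> C" "\<And>r R \<epsilon> \<eta>. r0 \<le> r \<Longrightarrow> r < R \<Longrightarrow> 0 < \<epsilon> \<Longrightarrow> \<epsilon> \<le> 1 \<Longrightarrow> \<eta> = 1 \<or> \<eta> = -1 \<Longrightarrow>
    \<bar>2 * pi * (\<integral>z. carleman_test \<epsilon> \<eta> r R z \<partial>\<mu>) - smoothed \<epsilon> r R\<bar> \<le> C"
proof -
  obtain CX where CX: "0 \<le> CX" "\<And>r R \<sigma>. r0 \<le> r \<Longrightarrow> r < R \<Longrightarrow> 0 \<le> \<sigma> \<Longrightarrow> \<bar>deriv (weight r R) \<sigma>\<bar> \<le> CX / (1 + \<sigma>)\<^sup>2"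
    using weight_deriv_bound[OF r0] by blast
  obtain C2 where C2: "0 \<le> C2" "\<And>r R z. 0 < r \<Longrightarrow> r < R \<Longrightarrow> \<bar>cutoff2 r R ((cmod z)\<^sup>2)\<bar>
    \<le> C2 / r ^ 4 * indicator (cball 0 (2 * r)) z + C2 / R ^ 4 * indicator (cball 0 (2 * R)) z"
    by (rule cutoff2_bound) (rule that)
  obtain Bk where Bk: "0 < Bk" "\<And>x. kern x \<le> Bk" using kern_bounded by blast
  \<comment> \<open>The leading powers \<open>\<rho>\<close> * \<open>\<rho>\<close>^(-4) *
    \<open>\<rho>\<close>^3 of an edge term cancel; \<open>D\<close> is the value at
    \<open>\<rho> = r0\<close>, where the lower-order terms are largest.\<close>
  define D where "D = 4 * C2 * (2 + 2 / r0) * (Cm * (2 + 1 / r0) ^ 3)"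
  \<comment> \<open>64 = 4 * 4 * 4: the factor 4 of the Laplacian, the bound 4 for the ramp, and (1
    + |z|)^4 \<open>\<le>\<close> 4 (1 + |z|^2)^2. 400 = 4 * 100: (Re z)^2 \<open>\<le>\<close> 4
    \<open>\<epsilon>\<close>^2 and, in the strip, (1 + |z|)^4 \<open>\<le>\<close> 100 (1 + (Im
    z)^2)^2. Each edge adds one \<open>D\<close>.\<close>
  define C where "C = (64 * CX + 400 * CX * Bk) * Tm + 2 * D"
  have D: "0 \<le> D" using C2 Cm(1) r0 by (simp add: D_def)
  have C: "0 \<le> C" using CX Bk Tm(1) D by (simp add: C_def)
  have edge: "4 * (2 * \<rho> + 2) * (C2 / \<rho> ^ 4) * (Cm * (1 + 2 * \<rho>) ^ 3) \<le> D" if "r0 \<le> \<rho>" for \<rho>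
  proof -
    have \<rho>: "0 < \<rho>" using that r0 by simp
    have "4 * (2 * \<rho> + 2) * (C2 / \<rho> ^ 4) * (Cm * (1 + 2 * \<rho>) ^ 3) = 4 * C2 * ((2 * \<rho> + 2) / \<rho>) * (Cm * ((1 + 2 * \<rho>) / \<rho>) ^ 3)"
      using \<rho> by (simp add: power_divide field_simps power4_eq_xxxx power3_eq_cube)
    also have "(2 * \<rho> + 2) / \<rho> = 2 + 2 / \<rho>" using \<rho> by (simp add: field_simps)
    also have "(1 + 2 * \<rho>) / \<rho> = 2 + 1 / \<rho>" using \<rho> by (simp add: field_simps)
    also have "4 * C2 * (2 + 2 / \<rho>) * (Cm * (2 + 1 / \<rho>) ^ 3) \<le> D"
    proof -
      have "2 / \<rho> \<le> 2 / r0" "1 / \<rho> \<le> 1 / r0" using that r0 \<rho> by (auto intro!: divide_left_mono)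
      then show ?thesis unfolding D_def using C2(1) Cm(1) \<rho> r0
        by (intro mult_mono power_mono add_mono order_refl) auto
    qed
    finally show ?thesis .
  qed
  have "\<bar>2 * pi * (\<integral>z. carleman_test \<epsilon> \<eta> r R z \<partial>\<mu>) - smoothed \<epsilon> r R\<bar> \<le> C"
    if rR0: "r0 \<le> r" "r < R" and \<epsilon>: "0 < \<epsilon>" "\<epsilon> \<le> 1" and \<eta>: "\<eta> = 1 \<or> \<eta> = -1" for r R \<epsilon> \<eta>
  proof -
    have rR: "0 < r" "r < R" using rR0 r0 by auto
    define g where "g z = laplacian (carleman_test \<epsilon> \<eta> r R) z - weight r R ((Im z)\<^sup>2) * (kern (Re z / \<epsilon>) / \<epsilon>)" for z
    define g0 where "g0 z = weight r R ((Im z)\<^sup>2) * (kern (Re z / \<epsilon>) / \<epsilon>)" for z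
    have sp: "smooth_plane (carleman_test \<epsilon> \<eta> r R)" by (rule smooth_carleman_test[OF rR])
    have "smooth_plane (dder 1 (dder 1 (carleman_test \<epsilon> \<eta> r R)))" "smooth_plane (dder \<i> (dder \<i> (carleman_test \<epsilon> \<eta> r R)))"
      by (intro smooth_plane_dder sp)+
    then have "continuous_on UNIV (laplacian (carleman_test \<epsilon> \<eta> r R))"
      unfolding laplacian_def[abs_def] by (intro continuous_on_add smooth_plane_continuous)
    then have [measurable]: "laplacian (carleman_test \<epsilon> \<eta> r R) \<in> borel_measurable borel"
      by (rule borel_measurable_continuous_onI)
    have wm[measurable]: "weight r R \<in> borel_measurable borel" by (rule measurable_weight[OF rR])
    have gm[measurable]: "g \<in> borel_measurable borel" "g0 \<in> borel_measurable borel" unfolding g_def g0_def by measurable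
    have vanish: "carleman_test \<epsilon> \<eta> r R z = 0" if "2 * R < cmod z" for z
    proof -
      have "(2 * R)\<^sup>2 \<le> (cmod z)\<^sup>2" using that rR by (intro power_mono) auto
      then show ?thesis using weight_eq_0[OF rR, of "(cmod z)\<^sup>2"] by (simp add: carleman_test_def power_mult_distrib)
    qed
    have tf: "test_fun (carleman_test \<epsilon> \<eta> r R)" by (rule smooth_plane_test_fun[OF sp vanish])
    have bound: "\<bar>g z\<bar> \<le> (64 * CX + 400 * CX * Bk) / (1 + cmod z) ^ 4
        + 4 * (2 * r + 2) * (C2 / r ^ 4) * indicator (cball 0 (2 * r)) z + 4 * (2 * R + 2) * (C2 / R ^ 4) * indicator (cball 0 (2 * R)) z" for z
    proof -
      define \<sigma> where "\<sigma> = (cmod z)\<^sup>2"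
      define u where "u = \<eta> * Re z / \<epsilon>"
      have \<sigma>0: "0 \<le> \<sigma>" by (simp add: \<sigma>_def)
      have \<sigma>4: "(1 + cmod z) ^ 4 \<le> 4 * (1 + \<sigma>)\<^sup>2" unfolding \<sigma>_def by (rule one_plus_square_le) simp
      have pos4: "0 < (1 + cmod z) ^ 4" by (intro zero_less_power) (simp add: add_pos_nonneg)
      have a1: "\<bar>4 * deriv (weight r R) \<sigma> * (\<epsilon> * (u * ramp1 u - ramp u))\<bar> \<le> 64 * CX / (1 + cmod z) ^ 4"
      proof -
        have "\<bar>4 * deriv (weight r R) \<sigma> * (\<epsilon> * (u * ramp1 u - ramp u))\<bar> = 4 * \<bar>deriv (weight r R) \<sigma>\<bar> * (\<epsilon> * \<bar>u * ramp1 u - ramp u\<bar>)"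
          using \<epsilon> by (simp add: abs_mult)
        also have "\<dots> \<le> 4 * (CX / (1 + \<sigma>)\<^sup>2) * (1 * 4)"
          using CX(2)[OF rR0 \<sigma>0] ramp(5)[of u] \<epsilon> CX(1) by (intro mult_mono) auto
        also have "\<dots> \<le> 64 * CX / (1 + cmod z) ^ 4"
        proof -
          have p: "0 < (1 + \<sigma>)\<^sup>2" using \<sigma>0 by simp
          have "16 * CX * (1 + cmod z) ^ 4 \<le> 16 * CX * (4 * (1 + \<sigma>)\<^sup>2)" using \<sigma>4 CX(1) by (intro mult_left_mono) auto
          then have "16 * CX / (1 + \<sigma>)\<^sup>2 \<le> 64 * CX / (1 + cmod z) ^ 4"
            using p pos4 by (auto simp: divide_simps mult_ac)
          then show ?thesis by simp
        qed
        finally show ?thesis .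
      qed
      \<comment> \<open>The ramp grows linearly, so its rescaled version is at most |z| + 2 for all
        \<open>\<epsilon> \<le> 1\<close>.\<close>
      have a2: "\<bar>4 * (\<epsilon> * ramp u) * cutoff2 r R \<sigma>\<bar> \<le> 4 * (2 * r + 2) * (C2 / r ^ 4) * indicator (cball 0 (2 * r)) z + 4 * (2 * R + 2) * (C2 / R ^ 4) * indicator (cball 0 (2 * R)) z"
      proof -
        have "\<bar>ramp u\<bar> \<le> \<bar>u\<bar> + 2" using ramp(4)[of u] by linarith
        then have "\<epsilon> * \<bar>ramp u\<bar> \<le> \<epsilon> * (\<bar>u\<bar> + 2)" using \<epsilon> by (intro mult_left_mono) auto
        also have "\<dots> = \<bar>Re z\<bar> + 2 * \<epsilon>" using \<epsilon> \<eta> by (auto simp: u_def abs_mult distrib_left)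
        also have "\<dots> \<le> cmod z + 2" using abs_Re_le_cmod[of z] \<epsilon> by linarith
        finally have e: "\<epsilon> * \<bar>ramp u\<bar> \<le> cmod z + 2" .
        have "\<bar>4 * (\<epsilon> * ramp u) * cutoff2 r R \<sigma>\<bar> = 4 * (\<epsilon> * \<bar>ramp u\<bar>) * \<bar>cutoff2 r R \<sigma>\<bar>" using \<epsilon> by (simp add: abs_mult)
        also have "\<dots> \<le> 4 * (cmod z + 2) * (C2 / r ^ 4 * indicator (cball 0 (2 * r)) z + C2 / R ^ 4 * indicator (cball 0 (2 * R)) z)"
          using e C2(2)[OF rR, of z] \<epsilon> unfolding \<sigma>_def by (intro mult_mono) auto
        also have "\<dots> = 4 * (cmod z + 2) * (C2 / r ^ 4 * indicator (cball 0 (2 * r)) z) + 4 * (cmod z + 2) * (C2 / R ^ 4 * indicator (cball 0 (2 * R)) z)"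
          by (rule distrib_left)
        also have "\<dots> \<le> 4 * (2 * r + 2) * (C2 / r ^ 4 * indicator (cball 0 (2 * r)) z) + 4 * (2 * R + 2) * (C2 / R ^ 4 * indicator (cball 0 (2 * R)) z)"
        proof (rule add_mono)
          have *: "4 * (cmod z + 2) * (C2 / \<rho> ^ 4 * indicator (cball 0 (2 * \<rho>)) z) \<le> 4 * (2 * \<rho> + 2) * (C2 / \<rho> ^ 4 * indicator (cball 0 (2 * \<rho>)) z)" for \<rho> :: real
          proof (cases "z \<in> cball 0 (2 * \<rho>)")
            case True
            then show ?thesis using C2(1) by (intro mult_right_mono) auto
          qed simp
          show "4 * (cmod z + 2) * (C2 / r ^ 4 * indicator (cball 0 (2 * r)) z) \<le> 4 * (2 * r + 2) * (C2 / r ^ 4 * indicator (cball 0 (2 * r)) z)" by (rule *)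
          show "4 * (cmod z + 2) * (C2 / R ^ 4 * indicator (cball 0 (2 * R)) z) \<le> 4 * (2 * R + 2) * (C2 / R ^ 4 * indicator (cball 0 (2 * R)) z)" by (rule *)
        qed
        finally show ?thesis by (simp add: mult.assoc)
      qed
      \<comment> \<open>By the mean value theorem, moving the weight from |z|^2 to (Im z)^2 costs a
        factor (Re z)^2 = O(\<open>\<epsilon>\<close>^2), which absorbs the
        1/\<open>\<epsilon>\<close> of the kernel.\<close>
      have a3: "\<bar>(weight r R \<sigma> - weight r R ((Im z)\<^sup>2)) * (kern (Re z / \<epsilon>) / \<epsilon>)\<bar> \<le> 400 * CX * Bk / (1 + cmod z) ^ 4"
      proof (cases "\<bar>Re z\<bar> < 2 * \<epsilon>")
        case False
        then have "kern (Re z / \<epsilon>) = 0" using \<epsilon> by (intro kern_eq_0) (simp add: field_simps)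
        then show ?thesis using CX Bk by simp
      next
        case True
        define y where "y = (Im z)\<^sup>2"
        define x where "x = (Re z)\<^sup>2"
        have y0: "0 \<le> y" and x0: "0 \<le> x" by (simp_all add: x_def y_def)
        have \<sigma>xy: "\<sigma> = x + y" unfolding \<sigma>_def x_def y_def by (rule cmod_power2)
        have x4: "x \<le> 4 * \<epsilon>\<^sup>2"
        proof -
          have "\<bar>Re z\<bar>\<^sup>2 \<le> (2 * \<epsilon>)\<^sup>2" using True by (intro power_mono) auto
          then show ?thesis by (simp add: x_def power_mult_distrib)
        qed
        have d: "\<bar>weight r R \<sigma> - weight r R y\<bar> \<le> x * (CX / (1 + y)\<^sup>2)"
        proof (cases "x = 0")
          case False
          then have "y < \<sigma>" using x0 \<sigma>xy by simp
          from MVT2[OF this, of "weight r R" "deriv (weight r R)"] weight_deriv(1)[OF rR]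
          obtain \<xi> where \<xi>: "y < \<xi>" "\<xi> < \<sigma>" "weight r R \<sigma> - weight r R y = (\<sigma> - y) * deriv (weight r R) \<xi>" by blast
          have "\<bar>deriv (weight r R) \<xi>\<bar> \<le> CX / (1 + \<xi>)\<^sup>2" using CX(2)[OF rR0, of \<xi>] \<xi> y0 by simp
          also have "\<dots> \<le> CX / (1 + y)\<^sup>2" using CX(1) \<xi> y0 by (intro divide_left_mono power_mono) auto
          finally have "x * \<bar>deriv (weight r R) \<xi>\<bar> \<le> x * (CX / (1 + y)\<^sup>2)" using x0 by (intro mult_left_mono)
          then show ?thesis unfolding \<xi>(3) abs_mult using \<sigma>xy x0 by simp
        qed (simp add: \<sigma>xy)
        have \<epsilon>2: "\<epsilon>\<^sup>2 \<le> 1" using \<epsilon> by (simp add: power_le_one)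
        have "4 * \<epsilon>\<^sup>2 \<le> 4 * 1" by (intro mult_left_mono \<epsilon>2) simp
        then have "x \<le> 4" using x4 by simp
        then have "1 + \<sigma> \<le> 5 * (1 + y)" using \<sigma>xy y0 by simp
        then have "(1 + \<sigma>)\<^sup>2 \<le> (5 * (1 + y))\<^sup>2" using \<sigma>0 by (intro power_mono) auto
        moreover have "(5 * (1 + y))\<^sup>2 = 25 * (1 + y)\<^sup>2" by (simp only: power_mult_distrib) simp
        ultimately have z100: "(1 + cmod z) ^ 4 \<le> 100 * (1 + y)\<^sup>2" using \<sigma>4 by linarith
        have "\<bar>(weight r R \<sigma> - weight r R y) * (kern (Re z / \<epsilon>) / \<epsilon>)\<bar> = \<bar>weight r R \<sigma> - weight r R y\<bar> * (kern (Re z / \<epsilon>) / \<epsilon>)"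
          using \<epsilon> kern_nonneg by (simp add: abs_mult)
        also have "\<dots> \<le> (4 * \<epsilon>\<^sup>2 * (CX / (1 + y)\<^sup>2)) * (Bk / \<epsilon>)"
        proof (rule mult_mono)
          show "\<bar>weight r R \<sigma> - weight r R y\<bar> \<le> 4 * \<epsilon>\<^sup>2 * (CX / (1 + y)\<^sup>2)"
            using d x4 CX(1) by (meson order_trans mult_right_mono divide_nonneg_nonneg zero_le_power2)
          show "kern (Re z / \<epsilon>) / \<epsilon> \<le> Bk / \<epsilon>" using Bk \<epsilon> by (intro divide_right_mono) auto
        qed (use \<epsilon> kern_nonneg CX(1) in auto)
        also have "\<dots> = 4 * CX * Bk / (1 + y)\<^sup>2 * \<epsilon>" using \<epsilon> by (simp add: power2_eq_square)
        also have "\<dots> \<le> 4 * CX * Bk / (1 + y)\<^sup>2 * 1" using \<epsilon> CX Bk by (intro mult_left_mono) auto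
        also have "\<dots> \<le> 400 * CX * Bk / (1 + cmod z) ^ 4"
        proof -
          have p: "0 < (1 + y)\<^sup>2" using y0 by simp
          have "4 * CX * Bk * (1 + cmod z) ^ 4 \<le> 4 * CX * Bk * (100 * (1 + y)\<^sup>2)" using z100 CX(1) Bk by (intro mult_left_mono) auto
          then show ?thesis using p pos4 by (auto simp: divide_simps mult_ac)
        qed
        finally show ?thesis by (simp add: y_def)
      qed
      have "g z = 4 * deriv (weight r R) \<sigma> * (\<epsilon> * (u * ramp1 u - ramp u)) + 4 * (\<epsilon> * ramp u) * cutoff2 r R \<sigma>
        + (weight r R \<sigma> - weight r R ((Im z)\<^sup>2)) * (kern (Re z / \<epsilon>) / \<epsilon>)"
        unfolding g_def laplacian_carleman_test[OF rR \<epsilon>(1) \<eta>] \<sigma>_def u_def by (simp add: algebra_simps)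
      then have "\<bar>g z\<bar> \<le> \<bar>4 * deriv (weight r R) \<sigma> * (\<epsilon> * (u * ramp1 u - ramp u))\<bar> + \<bar>4 * (\<epsilon> * ramp u) * cutoff2 r R \<sigma>\<bar>
        + \<bar>(weight r R \<sigma> - weight r R ((Im z)\<^sup>2)) * (kern (Re z / \<epsilon>) / \<epsilon>)\<bar>" by linarith
      then show ?thesis using a1 a2 a3 unfolding add_divide_distrib by linarith
    qed
    have nnQ: "0 \<le> 4 * (2 * \<rho> + 2) * (C2 / \<rho> ^ 4)" if "0 < \<rho>" for \<rho> using that C2(1) by simp
    have G: "integrable lborel (\<lambda>z. m z * g z)" "\<bar>\<integral>z. m z * g z \<partial>lborel\<bar> \<le> (64 * CX + 400 * CX * Bk) * Tm
        + 4 * (2 * r + 2) * (C2 / r ^ 4) * (Cm * (1 + 2 * r) ^ 3) + 4 * (2 * R + 2) * (C2 / R ^ 4) * (Cm * (1 + 2 * R) ^ 3)"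
      using CX(1) Bk rR by (intro m_error[OF gm(1) _ nnQ nnQ _ _ bound]; simp)+
    have G0: "integrable lborel (\<lambda>z. m z * g0 z)"
    proof (rule m_times_bounded(1)[OF gm(2)])
      show "\<bar>g0 z\<bar> \<le> 1 / r\<^sup>2 * (Bk / \<epsilon>)" for z
      proof -
        have "weight r R ((Im z)\<^sup>2) \<le> 1 / r\<^sup>2"
        proof (cases "(Im z)\<^sup>2 \<le> r\<^sup>2")
          case False
          have "0 < r\<^sup>2" using rR by simp
          moreover from this have "0 < (Im z)\<^sup>2" using False by linarith
          ultimately have "1 / (Im z)\<^sup>2 \<le> 1 / r\<^sup>2" using False by (intro divide_left_mono mult_pos_pos) auto
          then show ?thesis using weight_le[OF rR, of "(Im z)\<^sup>2"] by simp
        qed (use weight_eq_0[OF rR] in auto)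
        moreover have "kern (Re z / \<epsilon>) / \<epsilon> \<le> Bk / \<epsilon>" using Bk \<epsilon> by (intro divide_right_mono) auto
        ultimately have "weight r R ((Im z)\<^sup>2) * (kern (Re z / \<epsilon>) / \<epsilon>) \<le> 1 / r\<^sup>2 * (Bk / \<epsilon>)"
          using kern_nonneg weight_nonneg[OF rR] \<epsilon> by (intro mult_mono) auto
        then show ?thesis using kern_nonneg weight_nonneg[OF rR] \<epsilon> by (simp add: g0_def)
      qed
      show "g0 z = 0" if "2 * R + 2 < cmod z" for z
      proof (cases "\<bar>Re z\<bar> < 2")
        case True
        then have "2 * R \<le> \<bar>Im z\<bar>" using that cmod_le[of z] by linarith
        then have "(2 * R)\<^sup>2 \<le> \<bar>Im z\<bar>\<^sup>2" using rR by (intro power_mono) auto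
        then show ?thesis using weight_eq_0[OF rR, of "(Im z)\<^sup>2"] by (simp add: g0_def power_mult_distrib)
      next
        case False
        then have "2 \<le> \<bar>Re z / \<epsilon>\<bar>" using \<epsilon> by (simp add: field_simps)
        then show ?thesis using kern_eq_0 by (simp add: g0_def)
      qed
    qed (use rR in simp)
    have "2 * pi * (\<integral>z. carleman_test \<epsilon> \<eta> r R z \<partial>\<mu>) = (\<integral>z. m z * laplacian (carleman_test \<epsilon> \<eta> r R) z \<partial>lborel)"
      by (rule riesz_identity[OF tf, symmetric])
    also have "\<dots> = (\<integral>z. m z * g z + m z * g0 z \<partial>lborel)"
      by (intro Bochner_Integration.integral_cong) (auto simp: g_def g0_def algebra_simps)
    also have "\<dots> = (\<integral>z. m z * g z \<partial>lborel) + smoothed \<epsilon> r R"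
      using G G0 by (simp add: smoothed_def g0_def)
    finally have "\<bar>2 * pi * (\<integral>z. carleman_test \<epsilon> \<eta> r R z \<partial>\<mu>) - smoothed \<epsilon> r R\<bar> = \<bar>\<integral>z. m z * g z \<partial>lborel\<bar>" by simp
    also have "\<dots> \<le> (64 * CX + 400 * CX * Bk) * Tm + D + D"
      using G edge[of r] edge[of R] rR0 by linarith
    finally show ?thesis by (simp add: C_def)
  qed
  with C show thesis by (rule that)
qed

text \<open>The smoothed positive part is off by a bounded amount, and the weight O(|z|^(-2)) is
  integrable against \<open>\<mu>\<close>. Replacing the smooth cutoff by the sharp annulus costs
  1/\<open>\<rho>\<close> on a disc of mass O(\<open>\<rho>\<close>) at each edge.\<close>

lemma carleman_test_half_mass:
  assumes r0: "0 < r0"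
  obtains C where "0 \<le> C" "\<And>r R \<epsilon> \<eta>. r0 \<le> r \<Longrightarrow> r < R \<Longrightarrow> 0 < \<epsilon> \<Longrightarrow> \<epsilon> \<le> 1 \<Longrightarrow> \<eta> = 1 \<or> \<eta> = -1 \<Longrightarrow>
    \<bar>(\<integral>z. carleman_test \<epsilon> \<eta> r R z \<partial>\<mu>) - half_mass \<mu> \<eta> r R\<bar> \<le> C"
proof -
  obtain T where T: "0 \<le> T" "(\<integral>\<^sup>+z. ennreal (1 / (1 + cmod z)\<^sup>2) \<partial>\<mu>) \<le> ennreal T" using tail_mu by blast
  define \<kappa> where "\<kappa> = (1 + 1 / r0)\<^sup>2"
  define D where "D = Cmu * (2 + 1 / r0)"
  define C where "C = 2 * \<kappa> * T + 2 * D"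
  have C: "0 \<le> C" using T(1) Cmu(1) r0 by (simp add: C_def \<kappa>_def D_def)
  have "\<bar>(\<integral>z. carleman_test \<epsilon> \<eta> r R z \<partial>\<mu>) - half_mass \<mu> \<eta> r R\<bar> \<le> C"
    if rR0: "r0 \<le> r" "r < R" and \<epsilon>: "0 < \<epsilon>" "\<epsilon> \<le> 1" and \<eta>: "\<eta> = 1 \<or> \<eta> = -1" for r R \<epsilon> \<eta>
  proof -
    have rR: "0 < r" "r < R" using rR0 r0 by auto
    define h where "h z = indicator {z. r < cmod z \<and> cmod z \<le> R \<and> 0 < \<eta> * Re z} z * (\<eta> * Re z / (cmod z)\<^sup>2)" for z
    define f where "f = carleman_test \<epsilon> \<eta> r R"
    have sp: "smooth_plane f" unfolding f_def by (rule smooth_carleman_test[OF rR])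
    have fm[measurable]: "f \<in> borel_measurable borel"
      using smooth_plane_continuous[OF sp] by (rule borel_measurable_continuous_onI)
    have hm[measurable]: "h \<in> borel_measurable borel" unfolding h_def by measurable
    have bound: "\<bar>f z - h z\<bar> \<le> 2 * \<kappa> * (1 / (1 + cmod z)\<^sup>2) + 1 / r * indicator (cball 0 (2 * r)) z + 1 / R * indicator (cball 0 (2 * R)) z" for z
    proof (cases "cmod z \<le> r")
      case True
      have "(cmod z)\<^sup>2 \<le> r\<^sup>2" using True by (intro power_mono) auto
      then have "f z = 0" using weight_eq_0[OF rR, of "(cmod z)\<^sup>2"] by (simp add: f_def carleman_test_def)
      moreover have "h z = 0" using True by (simp add: h_def)
      ultimately show ?thesis using rR by (simp add: \<kappa>_def)
    next
      case False
      then have z: "r < cmod z" "0 < cmod z" using rR by auto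
      define \<sigma> where "\<sigma> = (cmod z)\<^sup>2"
      define u where "u = \<eta> * Re z"
      define p where "p = max u 0"
      have \<sigma>: "0 < \<sigma>" using z by (simp add: \<sigma>_def)
      have w: "0 \<le> weight r R \<sigma>" "weight r R \<sigma> \<le> 1 / \<sigma>" using weight_nonneg[OF rR] weight_le[OF rR] \<sigma> by auto
      have rp: "\<bar>\<epsilon> * ramp (u / \<epsilon>) - p\<bar> \<le> 2"
      proof -
        have "p = \<epsilon> * max (u / \<epsilon>) 0" using \<epsilon> by (auto simp: p_def max_def field_simps)
        then have "\<bar>\<epsilon> * ramp (u / \<epsilon>) - p\<bar> = \<epsilon> * \<bar>ramp (u / \<epsilon>) - max (u / \<epsilon>) 0\<bar>"
          using \<epsilon> by (simp add: right_diff_distrib[symmetric] abs_mult)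
        also have "\<dots> \<le> 1 * 2" using \<epsilon> ramp(4) by (intro mult_mono) auto
        finally show ?thesis by simp
      qed
      have k: "1 / \<sigma> \<le> \<kappa> * (1 / (1 + cmod z)\<^sup>2)"
      proof -
        have "1 \<le> cmod z / r0" using z rR0 r0 by (simp add: field_simps)
        then have "1 + cmod z \<le> (1 + 1 / r0) * cmod z" by (simp add: field_simps)
        then have "(1 + cmod z)\<^sup>2 \<le> ((1 + 1 / r0) * cmod z)\<^sup>2" by (intro power_mono) auto
        then have le: "(1 + cmod z)\<^sup>2 \<le> \<kappa> * \<sigma>" by (simp add: \<kappa>_def \<sigma>_def power_mult_distrib)
        have "0 < 1 + cmod z" using z by linarith
        then have pz: "0 < (1 + cmod z)\<^sup>2" by simp
        show ?thesis using le \<sigma> pz by (simp add: field_simps)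
      qed
      have 1: "\<bar>f z - weight r R \<sigma> * p\<bar> \<le> 2 * \<kappa> * (1 / (1 + cmod z)\<^sup>2)"
      proof -
        have "\<bar>f z - weight r R \<sigma> * p\<bar> = weight r R \<sigma> * \<bar>\<epsilon> * ramp (u / \<epsilon>) - p\<bar>"
          using w by (simp add: f_def carleman_test_def \<sigma>_def u_def right_diff_distrib[symmetric] abs_mult)
        also have "\<dots> \<le> (\<kappa> * (1 / (1 + cmod z)\<^sup>2)) * 2" using w k rp by (intro mult_mono) auto
        finally show ?thesis by (simp add: mult_ac)
      qed
      have pz: "0 \<le> p" "p \<le> cmod z"
        using \<eta> abs_Re_le_cmod[of z] by (auto simp: p_def u_def)
      have hz: "h z = p / \<sigma> * indicator {..R} (cmod z)"
        using z by (auto simp: h_def p_def u_def \<sigma>_def indicator_def max_def)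
      have "weight r R \<sigma> * p - h z = p / \<sigma> * (cutoff r R \<sigma> - indicator {..R} (cmod z))"
        by (simp add: hz weight_def algebra_simps)
      then have eq: "\<bar>weight r R \<sigma> * p - h z\<bar> = p / \<sigma> * \<bar>cutoff r R \<sigma> - indicator {..R} (cmod z)\<bar>"
        using pz \<sigma> by (simp add: abs_mult)
      have p\<sigma>: "p / \<sigma> \<le> 1 / cmod z" using pz z by (simp add: \<sigma>_def power2_eq_square field_simps)
      have 2: "\<bar>weight r R \<sigma> * p - h z\<bar> \<le> 1 / r * indicator (cball 0 (2 * r)) z + 1 / R * indicator (cball 0 (2 * R)) z"
      proof -
        \<comment> \<open>In the first case the annulus may already have ended when R < 2 r; only
          the difference of cutoff and indicator being at most 1 is used there.\<close>
        consider "cmod z \<le> 2 * r" | "2 * r < cmod z" "cmod z \<le> R" | "2 * r < cmod z" "R < cmod z" "cmod z \<le> 2 * R" | "2 * R < cmod z" by linarith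
        then show ?thesis
        proof cases
          case 1
          have "p / \<sigma> * \<bar>cutoff r R \<sigma> - indicator {..R} (cmod z)\<bar> \<le> 1 / r * 1"
          proof (rule mult_mono)
            have "1 / cmod z \<le> 1 / r" using z rR by (intro divide_left_mono) auto
            then show "p / \<sigma> \<le> 1 / r" using p\<sigma> by simp
            show "\<bar>cutoff r R \<sigma> - indicator {..R} (cmod z)\<bar> \<le> 1"
              using cutoff_bounds[OF rR, of \<sigma>] by (auto simp: indicator_def)
          qed (use rR in auto)
          then show ?thesis using 1 rR unfolding eq by (simp add: add_increasing2)
        next
          case 2
          have "(2 * r)\<^sup>2 \<le> (cmod z)\<^sup>2" using 2 rR by (intro power_mono) auto
          moreover have "(cmod z)\<^sup>2 \<le> R\<^sup>2" using 2 rR by (intro power_mono) auto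
          moreover have "(2 * r)\<^sup>2 = 4 * r\<^sup>2" by (simp add: power_mult_distrib)
          ultimately have "cutoff r R \<sigma> = 1" unfolding \<sigma>_def by (intro cutoff_eq_1[OF rR]) (simp_all only:)
          then show ?thesis using 2 rR unfolding eq by simp
        next
          case 3
          have "p / \<sigma> * \<bar>cutoff r R \<sigma> - indicator {..R} (cmod z)\<bar> \<le> 1 / R * 1"
          proof (rule mult_mono)
            have "1 / cmod z \<le> 1 / R" using 3 rR z by (intro divide_left_mono) auto
            then show "p / \<sigma> \<le> 1 / R" using p\<sigma> by simp
            show "\<bar>cutoff r R \<sigma> - indicator {..R} (cmod z)\<bar> \<le> 1"
              using cutoff_bounds[OF rR, of \<sigma>] by (auto simp: indicator_def)
          qed (use rR in auto)
          then show ?thesis using 3 rR unfolding eq by (simp add: add_increasing)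
        next
          case 4
          have "(2 * R)\<^sup>2 \<le> (cmod z)\<^sup>2" using 4 rR by (intro power_mono) auto
          moreover have "(2 * R)\<^sup>2 = 4 * R\<^sup>2" by (simp add: power_mult_distrib)
          ultimately have "cutoff r R \<sigma> = 0" unfolding \<sigma>_def by (intro cutoff_eq_0[OF rR] disjI2) (simp only:)
          then show ?thesis using 4 rR unfolding eq by simp
        qed
      qed
      have "\<bar>f z - h z\<bar> \<le> \<bar>f z - weight r R \<sigma> * p\<bar> + \<bar>weight r R \<sigma> * p - h z\<bar>" by linarith
      then show ?thesis using 1 2 by linarith
    qed
    have nnle: "(\<integral>\<^sup>+z. ennreal \<bar>f z - h z\<bar> \<partial>\<mu>) \<le> ennreal C"
    proof -
      have "(\<integral>\<^sup>+z. ennreal \<bar>f z - h z\<bar> \<partial>\<mu>) \<le> (\<integral>\<^sup>+z. ennreal (2 * \<kappa>) * ennreal (1 / (1 + cmod z)\<^sup>2)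
          + ennreal (1 / r) * indicator (cball 0 (2 * r)) z + ennreal (1 / R) * indicator (cball 0 (2 * R)) z \<partial>\<mu>)"
      proof (intro nn_integral_mono)
        fix z
        have "ennreal \<bar>f z - h z\<bar> \<le> ennreal (2 * \<kappa> * (1 / (1 + cmod z)\<^sup>2) + 1 / r * indicator (cball 0 (2 * r)) z + 1 / R * indicator (cball 0 (2 * R)) z)"
          by (rule ennreal_leI[OF bound])
        also have "\<dots> = ennreal (2 * \<kappa>) * ennreal (1 / (1 + cmod z)\<^sup>2)
          + ennreal (1 / r) * indicator (cball 0 (2 * r)) z + ennreal (1 / R) * indicator (cball 0 (2 * R)) z"
        proof -
          have gen: "ennreal (a * b + c * indicator A z + d * indicator B z) = ennreal a * ennreal b + ennreal c * indicator A z + ennreal d * indicator B z"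
            if "0 \<le> a" "0 \<le> b" "0 \<le> c" "0 \<le> d" for a b c d and A B :: "complex set"
            using that by (auto simp: indicator_def ennreal_mult)
          show ?thesis by (rule gen) (use rR in \<open>auto simp: \<kappa>_def\<close>)
        qed
        finally show "ennreal \<bar>f z - h z\<bar> \<le> ennreal (2 * \<kappa>) * ennreal (1 / (1 + cmod z)\<^sup>2)
          + ennreal (1 / r) * indicator (cball 0 (2 * r)) z + ennreal (1 / R) * indicator (cball 0 (2 * R)) z" .
      qed
      also have "\<dots> = ennreal (2 * \<kappa>) * (\<integral>\<^sup>+z. ennreal (1 / (1 + cmod z)\<^sup>2) \<partial>\<mu>)
          + ennreal (1 / r) * emeasure \<mu> (cball 0 (2 * r)) + ennreal (1 / R) * emeasure \<mu> (cball 0 (2 * R))"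
        by (subst nn_integral_add, measurable)+ (simp add: nn_integral_cmult nn_integral_cmult_indicator)
      also have "\<dots> \<le> ennreal (2 * \<kappa>) * ennreal T + ennreal (1 / r) * ennreal (Cmu * (1 + 2 * r)) + ennreal (1 / R) * ennreal (Cmu * (1 + 2 * R))"
        using rR by (intro add_mono mult_left_mono T Cmu) auto
      also have "\<dots> = ennreal (2 * \<kappa> * T + 1 / r * (Cmu * (1 + 2 * r)) + 1 / R * (Cmu * (1 + 2 * R)))"
      proof -
        have "ennreal a * ennreal b + ennreal c * ennreal d + ennreal e * ennreal k = ennreal (a * b + c * d + e * k)"
          if "0 \<le> a" "0 \<le> b" "0 \<le> c" "0 \<le> d" "0 \<le> e" "0 \<le> k" for a b c d e k using that by (simp add: ennreal_mult)
        moreover have "0 \<le> 2 * \<kappa>" "0 \<le> 1 / r" "0 \<le> 1 / R" "0 \<le> Cmu * (1 + 2 * r)" "0 \<le> Cmu * (1 + 2 * R)"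
          using rR Cmu(1) by (auto simp: \<kappa>_def)
        ultimately show ?thesis using T(1) by blast
      qed
      also have "\<dots> \<le> ennreal C"
      proof (intro ennreal_leI)
        have "1 / \<rho> * (Cmu * (1 + 2 * \<rho>)) \<le> D" if "r0 \<le> \<rho>" for \<rho>
        proof -
          have \<rho>: "0 < \<rho>" using that r0 by simp
          have "1 / \<rho> \<le> 1 / r0" using that r0 by (intro divide_left_mono) auto
          have "1 / \<rho> * (Cmu * (1 + 2 * \<rho>)) = Cmu * (2 + 1 / \<rho>)" using \<rho> by (simp add: field_simps)
          also have "\<dots> \<le> D" unfolding D_def using Cmu(1) \<open>1 / \<rho> \<le> 1 / r0\<close> by (intro mult_left_mono) auto
          finally show ?thesis .
        qed
        from this[of r] this[of R] rR0
        show "2 * \<kappa> * T + 1 / r * (Cmu * (1 + 2 * r)) + 1 / R * (Cmu * (1 + 2 * R)) \<le> C" by (simp add: C_def)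
      qed
      finally show ?thesis .
    qed
    have int: "integrable \<mu> (\<lambda>z. f z - h z)"
    proof (rule integrableI_bounded)
      show "(\<integral>\<^sup>+z. ennreal (norm (f z - h z)) \<partial>\<mu>) < \<infinity>" using nnle by (simp add: le_less_trans)
    qed measurable
    have hi: "integrable \<mu> h"
    proof (rule integrable_compact_support_mu[OF hm])
      show "\<bar>h z\<bar> \<le> 1 / r" for z
      proof (cases "r < cmod z")
        case True
        then have z: "0 < cmod z" using rR by linarith
        have "\<bar>\<eta> * Re z / (cmod z)\<^sup>2\<bar> \<le> cmod z / (cmod z)\<^sup>2"
          using \<eta> abs_Re_le_cmod[of z] by (auto simp: abs_mult intro!: divide_right_mono)
        also have "\<dots> = 1 / cmod z" using z by (simp add: power2_eq_square)
        also have "\<dots> \<le> 1 / r" using True rR z by (intro divide_left_mono) auto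
        finally show ?thesis using rR by (auto simp: h_def indicator_def)
      qed (use rR in \<open>simp add: h_def\<close>)
      show "h z = 0" if "R < cmod z" for z using that by (simp add: h_def)
    qed
    have fi: "integrable \<mu> f" using Bochner_Integration.integrable_add[OF int hi] by simp
    have "(\<integral>z. f z \<partial>\<mu>) - half_mass \<mu> \<eta> r R = (\<integral>z. f z - h z \<partial>\<mu>)"
      unfolding half_mass_def h_def[symmetric] using fi hi by simp
    moreover have "ennreal (norm (\<integral>z. f z - h z \<partial>\<mu>)) \<le> ennreal C"
      using integral_norm_bound_ennreal[OF int] nnle by simp
    ultimately show ?thesis using C by (simp add: f_def)
  qed
  with C show thesis by (rule that)
qed

lemma carleman_smoothed:
  assumes r0: "0 < r0"
  obtains C where "0 \<le> C" "\<And>r R \<epsilon> \<eta>. r0 \<le> r \<Longrightarrow> r < R \<Longrightarrow> 0 < \<epsilon> \<Longrightarrow> \<epsilon> \<le> 1 \<Longrightarrow> \<eta> = 1 \<or> \<eta> = -1 \<Longrightarrow>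
    \<bar>2 * pi * half_mass \<mu> \<eta> r R - smoothed \<epsilon> r R\<bar> \<le> C"
proof -
  obtain C1 where C1: "0 \<le> C1" "\<And>r R \<epsilon> \<eta>. r0 \<le> r \<Longrightarrow> r < R \<Longrightarrow> 0 < \<epsilon> \<Longrightarrow> \<epsilon> \<le> 1 \<Longrightarrow> \<eta> = 1 \<or> \<eta> = -1 \<Longrightarrow>
    \<bar>2 * pi * (\<integral>z. carleman_test \<epsilon> \<eta> r R z \<partial>\<mu>) - smoothed \<epsilon> r R\<bar> \<le> C1" by (rule carleman_test_mean[OF r0]) (rule that)
  obtain C2 where C2: "0 \<le> C2" "\<And>r R \<epsilon> \<eta>. r0 \<le> r \<Longrightarrow> r < R \<Longrightarrow> 0 < \<epsilon> \<Longrightarrow> \<epsilon> \<le> 1 \<Longrightarrow> \<eta> = 1 \<or> \<eta> = -1 \<Longrightarrow>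
    \<bar>(\<integral>z. carleman_test \<epsilon> \<eta> r R z \<partial>\<mu>) - half_mass \<mu> \<eta> r R\<bar> \<le> C2" by (rule carleman_test_half_mass[OF r0]) (rule that)
  show thesis
  proof (rule that[of "C1 + 2 * pi * C2"])
    show "0 \<le> C1 + 2 * pi * C2" using C1(1) C2(1) by simp
    fix r R \<epsilon> \<eta> :: real
    assume a: "r0 \<le> r" "r < R" "0 < \<epsilon>" "\<epsilon> \<le> 1" "\<eta> = 1 \<or> \<eta> = -1"
    define I where "I = (\<integral>z. carleman_test \<epsilon> \<eta> r R z \<partial>\<mu>)"
    have "\<bar>2 * pi * I - 2 * pi * half_mass \<mu> \<eta> r R\<bar> = 2 * pi * \<bar>I - half_mass \<mu> \<eta> r R\<bar>"
      by (simp add: right_diff_distrib[symmetric] abs_mult)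
    also have "\<dots> \<le> 2 * pi * C2" using C2(2)[OF a] by (intro mult_left_mono) (auto simp: I_def)
    finally show "\<bar>2 * pi * half_mass \<mu> \<eta> r R - smoothed \<epsilon> r R\<bar> \<le> C1 + 2 * pi * C2"
      using C1(2)[OF a] unfolding I_def[symmetric] by linarith
  qed
qed

end

section \<open>Integrals along the imaginary axis\<close>

lemma ereal_int_eq_integral:
  fixes f :: "real \<Rightarrow> ereal"
  assumes AE: "AE x in lborel. x \<in> A \<longrightarrow> f x = ereal (g x)"
    and int: "integrable lborel (\<lambda>x. g x * indicator A x)"
  shows "ereal_int lebesgue A f = ereal (\<integral>x. g x * indicator A x \<partial>lborel)"
proof -
  let ?g = "\<lambda>x. g x * indicator A x"
  have 1: "(\<integral>\<^sup>+x. e2ennreal (f x) * indicator A x \<partial>lborel) = (\<integral>\<^sup>+x. ennreal (?g x) \<partial>lborel)"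
    by (intro nn_integral_cong_AE, rule eventually_mono[OF AE]) (auto simp: indicator_def e2ennreal_ereal)
  have 2: "(\<integral>\<^sup>+x. e2ennreal (- f x) * indicator A x \<partial>lborel) = (\<integral>\<^sup>+x. ennreal (- ?g x) \<partial>lborel)"
    by (intro nn_integral_cong_AE, rule eventually_mono[OF AE]) (auto simp: indicator_def e2ennreal_ereal)
  have fin: "(\<integral>\<^sup>+x. ennreal (norm (?g x)) \<partial>lborel) < \<infinity>" using int by (simp add: integrable_iff_bounded)
  have "(\<integral>\<^sup>+x. ennreal (?g x) \<partial>lborel) \<le> (\<integral>\<^sup>+x. ennreal (norm (?g x)) \<partial>lborel)"
    by (intro nn_integral_mono ennreal_leI) (simp add: abs_le_iff)
  then have "(\<integral>\<^sup>+x. ennreal (?g x) \<partial>lborel) < \<infinity>" using fin by (rule le_less_trans)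
  then obtain p where p: "(\<integral>\<^sup>+x. ennreal (?g x) \<partial>lborel) = ennreal p" "0 \<le> p"
    by (cases "\<integral>\<^sup>+x. ennreal (?g x) \<partial>lborel") auto
  have "(\<integral>\<^sup>+x. ennreal (- ?g x) \<partial>lborel) \<le> (\<integral>\<^sup>+x. ennreal (norm (?g x)) \<partial>lborel)"
    by (intro nn_integral_mono ennreal_leI) (simp add: abs_le_iff)
  then have "(\<integral>\<^sup>+x. ennreal (- ?g x) \<partial>lborel) < \<infinity>" using fin by (rule le_less_trans)
  then obtain q where q: "(\<integral>\<^sup>+x. ennreal (- ?g x) \<partial>lborel) = ennreal q" "0 \<le> q"
    by (cases "\<integral>\<^sup>+x. ennreal (- ?g x) \<partial>lborel") auto
  show ?thesis
    unfolding ereal_int_def nn_integral_completion 1 2 real_lebesgue_integral_def[OF int] p(1) q(1) using p(2) q(2) by simp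
qed

context finite_type_subharmonic begin

definition Cl :: real where
  "Cl = (SOME C. 0 \<le> C \<and> (\<forall>\<rho> x0. 0 \<le> \<rho> \<longrightarrow> \<bar>x0\<bar> \<le> 2 \<longrightarrow>
    (\<integral>\<^sup>+y. ennreal \<bar>m (Complex x0 y)\<bar> * indicator {-\<rho>..\<rho>} y \<partial>lborel) \<le> ennreal (C * (1 + \<rho>)\<^sup>2)))"

lemma Cl: "0 \<le> Cl" "0 \<le> \<rho> \<Longrightarrow> \<bar>x0\<bar> \<le> 2 \<Longrightarrow>
    (\<integral>\<^sup>+y. ennreal \<bar>m (Complex x0 y)\<bar> * indicator {-\<rho>..\<rho>} y \<partial>lborel) \<le> ennreal (Cl * (1 + \<rho>)\<^sup>2)"
proof -
  obtain C where C: "0 \<le> C" "\<And>\<rho> x0. 0 \<le> \<rho> \<Longrightarrow> \<bar>x0\<bar> \<le> 2 \<Longrightarrow>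
    (\<integral>\<^sup>+y. e2ennreal \<bar>M (Complex x0 y)\<bar> * indicator {-\<rho>..\<rho>} y \<partial>lborel) \<le> ennreal (C * (1 + \<rho>)\<^sup>2)"
    by (rule line_abs) (rule that)
  have "(\<integral>\<^sup>+y. ennreal \<bar>m (Complex x0 y)\<bar> * indicator {-\<rho>..\<rho>} y \<partial>lborel) \<le> ennreal (C * (1 + \<rho>)\<^sup>2)"
    if "0 \<le> \<rho>" "\<bar>x0\<bar> \<le> 2" for \<rho> x0
  proof -
    have "(\<integral>\<^sup>+y. ennreal \<bar>m (Complex x0 y)\<bar> * indicator {-\<rho>..\<rho>} y \<partial>lborel)
      \<le> (\<integral>\<^sup>+y. e2ennreal \<bar>M (Complex x0 y)\<bar> * indicator {-\<rho>..\<rho>} y \<partial>lborel)"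
      by (intro nn_integral_mono mult_right_mono abs_m_le) auto
    then show ?thesis using C(2)[OF that] by (rule order_trans)
  qed
  then have "\<exists>C. 0 \<le> C \<and> (\<forall>\<rho> x0. 0 \<le> \<rho> \<longrightarrow> \<bar>x0\<bar> \<le> 2 \<longrightarrow>
    (\<integral>\<^sup>+y. ennreal \<bar>m (Complex x0 y)\<bar> * indicator {-\<rho>..\<rho>} y \<partial>lborel) \<le> ennreal (C * (1 + \<rho>)\<^sup>2))"
    using C(1) by blast
  from someI_ex[OF this] show "0 \<le> Cl" "0 \<le> \<rho> \<Longrightarrow> \<bar>x0\<bar> \<le> 2 \<Longrightarrow>
    (\<integral>\<^sup>+y. ennreal \<bar>m (Complex x0 y)\<bar> * indicator {-\<rho>..\<rho>} y \<partial>lborel) \<le> ennreal (Cl * (1 + \<rho>)\<^sup>2)"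
    unfolding Cl_def[symmetric] by blast+
qed

lemma line_error:
  assumes g[measurable]: "g \<in> borel_measurable borel" and nn: "0 \<le> Q1" "0 \<le> Q2" "0 \<le> \<rho>1" "0 \<le> \<rho>2" and x0: "\<bar>x0\<bar> \<le> 2"
    and le: "\<And>y. \<bar>g y\<bar> \<le> Q1 * indicator {-\<rho>1..\<rho>1} y + Q2 * indicator {-\<rho>2..\<rho>2} y"
  shows "integrable lborel (\<lambda>y. m (Complex x0 y) * g y)"
    and "\<bar>\<integral>y. m (Complex x0 y) * g y \<partial>lborel\<bar> \<le> Q1 * (Cl * (1 + \<rho>1)\<^sup>2) + Q2 * (Cl * (1 + \<rho>2)\<^sup>2)"
proof -
  have "(\<integral>\<^sup>+y. ennreal (norm (m (Complex x0 y) * g y)) \<partial>lborel)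
    \<le> (\<integral>\<^sup>+y. ennreal Q1 * (ennreal \<bar>m (Complex x0 y)\<bar> * indicator {-\<rho>1..\<rho>1} y) + ennreal Q2 * (ennreal \<bar>m (Complex x0 y)\<bar> * indicator {-\<rho>2..\<rho>2} y) \<partial>lborel)"
  proof (intro nn_integral_mono)
    fix y
    define x where "x = m (Complex x0 y)"
    have "ennreal (norm (x * g y)) = ennreal (\<bar>x\<bar> * \<bar>g y\<bar>)" by (simp add: abs_mult)
    also have "\<dots> \<le> ennreal (\<bar>x\<bar> * (Q1 * indicator {-\<rho>1..\<rho>1} y + Q2 * indicator {-\<rho>2..\<rho>2} y))"
      using le[of y] by (intro ennreal_leI mult_left_mono) auto
    also have "\<dots> = ennreal Q1 * (ennreal \<bar>x\<bar> * indicator {-\<rho>1..\<rho>1} y) + ennreal Q2 * (ennreal \<bar>x\<bar> * indicator {-\<rho>2..\<rho>2} y)"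
    proof -
      have gen: "ennreal (a * (Q1 * indicator A y + Q2 * indicator B y)) = ennreal Q1 * (ennreal a * indicator A y) + ennreal Q2 * (ennreal a * indicator B y)"
        if "0 \<le> a" for a and A B :: "real set"
        using nn that by (auto simp: indicator_def ennreal_mult distrib_left mult_ac)
      show ?thesis by (rule gen) simp
    qed
    finally show "ennreal (norm (m (Complex x0 y) * g y)) \<le> ennreal Q1 * (ennreal \<bar>m (Complex x0 y)\<bar> * indicator {-\<rho>1..\<rho>1} y)
      + ennreal Q2 * (ennreal \<bar>m (Complex x0 y)\<bar> * indicator {-\<rho>2..\<rho>2} y)" unfolding x_def .
  qed
  also have "\<dots> = ennreal Q1 * (\<integral>\<^sup>+y. ennreal \<bar>m (Complex x0 y)\<bar> * indicator {-\<rho>1..\<rho>1} y \<partial>lborel) + ennreal Q2 * (\<integral>\<^sup>+y. ennreal \<bar>m (Complex x0 y)\<bar> * indicator {-\<rho>2..\<rho>2} y \<partial>lborel)"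
    by (subst nn_integral_add, measurable) (simp add: nn_integral_cmult)
  also have "\<dots> \<le> ennreal Q1 * ennreal (Cl * (1 + \<rho>1)\<^sup>2) + ennreal Q2 * ennreal (Cl * (1 + \<rho>2)\<^sup>2)"
    by (intro add_mono mult_left_mono Cl nn x0) auto
  also have "\<dots> = ennreal (Q1 * (Cl * (1 + \<rho>1)\<^sup>2) + Q2 * (Cl * (1 + \<rho>2)\<^sup>2))"
  proof -
    have "0 \<le> Cl * (1 + \<rho>1)\<^sup>2" "0 \<le> Cl * (1 + \<rho>2)\<^sup>2" using Cl(1) nn by auto
    then show ?thesis using nn by (simp only: ennreal_mult[symmetric] ennreal_plus[symmetric] mult_nonneg_nonneg)
  qed
  finally have b: "(\<integral>\<^sup>+y. ennreal (norm (m (Complex x0 y) * g y)) \<partial>lborel) \<le> ennreal (Q1 * (Cl * (1 + \<rho>1)\<^sup>2) + Q2 * (Cl * (1 + \<rho>2)\<^sup>2))" .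
  show int: "integrable lborel (\<lambda>y. m (Complex x0 y) * g y)"
  proof (rule integrableI_bounded)
    show "(\<integral>\<^sup>+y. ennreal (norm (m (Complex x0 y) * g y)) \<partial>lborel) < \<infinity>" using b by (rule le_less_trans) simp
  qed measurable
  have "ennreal (norm (\<integral>y. m (Complex x0 y) * g y \<partial>lborel)) \<le> ennreal (Q1 * (Cl * (1 + \<rho>1)\<^sup>2) + Q2 * (Cl * (1 + \<rho>2)\<^sup>2))"
    using integral_norm_bound_ennreal[OF int] b by (rule order_trans)
  moreover have "0 \<le> Q1 * (Cl * (1 + \<rho>1)\<^sup>2) + Q2 * (Cl * (1 + \<rho>2)\<^sup>2)"
    using nn Cl(1) by (intro add_nonneg_nonneg mult_nonneg_nonneg) auto
  ultimately show "\<bar>\<integral>y. m (Complex x0 y) * g y \<partial>lborel\<bar> \<le> Q1 * (Cl * (1 + \<rho>1)\<^sup>2) + Q2 * (Cl * (1 + \<rho>2)\<^sup>2)"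
    by (simp add: ennreal_le_iff)
qed

text \<open>This is 2 pi times the integral \<open>J_iR\<close>, with both half-axes gathered in one
  real integral that can be compared with the planar ones.\<close>

definition line_mean :: "real \<Rightarrow> real \<Rightarrow> real" where
  "line_mean r R = (\<integral>y. m (Complex 0 y) * (indicator {r..R} \<bar>y\<bar> / y\<^sup>2) \<partial>lborel)"

definition line_weighted :: "real \<Rightarrow> real \<Rightarrow> real" where
  "line_weighted r R = (\<integral>y. m (Complex 0 y) * weight r R (y\<^sup>2) \<partial>lborel)"

lemma line_mean_integrable:
  assumes "0 < r" "r < R"
  shows "integrable lborel (\<lambda>y. m (Complex 0 y) * (indicator {r..R} \<bar>y\<bar> / y\<^sup>2))"
proof (rule line_error(1)[where ?Q1.0 = "1 / r\<^sup>2" and ?\<rho>1.0 = R and ?Q2.0 = 0 and ?\<rho>2.0 = R])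
  show "\<bar>indicator {r..R} \<bar>y\<bar> / y\<^sup>2\<bar> \<le> 1 / r\<^sup>2 * indicator {-R..R} y + 0 * indicator {-R..R} y" for y
  proof (cases "\<bar>y\<bar> \<in> {r..R}")
    case True
    have "r\<^sup>2 \<le> \<bar>y\<bar>\<^sup>2" using True assms by (intro power_mono) auto
    then have "1 / y\<^sup>2 \<le> 1 / r\<^sup>2" using True assms by (intro divide_left_mono) auto
    moreover have "y \<in> {-R..R}" using True by auto
    ultimately show ?thesis using True by simp
  qed simp
qed (use assms in auto)

lemma weight_le_const:
  assumes "0 < r" "r < R" shows "weight r R (y\<^sup>2) \<le> 1 / r\<^sup>2 * indicator {-(2*R)..2*R} y"
proof (cases "\<bar>y\<bar> \<in> {r..2*R}")
  case True
  have "r\<^sup>2 \<le> \<bar>y\<bar>\<^sup>2" using True assms by (intro power_mono) auto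
  then have "1 / y\<^sup>2 \<le> 1 / r\<^sup>2" using True assms by (intro divide_left_mono) auto
  moreover have "y \<in> {-(2*R)..2*R}" using True by auto
  ultimately show ?thesis using weight_le[OF assms, of "y\<^sup>2"] by simp
next
  case False
  then have "\<bar>y\<bar> < r \<or> 2 * R < \<bar>y\<bar>" by auto
  then have "y\<^sup>2 \<le> r\<^sup>2 \<or> 4 * R\<^sup>2 \<le> y\<^sup>2"
  proof
    assume "\<bar>y\<bar> < r"
    then have "\<bar>y\<bar>\<^sup>2 \<le> r\<^sup>2" by (intro power_mono) auto
    then show ?thesis by simp
  next
    assume "2 * R < \<bar>y\<bar>"
    then have "(2 * R)\<^sup>2 \<le> \<bar>y\<bar>\<^sup>2" using assms by (intro power_mono) auto
    moreover have "(2 * R)\<^sup>2 = 4 * R\<^sup>2" by (simp add: power_mult_distrib)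
    ultimately show ?thesis by simp
  qed
  then have "weight r R (y\<^sup>2) = 0" by (rule weight_eq_0[OF assms])
  then show ?thesis by simp
qed

lemma line_weighted_integrable:
  assumes rR: "0 < r" "r < R"
  shows "integrable lborel (\<lambda>y. m (Complex 0 y) * weight r R (y\<^sup>2))"
proof -
  have [measurable]: "weight r R \<in> borel_measurable borel" by (rule measurable_weight[OF rR])
  show ?thesis
  proof (rule line_error(1)[where ?Q1.0 = "1 / r\<^sup>2" and ?\<rho>1.0 = "2 * R" and ?Q2.0 = 0 and ?\<rho>2.0 = R])
    show "\<bar>weight r R (y\<^sup>2)\<bar> \<le> 1 / r\<^sup>2 * indicator {-(2*R)..2*R} y + 0 * indicator {-R..R} y" for y
      using weight_le_const[OF rR, of y] weight_nonneg[OF rR, of "y\<^sup>2"] by simp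
  qed (use assms in auto)
qed

text \<open>At an edge \<open>\<rho>\<close> the smooth and the sharp weight differ by at most
  1/\<open>\<rho>\<close>^2, while |M| has integral O(\<open>\<rho>\<close>^2) over a segment of
  that scale.\<close>

lemma line_weighted_vs_mean:
  assumes r0: "0 < r0"
  obtains C where "0 \<le> C" "\<And>r R. r0 \<le> r \<Longrightarrow> r < R \<Longrightarrow> \<bar>line_weighted r R - line_mean r R\<bar> \<le> C"
proof -
  define D where "D = Cl * (2 + 1 / r0)\<^sup>2"
  have D: "1 / \<rho>\<^sup>2 * (Cl * (1 + 2 * \<rho>)\<^sup>2) \<le> D" if "r0 \<le> \<rho>" for \<rho>
  proof -
    have \<rho>: "0 < \<rho>" using that r0 by simp
    have "1 / \<rho>\<^sup>2 * (Cl * (1 + 2 * \<rho>)\<^sup>2) = Cl * ((1 + 2 * \<rho>) / \<rho>)\<^sup>2" by (simp add: power_divide)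
    also have "(1 + 2 * \<rho>) / \<rho> = 2 + 1 / \<rho>" using \<rho> by (simp add: field_simps)
    also have "Cl * (2 + 1 / \<rho>)\<^sup>2 \<le> D"
    proof -
      have "1 / \<rho> \<le> 1 / r0" using that r0 by (intro divide_left_mono) auto
      then show ?thesis unfolding D_def using Cl(1) \<rho> by (intro mult_left_mono power_mono) auto
    qed
    finally show ?thesis .
  qed
  show thesis
  proof (rule that[of "2 * D"])
    show "0 \<le> 2 * D" using Cl(1) by (simp add: D_def)
    fix r R assume rR0: "r0 \<le> r" "r < R"
    then have rR: "0 < r" "r < R" using r0 by auto
    have [measurable]: "weight r R \<in> borel_measurable borel" by (rule measurable_weight[OF rR])
    define g where "g y = weight r R (y\<^sup>2) - indicator {r..R} \<bar>y\<bar> / y\<^sup>2" for y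
    have [measurable]: "g \<in> borel_measurable borel" unfolding g_def by measurable
    have gb: "\<bar>g y\<bar> \<le> 1 / r\<^sup>2 * indicator {-(2*r)..2*r} y + 1 / R\<^sup>2 * indicator {-(2*R)..2*R} y" for y
    proof -
      define t where "t = \<bar>y\<bar>"
      have t2: "y\<^sup>2 = t\<^sup>2" and t0: "0 \<le> t" by (simp_all add: t_def)
      have geq: "\<bar>g y\<bar> = \<bar>cutoff r R (t\<^sup>2) - indicator {r..R} t\<bar> / t\<^sup>2"
        unfolding g_def weight_def t2 t_def[symmetric] by (simp add: diff_divide_distrib[symmetric])
      have c1: "\<bar>cutoff r R (t\<^sup>2) - indicator {r..R} t\<bar> \<le> 1"
        using cutoff_bounds[OF rR, of "t\<^sup>2"] by (auto simp: indicator_def)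
      consider "t < r" | "r \<le> t" "t \<le> 2 * r" | "2 * r < t" "t \<le> R" | "2 * r < t" "R < t" "t \<le> 2 * R" | "2 * R < t" by linarith
      then show ?thesis
      proof cases
        case 1
        then have "t\<^sup>2 \<le> r\<^sup>2" using t0 by (intro power_mono) auto
        then have "g y = 0" using 1 cutoff_eq_0[OF rR, of "t\<^sup>2"] geq by simp
        then show ?thesis using rR by simp
      next
        case 2
        then have "r\<^sup>2 \<le> t\<^sup>2" using rR by (intro power_mono) auto
        then have "\<bar>g y\<bar> \<le> 1 / r\<^sup>2" unfolding geq using c1 rR by (intro frac_le) auto
        moreover have "y \<in> {-(2*r)..2*r}" using 2 by (auto simp: t_def)
        ultimately show ?thesis using rR by (simp add: add_increasing2)
      next
        case 3
        have "(2 * r)\<^sup>2 \<le> t\<^sup>2" using 3 rR by (intro power_mono) auto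
        moreover have "t\<^sup>2 \<le> R\<^sup>2" using 3 t0 by (intro power_mono) auto
        moreover have "(2 * r)\<^sup>2 = 4 * r\<^sup>2" by (simp add: power_mult_distrib)
        ultimately have "cutoff r R (t\<^sup>2) = 1" by (intro cutoff_eq_1[OF rR]) (simp_all only:)
        moreover have "t \<in> {r..R}" using 3 rR by simp
        ultimately have "g y = 0" using geq by simp
        then show ?thesis using rR by simp
      next
        case 4
        then have "R\<^sup>2 \<le> t\<^sup>2" using rR by (intro power_mono) auto
        then have "\<bar>g y\<bar> \<le> 1 / R\<^sup>2" unfolding geq using c1 rR by (intro frac_le) auto
        moreover have "y \<in> {-(2*R)..2*R}" using 4 by (auto simp: t_def)
        ultimately show ?thesis using rR by (simp add: add_increasing)
      next
        case 5
        have "(2 * R)\<^sup>2 \<le> t\<^sup>2" using 5 rR by (intro power_mono) auto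
        moreover have "(2 * R)\<^sup>2 = 4 * R\<^sup>2" by (simp add: power_mult_distrib)
        ultimately have "cutoff r R (t\<^sup>2) = 0" by (intro cutoff_eq_0[OF rR] disjI2) (simp only:)
        moreover have "t \<notin> {r..R}" using 5 rR by simp
        ultimately have "g y = 0" using geq by simp
        then show ?thesis using rR by simp
      qed
    qed
    have "line_weighted r R - line_mean r R = (\<integral>y. m (Complex 0 y) * g y \<partial>lborel)"
      unfolding line_weighted_def line_mean_def g_def using line_weighted_integrable[OF rR] line_mean_integrable[OF rR]
      by (simp add: right_diff_distrib)
    moreover have "\<bar>\<integral>y. m (Complex 0 y) * g y \<partial>lborel\<bar> \<le> 1 / r\<^sup>2 * (Cl * (1 + 2 * r)\<^sup>2) + 1 / R\<^sup>2 * (Cl * (1 + 2 * R)\<^sup>2)"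
      using rR by (intro line_error(2) gb) auto
    ultimately show "\<bar>line_weighted r R - line_mean r R\<bar> \<le> 2 * D"
      using D[of r] D[of R] rR0 by linarith
  qed
qed

lemma line_mean_fold:
  assumes rR: "0 < r" "r < R"
  shows "integrable lborel (\<lambda>y. (m (Complex 0 (- y)) + m (Complex 0 y)) / y\<^sup>2 * indicator {r..R} y)"
    and "(\<integral>y. (m (Complex 0 (- y)) + m (Complex 0 y)) / y\<^sup>2 * indicator {r..R} y \<partial>lborel) = line_mean r R"
proof -
  define f where "f y = m (Complex 0 y) * (indicator {r..R} \<bar>y\<bar> / y\<^sup>2)" for y
  have fi: "integrable lborel f" unfolding f_def by (rule line_mean_integrable[OF rR])
  have fm[measurable]: "f \<in> borel_measurable borel" using borel_measurable_integrable[OF fi] by simp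
  define g where "g y = (m (Complex 0 (- y)) + m (Complex 0 y)) / y\<^sup>2" for y
  have geq: "g y * indicator {r..R} y = f y * indicator {0..} y + f (- y) * indicator {0..} y" for y
    using rR by (auto simp: g_def f_def indicator_def add_divide_distrib)
  have refl: "integrable lborel (\<lambda>y. h (- y)) \<and> (\<integral>y. h (- y) \<partial>lborel) = (\<integral>y. h y \<partial>lborel)" if h: "integrable lborel h" for h :: "real \<Rightarrow> real"
    using lborel_integrable_real_affine[OF h, of "-1" 0] lborel_integral_real_affine[of "-1" h 0] by simp
  have i1: "integrable lborel (\<lambda>y. f y * indicator {0..} y)" by (rule integrable_real_mult_indicator[OF _ fi]) simp
  have i2: "integrable lborel (\<lambda>y. f y * indicator {..0} y)" by (rule integrable_real_mult_indicator[OF _ fi]) simp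
  have e: "f (- y) * indicator {0..} y = (\<lambda>y. f y * indicator {..0} y) (- y)" for y by (auto simp: indicator_def)
  have i3: "integrable lborel (\<lambda>y. f (- y) * indicator {0..} y)" unfolding e using refl[OF i2] by blast
  have gi: "integrable lborel (\<lambda>y. g y * indicator {r..R} y)" unfolding geq using i1 i3 by simp
  have "(\<integral>y. g y * indicator {r..R} y \<partial>lborel) = (\<integral>y. f y * indicator {0..} y \<partial>lborel) + (\<integral>y. f y * indicator {..0} y \<partial>lborel)"
  proof -
    have e3: "(\<integral>y. f (- y) * indicator {0..} y \<partial>lborel) = (\<integral>y. f y * indicator {..0} y \<partial>lborel)"
      unfolding e using refl[OF i2] by simp
    show ?thesis unfolding geq Bochner_Integration.integral_add[OF i1 i3] e3 ..
  qed
  also have "\<dots> = (\<integral>y. f y * indicator {0..} y + f y * indicator {..0} y \<partial>lborel)"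
    using i1 i2 by simp
  also have "\<dots> = (\<integral>y. f y \<partial>lborel)"
    by (intro Bochner_Integration.integral_cong) (use rR in \<open>auto simp: f_def indicator_def\<close>)
  finally have G: "(\<integral>y. g y * indicator {r..R} y \<partial>lborel) = line_mean r R" by (simp add: line_mean_def f_def)
  show "integrable lborel (\<lambda>y. (m (Complex 0 (- y)) + m (Complex 0 y)) / y\<^sup>2 * indicator {r..R} y)"
    "(\<integral>y. (m (Complex 0 (- y)) + m (Complex 0 y)) / y\<^sup>2 * indicator {r..R} y \<partial>lborel) = line_mean r R"
    using gi G unfolding g_def .
qed

lemma AE_lines_finite:
  "AE y in lborel. M (Complex 0 (- y)) = ereal (m (Complex 0 (- y))) \<and> M (Complex 0 y) = ereal (m (Complex 0 y))"
proof -
  have AE1: "AE y in lborel. M (Complex 0 y) = ereal (m (Complex 0 y))" by (rule AE_line_finite) simp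
  have AE2: "AE y in lborel. M (Complex 0 (- y)) = ereal (m (Complex 0 (- y)))"
  proof -
    have "AE y in distr lborel borel (uminus :: real \<Rightarrow> real). M (Complex 0 y) = ereal (m (Complex 0 y))"
      unfolding lborel_distr_uminus by (rule AE1)
    then show ?thesis by (subst (asm) AE_distr_iff) (auto simp: space_borel)
  qed
  from AE1 AE2 show ?thesis by eventually_elim simp
qed

lemma J_iR_eq_line_mean:
  assumes rR: "0 < r" "r < R"
  shows "J_iR r R M = ereal (line_mean r R / (2 * pi))"
proof -
  define g where "g y = (m (Complex 0 (- y)) + m (Complex 0 y)) / y\<^sup>2" for y
  have gi: "integrable lborel (\<lambda>y. g y * indicator {r..R} y)" "(\<integral>y. g y * indicator {r..R} y \<partial>lborel) = line_mean r R"
    unfolding g_def by (rule line_mean_fold[OF rR])+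
  have AE: "AE y in lborel. y \<in> {r..R} \<longrightarrow> (M (- \<i> * of_real y) + M (\<i> * of_real y)) / ereal (y\<^sup>2) = ereal (g y)"
    using AE_lines_finite
  proof eventually_elim
    case (elim y)
    have c: "- \<i> * of_real y = Complex 0 (- y)" "\<i> * of_real y = Complex 0 y" by (simp_all add: complex_eq_iff)
    define a b where "a = m (Complex 0 (- y))" and "b = m (Complex 0 y)"
    have ab: "M (Complex 0 (- y)) = ereal a" "M (Complex 0 y) = ereal b" "g y = (a + b) / y\<^sup>2"
      using elim by (simp_all only: a_def b_def g_def)
    have "(M (Complex 0 (- y)) + M (Complex 0 y)) / ereal (y\<^sup>2) = ereal (g y)" if "y \<in> {r..R}"
      unfolding ab using that rR by simp
    then show ?case unfolding c by blast
  qed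
  show ?thesis unfolding J_iR_def ereal_int_eq_integral[OF AE gi(1)] gi(2) by simp
qed

end

section \<open>Half-plane masses against the axis integral\<close>

context finite_type_subharmonic begin

text \<open>The value at \<open>w\<close> is bounded by the circular mean of radius 0, a radius
  which the comparison with mollified means admits.\<close>

lemma M_le_moll_mean: "0 < b \<Longrightarrow> M w \<le> ereal (moll_mean w b / c0)"
proof -
  assume b: "0 < b"
  obtain K where K: "0 \<le> K" "\<forall>z\<in>{w}. M z \<le> ereal K" using bounded_above[of "{w}"] by auto
  have "M w \<le> circ_mean M w 0"
    using K circ_defect_0[of K w] by (subst le_circ_mean_iff[where K=K]) auto
  also have "\<dots> \<le> ereal (moll_mean w b / c0)" by (rule circ_mean_le_moll_mean) (use b in auto)
  finally show ?thesis .
qed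

lemma weight_integral:
  assumes rR: "0 < r" "r < R"
  shows "integrable lborel (\<lambda>y. weight r R (y\<^sup>2))"
proof -
  have [measurable]: "weight r R \<in> borel_measurable borel" by (rule measurable_weight[OF rR])
  have "integrable lborel (\<lambda>y. 1 / r\<^sup>2 * indicator {-(2*R)..2*R} y :: real)"
    by (intro integrable_mult_right integrable_real_indicator) (auto simp: emeasure_lborel_Icc_eq)
  then show ?thesis
    by (rule Bochner_Integration.integrable_bound) (use weight_le_const[OF rR] weight_nonneg[OF rR] in auto)
qed

text \<open>As \<open>\<epsilon> \<rightarrow> 0\<close>, Fatou's lemma and upper semicontinuity bound the averages over thin strips by the line integral.\<close>

lemma smoothed_le_line_weighted:
  assumes rR: "0 < r" "r < R"
  obtains \<epsilon> where "0 < \<epsilon>" "\<epsilon> \<le> 1" "smoothed \<epsilon> r R \<le> line_weighted r R + 1"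
proof -
  define w where "w y = weight r R (y\<^sup>2)" for y
  have [measurable]: "weight r R \<in> borel_measurable borel" by (rule measurable_weight[OF rR])
  have wm[measurable]: "w \<in> borel_measurable borel" unfolding w_def by measurable
  have w0: "0 \<le> w y" for y unfolding w_def by (rule weight_nonneg[OF rR])
  have wz: "w y = 0" if "2 * R < \<bar>y\<bar>" for y
  proof -
    have "y \<notin> {-(2*R)..2*R}" using that by auto
    then show ?thesis using weight_le_const[OF rR, of y] w0[of y] by (simp add: w_def)
  qed
  define W where "W = (\<integral>y. w y \<partial>lborel)"
  have wi: "integrable lborel w" unfolding w_def by (rule weight_integral[OF rR])
  obtain K where K: "0 \<le> K" "\<And>z. z \<in> cball 0 (2 * R + 2) \<Longrightarrow> M z \<le> ereal K"
    using bounded_above[OF compact_cball] by blast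
  define \<epsilon> where "\<epsilon> n = 1 / real (Suc n)" for n
  have \<epsilon>: "0 < \<epsilon> n" "\<epsilon> n \<le> 1" for n by (auto simp: \<epsilon>_def)
  \<comment> \<open>Rescaling \<open>x\<close> by \<open>\<epsilon> n\<close> fixes the kernel and
    lets only the argument of \<open>M\<close> move towards the axis. Subtracting \<open>M\<close>
    from an upper bound \<open>K\<close> gives the nonnegative integrand that Fatou's lemma
    requires.\<close>
  define F where "F n y x = e2ennreal (ereal K - M (Complex (\<epsilon> n * x) y)) * ennreal (w y) * ennreal (kern x)" for n y x
  have Fm[measurable]: "(\<lambda>(y, x). F n y x) \<in> borel_measurable (lborel \<Otimes>\<^sub>M lborel)" for n
    unfolding F_def by measurable
  have inK: "Complex x y \<in> cball 0 (2 * R + 2)" if "\<bar>y\<bar> \<le> 2 * R" "\<bar>x\<bar> \<le> 2" for x y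
    using that cmod_le[of "Complex x y"] by auto
  have \<alpha>: "(\<integral>\<^sup>+y. \<integral>\<^sup>+x. F n y x \<partial>lborel \<partial>lborel) = ennreal (K * W - smoothed (\<epsilon> n) r R)" and S_le: "smoothed (\<epsilon> n) r R \<le> K * W" for n
  proof -
    let ?e = "\<epsilon> n"
    define G where "G z = w (Im z) * (kern (Re z / ?e) / ?e)" for z
    have Gm[measurable]: "G \<in> borel_measurable borel" unfolding G_def by measurable
    have G0: "0 \<le> G z" for z unfolding G_def using w0 kern_nonneg \<epsilon>[of n] by simp
    have Gz: "G z = 0" if "z \<notin> cball 0 (2 * R + 2)" for z
    proof -
      have "2 * R < \<bar>Im z\<bar> \<or> 2 < \<bar>Re z\<bar>" using that inK[of "Im z" "Re z"] by force
      then show ?thesis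
      proof
        assume "2 < \<bar>Re z\<bar>"
        moreover have "2 * ?e \<le> 2" using \<epsilon>(2)[of n] by simp
        ultimately have "2 * ?e \<le> \<bar>Re z\<bar>" by linarith
        then have "2 \<le> \<bar>Re z / ?e\<bar>" using \<epsilon>(1)[of n] by (simp add: pos_le_divide_eq)
        then show ?thesis using kern_eq_0 by (simp add: G_def)
      qed (simp add: G_def wz)
    qed
    have kint: "(\<integral>\<^sup>+x. ennreal (kern (x / ?e) / ?e) \<partial>lborel) = 1"
    proof -
      have "(\<integral>\<^sup>+x. ennreal (kern (x / ?e) / ?e) \<partial>lborel) = \<bar>?e\<bar> * (\<integral>\<^sup>+x. ennreal (kern ((0 + ?e * x) / ?e) / ?e) \<partial>lborel)"
        using \<epsilon>(1)[of n] by (subst nn_integral_real_affine[of _ "?e" 0]) auto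
      also have "\<dots> = ennreal ?e * (\<integral>\<^sup>+x. ennreal (1 / ?e) * ennreal (kern x) \<partial>lborel)"
        using \<epsilon>(1)[of n] by (simp add: ennreal_mult'[symmetric])
      also have "\<dots> = ennreal ?e * ennreal (1 / ?e)" by (simp add: nn_integral_cmult nn_integral_kern)
      also have "\<dots> = 1" using \<epsilon>(1)[of n] by (simp add: ennreal_mult'[symmetric])
      finally show ?thesis .
    qed
    have "(\<integral>\<^sup>+z. ennreal (G z) \<partial>lborel) = (\<integral>\<^sup>+y. \<integral>\<^sup>+x. ennreal (w y) * ennreal (kern (x / ?e) / ?e) \<partial>lborel \<partial>lborel)"
      by (subst nn_integral_complex(2)) (simp_all add: G_def ennreal_mult'[OF w0] del: times_divide_eq_right)
    also have "\<dots> = (\<integral>\<^sup>+y. ennreal (w y) \<partial>lborel)" by (simp add: nn_integral_cmult kint)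
    also have "\<dots> = ennreal W" unfolding W_def using w0 by (intro nn_integral_eq_integral wi) auto
    finally have Gnn: "(\<integral>\<^sup>+z. ennreal (G z) \<partial>lborel) = ennreal W" .
    have W0: "0 \<le> W" unfolding W_def using w0 by simp
    have "has_bochner_integral lborel G W"
      using W0 G0 by (intro has_bochner_integral_nn_integral) (auto simp: Gnn)
    then have Gi: "integrable lborel G" "(\<integral>z. G z \<partial>lborel) = W" by (auto simp: has_bochner_integral_iff)
    obtain Bk where Bk: "0 < Bk" "\<And>x. kern x \<le> Bk" using kern_bounded by blast
    have mG: "integrable lborel (\<lambda>z. m z * G z)"
    proof (rule m_times_bounded(1)[OF Gm])
      show "\<bar>G z\<bar> \<le> 1 / r\<^sup>2 * (Bk / ?e)" for z
      proof -
        have "w (Im z) \<le> 1 / r\<^sup>2" using weight_le_const[OF rR, of "Im z"] by (auto simp: w_def indicator_def split: if_splits intro: order_trans)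
        moreover have "kern (Re z / ?e) / ?e \<le> Bk / ?e" using Bk \<epsilon>(1)[of n] by (intro divide_right_mono) auto
        ultimately have "G z \<le> 1 / r\<^sup>2 * (Bk / ?e)" unfolding G_def using w0 kern_nonneg \<epsilon>(1)[of n] by (intro mult_mono) auto
        then show ?thesis using G0[of z] by simp
      qed
      show "G z = 0" if "2 * R + 2 < cmod z" for z using Gz[of z] that by simp
    qed (use rR in simp)
    have KG: "integrable lborel (\<lambda>z. (K - m z) * G z)" using Gi mG by (simp add: left_diff_distrib)
    have val: "(\<integral>z. (K - m z) * G z \<partial>lborel) = K * W - smoothed ?e r R"
    proof -
      have "smoothed ?e r R = (\<integral>z. m z * G z \<partial>lborel)" by (simp add: smoothed_def G_def w_def)
      then show ?thesis using Gi mG by (simp add: left_diff_distrib)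
    qed
    have nn: "AE z in lborel. 0 \<le> (K - m z) * G z"
      using AE_M_finite
    proof (rule eventually_mono)
      fix z assume z: "M z = ereal (m z)"
      show "0 \<le> (K - m z) * G z"
      proof (cases "z \<in> cball 0 (2 * R + 2)")
        case True
        then have "m z \<le> K" using K(2)[OF True] z by (metis ereal_less_eq(3))
        then show ?thesis using G0 by simp
      qed (simp add: Gz)
    qed
    have "(\<integral>\<^sup>+y. \<integral>\<^sup>+x. F n y x \<partial>lborel \<partial>lborel) = (\<integral>\<^sup>+y. \<integral>\<^sup>+x. e2ennreal (ereal K - M (Complex x y)) * ennreal (G (Complex x y)) \<partial>lborel \<partial>lborel)"
    proof (rule nn_integral_cong)
      fix y
      have "(\<integral>\<^sup>+x. e2ennreal (ereal K - M (Complex x y)) * ennreal (G (Complex x y)) \<partial>lborel)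
        = ennreal \<bar>?e\<bar> * (\<integral>\<^sup>+x. e2ennreal (ereal K - M (Complex (0 + ?e * x) y)) * ennreal (G (Complex (0 + ?e * x) y)) \<partial>lborel)"
        using \<epsilon>(1)[of n] by (intro nn_integral_real_affine) auto
      also have "\<dots> = (\<integral>\<^sup>+x. ennreal ?e * (e2ennreal (ereal K - M (Complex (?e * x) y)) * ennreal (G (Complex (?e * x) y))) \<partial>lborel)"
        using \<epsilon>(1)[of n] by (subst nn_integral_cmult) auto
      also have "\<dots> = (\<integral>\<^sup>+x. F n y x \<partial>lborel)"
      proof (intro nn_integral_cong)
        fix x
        have "ennreal ?e * ennreal (G (Complex (?e * x) y)) = ennreal (w y * kern x)"
          using \<epsilon>(1)[of n] by (simp add: G_def ennreal_mult'[symmetric])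
        then have "ennreal ?e * ennreal (G (Complex (?e * x) y)) = ennreal (w y) * ennreal (kern x)"
          using w0 by (simp add: ennreal_mult')
        then show "ennreal ?e * (e2ennreal (ereal K - M (Complex (?e * x) y)) * ennreal (G (Complex (?e * x) y))) = F n y x"
          by (simp only: F_def mult.left_commute[of "ennreal ?e"] mult.assoc)
      qed
      finally show "(\<integral>\<^sup>+x. F n y x \<partial>lborel) = (\<integral>\<^sup>+x. e2ennreal (ereal K - M (Complex x y)) * ennreal (G (Complex x y)) \<partial>lborel)" ..
    qed
    also have "\<dots> = (\<integral>\<^sup>+z. e2ennreal (ereal K - M z) * ennreal (G z) \<partial>lborel)"
      by (subst nn_integral_complex(2)) auto
    also have "\<dots> = (\<integral>\<^sup>+z. ennreal ((K - m z) * G z) \<partial>lborel)"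
    proof (rule nn_integral_cong_AE, rule eventually_mono[OF AE_M_finite])
      fix z assume z: "M z = ereal (m z)"
      show "e2ennreal (ereal K - M z) * ennreal (G z) = ennreal ((K - m z) * G z)"
        by (subst z) (simp add: e2ennreal_ereal ennreal_mult''[OF G0])
    qed
    also have "\<dots> = ennreal (K * W - smoothed ?e r R)"
      using nn_integral_eq_integral[OF KG nn] val by simp
    finally show "(\<integral>\<^sup>+y. \<integral>\<^sup>+x. F n y x \<partial>lborel \<partial>lborel) = ennreal (K * W - smoothed ?e r R)" .
    have "0 \<le> (\<integral>z. (K - m z) * G z \<partial>lborel)" using nn by (rule integral_nonneg_AE)
    then show "smoothed ?e r R \<le> K * W" using val by simp
  qed
  have AE0: "AE y in lborel. M (Complex 0 y) = ereal (m (Complex 0 y))" by (rule AE_line_finite) simp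
  have L: "(\<integral>\<^sup>+y. \<integral>\<^sup>+x. e2ennreal (ereal K - M (Complex 0 y)) * ennreal (w y) * ennreal (kern x) \<partial>lborel \<partial>lborel) = ennreal (K * W - line_weighted r R)"
  proof -
    have mw: "integrable lborel (\<lambda>y. m (Complex 0 y) * w y)" unfolding w_def by (rule line_weighted_integrable[OF rR])
    have nn: "AE y in lborel. 0 \<le> (K - m (Complex 0 y)) * w y"
      using AE0
    proof (rule eventually_mono)
      fix y assume z: "M (Complex 0 y) = ereal (m (Complex 0 y))"
      show "0 \<le> (K - m (Complex 0 y)) * w y"
      proof (cases "\<bar>y\<bar> \<le> 2 * R")
        case True
        then have "m (Complex 0 y) \<le> K" using K(2)[OF inK[of y 0]] z by (metis abs_zero ereal_less_eq(3) zero_le_numeral)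
        then show ?thesis using w0 by simp
      qed (simp add: wz)
    qed
    have "(\<integral>\<^sup>+y. \<integral>\<^sup>+x. e2ennreal (ereal K - M (Complex 0 y)) * ennreal (w y) * ennreal (kern x) \<partial>lborel \<partial>lborel)
      = (\<integral>\<^sup>+y. e2ennreal (ereal K - M (Complex 0 y)) * ennreal (w y) \<partial>lborel)"
      by (simp add: nn_integral_cmult nn_integral_kern)
    also have "\<dots> = (\<integral>\<^sup>+y. ennreal ((K - m (Complex 0 y)) * w y) \<partial>lborel)"
    proof (rule nn_integral_cong_AE, rule eventually_mono[OF AE0])
      fix y assume z: "M (Complex 0 y) = ereal (m (Complex 0 y))"
      show "e2ennreal (ereal K - M (Complex 0 y)) * ennreal (w y) = ennreal ((K - m (Complex 0 y)) * w y)"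
        by (subst z) (simp add: e2ennreal_ereal ennreal_mult''[OF w0])
    qed
    also have "\<dots> = ennreal (\<integral>y. (K - m (Complex 0 y)) * w y \<partial>lborel)"
      using wi mw nn by (intro nn_integral_eq_integral) (auto simp: left_diff_distrib)
    also have "(\<integral>y. (K - m (Complex 0 y)) * w y \<partial>lborel) = K * W - line_weighted r R"
    proof -
      have "line_weighted r R = (\<integral>y. m (Complex 0 y) * w y \<partial>lborel)" by (simp add: line_weighted_def w_def)
      then show ?thesis using wi mw by (simp add: left_diff_distrib W_def)
    qed
    finally show ?thesis .
  qed
  \<comment> \<open>Upper semicontinuity at a point of the axis bounds \<open>M\<close> nearby up to
    a loss \<open>d\<close>, which is removed at the end.\<close>
  have pt: "e2ennreal (ereal K - M (Complex 0 y)) * ennreal (w y) * ennreal (kern x) \<le> liminf (\<lambda>n. F n y x)"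
    if fin: "M (Complex 0 y) = ereal (m (Complex 0 y))" for y x
  proof -
    define t where "t = m (Complex 0 y)"
    define c where "c = w y * kern x"
    have t: "M (Complex 0 y) = ereal t" using fin by (simp add: t_def)
    have c0: "0 \<le> c" using w0 kern_nonneg by (simp add: c_def)
    have cc: "ennreal (w y) * ennreal (kern x) = ennreal c" using w0 by (simp add: c_def ennreal_mult')
    have step: "ennreal ((K - t - d) * c) \<le> liminf (\<lambda>n. F n y x)" if d: "0 < d" for d
    proof -
      have "M (Complex 0 y) < ereal (t + d)" using t d by simp
      then obtain \<delta> where \<delta>: "0 < \<delta>" "\<And>z. dist z (Complex 0 y) < \<delta> \<Longrightarrow> M z < ereal (t + d)"
        using usc_nhds[of "Complex 0 y" "ereal (t + d)"] by (auto simp: eventually_nhds_metric)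
      have "(\<lambda>n. \<epsilon> n * x) \<longlonglongrightarrow> 0 * x" unfolding \<epsilon>_def using LIMSEQ_inverse_real_of_nat
        by (intro tendsto_mult tendsto_const) (simp add: inverse_eq_divide)
      then have "\<forall>\<^sub>F n in sequentially. dist (\<epsilon> n * x) 0 < \<delta>" using \<delta>(1) by (intro tendstoD) auto
      then have "\<forall>\<^sub>F n in sequentially. ennreal ((K - t - d) * c) \<le> F n y x"
      proof eventually_elim
        case (elim n)
        have "Complex (\<epsilon> n * x) y - Complex 0 y = of_real (\<epsilon> n * x)" by (simp add: complex_eq_iff)
        then have "dist (Complex (\<epsilon> n * x) y) (Complex 0 y) < \<delta>" using elim by (simp add: dist_norm del: of_real_mult)
        from \<delta>(2)[OF this] have "e2ennreal (ereal (K - (t + d))) \<le> e2ennreal (ereal K - M (Complex (\<epsilon> n * x) y))"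
          by (intro e2ennreal_mono) (cases "M (Complex (\<epsilon> n * x) y)"; simp)
        then have "ennreal (K - t - d) * ennreal c \<le> e2ennreal (ereal K - M (Complex (\<epsilon> n * x) y)) * ennreal c"
          by (intro mult_right_mono) (simp_all add: e2ennreal_ereal diff_diff_eq)
        then show ?case using c0 by (simp add: F_def mult.assoc cc ennreal_mult'')
      qed
      then show ?thesis by (intro Liminf_bounded) auto
    qed
    have "ennreal ((K - t) * c) \<le> liminf (\<lambda>n. F n y x)"
    proof (cases "liminf (\<lambda>n. F n y x)")
      case (real X)
      have "(K - t) * c \<le> X"
      proof (rule field_le_epsilon)
        fix e :: real assume e: "0 < e"
        \<comment> \<open>Adding 1 to \<open>c\<close> makes the total loss \<open>d * c\<close> at
          most \<open>e\<close> even when \<open>c\<close> is 0.\<close>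
        define d where "d = e / (c + 1)"
        have d: "0 < d" using e c0 by (simp add: d_def)
        have dc: "d * c \<le> e" using e c0 by (simp add: d_def field_simps)
        have "(K - t - d) * c \<le> X" using step[OF d] real by (simp add: ennreal_le_iff)
        then show "(K - t) * c \<le> X + e" using dc by (simp add: left_diff_distrib)
      qed
      then show ?thesis using real by (simp add: ennreal_leI)
    qed simp
    then show ?thesis by (simp add: t e2ennreal_ereal mult.assoc cc ennreal_mult''[OF c0])
  qed
  have "ennreal (K * W - line_weighted r R) \<le> (\<integral>\<^sup>+y. \<integral>\<^sup>+x. liminf (\<lambda>n. F n y x) \<partial>lborel \<partial>lborel)"
    unfolding L[symmetric]
    by (intro nn_integral_mono_AE, rule eventually_mono[OF AE0], intro nn_integral_mono pt)
  also have "\<dots> \<le> (\<integral>\<^sup>+y. liminf (\<lambda>n. \<integral>\<^sup>+x. F n y x \<partial>lborel) \<partial>lborel)"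
    by (intro nn_integral_mono nn_integral_liminf) (simp add: F_def)
  also have "\<dots> \<le> liminf (\<lambda>n. \<integral>\<^sup>+y. \<integral>\<^sup>+x. F n y x \<partial>lborel \<partial>lborel)"
    by (intro nn_integral_liminf lborel.borel_measurable_nn_integral Fm)
  also have "\<dots> = liminf (\<lambda>n. ennreal (K * W - smoothed (\<epsilon> n) r R))" by (simp only: \<alpha>)
  finally have lim: "ennreal (K * W - line_weighted r R) \<le> liminf (\<lambda>n. ennreal (K * W - smoothed (\<epsilon> n) r R))" .
  \<comment> \<open>The slack 1 extracts a single \<open>\<epsilon>\<close> from the liminf
    inequality: if every average overshot by more than 1, the liminf would be too small by
    1.\<close>
  have "\<exists>n. smoothed (\<epsilon> n) r R \<le> line_weighted r R + 1"
  proof (rule ccontr)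
    assume "\<not> ?thesis"
    then have neg: "line_weighted r R + 1 < smoothed (\<epsilon> n) r R" for n by (simp add: not_le)
    then have pos: "0 < K * W - line_weighted r R - 1" using S_le[of 0] neg[of 0] by linarith
    have "liminf (\<lambda>n. ennreal (K * W - smoothed (\<epsilon> n) r R)) \<le> ennreal (K * W - line_weighted r R - 1)"
    proof (rule Liminf_le)
      show "\<forall>\<^sub>F n in sequentially. ennreal (K * W - smoothed (\<epsilon> n) r R) \<le> ennreal (K * W - line_weighted r R - 1)"
        using neg by (intro always_eventually allI ennreal_leI) (smt (verit))
    qed simp
    with lim have "ennreal (K * W - line_weighted r R) \<le> ennreal (K * W - line_weighted r R - 1)" by (rule order_trans)
    then show False using pos by (simp add: ennreal_le_iff)
  qed
  then show thesis using that \<epsilon> by blast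
qed

text \<open>The constant of \<open>carleman_smoothed\<close> is uniform in
  \<open>\<epsilon>\<close>, so the \<open>\<epsilon>\<close> found for the given \<open>r\<close>
  and \<open>R\<close> may be inserted.\<close>

lemma half_mass_le_line_mean:
  assumes r0: "0 < r0"
  obtains C where "0 \<le> C" "\<And>r R \<eta>. r0 \<le> r \<Longrightarrow> r < R \<Longrightarrow> \<eta> = 1 \<or> \<eta> = -1 \<Longrightarrow> 2 * pi * half_mass \<mu> \<eta> r R \<le> line_mean r R + C"
proof -
  obtain C1 where C1: "0 \<le> C1" "\<And>r R \<epsilon> \<eta>. r0 \<le> r \<Longrightarrow> r < R \<Longrightarrow> 0 < \<epsilon> \<Longrightarrow> \<epsilon> \<le> 1 \<Longrightarrow> \<eta> = 1 \<or> \<eta> = -1 \<Longrightarrow>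
    \<bar>2 * pi * half_mass \<mu> \<eta> r R - smoothed \<epsilon> r R\<bar> \<le> C1" by (rule carleman_smoothed[OF r0]) (rule that)
  obtain C2 where C2: "0 \<le> C2" "\<And>r R. r0 \<le> r \<Longrightarrow> r < R \<Longrightarrow> \<bar>line_weighted r R - line_mean r R\<bar> \<le> C2"
    by (rule line_weighted_vs_mean[OF r0]) (rule that)
  show thesis
  proof (rule that[of "C1 + C2 + 1"])
    show "0 \<le> C1 + C2 + 1" using C1(1) C2(1) by simp
    fix r R \<eta> :: real assume a: "r0 \<le> r" "r < R" "\<eta> = 1 \<or> \<eta> = -1"
    have r: "0 < r" using a r0 by simp
    obtain \<epsilon> where \<epsilon>: "0 < \<epsilon>" "\<epsilon> \<le> 1" "smoothed \<epsilon> r R \<le> line_weighted r R + 1"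
      by (rule smoothed_le_line_weighted[OF r a(2)])
    show "2 * pi * half_mass \<mu> \<eta> r R \<le> line_mean r R + (C1 + C2 + 1)"
      using C1(2)[OF a(1,2) \<epsilon>(1,2) a(3)] C2(2)[OF a(1,2)] \<epsilon>(3) by linarith
  qed
qed

text \<open>On the axis \<open>M\<close> is at most its mollified mean of scale 1. Fubini transfers
  the mollification from \<open>M\<close> to the weight: vertical slices of the mollifier integrate
  to \<open>c0 * kern (Re z)\<close>, so the transferred weight is
  \<open>w (Im z) * kern (Re z)\<close> up to the variation of \<open>w\<close> over a distance of
  at most 2. That variation is O((1 + |z|)^(-3)), against which |M| is integrable in the
  strip.\<close>

lemma line_weighted_le_smoothed:
  assumes r0: "0 < r0"
  obtains C where "0 \<le> C" "\<And>r R. r0 \<le> r \<Longrightarrow> r < R \<Longrightarrow> line_weighted r R \<le> smoothed 1 r R + C"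
proof -
  obtain CX where CX: "0 \<le> CX" "\<And>r R \<sigma>. r0 \<le> r \<Longrightarrow> r < R \<Longrightarrow> 0 \<le> \<sigma> \<Longrightarrow> \<bar>deriv (weight r R) \<sigma>\<bar> \<le> CX / (1 + \<sigma>)\<^sup>2"
    using weight_deriv_bound[OF r0] by blast
  obtain Bk where Bk: "0 < Bk" "\<And>x. kern x \<le> Bk" using kern_bounded by blast
  obtain B where B: "0 < B" "\<And>x. step1 x \<le> B" using step_deriv_bounded by blast
  obtain T where T: "0 \<le> T" "(\<integral>\<^sup>+z. ennreal \<bar>m z\<bar> * indicator {z. \<bar>Re z\<bar> \<le> 2} z * ennreal (1 / (1 + cmod z) ^ 3) \<partial>lborel) \<le> ennreal T"
    using tail_strip by blast
  \<comment> \<open>34992 = 4 * 324 * 27, from |y^2 - Y^2| \<open>\<le>\<close> 4 (1 + |Y|), (1 +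
    |Y|)^4 \<open>\<le>\<close> 324 (1 + s)^2 and 1 + |z| \<open>\<le>\<close> 3 (1 + |Y|), the last
    one cubed.\<close>
  define C3 where "C3 = 34992 * CX"
  have C3: "0 \<le> C3" using CX by (simp add: C3_def)
  show thesis
  proof (rule that[of "C3 * Bk * T"])
    show "0 \<le> C3 * Bk * T" using C3 Bk T by simp
    fix r R assume rR0: "r0 \<le> r" "r < R"
    then have rR: "0 < r" "r < R" using r0 by auto
    define w where "w y = weight r R (y\<^sup>2)" for y
    have [measurable]: "weight r R \<in> borel_measurable borel" by (rule measurable_weight[OF rR])
    have wm[measurable]: "w \<in> borel_measurable borel" unfolding w_def by measurable
    have w0: "0 \<le> w y" for y unfolding w_def by (rule weight_nonneg[OF rR])
    have wz: "w y = 0" if "2 * R < \<bar>y\<bar>" for y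
    proof -
    have "y \<notin> {-(2*R)..2*R}" using that by auto
    then show ?thesis using weight_le_const[OF rR, of y] w0[of y] by (simp add: w_def)
  qed
    have wle: "w y \<le> 1 / r\<^sup>2" for y
      using weight_le_const[OF rR, of y] by (auto simp: w_def indicator_def split: if_splits intro: order_trans)
    have wdiff: "\<bar>w y - w Y\<bar> \<le> C3 / (1 + cmod z) ^ 3" if yY: "\<bar>Y - y\<bar> \<le> 2" and x: "\<bar>Re z\<bar> \<le> 2" and Y: "Y = Im z" for y Y z
    proof (cases "y\<^sup>2 = Y\<^sup>2")
      case True
      then show ?thesis using C3 by (simp add: w_def)
    next
      case False
      \<comment> \<open>Either square may be the larger one, so the mean value theorem is applied
        between their minimum and maximum.\<close>
      define s where "s = min (y\<^sup>2) (Y\<^sup>2)"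
      define s' where "s' = max (y\<^sup>2) (Y\<^sup>2)"
      have s: "s < s'" "0 \<le> s" using False by (auto simp: s_def s'_def)
      from MVT2[OF s(1), of "weight r R" "deriv (weight r R)"] weight_deriv(1)[OF rR]
      obtain \<xi> where \<xi>: "s < \<xi>" "\<xi> < s'" "weight r R s' - weight r R s = (s' - s) * deriv (weight r R) \<xi>" by blast
      have ab: "\<bar>w y - w Y\<bar> = \<bar>weight r R s' - weight r R s\<bar>" "s' - s = \<bar>y\<^sup>2 - Y\<^sup>2\<bar>"
        by (auto simp: w_def s_def s'_def min_def max_def)
      have Yp: "1 \<le> 1 + \<bar>Y\<bar>" by simp
      have sq: "\<bar>y\<^sup>2 - Y\<^sup>2\<bar> \<le> 4 * (1 + \<bar>Y\<bar>)"
      proof -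
        have "y\<^sup>2 - Y\<^sup>2 = (y - Y) * (y + Y)" by (simp add: power2_eq_square algebra_simps)
        then have "\<bar>y\<^sup>2 - Y\<^sup>2\<bar> = \<bar>y - Y\<bar> * \<bar>y + Y\<bar>" by (simp add: abs_mult)
        also have "\<dots> \<le> 2 * (2 * (1 + \<bar>Y\<bar>))" using yY by (intro mult_mono) auto
        finally show ?thesis by simp
      qed
      have s4: "(1 + \<bar>Y\<bar>) ^ 4 \<le> 324 * (1 + s)\<^sup>2"
      proof -
        have "\<bar>Y\<bar> \<le> \<bar>y\<bar> + 2" using yY abs_triangle_ineq[of y "Y - y"] by simp
        then have "1 + \<bar>Y\<bar> \<le> 3 * (1 + \<bar>y\<bar>)" by simp
        then have "(1 + \<bar>Y\<bar>) ^ 4 \<le> (3 * (1 + \<bar>y\<bar>)) ^ 4" by (intro power_mono) auto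
        also have "\<dots> = 81 * (1 + \<bar>y\<bar>) ^ 4" by (simp only: power_mult_distrib) simp
        also have "\<dots> \<le> 324 * (1 + y\<^sup>2)\<^sup>2" using one_plus_square_le[of "\<bar>y\<bar>"] by simp
        finally have 1: "(1 + \<bar>Y\<bar>) ^ 4 \<le> 324 * (1 + y\<^sup>2)\<^sup>2" .
        have "(1 + \<bar>Y\<bar>) ^ 4 \<le> 4 * (1 + Y\<^sup>2)\<^sup>2" using one_plus_square_le[of "\<bar>Y\<bar>"] by simp
        also have "\<dots> \<le> 324 * (1 + Y\<^sup>2)\<^sup>2" by simp
        finally show ?thesis using 1 by (simp add: s_def min_def)
      qed
      have "\<bar>deriv (weight r R) \<xi>\<bar> \<le> CX / (1 + \<xi>)\<^sup>2" using CX(2)[OF rR0, of \<xi>] \<xi> s by simp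
      also have "\<dots> \<le> CX / (1 + s)\<^sup>2" using CX(1) \<xi> s by (intro divide_left_mono power_mono) auto
      also have "\<dots> \<le> 324 * CX / (1 + \<bar>Y\<bar>) ^ 4"
      proof -
        have p: "0 < (1 + s)\<^sup>2" "0 < (1 + \<bar>Y\<bar>) ^ 4" using s(2) by (auto intro!: zero_less_power add_pos_nonneg)
        have "CX * (1 + \<bar>Y\<bar>) ^ 4 \<le> CX * (324 * (1 + s)\<^sup>2)" using s4 CX(1) by (intro mult_left_mono) auto
        then show ?thesis using p by (auto simp: divide_simps mult_ac)
      qed
      finally have d: "\<bar>deriv (weight r R) \<xi>\<bar> \<le> 324 * CX / (1 + \<bar>Y\<bar>) ^ 4" .
      have "\<bar>w y - w Y\<bar> = \<bar>y\<^sup>2 - Y\<^sup>2\<bar> * \<bar>deriv (weight r R) \<xi>\<bar>"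
        unfolding ab(1) \<xi>(3) abs_mult ab(2) by simp
      also have "\<dots> \<le> (4 * (1 + \<bar>Y\<bar>)) * (324 * CX / (1 + \<bar>Y\<bar>) ^ 4)"
        using sq d by (intro mult_mono) auto
      also have "\<dots> = 1296 * CX / (1 + \<bar>Y\<bar>) ^ 3"
      proof -
        have "(4 * p) * (324 * CX / p ^ 4) = 1296 * CX / p ^ 3" if "1 \<le> p" for p
          using that by (simp add: power4_eq_xxxx power3_eq_cube)
        then show ?thesis using Yp by blast
      qed
      also have "\<dots> \<le> C3 / (1 + cmod z) ^ 3"
      proof -
        have "1 + cmod z \<le> 3 * (1 + \<bar>Y\<bar>)" using x cmod_le[of z] by (simp add: Y)
        then have "(1 + cmod z) ^ 3 \<le> (3 * (1 + \<bar>Y\<bar>)) ^ 3" by (intro power_mono) auto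
        also have "\<dots> = 27 * (1 + \<bar>Y\<bar>) ^ 3" by (simp only: power_mult_distrib) simp
        finally have le: "1296 * CX * (1 + cmod z) ^ 3 \<le> 1296 * CX * (27 * (1 + \<bar>Y\<bar>) ^ 3)"
          using CX(1) by (intro mult_left_mono) auto
        have p: "0 < (1 + cmod z) ^ 3" "0 < (1 + \<bar>Y\<bar>) ^ 3" by (auto intro!: zero_less_power add_pos_nonneg)
        show ?thesis using le p unfolding C3_def by (auto simp: divide_simps mult_ac)
      qed
      finally show ?thesis .
    qed
    define g where "g y z = step1 (Re z * Re z + (Im z - y) * (Im z - y))" for y z
    have gmoll: "g y z = mollifier (Complex 0 y) 1 z" for y z
      by (simp add: g_def mollifier_def cmod_diff_squared)
    have gm[measurable]: "(\<lambda>(y, z). g y z) \<in> borel_measurable (lborel \<Otimes>\<^sub>M lborel)" unfolding g_def by measurable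
    have g0: "0 \<le> g y z" for y z by (simp add: g_def step_props(4))
    have gz: "g y z = 0" if "2 \<le> \<bar>Re z\<bar> \<or> 2 \<le> \<bar>Im z - y\<bar>" for y z
    proof -
      have "2 \<le> cmod (z - Complex 0 y)"
        using that abs_Re_le_cmod[of "z - Complex 0 y"] abs_Im_le_cmod[of "z - Complex 0 y"] by auto
      then show ?thesis unfolding gmoll by (intro mollifier_eq_0) auto
    qed
    have gint: "(\<integral>\<^sup>+y. ennreal (g y z) \<partial>lborel) = ennreal (c0 * kern (Re z))" for z
    proof -
      have "(\<integral>\<^sup>+y. ennreal (g y z) \<partial>lborel) = ennreal \<bar>-1\<bar> * (\<integral>\<^sup>+y. ennreal (g (Im z + (-1) * y) z) \<partial>lborel)"
        by (intro nn_integral_real_affine) (auto simp: g_def)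
      also have "\<dots> = (\<integral>\<^sup>+y. ennreal (step1 (Re z * Re z + y * y)) \<partial>lborel)" by (simp add: g_def)
      finally show ?thesis by (simp add: nn_integral_kern_slice)
    qed
    have gbi: "integrable lborel (\<lambda>y. g y z)" "(\<integral>y. g y z \<partial>lborel) = c0 * kern (Re z)" for z
    proof -
      have "has_bochner_integral lborel (\<lambda>y. g y z) (c0 * kern (Re z))"
      proof (rule has_bochner_integral_nn_integral)
        show "(\<lambda>y. g y z) \<in> borel_measurable lborel" unfolding g_def by measurable
      qed (use c0(2) kern_nonneg[of "Re z"] g0 gint in auto)
      then show "integrable lborel (\<lambda>y. g y z)" "(\<integral>y. g y z \<partial>lborel) = c0 * kern (Re z)"
        by (auto simp: has_bochner_integral_iff)
    qed
    \<comment> \<open>The weight that \<open>M\<close> meets after the exchange of integrals: the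
      vertical average of \<open>w\<close> against the mollifier, normalised by
      \<open>c0\<close>.\<close>
    define \<Psi> where "\<Psi> z = (\<integral>y. g y z * w y \<partial>lborel) / c0" for z
    have gwi: "integrable lborel (\<lambda>y. g y z * w y)" for z
    proof (rule Bochner_Integration.integrable_bound[OF integrable_mult_left[OF gbi(1)[of z], of "1 / r\<^sup>2"]])
      show "(\<lambda>y. g y z * w y) \<in> borel_measurable lborel" unfolding g_def by measurable
      show "AE y in lborel. norm (g y z * w y) \<le> norm (g y z * (1 / r\<^sup>2))"
        using g0 w0 wle by (intro always_eventually allI) (simp add: abs_mult mult_left_mono del: times_divide_eq_right)
    qed
    have \<Psi>m[measurable]: "\<Psi> \<in> borel_measurable borel"
      unfolding \<Psi>_def g_def by measurable
    have \<Psi>diff: "\<bar>\<Psi> z - w (Im z) * kern (Re z)\<bar> \<le> C3 * Bk * (indicator {z. \<bar>Re z\<bar> \<le> 2} z * (1 / (1 + cmod z) ^ 3))" for z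
    proof (cases "\<bar>Re z\<bar> \<le> 2")
      case False
      then have "g y z = 0" for y by (intro gz) auto
      moreover have "kern (Re z) = 0" using False by (intro kern_eq_0) auto
      ultimately show ?thesis using C3 Bk by (simp add: \<Psi>_def)
    next
      case True
      have "\<Psi> z - w (Im z) * kern (Re z) = ((\<integral>y. g y z * w y \<partial>lborel) - (\<integral>y. g y z * w (Im z) \<partial>lborel)) / c0"
        using gbi[of z] c0(2) by (simp add: \<Psi>_def diff_divide_distrib)
      also have "(\<integral>y. g y z * w y \<partial>lborel) - (\<integral>y. g y z * w (Im z) \<partial>lborel) = (\<integral>y. g y z * (w y - w (Im z)) \<partial>lborel)"
        using gwi[of z] gbi(1)[of z] by (simp add: right_diff_distrib)
      finally have eq: "\<bar>\<Psi> z - w (Im z) * kern (Re z)\<bar> = \<bar>\<integral>y. g y z * (w y - w (Im z)) \<partial>lborel\<bar> / c0"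
        using c0(2) by simp
      have i1: "integrable lborel (\<lambda>y. g y z * (w y - w (Im z)))"
        using gwi[of z] gbi(1)[of z] by (simp add: right_diff_distrib)
      have "\<bar>\<integral>y. g y z * (w y - w (Im z)) \<partial>lborel\<bar> \<le> (\<integral>y. \<bar>g y z * (w y - w (Im z))\<bar> \<partial>lborel)"
        by (rule integral_abs_bound)
      also have "\<dots> \<le> (\<integral>y. g y z * (C3 / (1 + cmod z) ^ 3) \<partial>lborel)"
      proof (rule integral_mono)
        show "integrable lborel (\<lambda>y. \<bar>g y z * (w y - w (Im z))\<bar>)" using i1 by (rule integrable_abs)
        show "integrable lborel (\<lambda>y. g y z * (C3 / (1 + cmod z) ^ 3))" using gbi(1)[of z] by (rule integrable_mult_left)
        fix y
        show "\<bar>g y z * (w y - w (Im z))\<bar> \<le> g y z * (C3 / (1 + cmod z) ^ 3)"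
        proof (cases "2 \<le> \<bar>Im z - y\<bar>")
          case True
          then show ?thesis by (simp add: gz)
        next
          case False
          then have "\<bar>w y - w (Im z)\<bar> \<le> C3 / (1 + cmod z) ^ 3" using True by (intro wdiff) auto
          then show ?thesis unfolding abs_mult using g0[of y z] by (simp add: mult_left_mono del: times_divide_eq_right)
        qed
      qed
      also have "\<dots> = c0 * kern (Re z) * (C3 / (1 + cmod z) ^ 3)" using gbi[of z] by simp
      finally have "\<bar>\<Psi> z - w (Im z) * kern (Re z)\<bar> \<le> c0 * kern (Re z) * (C3 / (1 + cmod z) ^ 3) / c0"
        unfolding eq using c0(2) by (intro divide_right_mono) auto
      also have "\<dots> = kern (Re z) * (C3 / (1 + cmod z) ^ 3)" using c0(2) by simp
      also have "\<dots> \<le> Bk * (C3 / (1 + cmod z) ^ 3)" using Bk(2) C3 by (intro mult_right_mono) auto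
      finally show ?thesis using True by (simp add: mult_ac)
    qed
    define D where "D z = \<Psi> z - w (Im z) * kern (Re z)" for z
    have Dm[measurable]: "D \<in> borel_measurable borel" unfolding D_def by measurable
    have Dnn: "(\<integral>\<^sup>+z. ennreal (norm (m z * D z)) \<partial>lborel) \<le> ennreal (C3 * Bk * T)"
    proof -
      have "(\<integral>\<^sup>+z. ennreal (norm (m z * D z)) \<partial>lborel)
        \<le> (\<integral>\<^sup>+z. ennreal (C3 * Bk) * (ennreal \<bar>m z\<bar> * indicator {z. \<bar>Re z\<bar> \<le> 2} z * ennreal (1 / (1 + cmod z) ^ 3)) \<partial>lborel)"
      proof (intro nn_integral_mono)
        fix z
        define x where "x = m z"
        have "ennreal (norm (x * D z)) \<le> ennreal (\<bar>x\<bar> * (C3 * Bk * (indicator {z. \<bar>Re z\<bar> \<le> 2} z * (1 / (1 + cmod z) ^ 3))))"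
          unfolding real_norm_def abs_mult D_def by (intro ennreal_leI mult_left_mono \<Psi>diff) auto
        also have "\<dots> = ennreal (C3 * Bk) * (ennreal \<bar>x\<bar> * indicator {z. \<bar>Re z\<bar> \<le> 2} z * ennreal (1 / (1 + cmod z) ^ 3))"
        proof -
          have gen: "ennreal (a * (b * (indicator A z * c))) = ennreal b * (ennreal a * indicator A z * ennreal c)"
            if "0 \<le> a" "0 \<le> b" "0 \<le> c" for a b c and A :: "complex set"
            using that by (auto simp: indicator_def ennreal_mult mult_ac)
          show ?thesis by (rule gen) (use C3 Bk in auto)
        qed
        finally show "ennreal (norm (m z * D z)) \<le> ennreal (C3 * Bk) * (ennreal \<bar>m z\<bar> * indicator {z. \<bar>Re z\<bar> \<le> 2} z * ennreal (1 / (1 + cmod z) ^ 3))"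
          unfolding x_def .
      qed
      also have "\<dots> = ennreal (C3 * Bk) * (\<integral>\<^sup>+z. ennreal \<bar>m z\<bar> * indicator {z. \<bar>Re z\<bar> \<le> 2} z * ennreal (1 / (1 + cmod z) ^ 3) \<partial>lborel)"
        by (rule nn_integral_cmult) measurable
      also have "\<dots> \<le> ennreal (C3 * Bk) * ennreal T" by (intro mult_left_mono T) auto
      also have "\<dots> = ennreal (C3 * Bk * T)" using C3 Bk T by (simp add: ennreal_mult)
      finally show ?thesis .
    qed
    have Di: "integrable lborel (\<lambda>z. m z * D z)"
    proof (rule integrableI_bounded)
      show "(\<integral>\<^sup>+z. ennreal (norm (m z * D z)) \<partial>lborel) < \<infinity>" using Dnn by (rule le_less_trans) simp
    qed measurable
    have Db: "(\<integral>z. m z * D z \<partial>lborel) \<le> C3 * Bk * T"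
    proof -
      have "ennreal (norm (\<integral>z. m z * D z \<partial>lborel)) \<le> ennreal (C3 * Bk * T)"
        using integral_norm_bound_ennreal[OF Di] Dnn by (rule order_trans)
      then show ?thesis using C3 Bk T by (simp add: ennreal_le_iff abs_le_iff)
    qed
    have G0i: "integrable lborel (\<lambda>z. m z * (w (Im z) * kern (Re z)))"
    proof (rule m_times_bounded(1))
      show "\<bar>w (Im z) * kern (Re z)\<bar> \<le> 1 / r\<^sup>2 * Bk" for z
        unfolding abs_mult using w0[of "Im z"] wle[of "Im z"] kern_nonneg[of "Re z"] Bk(2)[of "Re z"] by (intro mult_mono) auto
      show "w (Im z) * kern (Re z) = 0" if "2 * R + 2 < cmod z" for z
        using that cmod_le[of z] wz[of "Im z"] kern_eq_0[of "Re z"] by (cases "2 \<le> \<bar>Re z\<bar>") auto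
    qed (use rR in auto)
    \<comment> \<open>Absolute integrability on the product: the weight confines \<open>y\<close> to
      |y| \<open>\<le>\<close> 2 R, and the mollifier then confines \<open>z\<close> to a disc, on
      which |M| has finite mass.\<close>
    have pair: "integrable (lborel \<Otimes>\<^sub>M lborel) (\<lambda>(y, z). m z * (g y z * w y))"
    proof (rule integrableI_bounded)
      have "(\<integral>\<^sup>+p. ennreal (norm (case p of (y, z) \<Rightarrow> m z * (g y z * w y))) \<partial>(lborel \<Otimes>\<^sub>M lborel))
        \<le> (\<integral>\<^sup>+p. (ennreal (B / r\<^sup>2) * indicator {-(2*R)..2*R} (fst p)) * (ennreal \<bar>m (snd p)\<bar> * indicator (cball 0 (2 * R + 4)) (snd p)) \<partial>(lborel \<Otimes>\<^sub>M lborel))"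
      proof (intro nn_integral_mono)
        fix p :: "real \<times> complex"
        obtain y z where p: "p = (y, z)" by (cases p)
        define x where "x = m z"
        have "ennreal (norm (x * (g y z * w y))) \<le> (ennreal (B / r\<^sup>2) * indicator {-(2*R)..2*R} y) * (ennreal \<bar>x\<bar> * indicator (cball 0 (2 * R + 4)) z)"
        proof (cases "y \<in> {-(2*R)..2*R} \<and> z \<in> cball 0 (2 * R + 4)")
          case True
          have "g y z * w y \<le> B * (1 / r\<^sup>2)" using g0 w0 wle B by (intro mult_mono) (auto simp: g_def)
          then have "\<bar>x\<bar> * (g y z * w y) \<le> \<bar>x\<bar> * (B / r\<^sup>2)" by (intro mult_left_mono) auto
          then show ?thesis using True g0[of y z] w0[of y] B(1)
            by (simp add: abs_mult ennreal_mult'[symmetric] mult.commute[of _ "\<bar>x\<bar>"] ennreal_leI del: times_divide_eq_right)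
        next
          case False
          have "g y z * w y = 0"
          proof (cases "y \<in> {-(2*R)..2*R}")
            case True
            then have "2 \<le> \<bar>Re z\<bar> \<or> 2 \<le> \<bar>Im z - y\<bar>" using False cmod_le[of z] by (auto simp: not_le)
            then show ?thesis by (simp add: gz)
          next
            case False
            then have "2 * R < \<bar>y\<bar>" by auto
            then show ?thesis by (simp add: wz)
          qed
          then show ?thesis by (simp only: mult_zero_right norm_zero ennreal_0 zero_le)
        qed
        then show "ennreal (norm (case p of (y, z) \<Rightarrow> m z * (g y z * w y))) \<le> (ennreal (B / r\<^sup>2) * indicator {-(2*R)..2*R} (fst p)) * (ennreal \<bar>m (snd p)\<bar> * indicator (cball 0 (2 * R + 4)) (snd p))"
          unfolding p x_def by simp
      qed
      also have "\<dots> = (\<integral>\<^sup>+y. \<integral>\<^sup>+z. (ennreal (B / r\<^sup>2) * indicator {-(2*R)..2*R} y) * (ennreal \<bar>m z\<bar> * indicator (cball 0 (2 * R + 4)) z) \<partial>lborel \<partial>lborel)"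
        by (subst lborel.nn_integral_fst[symmetric]) auto
      also have "\<dots> = (\<integral>\<^sup>+y. (ennreal (B / r\<^sup>2) * indicator {-(2*R)..2*R} y) * (\<integral>\<^sup>+z. ennreal \<bar>m z\<bar> * indicator (cball 0 (2 * R + 4)) z \<partial>lborel) \<partial>lborel)"
        by (intro nn_integral_cong nn_integral_cmult) measurable
      also have "\<dots> = ennreal (B / r\<^sup>2) * ennreal (4 * R) * (\<integral>\<^sup>+z. ennreal \<bar>m z\<bar> * indicator (cball 0 (2 * R + 4)) z \<partial>lborel)"
        using rR by (subst nn_integral_multc) (auto simp: nn_integral_cmult_indicator)
      also have "\<dots> \<le> ennreal (B / r\<^sup>2) * ennreal (4 * R) * ennreal (Cm * (1 + (2 * R + 4)) ^ 3)"
        using rR by (intro mult_left_mono Cm) auto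
      also have "\<dots> < \<infinity>" by (simp add: ennreal_mult_less_top)
      finally show "(\<integral>\<^sup>+p. ennreal (norm (case p of (y, z) \<Rightarrow> m z * (g y z * w y))) \<partial>(lborel \<Otimes>\<^sub>M lborel)) < \<infinity>" .
    qed (unfold g_def, measurable)
    have swap: "(\<integral>z. (\<integral>y. m z * (g y z * w y) \<partial>lborel) \<partial>lborel) = (\<integral>y. (\<integral>z. m z * (g y z * w y) \<partial>lborel) \<partial>lborel)"
      by (rule lborel_pair.Fubini_integral[OF pair])
    have intz: "integrable lborel (\<lambda>y. \<integral>z. m z * (g y z * w y) \<partial>lborel)"
      using lborel_pair.integrable_fst'[OF pair] by simp
    have inner: "(\<integral>z. m z * (g y z * w y) \<partial>lborel) = moll_mean (Complex 0 y) 1 * w y" for y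
      using m_times_mollifier[of 1 "Complex 0 y"] by (simp add: moll_mean_def gmoll mult.assoc[symmetric])
    have "line_weighted r R \<le> (\<integral>y. moll_mean (Complex 0 y) 1 * w y / c0 \<partial>lborel)"
      unfolding line_weighted_def
    proof (rule integral_mono_AE)
      show "integrable lborel (\<lambda>y. m (Complex 0 y) * weight r R (y\<^sup>2))" by (rule line_weighted_integrable[OF rR])
      show "integrable lborel (\<lambda>y. moll_mean (Complex 0 y) 1 * w y / c0)" using intz unfolding inner by simp
      show "AE y in lborel. m (Complex 0 y) * weight r R (y\<^sup>2) \<le> moll_mean (Complex 0 y) 1 * w y / c0"
      proof (rule eventually_mono[OF AE_line_finite[of 0]])
        fix y assume z: "M (Complex 0 y) = ereal (m (Complex 0 y))"
        have "m (Complex 0 y) \<le> moll_mean (Complex 0 y) 1 / c0"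
          using M_le_moll_mean[of 1 "Complex 0 y"] z by (metis ereal_less_eq(3) zero_less_one)
        then have "m (Complex 0 y) * w y \<le> moll_mean (Complex 0 y) 1 / c0 * w y" using w0 by (intro mult_right_mono)
        then show "m (Complex 0 y) * weight r R (y\<^sup>2) \<le> moll_mean (Complex 0 y) 1 * w y / c0" by (simp add: w_def)
      qed simp
    qed
    also have "\<dots> = (\<integral>y. moll_mean (Complex 0 y) 1 * w y \<partial>lborel) / c0" by simp
    also have "(\<integral>y. moll_mean (Complex 0 y) 1 * w y \<partial>lborel) = (\<integral>z. (\<integral>y. m z * (g y z * w y) \<partial>lborel) \<partial>lborel)"
      unfolding swap inner ..
    also have "\<dots> / c0 = (\<integral>z. m z * \<Psi> z \<partial>lborel)"
      by (simp add: \<Psi>_def)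
    also have "\<dots> = (\<integral>z. m z * D z + m z * (w (Im z) * kern (Re z)) \<partial>lborel)"
      by (intro Bochner_Integration.integral_cong) (auto simp: D_def algebra_simps)
    also have "\<dots> = (\<integral>z. m z * D z \<partial>lborel) + smoothed 1 r R"
      using Di G0i by (simp add: smoothed_def w_def)
    finally show "line_weighted r R \<le> smoothed 1 r R + C3 * Bk * T" using Db by linarith
  qed
qed

text \<open>Here \<open>\<epsilon> = 1\<close>, the scale at which the strip kernel is exactly the
  marginal of the mollifier of scale 1.\<close>

lemma line_mean_le_half_mass:
  assumes r0: "0 < r0"
  obtains C where "0 \<le> C" "\<And>r R \<eta>. r0 \<le> r \<Longrightarrow> r < R \<Longrightarrow> \<eta> = 1 \<or> \<eta> = -1 \<Longrightarrow> line_mean r R \<le> 2 * pi * half_mass \<mu> \<eta> r R + C"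
proof -
  obtain C1 where C1: "0 \<le> C1" "\<And>r R \<epsilon> \<eta>. r0 \<le> r \<Longrightarrow> r < R \<Longrightarrow> 0 < \<epsilon> \<Longrightarrow> \<epsilon> \<le> 1 \<Longrightarrow> \<eta> = 1 \<or> \<eta> = -1 \<Longrightarrow>
    \<bar>2 * pi * half_mass \<mu> \<eta> r R - smoothed \<epsilon> r R\<bar> \<le> C1" by (rule carleman_smoothed[OF r0]) (rule that)
  obtain C2 where C2: "0 \<le> C2" "\<And>r R. r0 \<le> r \<Longrightarrow> r < R \<Longrightarrow> \<bar>line_weighted r R - line_mean r R\<bar> \<le> C2"
    by (rule line_weighted_vs_mean[OF r0]) (rule that)
  obtain C3 where C3: "0 \<le> C3" "\<And>r R. r0 \<le> r \<Longrightarrow> r < R \<Longrightarrow> line_weighted r R \<le> smoothed 1 r R + C3"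
    by (rule line_weighted_le_smoothed[OF r0]) (rule that)
  show thesis
  proof (rule that[of "C1 + C2 + C3"])
    show "0 \<le> C1 + C2 + C3" using C1(1) C2(1) C3(1) by simp
    fix r R \<eta> :: real assume a: "r0 \<le> r" "r < R" "\<eta> = 1 \<or> \<eta> = -1"
    show "line_mean r R \<le> 2 * pi * half_mass \<mu> \<eta> r R + (C1 + C2 + C3)"
      using C1(2)[OF a(1,2) zero_less_one order_refl a(3)] C2(2)[OF a(1,2)] C3(2)[OF a(1,2)] by linarith
  qed
qed

end

subsection \<open>Summation over dyadic blocks\<close>

lemma nn_integral_split_le:
  assumes [measurable]: "f \<in> borel_measurable borel"
  shows "(\<integral>\<^sup>+y. f y * indicator {a..c} y \<partial>lborel)
    \<le> (\<integral>\<^sup>+y. f y * indicator {a..b} y \<partial>lborel) + (\<integral>\<^sup>+y. f y * indicator {b..c::real} y \<partial>lborel)"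
proof -
  have "(\<integral>\<^sup>+y. f y * indicator {a..c} y \<partial>lborel)
    \<le> (\<integral>\<^sup>+y. f y * indicator {a..b} y + f y * indicator {b..c} y \<partial>lborel)"
    by (rule nn_integral_mono) (auto simp: indicator_def)
  then show ?thesis by (subst (asm) nn_integral_add) auto
qed

lemma nn_integral_join_le:
  assumes [measurable]: "f \<in> borel_measurable borel" and abc: "a \<le> b" "b \<le> c"
  shows "(\<integral>\<^sup>+y. f y * indicator {a..b} y \<partial>lborel) + (\<integral>\<^sup>+y. f y * indicator {b..c::real} y \<partial>lborel)
    \<le> (\<integral>\<^sup>+y. f y * indicator {a..c} y \<partial>lborel)"
proof -
  have "(\<integral>\<^sup>+y. f y * indicator {a..b} y + f y * indicator {b..c} y \<partial>lborel)
    \<le> (\<integral>\<^sup>+y. f y * indicator {a..c} y \<partial>lborel)"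
  proof (rule nn_integral_mono_AE)
    show "AE y in lborel. f y * indicator {a..b} y + f y * indicator {b..c} y \<le> f y * indicator {a..c} y"
      using AE_lborel_singleton[of b] by eventually_elim (use abc in \<open>auto simp: indicator_def\<close>)
  qed
  then show ?thesis by (subst (asm) nn_integral_add) auto
qed

lemma nn_integral_interval_mono:
  assumes "a' \<le> a" "b \<le> b'"
  shows "(\<integral>\<^sup>+y. f y * indicator {a..b} y \<partial>lborel) \<le> (\<integral>\<^sup>+y. f y * indicator {a'..b'::real} y \<partial>lborel)"
  by (rule nn_integral_mono) (use assms in \<open>auto simp: indicator_def\<close>)

lemma dyadic_bound: "0 < (r::real) \<Longrightarrow> \<exists>n. b \<le> 2 ^ n * 4 * r"
proof -
  assume r: "0 < r"
  obtain n where "b / (4 * r) < 2 ^ n" using real_arch_pow[of 2 "b / (4 * r)"] by auto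
  then have "b \<le> 2 ^ n * 4 * r" using r by (simp add: field_simps)
  then show ?thesis ..
qed

text \<open>Each block is charged to the block on its left, so the charged intervals overlap only in
  endpoints. The induction halves the right end \<open>b\<close> and keeps the stronger bound up to
  \<open>b/2\<close>, which leaves the next block free to be charged; the stretch up to 4 r is
  covered by two blocks and costs \<open>2 * C0\<close>.\<close>

lemma dyadic_backward:
  fixes f h :: "real \<Rightarrow> ennreal"
  assumes f[measurable]: "f \<in> borel_measurable borel" and h[measurable]: "h \<in> borel_measurable borel"
    and r: "0 < r" "r \<le> R"
    and block: "\<And>a b. r \<le> a \<Longrightarrow> a \<le> b \<Longrightarrow> b \<le> 2 * a \<Longrightarrow> b \<le> R \<Longrightarrow> (\<integral>\<^sup>+y. f y * indicator {a..b} y \<partial>lborel) \<le> C0"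
    and step: "\<And>a b. 2 * r \<le> a \<Longrightarrow> a \<le> b \<Longrightarrow> b \<le> 2 * a \<Longrightarrow> b \<le> R \<Longrightarrow>
      (\<integral>\<^sup>+y. f y * indicator {a..b} y \<partial>lborel) \<le> C1 * (\<integral>\<^sup>+y. h y * indicator {a/2..a} y \<partial>lborel)"
  shows "(\<integral>\<^sup>+y. f y * indicator {r..R} y \<partial>lborel) \<le> 2 * C0 + C1 * (\<integral>\<^sup>+y. h y * indicator {r..R} y \<partial>lborel)"
proof -
  let ?F = "\<lambda>a b. \<integral>\<^sup>+y. f y * indicator {a..b} y \<partial>lborel"
  let ?H = "\<lambda>a b. \<integral>\<^sup>+y. h y * indicator {a..b} y \<partial>lborel"
  have base: "?F r b \<le> 2 * C0 + C1 * ?H r (b/2)" if "r \<le> b" "b \<le> R" "b \<le> 4 * r" for b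
  proof (cases "b \<le> 2 * r")
    case True
    have "?F r b \<le> C0" by (rule block) (use that True in auto)
    then show ?thesis unfolding mult_2 by (simp add: add_increasing2 add.assoc)
  next
    case False
    have "?F r b \<le> ?F r (2 * r) + ?F (2 * r) b" by (rule nn_integral_split_le) fact
    also have "\<dots> \<le> C0 + C0" by (intro add_mono block) (use that False r in auto)
    finally show ?thesis unfolding mult_2 by (simp add: add_increasing2)
  qed
  have "?F r b \<le> 2 * C0 + C1 * ?H r (b/2)" if "r \<le> b" "b \<le> R" "b \<le> 2 ^ n * 4 * r" for n b
    using that
  proof (induction n arbitrary: b)
    case 0
    then show ?case by (intro base) auto
  next
    case (Suc n)
    show ?case
    proof (cases "b \<le> 4 * r")
      case True
      then show ?thesis using Suc by (intro base) auto
    next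
      case False
      have "?F r b \<le> ?F r (b/2) + ?F (b/2) b" by (rule nn_integral_split_le) fact
      also have "\<dots> \<le> (2 * C0 + C1 * ?H r (b/2/2)) + C1 * ?H (b/2/2) (b/2)"
        by (intro add_mono Suc.IH step) (use Suc.prems False r in auto)
      also have "\<dots> = 2 * C0 + C1 * (?H r (b/2/2) + ?H (b/2/2) (b/2))" by (simp only: add.assoc distrib_left)
      also have "\<dots> \<le> 2 * C0 + C1 * ?H r (b/2)"
        by (intro add_mono mult_left_mono nn_integral_join_le h order_refl) (use False Suc.prems r in auto)
      finally show ?thesis .
    qed
  qed
  then have "?F r R \<le> 2 * C0 + C1 * ?H r (R/2)" using dyadic_bound[OF r(1), of R] r by auto
  also have "\<dots> \<le> 2 * C0 + C1 * ?H r R"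
    by (intro add_mono mult_left_mono nn_integral_interval_mono order_refl) (use r in auto)
  finally show ?thesis .
qed

text \<open>The mirror image. A block is charged only to a full following block inside the interval,
  so the final stretch is covered by two uncharged blocks.\<close>

lemma dyadic_forward:
  fixes f h :: "real \<Rightarrow> ennreal"
  assumes f[measurable]: "f \<in> borel_measurable borel" and h[measurable]: "h \<in> borel_measurable borel"
    and r: "0 < r" "r \<le> R"
    and block: "\<And>a b. r \<le> a \<Longrightarrow> a \<le> b \<Longrightarrow> b \<le> 2 * a \<Longrightarrow> b \<le> R \<Longrightarrow> (\<integral>\<^sup>+y. f y * indicator {a..b} y \<partial>lborel) \<le> C0"
    and step: "\<And>a. r \<le> a \<Longrightarrow> 4 * a \<le> R \<Longrightarrow>
      (\<integral>\<^sup>+y. f y * indicator {a..2*a} y \<partial>lborel) \<le> C1 * (\<integral>\<^sup>+y. h y * indicator {2*a..4*a} y \<partial>lborel)"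
  shows "(\<integral>\<^sup>+y. f y * indicator {r..R} y \<partial>lborel) \<le> 2 * C0 + C1 * (\<integral>\<^sup>+y. h y * indicator {r..R} y \<partial>lborel)"
proof -
  let ?F = "\<lambda>a b. \<integral>\<^sup>+y. f y * indicator {a..b} y \<partial>lborel"
  let ?H = "\<lambda>a b. \<integral>\<^sup>+y. h y * indicator {a..b} y \<partial>lborel"
  have base: "?F a R \<le> 2 * C0 + C1 * ?H (2 * a) R" if "r \<le> a" "a \<le> R" "R \<le> 4 * a" for a
  proof (cases "R \<le> 2 * a")
    case True
    have "?F a R \<le> C0" by (rule block) (use that True in auto)
    then show ?thesis unfolding mult_2 by (simp add: add_increasing2 add.assoc)
  next
    case False
    have "?F a R \<le> ?F a (2 * a) + ?F (2 * a) R" by (rule nn_integral_split_le) fact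
    also have "\<dots> \<le> C0 + C0" by (intro add_mono block) (use that False r in auto)
    finally show ?thesis unfolding mult_2 by (simp add: add_increasing2)
  qed
  have "?F a R \<le> 2 * C0 + C1 * ?H (2 * a) R" if "r \<le> a" "a \<le> R" "R \<le> 2 ^ n * 4 * a" for n a
    using that
  proof (induction n arbitrary: a)
    case 0
    then show ?case by (intro base) auto
  next
    case (Suc n)
    show ?case
    proof (cases "R \<le> 4 * a")
      case True
      then show ?thesis using Suc by (intro base) auto
    next
      case False
      have IH: "?F (2 * a) R \<le> 2 * C0 + C1 * ?H (2 * (2 * a)) R" by (rule Suc.IH) (use Suc.prems False r in auto)
      have "?F a R \<le> ?F a (2 * a) + ?F (2 * a) R" by (rule nn_integral_split_le) fact
      also have "\<dots> \<le> C1 * ?H (2 * a) (4 * a) + (2 * C0 + C1 * ?H (2 * (2 * a)) R)"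
        by (intro add_mono IH step) (use Suc.prems False r in auto)
      also have "\<dots> = 2 * C0 + C1 * (?H (2 * a) (4 * a) + ?H (4 * a) R)" by (simp add: ac_simps distrib_left)
      also have "\<dots> \<le> 2 * C0 + C1 * ?H (2 * a) R"
        by (intro add_mono mult_left_mono nn_integral_join_le h order_refl) (use False Suc.prems r in auto)
      finally show ?thesis .
    qed
  qed
  then have "?F r R \<le> 2 * C0 + C1 * ?H (2 * r) R" using dyadic_bound[OF r(1), of R] r by auto
  also have "\<dots> \<le> 2 * C0 + C1 * ?H r R"
    by (intro add_mono mult_left_mono nn_integral_interval_mono order_refl) (use r in auto)
  finally show ?thesis .
qed

lemma half_mass_eq_l_rh: "half_mass \<mu> 1 r R = l_rh \<mu> r R"
  unfolding half_mass_def l_rh_def by (simp add: Re_divide cmod_def power2_eq_square)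

lemma half_mass_eq_l_lh: "half_mass \<mu> (-1) r R = l_lh \<mu> r R"
  unfolding half_mass_def l_lh_def by (simp add: Re_divide cmod_def power2_eq_square)

text \<open>Circular means and the values of \<open>q0\<close> may be infinite. Splitting into
  positive parts avoids subtracting infinities: a summand equal to plus infinity makes the
  right-hand side infinite as well.\<close>

lemma e2ennreal_excess:
  assumes "0 \<le> p1" "0 \<le> p2" and "ereal a \<le> c1 + c2 + p1 + p2"
  shows "ennreal (a - (x1 + x2)) \<le> e2ennreal (c1 - ereal x1) + e2ennreal (c2 - ereal x2) + e2ennreal (p1 + p2)"
proof -
  have real: "ennreal (a - (x1 + x2)) \<le> ennreal (s1 - x1) + ennreal (s2 - x2) + ennreal p"
    if "a \<le> s1 + s2 + p" for s1 s2 p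
  proof -
    have "ennreal (a - (x1 + x2)) \<le> ennreal ((s1 - x1) + (s2 - x2) + p)" by (rule ennreal_leI) (use that in simp)
    also have "\<dots> \<le> ennreal ((s1 - x1) + (s2 - x2)) + ennreal p" by (rule ennreal_add_le)
    also have "\<dots> \<le> ennreal (s1 - x1) + ennreal (s2 - x2) + ennreal p"
      by (rule add_right_mono) (rule ennreal_add_le)
    finally show ?thesis .
  qed
  have p: "0 \<le> p1 + p2" "ereal a \<le> c1 + c2 + (p1 + p2)" using assms by (auto simp: add.assoc)
  obtain p where pdef: "p = p1 + p2" by simp
  show ?thesis
    using p real unfolding pdef[symmetric]
    by (cases c1; cases c2; cases p) auto
qed

context finite_type_subharmonic
begin

lemma circ_mean_zero: 
  assumes z: "M z = ereal x" shows "circ_mean M z 0 = ereal x"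
proof -
  have "circ_mean M z 0 = (ereal (\<bar>x\<bar> * (2 * pi)) - enn2ereal (circ_defect \<bar>x\<bar> M z (of_real 0))) / ereal (2 * pi)"
    by (rule circ_mean_eq) (use z in auto)
  also have "circ_defect \<bar>x\<bar> M z (of_real 0) = ennreal (2 * pi * (\<bar>x\<bar> - x))"
    using z by (simp add: circ_defect_0 ennreal_mult)
  also have "(ereal (\<bar>x\<bar> * (2 * pi)) - enn2ereal (ennreal (2 * pi * (\<bar>x\<bar> - x)))) / ereal (2 * pi) = ereal x"
    by (subst enn2ereal_ennreal) (auto simp: field_simps)
  finally show ?thesis by simp
qed

text \<open>The case \<open>b = 0\<close> is separate because \<open>q\<close> may vanish: the
  mollifier needs a positive scale, whereas the circular mean of radius 0 is the value
  itself.\<close>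

lemma circ_mean_defect:
  assumes t: "0 \<le> t" "t \<le> b" and z: "M z = ereal (m z)"
  shows "e2ennreal (circ_mean M z t - ereal (m z)) \<le> ennreal (pi / c0) * log_potential (2 * b) z"
proof (cases "b = 0")
  case True
  then have "t = 0" using t by simp
  moreover obtain x where x: "M z = ereal x" using z by blast
  ultimately show ?thesis by (simp add: circ_mean_zero[OF x] e2ennreal_neg)
next
  case False
  then have b: "0 < b" using t by simp
  have "circ_mean M z t - ereal (m z) \<le> ereal (moll_mean z b / c0) - M z"
    unfolding z[symmetric] by (intro ereal_minus_mono circ_mean_le_moll_mean t b order_refl)
  then have "e2ennreal (circ_mean M z t - ereal (m z)) \<le> e2ennreal (ereal (moll_mean z b / c0) - M z)"
    by (rule e2ennreal_mono)
  also have "\<dots> \<le> ennreal (pi / c0) * log_potential (2 * b) z" by (rule moll_mean_defect[OF b])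
  finally show ?thesis .
qed

end

subsection \<open>The radius term\<close>

definition tail_sup :: "real \<Rightarrow> (real \<Rightarrow> real) \<Rightarrow> real \<Rightarrow> ereal" where
  "tail_sup N q t = (SUP s\<in>{t..}. ereal ((q s + q (- s)) / s powr (2 + N)))"

text \<open>The tail supremum decreases in \<open>t\<close>, so its superlevel sets are
  intervals.\<close>

lemma measurable_tail_sup[measurable]: "tail_sup N q \<in> borel_measurable borel"
proof (rule borel_measurableI_greater)
  fix y :: ereal
  have "is_interval {t. y < tail_sup N q t}"
    unfolding is_interval_1
  proof (intro ballI allI impI)
    fix a b x assume *: "a \<in> {t. y < tail_sup N q t}" "b \<in> {t. y < tail_sup N q t}" "a \<le> x \<and> x \<le> b"
    have "tail_sup N q b \<le> tail_sup N q x" unfolding tail_sup_def by (rule SUP_subset_mono) (use * in auto)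
    then show "x \<in> {t. y < tail_sup N q t}" using * by auto
  qed
  then have "{t. y < tail_sup N q t} \<in> sets borel" by (rule real_interval_borel_measurable)
  then show "{t \<in> space borel. y < tail_sup N q t} \<in> sets borel" by simp
qed

text \<open>The largest value that the tail supremum admits for \<open>q y + q (- y)\<close>. It
  replaces the radii themselves because, unlike them, it is controlled by the supremum at earlier
  points.\<close>

definition tail_radius :: "real \<Rightarrow> (real \<Rightarrow> real) \<Rightarrow> real \<Rightarrow> real" where
  "tail_radius N q y = y powr (2 + N) * real_of_ereal (tail_sup N q y)"

lemma measurable_tail_radius[measurable]: "tail_radius N q \<in> borel_measurable borel"
  unfolding tail_radius_def by measurable

lemma linear_bound_of_Limsup:
  fixes q :: "real \<Rightarrow> real"
  assumes cont: "continuous_on UNIV q" and growth: "Limsup at_infinity (\<lambda>y. ereal (q y / \<bar>y\<bar>)) < 1"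
    and r0: "0 < r0"
  obtains B where "0 \<le> B" "\<And>s. r0 \<le> s \<Longrightarrow> q s + q (- s) \<le> B * s"
proof -
  have "eventually (\<lambda>y. ereal (q y / \<bar>y\<bar>) < 1) at_infinity" by (rule Limsup_lessD[OF growth])
  then obtain b where b: "\<And>y. b \<le> \<bar>y\<bar> \<Longrightarrow> q y / \<bar>y\<bar> < 1"
    unfolding eventually_at_infinity by (auto simp: one_ereal_def)
  have "compact (q ` {-\<bar>b\<bar>..\<bar>b\<bar>})" by (intro compact_continuous_image continuous_on_subset[OF cont]) auto
  then obtain K where "\<forall>y\<in>{-\<bar>b\<bar>..\<bar>b\<bar>}. \<bar>q y\<bar> \<le> K"
    by (fastforce dest!: compact_imp_bounded simp: bounded_iff simp del: atLeastAtMost_iff)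
  then have K: "\<And>y. y \<in> {-\<bar>b\<bar>..\<bar>b\<bar>} \<Longrightarrow> \<bar>q y\<bar> \<le> K" by (rule bspec)
  have K0: "0 \<le> K" using K[of 0] by auto
  have q: "q y \<le> \<bar>y\<bar> + K" for y
  proof (cases "b \<le> \<bar>y\<bar> \<and> y \<noteq> 0")
    case True
    then have "q y < \<bar>y\<bar>" using b[of y] by (simp add: divide_simps)
    then show ?thesis using K0 by simp
  next
    case False
    then have "\<bar>q y\<bar> \<le> K" by (intro K) auto
    then show ?thesis by auto
  qed
  show ?thesis
  proof (rule that[of "2 + 2 * K / r0"])
    show "0 \<le> 2 + 2 * K / r0" using K0 r0 by simp
    fix s assume s: "r0 \<le> s"
    have "K * r0 \<le> K * s" using s K0 by (rule mult_left_mono)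
    then have "K \<le> K / r0 * s" using r0 by (simp add: field_simps)
    moreover have "(2 + 2 * K / r0) * s = 2 * s + 2 * (K / r0 * s)" by (simp add: algebra_simps)
    ultimately show "q s + q (- s) \<le> (2 + 2 * K / r0) * s" using q[of s] q[of "-s"] s r0 by linarith
  qed
qed

text \<open>The linear bound on \<open>q\<close> makes the supremum at \<open>t\<close> finite, at
  most B / t^(1 + N), so that radii drawn from it stay comparable with the distance to the
  origin.\<close>

lemma tail_sup_facts:
  fixes q :: "real \<Rightarrow> real"
  assumes q0: "\<And>y. 0 \<le> q y" and r0: "0 < r0" and N: "0 \<le> N"
    and B: "0 \<le> B" "\<And>s. r0 \<le> s \<Longrightarrow> q s + q (- s) \<le> B * s" and t: "r0 \<le> t"
  shows "tail_sup N q t = ereal (real_of_ereal (tail_sup N q t))" "0 \<le> real_of_ereal (tail_sup N q t)"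
    and "real_of_ereal (tail_sup N q t) * t powr (1 + N) \<le> B"
    and "t \<le> s \<Longrightarrow> q s + q (- s) \<le> s powr (2 + N) * real_of_ereal (tail_sup N q t)"
proof -
  have le: "ereal ((q s + q (- s)) / s powr (2 + N)) \<le> tail_sup N q t" if "t \<le> s" for s
    unfolding tail_sup_def by (rule SUP_upper) (use that in auto)
  have "0 \<le> ereal ((q t + q (- t)) / t powr (2 + N))" using q0[of t] q0[of "-t"] by simp
  then have pos: "0 \<le> tail_sup N q t" using le[of t] by (meson order_trans order_refl)
  have up: "tail_sup N q t \<le> ereal (B / t powr (1 + N))"
    unfolding tail_sup_def
  proof (rule SUP_least)
    fix s assume "s \<in> {t..}"
    then have s: "t \<le> s" by simp
    then have s0: "0 < s" using t r0 by simp
    have "(q s + q (- s)) / s powr (2 + N) \<le> B * s / s powr (2 + N)"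
      by (intro divide_right_mono B) (use s t in auto)
    also have "\<dots> = B / s powr (1 + N)" using s0 powr_add[of s 1 "1 + N"] by (simp add: add.assoc[symmetric])
    also have "\<dots> \<le> B / t powr (1 + N)"
      using s s0 t r0 B(1) N by (intro divide_left_mono powr_mono2 mult_pos_pos) auto
    finally show "ereal ((q s + q (- s)) / s powr (2 + N)) \<le> ereal (B / t powr (1 + N))" by simp
  qed
  obtain v where v: "tail_sup N q t = ereal v" using pos up by (cases "tail_sup N q t") auto
  show "tail_sup N q t = ereal (real_of_ereal (tail_sup N q t))" "0 \<le> real_of_ereal (tail_sup N q t)"
    using v pos by simp_all
  show "real_of_ereal (tail_sup N q t) * t powr (1 + N) \<le> B"
    using up t r0 unfolding v by (simp add: field_simps)
  show "q s + q (- s) \<le> s powr (2 + N) * real_of_ereal (tail_sup N q t)" if "t \<le> s"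
    using le[OF that] that t r0 unfolding v by (simp add: field_simps)
qed

lemma tail_sup_antimono: "a \<le> b \<Longrightarrow> tail_sup N q b \<le> tail_sup N q a"
  unfolding tail_sup_def by (rule SUP_subset_mono) auto

context finite_type_subharmonic
begin

lemma log_potential_mono: "b \<le> b' \<Longrightarrow> 0 \<le> b \<Longrightarrow> log_potential b w \<le> log_potential b' w"
  unfolding log_potential_def by (intro nn_integral_mono log_kernel_mono)

lemma measurable_log_potential_comp:
  assumes [measurable]: "f \<in> borel_measurable borel" "g \<in> borel_measurable borel"
  shows "(\<lambda>x::real. log_potential (f x) (g x)) \<in> borel_measurable borel"
proof -
  interpret sigma_finite_measure \<mu> by (rule sigma_finite_mu)
  note [measurable_cong] = sets_mu
  show ?thesis unfolding log_potential_def log_kernel_def by measurable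
qed

text \<open>With \<open>\<tau>\<close> equal to the truncation radius the logarithm vanishes, and
  the bound becomes proportional to that radius.\<close>

lemma line_log_potential_le:
  assumes S[measurable]: "S \<in> sets borel" and S\<rho>: "S \<subseteq> {-\<rho>..\<rho>}" and \<rho>: "0 \<le> \<rho>" and k: "0 \<le> k"
  shows "(\<integral>\<^sup>+y. log_potential (2 * k) (Complex 0 y) * indicator S y \<partial>lborel) \<le> ennreal (16 * k * (Cmu * (3 + \<rho> + 2 * k)))"
proof -
  have pos: "(\<integral>\<^sup>+y. log_potential (2 * d) (Complex 0 y) * indicator S y \<partial>lborel) \<le> ennreal (16 * d * (Cmu * (3 + \<rho> + 2 * d)))"
    if d: "0 < d" for d
  proof -
    have "(\<integral>\<^sup>+y. log_potential (2 * d) (Complex 0 y) * indicator S y \<partial>lborel)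
      \<le> (ennreal (ln (2 * d / (2 * d))) * emeasure lborel S + ennreal (8 * (2 * d))) * ennreal (Cmu * (3 + \<rho> + 2 * d))"
      by (rule line_log_potential[OF S S\<rho>]) (use d \<rho> in auto)
    also have "\<dots> = ennreal (16 * d * (Cmu * (3 + \<rho> + 2 * d)))"
      using d \<rho> Cmu(1) by (simp add: ennreal_mult)
    finally show ?thesis .
  qed
  show ?thesis
  proof (cases "k = 0")
    case False
    then show ?thesis using k by (intro pos) simp
  next
    \<comment> \<open>For \<open>k = 0\<close> the kernel is still infinite at its centre, so the
      potential detects atoms of \<open>\<mu>\<close>; it is dominated by potentials of arbitrarily
      small positive radius.\<close>
    case True
    have "(\<integral>\<^sup>+y. log_potential (2 * k) (Complex 0 y) * indicator S y \<partial>lborel) \<le> 0"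
    proof (rule ennreal_le_epsilon)
      fix e :: real assume e: "0 < e"
      define L where "L = 16 * (Cmu * (5 + \<rho>)) + 1"
      have L: "0 < L" using Cmu(1) \<rho> by (simp add: L_def add_nonneg_pos)
      define d where "d = min 1 (e / L)"
      have d: "0 < d" "d \<le> 1" "d * L \<le> e" using e L by (auto simp: d_def min_def field_simps)
      have "(\<integral>\<^sup>+y. log_potential (2 * k) (Complex 0 y) * indicator S y \<partial>lborel)
        \<le> (\<integral>\<^sup>+y. log_potential (2 * d) (Complex 0 y) * indicator S y \<partial>lborel)"
        by (intro nn_integral_mono mult_right_mono log_potential_mono) (use True d in auto)
      also have "\<dots> \<le> ennreal (16 * d * (Cmu * (3 + \<rho> + 2 * d)))" by (rule pos[OF d(1)])
      also have "\<dots> \<le> ennreal e"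
      proof (rule ennreal_leI)
        have "16 * d * (Cmu * (3 + \<rho> + 2 * d)) \<le> 16 * d * (Cmu * (5 + \<rho>))"
          using d \<rho> Cmu(1) by (intro mult_left_mono) auto
        also have "\<dots> \<le> d * L" using d by (simp add: L_def algebra_simps)
        finally show "16 * d * (Cmu * (3 + \<rho> + 2 * d)) \<le> e" by (rule order_trans) (rule d(3))
      qed
      finally show "(\<integral>\<^sup>+y. log_potential (2 * k) (Complex 0 y) * indicator S y \<partial>lborel) \<le> 0 + ennreal e" by simp
    qed
    then show ?thesis by simp
  qed
qed

definition tail_potential :: "real \<Rightarrow> (real \<Rightarrow> real) \<Rightarrow> real \<Rightarrow> ennreal" where
  "tail_potential N q y = (log_potential (2 * tail_radius N q y) (Complex 0 y)
     + log_potential (2 * tail_radius N q y) (Complex 0 (- y))) * ennreal (1 / y\<^sup>2)"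

lemma measurable_tail_potential[measurable]: "tail_potential N q \<in> borel_measurable borel"
proof -
  have [measurable]: "(\<lambda>y. Complex 0 (f y)) \<in> borel_measurable borel" if [measurable]: "f \<in> borel_measurable borel"
    for f :: "real \<Rightarrow> real"
    unfolding Complex_eq by measurable
  have [measurable]: "(\<lambda>y. log_potential (2 * tail_radius N q y) (Complex 0 y)) \<in> borel_measurable borel"
    "(\<lambda>y. log_potential (2 * tail_radius N q y) (Complex 0 (- y))) \<in> borel_measurable borel"
    by (rule measurable_log_potential_comp; measurable)+
  show ?thesis unfolding tail_potential_def by measurable
qed

lemma tail_potential_block:
  assumes a: "0 < a" "a \<le> b" "b \<le> 2 * a" and k: "0 \<le> k"
    and rad: "\<And>y. a \<le> y \<Longrightarrow> y \<le> b \<Longrightarrow> 0 \<le> tail_radius N q y \<and> tail_radius N q y \<le> k"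
  shows "(\<integral>\<^sup>+y. tail_potential N q y * indicator {a..b} y \<partial>lborel) \<le> ennreal (32 * k * (Cmu * (3 + 2 * a + 2 * k)) / a\<^sup>2)"
proof -
  have [measurable]: "(\<lambda>y. log_potential (2 * k) (Complex 0 y)) \<in> borel_measurable borel"
    "(\<lambda>y. log_potential (2 * k) (Complex 0 (- y))) \<in> borel_measurable borel"
    unfolding Complex_eq by measurable
  let ?X = "16 * k * (Cmu * (3 + 2 * a + 2 * k))"
  have X: "0 \<le> ?X" using k a Cmu(1) by simp
  have 1: "(\<integral>\<^sup>+y. log_potential (2 * k) (Complex 0 y) * indicator {a..b} y \<partial>lborel) \<le> ennreal ?X"
    by (rule line_log_potential_le) (use a k in auto)
  have "(\<integral>\<^sup>+y. log_potential (2 * k) (Complex 0 (- y)) * indicator {a..b} y \<partial>lborel)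
    = (\<integral>\<^sup>+y. log_potential (2 * k) (Complex 0 y) * indicator {-b..-a} y \<partial>lborel)"
    by (subst nn_integral_real_affine[of _ "-1" 0]) (auto intro!: nn_integral_cong simp: indicator_def)
  also have "\<dots> \<le> ennreal ?X" by (rule line_log_potential_le) (use a k in auto)
  finally have 2: "(\<integral>\<^sup>+y. log_potential (2 * k) (Complex 0 (- y)) * indicator {a..b} y \<partial>lborel) \<le> ennreal ?X" .
  have "(\<integral>\<^sup>+y. tail_potential N q y * indicator {a..b} y \<partial>lborel)
    \<le> (\<integral>\<^sup>+y. ennreal (1 / a\<^sup>2) * (log_potential (2 * k) (Complex 0 y) * indicator {a..b} y
        + log_potential (2 * k) (Complex 0 (- y)) * indicator {a..b} y) \<partial>lborel)"
  proof (rule nn_integral_mono)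
    fix y
    show "tail_potential N q y * indicator {a..b} y \<le> ennreal (1 / a\<^sup>2) * (log_potential (2 * k) (Complex 0 y) * indicator {a..b} y
        + log_potential (2 * k) (Complex 0 (- y)) * indicator {a..b} y)"
    proof (cases "y \<in> {a..b}")
      case True
      have "a\<^sup>2 \<le> y\<^sup>2" using True a by (intro power_mono) auto
      then have "1 / y\<^sup>2 \<le> 1 / a\<^sup>2" using a by (intro divide_left_mono mult_pos_pos) (auto intro: less_le_trans)
      then have "tail_potential N q y \<le> (log_potential (2 * k) (Complex 0 y) + log_potential (2 * k) (Complex 0 (- y))) * ennreal (1 / a\<^sup>2)"
        unfolding tail_potential_def by (intro mult_mono add_mono log_potential_mono ennreal_leI) (use True rad[of y] in auto)
      then show ?thesis using True by (simp add: mult.commute)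
    qed simp
  qed
  also have "\<dots> = ennreal (1 / a\<^sup>2) * ((\<integral>\<^sup>+y. log_potential (2 * k) (Complex 0 y) * indicator {a..b} y \<partial>lborel)
        + (\<integral>\<^sup>+y. log_potential (2 * k) (Complex 0 (- y)) * indicator {a..b} y \<partial>lborel))"
    by (subst nn_integral_cmult, measurable, subst nn_integral_add, measurable)
  also have "\<dots> \<le> ennreal (1 / a\<^sup>2) * (ennreal ?X + ennreal ?X)" by (intro mult_left_mono add_mono 1 2) simp
  also have "\<dots> = ennreal (1 / a\<^sup>2 * (?X + ?X))" using X by (simp only: ennreal_plus[symmetric]) (rule ennreal_mult[symmetric], auto)
  also have "1 / a\<^sup>2 * (?X + ?X) = 32 * k * (Cmu * (3 + 2 * a + 2 * k)) / a\<^sup>2" by (simp add: field_simps)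
  finally show ?thesis .
qed

text \<open>On a block starting at \<open>a\<close> the radii are at most k = (2 a)^(2 + N)
  \<open>v a\<close> = O(a), and the potential contributes O(k / a). As \<open>v\<close> decreases,
  \<open>v a\<close> is a lower bound for \<open>v\<close> on the preceding block from a/2 to a, so
  the integrand of \<open>I_N\<close> there has integral at least a fixed multiple of k / a. The
  supremum over all later points in \<open>I_N\<close> is what makes this comparison
  possible.\<close>

lemma tail_potential_integral:
  fixes q :: "real \<Rightarrow> real"
  assumes q0: "\<And>y. 0 \<le> q y" and cont: "continuous_on UNIV q"
    and growth: "Limsup at_infinity (\<lambda>y. ereal (q y / \<bar>y\<bar>)) < 1" and r0: "0 < r0" and N: "0 \<le> N"
  obtains C where "0 \<le> C" "\<And>r R. r0 \<le> r \<Longrightarrow> r < R \<Longrightarrow>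
      (\<integral>\<^sup>+y. tail_potential N q y * indicator {r..R} y \<partial>lborel)
        \<le> ennreal C + ennreal C * (\<integral>\<^sup>+t. ennreal (t powr N) * e2ennreal (tail_sup N q t) * indicator {r..R} t \<partial>lborel)"
proof -
  obtain B where B: "0 \<le> B" "\<And>s. r0 \<le> s \<Longrightarrow> q s + q (- s) \<le> B * s"
    using linear_bound_of_Limsup[OF cont growth r0] by blast
  define v where "v t = real_of_ereal (tail_sup N q t)" for t
  note tf = tail_sup_facts[OF q0 r0 N B, folded v_def]
  define \<kappa> where "\<kappa> = 2 powr (2 + N) * B"
  define L where "L = Cmu * (3 / r0 + 2 + 2 * \<kappa>)"
  have \<kappa>: "0 \<le> \<kappa>" using B by (simp add: \<kappa>_def)
  have L: "0 \<le> L" using \<kappa> r0 Cmu(1) by (simp add: L_def)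
  have vmono: "v b \<le> v a" if "r0 \<le> a" "a \<le> b" for a b
    using tail_sup_antimono[OF that(2), of N q] tf(1)[of a] tf(1)[of b] that by (metis ereal_less_eq(3) order_trans)
  have blk: "(\<integral>\<^sup>+y. tail_potential N q y * indicator {a..b} y \<partial>lborel) \<le> ennreal (32 * L * ((2 * a) powr (2 + N) * v a) / a)"
    "(2 * a) powr (2 + N) * v a \<le> \<kappa> * a"
    if a: "r0 \<le> a" "a \<le> b" "b \<le> 2 * a" for a b
  proof -
    define k where "k = (2 * a) powr (2 + N) * v a"
    have a0: "0 < a" using a r0 by simp
    have k: "0 \<le> k" using tf(2)[of a] a by (simp add: k_def)
    have "k = 2 powr (2 + N) * (v a * a powr (1 + N)) * a"
      using a0 powr_add[of a 1 "1 + N"] by (simp add: k_def powr_mult add.assoc[symmetric])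
    also have "\<dots> \<le> 2 powr (2 + N) * B * a" using tf(3)[of a] a a0 by (intro mult_right_mono mult_left_mono) auto
    finally show kk: "(2 * a) powr (2 + N) * v a \<le> \<kappa> * a" unfolding k_def \<kappa>_def .
    have "(\<integral>\<^sup>+y. tail_potential N q y * indicator {a..b} y \<partial>lborel) \<le> ennreal (32 * k * (Cmu * (3 + 2 * a + 2 * k)) / a\<^sup>2)"
    proof (rule tail_potential_block)
      fix y assume y: "a \<le> y" "y \<le> b"
      have "0 \<le> v y" by (rule tf(2)) (use y a in auto)
      moreover have "y powr (2 + N) * v y \<le> (2 * a) powr (2 + N) * v a"
        using y a a0 N calculation by (intro mult_mono powr_mono2 vmono) auto
      ultimately show "0 \<le> tail_radius N q y \<and> tail_radius N q y \<le> k"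
        unfolding tail_radius_def k_def v_def by simp
    qed (use a a0 k in auto)
    also have "\<dots> \<le> ennreal (32 * L * k / a)"
    proof (rule ennreal_leI)
      have "3 = 3 / r0 * r0" using r0 by simp
      also have "\<dots> \<le> 3 / r0 * a" using a r0 by (intro mult_left_mono) auto
      finally have "3 + 2 * a + 2 * k \<le> (3 / r0 + 2 + 2 * \<kappa>) * a" using kk by (simp add: k_def algebra_simps)
      then have "Cmu * (3 + 2 * a + 2 * k) \<le> L * a" using Cmu(1) unfolding L_def mult.assoc by (rule mult_left_mono)
      then have "32 * k * (Cmu * (3 + 2 * a + 2 * k)) / a\<^sup>2 \<le> 32 * k * (L * a) / a\<^sup>2"
        using k a0 by (intro divide_right_mono mult_left_mono) auto
      also have "\<dots> = 32 * L * k / a" using a0 by (simp add: field_simps power2_eq_square)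
      finally show "32 * k * (Cmu * (3 + 2 * a + 2 * k)) / a\<^sup>2 \<le> 32 * L * k / a" .
    qed
    finally show "(\<integral>\<^sup>+y. tail_potential N q y * indicator {a..b} y \<partial>lborel) \<le> ennreal (32 * L * ((2 * a) powr (2 + N) * v a) / a)"
      unfolding k_def .
  qed
  define C0 where "C0 = 32 * L * \<kappa>"
  \<comment> \<open>With a = 2 p one has (2 a)^(2 + N) = 4^(2 + N) p^2 p^N and 32 / a = 16 /
    p.\<close>
  define C1 where "C1 = 16 * L * 4 powr (2 + N)"
  have C01: "0 \<le> C0" "0 \<le> C1" using L \<kappa> by (auto simp: C0_def C1_def)
  show ?thesis
  proof (rule that[of "2 * C0 + C1"])
    show "0 \<le> 2 * C0 + C1" using C01 by simp
    fix r R assume rR: "r0 \<le> r" "r < R"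
    let ?h = "\<lambda>t. ennreal (t powr N) * e2ennreal (tail_sup N q t)"
    have "(\<integral>\<^sup>+y. tail_potential N q y * indicator {r..R} y \<partial>lborel)
      \<le> 2 * ennreal C0 + ennreal C1 * (\<integral>\<^sup>+t. ?h t * indicator {r..R} t \<partial>lborel)"
    proof (rule dyadic_backward)
      show "?h \<in> borel_measurable borel" by measurable
      fix a b assume a: "a \<le> b" "b \<le> 2 * a" "b \<le> R"
      show "(\<integral>\<^sup>+y. tail_potential N q y * indicator {a..b} y \<partial>lborel) \<le> ennreal C0" if "r \<le> a"
      proof -
        have ra: "r0 \<le> a" "0 < a" using that rR r0 by auto
        have "32 * L * ((2 * a) powr (2 + N) * v a) / a \<le> 32 * L * (\<kappa> * a) / a"
          using ra L blk(2)[OF ra(1) a(1,2)] by (intro divide_right_mono mult_left_mono) auto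
        also have "\<dots> = C0" using ra by (simp add: C0_def)
        finally show ?thesis using blk(1)[OF ra(1) a(1,2)] by (meson ennreal_leI order_trans)
      qed
      show "(\<integral>\<^sup>+y. tail_potential N q y * indicator {a..b} y \<partial>lborel) \<le> ennreal C1 * (\<integral>\<^sup>+t. ?h t * indicator {a/2..a} t \<partial>lborel)"
        if "2 * r \<le> a"
      proof -
        define p where "p = a / 2"
        have ap: "a = 2 * p" by (simp add: p_def)
        have p: "r0 \<le> p" "0 < p" using that rR r0 by (auto simp: p_def)
        have va: "0 \<le> v a" by (rule tf(2)) (use p ap in auto)
        have "ennreal (p powr N * v a) * ennreal p = (\<integral>\<^sup>+t. ennreal (p powr N * v a) * indicator {p..a} t \<partial>lborel)"
          using p by (subst nn_integral_cmult_indicator) (auto simp: ap)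
        also have "\<dots> \<le> (\<integral>\<^sup>+t. ?h t * indicator {p..a} t \<partial>lborel)"
        proof (rule nn_integral_mono)
          fix t
          show "ennreal (p powr N * v a) * indicator {p..a} t \<le> ?h t * indicator {p..a} t"
          proof (cases "t \<in> {p..a}")
            case True
            have vt: "0 \<le> v t" by (rule tf(2)) (use True p in auto)
            have "p powr N * v a \<le> t powr N * v t"
              using True p va N by (intro mult_mono powr_mono2 vmono) auto
            then have "ennreal (p powr N * v a) \<le> ennreal (t powr N) * ennreal (v t)"
              using vt by (subst ennreal_mult[symmetric]) (auto intro: ennreal_leI)
            also have "ennreal (v t) = e2ennreal (tail_sup N q t)"
              using tf(1)[of t] True p by (metis atLeastAtMost_iff e2ennreal_ereal order_trans)
            finally show ?thesis using True by simp
          qed simp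
        qed
        finally have low: "ennreal (p powr N * v a * p) \<le> (\<integral>\<^sup>+t. ?h t * indicator {a/2..a} t \<partial>lborel)"
          using p va by (simp add: ennreal_mult[symmetric] p_def[symmetric])
        have e: "32 * L * ((2 * a) powr (2 + N) * v a) / a = C1 * (p powr N * v a * p)"
        proof -
          have "(2 * a) powr (2 + N) = 4 powr (2 + N) * (p powr 2 * p powr N)"
            using p by (simp add: ap powr_mult powr_add)
          also have "p powr 2 = p * p" using p by (simp add: power2_eq_square)
          finally show ?thesis using p by (simp add: C1_def ap)
        qed
        have "(\<integral>\<^sup>+y. tail_potential N q y * indicator {a..b} y \<partial>lborel) \<le> ennreal (C1 * (p powr N * v a * p))"
          unfolding e[symmetric] by (rule blk(1)) (use a p ap in auto)
        also have "\<dots> = ennreal C1 * ennreal (p powr N * v a * p)"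
          using C01 p va by (intro ennreal_mult) auto
        also have "\<dots> \<le> ennreal C1 * (\<integral>\<^sup>+t. ?h t * indicator {a/2..a} t \<partial>lborel)"
          by (rule mult_left_mono[OF low]) simp
        finally show ?thesis .
      qed
    qed (use rR r0 in auto)
    also have "\<dots> \<le> ennreal (2 * C0 + C1) + ennreal (2 * C0 + C1) * (\<integral>\<^sup>+t. ?h t * indicator {r..R} t \<partial>lborel)"
    proof (intro add_mono mult_right_mono)
      have "2 * ennreal C0 = ennreal (2 * C0)" using C01 by (simp add: ennreal_mult)
      then show "2 * ennreal C0 \<le> ennreal (2 * C0 + C1)" using C01 by (simp add: ennreal_leI)
    qed (use C01 in \<open>auto intro: ennreal_leI\<close>)
    finally show "(\<integral>\<^sup>+y. tail_potential N q y * indicator {r..R} y \<partial>lborel)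
        \<le> ennreal (2 * C0 + C1) + ennreal (2 * C0 + C1) * (\<integral>\<^sup>+t. ?h t * indicator {r..R} t \<partial>lborel)" .
  qed
qed

end

subsection \<open>The exceptional set\<close>

text \<open>The factor e in the logarithm makes this increasing in \<open>m\<close> up to
  \<open>t\<close>: for positive \<open>m\<close> the derivative is ln (t / m).\<close>

definition entropy :: "real \<Rightarrow> real \<Rightarrow> real" where
  "entropy m t = (if m = 0 then 0 else m * ln (exp 1 * t / m))"

lemma qE_eq_entropy: "qE E x = entropy (measure lebesgue (E \<inter> {0..\<bar>x\<bar>})) \<bar>x\<bar>"
  by (simp add: qE_def entropy_def Let_def)

lemma entropy_eq: "0 < m \<Longrightarrow> 0 < t \<Longrightarrow> entropy m t = m * (1 + ln t - ln m)"
  by (simp add: entropy_def ln_div ln_mult)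

lemma entropy_mono:
  assumes "0 \<le> m" "m \<le> m'" "m' \<le> t'" "m \<le> t" "t \<le> t'" shows "entropy m t \<le> entropy m' t'"
proof (cases "m = 0")
  case True
  show ?thesis
  proof (cases "m' = 0")
    case True
    then show ?thesis using \<open>m = 0\<close> by (simp add: entropy_def)
  next
    case False
    then have "0 < m'" "0 < t'" using assms by auto
    moreover have "ln m' \<le> 1 + ln t'" using assms calculation ln_mono[of m' t'] by linarith
    ultimately have "0 \<le> entropy m' t'" by (simp add: entropy_eq)
    then show ?thesis using True by (simp add: entropy_def)
  qed
next
  case False
  then have m: "0 < m" "0 < m'" "0 < t" "0 < t'" using assms by auto
  have "entropy m t \<le> m * (1 + ln t' - ln m)" unfolding entropy_eq[OF m(1,3)]
    using assms m by (intro mult_left_mono) auto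
  also have "\<dots> \<le> m' * (1 + ln t' - ln m')"
  proof -
    \<comment> \<open>The tangent bound of the logarithm pays for replacing \<open>m\<close> by
      \<open>m'\<close> inside it; what is left has the sign of ln (t' / m').\<close>
    have "ln (m' / m) \<le> m' / m - 1" using m by (intro ln_le_minus_one) simp
    then have "m * ln (m' / m) \<le> m * (m' / m - 1)" using m by (intro mult_left_mono) auto
    then have 1: "m * (ln m' - ln m) \<le> m' - m" using m by (simp add: ln_div algebra_simps)
    have 2: "0 \<le> (m' - m) * (ln t' - ln m')" using assms m by (intro mult_nonneg_nonneg) auto
    show ?thesis using 1 2 by (simp add: algebra_simps)
  qed
  also have "\<dots> = entropy m' t'" using m by (simp add: entropy_eq)
  finally show ?thesis .
qed

lemma entropy_nonneg: "0 \<le> m \<Longrightarrow> m \<le> t \<Longrightarrow> 0 \<le> entropy m t"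
  using entropy_mono[of 0 m t t] by (simp add: entropy_def)

lemma entropy_le: "0 \<le> m \<Longrightarrow> m \<le> t \<Longrightarrow> entropy m t \<le> t"
  using entropy_mono[of m t t t] by (auto simp: entropy_def split: if_splits)

lemma lmeasurable_Int_interval: "E \<in> sets lebesgue \<Longrightarrow> E \<inter> {a..b::real} \<in> lmeasurable"
  by (intro fmeasurable_Int_fmeasurable[of "{a..b}" _ E, simplified Int_commute]) auto

lemma measure_Int_interval_le:
  assumes "E \<in> sets lebesgue" "a \<le> b" shows "measure lebesgue (E \<inter> {a..b::real}) \<le> b - a"
proof -
  have "measure lebesgue (E \<inter> {a..b}) \<le> measure lebesgue {a..b}"
    by (intro measure_mono_fmeasurable) (use assms in auto)
  then show ?thesis using assms by simp
qed

lemma qE_nonneg: "E \<in> sets lebesgue \<Longrightarrow> 0 \<le> qE E x"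
  unfolding qE_eq_entropy using measure_Int_interval_le[of E 0 "\<bar>x\<bar>"] by (intro entropy_nonneg) auto

lemma measurable_qE: 
  assumes "E \<in> sets lebesgue" shows "qE E \<in> borel_measurable borel"
proof -
  have "mono (\<lambda>t. measure lebesgue (E \<inter> {0..t}))"
    by (intro monoI measure_mono_fmeasurable lmeasurable_Int_interval) (use assms in auto)
  then have [measurable]: "(\<lambda>t. measure lebesgue (E \<inter> {0..t})) \<in> borel_measurable borel"
    by (rule borel_measurable_mono)
  show ?thesis unfolding qE_eq_entropy entropy_def by measurable
qed

context finite_type_subharmonic
begin

text \<open>On the exceptional set nothing relates \<open>u\<close> to \<open>M\<close>, so
  \<open>u\<close> is replaced by its linear bound with constant \<open>A\<close> and
  \<open>M\<close> by its negative part.\<close>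

definition exceptional_term :: "real \<Rightarrow> real set \<Rightarrow> real \<Rightarrow> ennreal" where
  "exceptional_term A S y = (ennreal (2 * A * (1 + y)) + e2ennreal (- M (Complex 0 y)) + e2ennreal (- M (Complex 0 (- y))))
      * indicator S y * ennreal (1 / y\<^sup>2)"

lemma measurable_exceptional_term[measurable]:
  assumes [measurable]: "S \<in> sets borel" shows "exceptional_term A S \<in> borel_measurable borel"
  unfolding exceptional_term_def Complex_eq by measurable

text \<open>Choosing the truncation \<open>\<tau>\<close> equal to the measure \<open>s\<close> of
  the set inside the block turns the bound on the negative part into a multiple of s ln (e a /
  s).\<close>

lemma exceptional_block:
  assumes r0: "0 < r0" and A: "0 \<le> A"
  obtains K where "0 \<le> K" "\<And>S a b. S \<in> sets borel \<Longrightarrow> r0 \<le> a \<Longrightarrow> a \<le> b \<Longrightarrow> b \<le> 2 * a \<Longrightarrow>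
    (\<integral>\<^sup>+y. exceptional_term A S y * indicator {a..b} y \<partial>lborel)
      \<le> ennreal (K * (entropy (measure lborel (S \<inter> {a..b})) a / a))"
proof -
  obtain C where C: "0 \<le> C" "\<And>\<rho> x0 S \<tau>. 0 \<le> \<rho> \<Longrightarrow> \<bar>x0\<bar> \<le> 2 \<Longrightarrow> S \<in> sets borel \<Longrightarrow> S \<subseteq> {-\<rho>..\<rho>} \<Longrightarrow> 0 < \<tau> \<Longrightarrow> \<tau> \<le> 2 * (1 + \<rho>) \<Longrightarrow>
    (\<integral>\<^sup>+y. e2ennreal (- M (Complex x0 y)) * indicator S y \<partial>lborel)
      \<le> ennreal (C * (1 + \<rho>) * (measure lborel S + measure lborel S * ln (2 * (1 + \<rho>) / \<tau>) + \<tau>))"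
    by (rule line_negative_part) (rule that)
  \<comment> \<open>Chosen so that \<open>1 + 2 * a \<le> \<kappa> * a\<close> for all
    \<open>a \<ge> r0\<close>.\<close>
  define \<kappa> where "\<kappa> = 1 / r0 + 2"
  define K where "K = \<kappa> * (2 * A + 2 * C * (3 + ln (2 * \<kappa>)))"
  have \<kappa>: "2 \<le> \<kappa>" "0 \<le> ln (2 * \<kappa>)" using r0 by (auto simp: \<kappa>_def)
  have K: "0 \<le> K" using A C(1) \<kappa> by (simp add: K_def)
  show ?thesis
  proof (rule that[OF K])
    fix S :: "real set" and a b :: real
    assume S[measurable]: "S \<in> sets borel" and a: "r0 \<le> a" "a \<le> b" "b \<le> 2 * a"
    have a0: "0 < a" using a r0 by simp
    define T where "T = S \<inter> {a..b}"
    have T[measurable]: "T \<in> sets borel" unfolding T_def by measurable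
    define s where "s = measure lborel T"
    have "emeasure lborel T \<le> emeasure lborel {a..b}" unfolding T_def by (rule emeasure_mono) auto
    then have eT: "emeasure lborel T \<le> ennreal (b - a)" using a by simp
    then have es: "emeasure lborel T = ennreal s" unfolding s_def
      by (intro emeasure_eq_ennreal_measure) (auto simp: top_unique)
    have s: "0 \<le> s" "s \<le> a" using eT a unfolding es by (auto simp: s_def)
    show "(\<integral>\<^sup>+y. exceptional_term A S y * indicator {a..b} y \<partial>lborel)
      \<le> ennreal (K * (entropy (measure lborel (S \<inter> {a..b})) a / a))"
      unfolding T_def[symmetric] s_def[symmetric]
    proof (cases "s = 0")
      case True
      then have "T \<in> null_sets lborel" using es by (auto simp: null_sets_def)
      then have "AE y in lborel. y \<notin> T" by (rule AE_not_in)
      then have "AE y in lborel. exceptional_term A S y * indicator {a..b} y = 0"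
        by eventually_elim (auto simp: T_def exceptional_term_def indicator_def)
      then have "(\<integral>\<^sup>+y. exceptional_term A S y * indicator {a..b} y \<partial>lborel) = (\<integral>\<^sup>+y. 0 \<partial>(lborel :: real measure))" by (rule nn_integral_cong_AE)
      then show "(\<integral>\<^sup>+y. exceptional_term A S y * indicator {a..b} y \<partial>lborel) \<le> ennreal (K * (entropy s a / a))" by simp
    next
      case False
      then have s0: "0 < s" using s by simp
      define l where "l = 1 + ln a - ln s"
      \<comment> \<open>The block has length at most \<open>a\<close>, hence
        \<open>s \<le> a\<close>; with the logarithmic factor at least 1, all lower-order terms are
        absorbed into \<open>s * l\<close>.\<close>
      have l: "1 \<le> l" using s s0 by (simp add: l_def)
      have ent: "entropy s a = s * l" using s0 a0 by (simp add: entropy_eq l_def)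
      define Y where "Y = C * (1 + 2 * a) * (s + s * ln (2 * (1 + 2 * a) / s) + s)"
      have [measurable]: "(\<lambda>y. e2ennreal (- M (Complex 0 y))) \<in> borel_measurable borel"
        "(\<lambda>y. e2ennreal (- M (Complex 0 (- y)))) \<in> borel_measurable borel"
        unfolding Complex_eq by measurable
      have 1: "(\<integral>\<^sup>+y. e2ennreal (- M (Complex 0 y)) * indicator T y \<partial>lborel) \<le> ennreal Y"
        unfolding Y_def s_def by (rule C(2)) (use a a0 s s0 in \<open>auto simp: T_def s_def[symmetric, unfolded T_def]\<close>)
      \<comment> \<open>The values at the points \<open>- y\<close> are integrated over the
        reflected set, which has the same measure.\<close>
      define T' where "T' = uminus -` T"
      have T'[measurable]: "T' \<in> sets borel" unfolding T'_def
        using measurable_sets[of uminus borel borel T] T by (simp add: borel_measurable_uminus)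
      have "emeasure lborel T' = (\<integral>\<^sup>+y. indicator T' y \<partial>lborel)" by simp
      also have "\<dots> = (\<integral>\<^sup>+y. indicator T y \<partial>lborel)"
        by (subst nn_integral_real_affine[of _ "-1" 0]) (auto intro!: nn_integral_cong simp: indicator_def T'_def)
      finally have "measure lborel T' = s" by (simp add: measure_def s_def)
      have "(\<integral>\<^sup>+y. e2ennreal (- M (Complex 0 (- y))) * indicator T y \<partial>lborel)
        = (\<integral>\<^sup>+y. e2ennreal (- M (Complex 0 y)) * indicator T' y \<partial>lborel)"
        by (subst nn_integral_real_affine[of _ "-1" 0]) (auto intro!: nn_integral_cong simp: indicator_def T'_def)
      also have "\<dots> \<le> ennreal Y"
        unfolding Y_def \<open>measure lborel T' = s\<close>[symmetric]
        by (rule C(2)) (use a a0 s s0 \<open>measure lborel T' = s\<close> in \<open>auto simp: T_def T'_def\<close>)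
      finally have 2: "(\<integral>\<^sup>+y. e2ennreal (- M (Complex 0 (- y))) * indicator T y \<partial>lborel) \<le> ennreal Y" .
      have arg: "1 \<le> 2 * (1 + 2 * a) / s" using s s0 a0 by (simp add: field_simps)
      have Y0: "0 \<le> Y" unfolding Y_def using C(1) a0 s arg by (intro mult_nonneg_nonneg add_nonneg_nonneg) auto
      have "(\<integral>\<^sup>+y. exceptional_term A S y * indicator {a..b} y \<partial>lborel)
        \<le> (\<integral>\<^sup>+y. ennreal (1 / a\<^sup>2) * (ennreal (2 * A * (1 + 2 * a)) * indicator T y
           + e2ennreal (- M (Complex 0 y)) * indicator T y + e2ennreal (- M (Complex 0 (- y))) * indicator T y) \<partial>lborel)"
      proof (rule nn_integral_mono)
        fix y
        show "exceptional_term A S y * indicator {a..b} y \<le> ennreal (1 / a\<^sup>2) * (ennreal (2 * A * (1 + 2 * a)) * indicator T y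
           + e2ennreal (- M (Complex 0 y)) * indicator T y + e2ennreal (- M (Complex 0 (- y))) * indicator T y)"
        proof (cases "y \<in> T")
          case True
          then have y: "a \<le> y" "y \<le> b" "y \<in> S" by (auto simp: T_def)
          have "a\<^sup>2 \<le> y\<^sup>2" using y a0 by (intro power_mono) auto
          then have q: "1 / y\<^sup>2 \<le> 1 / a\<^sup>2" using a0 y by (intro divide_left_mono mult_pos_pos) auto
          have "2 * A * (1 + y) \<le> 2 * A * (1 + 2 * a)" using A y a by (intro mult_left_mono) auto
          note big = ennreal_leI[OF this]
          have "exceptional_term A S y \<le> (ennreal (2 * A * (1 + 2 * a)) + e2ennreal (- M (Complex 0 y)) + e2ennreal (- M (Complex 0 (- y)))) * 1 * ennreal (1 / a\<^sup>2)"
            unfolding exceptional_term_def using y by (intro mult_mono[OF mult_mono[OF add_mono[OF add_mono[OF big]]] ennreal_leI[OF q]]) auto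
          then show ?thesis using True y by (simp add: mult.commute)
        next
          case False
          then show ?thesis by (auto simp: T_def exceptional_term_def indicator_def)
        qed
      qed
      also have "\<dots> = ennreal (1 / a\<^sup>2) * (ennreal (2 * A * (1 + 2 * a)) * emeasure lborel T
          + (\<integral>\<^sup>+y. e2ennreal (- M (Complex 0 y)) * indicator T y \<partial>lborel)
          + (\<integral>\<^sup>+y. e2ennreal (- M (Complex 0 (- y))) * indicator T y \<partial>lborel))"
        by (simp add: nn_integral_cmult nn_integral_add)
      also have "\<dots> \<le> ennreal (1 / a\<^sup>2) * (ennreal (2 * A * (1 + 2 * a)) * ennreal s + ennreal Y + ennreal Y)"
        unfolding es by (intro mult_left_mono add_mono 1 2 order_refl) simp
      also have "\<dots> = ennreal (1 / a\<^sup>2 * (2 * A * (1 + 2 * a) * s + Y + Y))"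
      proof -
        have gen: "ennreal x * (ennreal p * ennreal s + ennreal Y + ennreal Y) = ennreal (x * (p * s + Y + Y))"
          if "0 \<le> x" "0 \<le> p" for x p using that s Y0 by (simp add: ennreal_mult[symmetric] ennreal_plus[symmetric] del: ennreal_plus)
        show ?thesis by (rule gen) (use A a0 in auto)
      qed
      also have "\<dots> \<le> ennreal (K * (entropy s a / a))"
      proof (rule ennreal_leI)
        have "1 = 1 / r0 * r0" using r0 by simp
        also have "\<dots> \<le> 1 / r0 * a" using a r0 by (intro mult_left_mono) auto
        finally have ka: "1 + 2 * a \<le> \<kappa> * a" by (simp add: \<kappa>_def algebra_simps)
        have "2 * (1 + 2 * a) / s \<le> 2 * \<kappa> * a / s" using ka s0 by (intro divide_right_mono) auto
        then have "ln (2 * (1 + 2 * a) / s) \<le> ln (2 * \<kappa> * a / s)" using arg by (intro ln_mono) auto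
        also have "\<dots> = ln (2 * \<kappa>) + (l - 1)" using s0 a0 \<kappa> by (simp add: l_def ln_div ln_mult)
        also have "\<dots> \<le> ln (2 * \<kappa>) * l + l" using l mult_left_mono[OF l \<kappa>(2)] by linarith
        finally have ln: "ln (2 * (1 + 2 * a) / s) \<le> (1 + ln (2 * \<kappa>)) * l" by (simp add: algebra_simps)
        have "s + s * ln (2 * (1 + 2 * a) / s) + s \<le> s * l + s * ((1 + ln (2 * \<kappa>)) * l) + s * l"
          using mult_left_mono[OF ln s(1)] mult_left_mono[OF l s(1)] by linarith
        also have "\<dots> = (3 + ln (2 * \<kappa>)) * (s * l)" by (simp add: algebra_simps)
        finally have "Y \<le> C * (\<kappa> * a) * ((3 + ln (2 * \<kappa>)) * (s * l))"
          unfolding Y_def using ka C(1) s s0 a0 arg by (intro mult_mono) auto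
        moreover have "2 * A * (1 + 2 * a) * s \<le> 2 * A * (\<kappa> * a) * (s * l)"
          using A ka s a0 \<kappa> mult_left_mono[OF l s(1)] by (intro mult_mono) auto
        ultimately have "2 * A * (1 + 2 * a) * s + Y + Y \<le> K * a * (s * l)"
          unfolding K_def by (simp add: algebra_simps)
        then have "1 / a\<^sup>2 * (2 * A * (1 + 2 * a) * s + Y + Y) \<le> 1 / a\<^sup>2 * (K * a * (s * l))" by (rule mult_left_mono) simp
        also have "\<dots> = K * (entropy s a / a)" using a0 by (simp add: ent power2_eq_square)
        finally show "1 / a\<^sup>2 * (2 * A * (1 + 2 * a) * s + Y + Y) \<le> K * (entropy s a / a)" .
      qed
      finally show "(\<integral>\<^sup>+y. exceptional_term A S y * indicator {a..b} y \<partial>lborel) \<le> ennreal (K * (entropy s a / a))" .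
    qed
  qed
qed

text \<open>The measure of the set in [a, 2 a] is at most that of \<open>E\<close> in [0, t] for
  every t \<open>\<ge>\<close> 2 a, and entropy is monotone in both arguments. Hence
  \<open>qE\<close> on the following block dominates the entropy of the present one, which is why
  blocks are charged forward.\<close>

lemma exceptional_term_integral:
  assumes r0: "0 < r0" and A: "0 \<le> A" and E[measurable]: "E \<in> sets lebesgue" and S[measurable]: "S \<in> sets borel" and SE: "S \<subseteq> E"
  obtains C where "0 \<le> C" "\<And>r R. r0 \<le> r \<Longrightarrow> r < R \<Longrightarrow>
      (\<integral>\<^sup>+y. exceptional_term A S y * indicator {r..R} y \<partial>lborel)
        \<le> ennreal C + ennreal C * (\<integral>\<^sup>+t. ennreal (qE E t / t\<^sup>2) * indicator {r..R} t \<partial>lborel)"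
proof -
  obtain K where K: "0 \<le> K" "\<And>S a b. S \<in> sets borel \<Longrightarrow> r0 \<le> a \<Longrightarrow> a \<le> b \<Longrightarrow> b \<le> 2 * a \<Longrightarrow>
    (\<integral>\<^sup>+y. exceptional_term A S y * indicator {a..b} y \<partial>lborel)
      \<le> ennreal (K * (entropy (measure lborel (S \<inter> {a..b})) a / a))" by (rule exceptional_block[OF r0 A]) (rule that)
  have [measurable]: "qE E \<in> borel_measurable borel" by (rule measurable_qE[OF E])
  have me: "measure lborel (S \<inter> {a..b}) = measure lebesgue (S \<inter> {a..b})" for a b by simp
  show ?thesis
  proof (rule that[of "8 * K + 2 * K"])
    show "0 \<le> 8 * K + 2 * K" using K by simp
    fix r R assume rR: "r0 \<le> r" "r < R"
    let ?h = "\<lambda>t. ennreal (qE E t / t\<^sup>2)"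
    have "(\<integral>\<^sup>+y. exceptional_term A S y * indicator {r..R} y \<partial>lborel)
      \<le> 2 * ennreal K + ennreal (8 * K) * (\<integral>\<^sup>+t. ?h t * indicator {r..R} t \<partial>lborel)"
    proof (rule dyadic_forward)
      show "exceptional_term A S \<in> borel_measurable borel" by measurable
      show "?h \<in> borel_measurable borel" by measurable
      show "(\<integral>\<^sup>+y. exceptional_term A S y * indicator {a..b} y \<partial>lborel) \<le> ennreal K"
        if a: "r \<le> a" "a \<le> b" "b \<le> 2 * a" "b \<le> R" for a b
      proof -
        have ra: "r0 \<le> a" "0 < a" using a rR r0 by auto
        have "measure lebesgue (S \<inter> {a..b}) \<le> b - a" by (rule measure_Int_interval_le) (use a S in auto)
        then have "entropy (measure lborel (S \<inter> {a..b})) a \<le> a" using a by (intro entropy_le) auto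
        then have "K * (entropy (measure lborel (S \<inter> {a..b})) a / a) \<le> K * 1"
          using ra K by (intro mult_left_mono) auto
        then show ?thesis using K(2)[OF S ra(1) a(2,3)] by (simp add: order_trans[OF _ ennreal_leI])
      qed
      show "(\<integral>\<^sup>+y. exceptional_term A S y * indicator {a..2*a} y \<partial>lborel)
        \<le> ennreal (8 * K) * (\<integral>\<^sup>+t. ?h t * indicator {2*a..4*a} t \<partial>lborel)" if a: "r \<le> a" "4 * a \<le> R" for a
      proof -
        have ra: "r0 \<le> a" "0 < a" using a rR r0 by auto
        define e where "e = entropy (measure lborel (S \<inter> {a..2*a})) a"
        have ms: "measure lebesgue (S \<inter> {a..2*a}) \<le> a" using measure_Int_interval_le[of S a "2*a"] ra S by auto
        have e0: "0 \<le> e" unfolding e_def using ms by (intro entropy_nonneg) auto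
        have qe: "e \<le> qE E t" if t: "2 * a \<le> t" for t
        proof -
          have "measure lebesgue (S \<inter> {a..2*a}) \<le> measure lebesgue (E \<inter> {0..t})"
            by (intro measure_mono_fmeasurable lmeasurable_Int_interval) (use t ra SE E S in auto)
          moreover have "measure lebesgue (E \<inter> {0..t}) \<le> t" using measure_Int_interval_le[OF E, of 0 t] t ra by simp
          ultimately have "e \<le> entropy (measure lebesgue (E \<inter> {0..t})) t" unfolding e_def
            using ms t ra by (intro entropy_mono) auto
          then show ?thesis using t ra by (simp add: qE_eq_entropy)
        qed
        have "ennreal (e / (4 * a)\<^sup>2) * ennreal (2 * a) = (\<integral>\<^sup>+t. ennreal (e / (4 * a)\<^sup>2) * indicator {2*a..4*a} t \<partial>lborel)"
          using ra by (subst nn_integral_cmult_indicator) auto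
        also have "\<dots> \<le> (\<integral>\<^sup>+t. ?h t * indicator {2*a..4*a} t \<partial>lborel)"
        proof (rule nn_integral_mono)
          fix t
          show "ennreal (e / (4 * a)\<^sup>2) * indicator {2*a..4*a} t \<le> ?h t * indicator {2*a..4*a} t"
          proof (cases "t \<in> {2*a..4*a}")
            case True
            have "t\<^sup>2 \<le> (4 * a)\<^sup>2" using True ra by (intro power_mono) auto
            then have "e / (4 * a)\<^sup>2 \<le> qE E t / t\<^sup>2"
              using True ra e0 qe[of t] by (intro frac_le) auto
            then show ?thesis using True by (auto intro: ennreal_leI)
          qed simp
        qed
        finally have low: "ennreal (e / (4 * a)\<^sup>2 * (2 * a)) \<le> (\<integral>\<^sup>+t. ?h t * indicator {2*a..4*a} t \<partial>lborel)"
          using ra e0 by (subst ennreal_mult) auto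
        \<comment> \<open>The following block has length 2 a and ends at 4 a, so the integral of e /
          t^2 over it is at least e / (8 a); this is the 8 in \<open>8 * K\<close>.\<close>
        have "K * (e / a) = 8 * K * (e / (4 * a)\<^sup>2 * (2 * a))" using ra by (simp add: field_simps power2_eq_square)
        then have "(\<integral>\<^sup>+y. exceptional_term A S y * indicator {a..2*a} y \<partial>lborel) \<le> ennreal (8 * K * (e / (4 * a)\<^sup>2 * (2 * a)))"
          using K(2)[OF S ra(1), of "2 * a"] ra unfolding e_def by simp
        also have "\<dots> = ennreal (8 * K) * ennreal (e / (4 * a)\<^sup>2 * (2 * a))" using K e0 ra by (intro ennreal_mult) auto
        also have "\<dots> \<le> ennreal (8 * K) * (\<integral>\<^sup>+t. ?h t * indicator {2*a..4*a} t \<partial>lborel)" by (rule mult_left_mono[OF low]) simp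
        finally show ?thesis .
      qed
    qed (use rR r0 in auto)
    also have "\<dots> \<le> ennreal (8 * K + 2 * K) + ennreal (8 * K + 2 * K) * (\<integral>\<^sup>+t. ?h t * indicator {r..R} t \<partial>lborel)"
    proof (intro add_mono mult_right_mono)
      have "2 * ennreal K = ennreal (2 * K)" using K by (simp add: ennreal_mult)
      then show "2 * ennreal K \<le> ennreal (8 * K + 2 * K)" using K by (simp add: ennreal_leI)
    qed (use K in \<open>auto intro: ennreal_leI\<close>)
    finally show "(\<integral>\<^sup>+y. exceptional_term A S y * indicator {r..R} y \<partial>lborel)
        \<le> ennreal (8 * K + 2 * K) + ennreal (8 * K + 2 * K) * (\<integral>\<^sup>+t. ?h t * indicator {r..R} t \<partial>lborel)" .
  qed
qed

end

lemma ennreal_integral_le_nn_integral: "ennreal (\<integral>x. f x \<partial>M) \<le> (\<integral>\<^sup>+x. ennreal (f x) \<partial>M)"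
proof (cases "integrable M f")
  case True
  let ?X = "\<integral>\<^sup>+x. ennreal (f x) \<partial>M"
  have "(\<integral>x. f x \<partial>M) \<le> enn2real ?X" using real_lebesgue_integral_def[OF True] by simp
  then have "ennreal (\<integral>x. f x \<partial>M) \<le> ennreal (enn2real ?X)" by (rule ennreal_leI)
  also have "\<dots> \<le> ?X" by (cases ?X rule: ennreal_cases) auto
  finally show ?thesis .
qed (simp add: not_integrable_integral_eq)

lemma e2ennreal_divide: 
  assumes "0 < c" shows "e2ennreal (P / ereal c) = e2ennreal P * ennreal (1 / c)"
proof (cases P)
  case (real p)
  then show ?thesis using assms by (simp add: ennreal_mult''[symmetric])
next
  case PInf
  then show ?thesis using assms by (simp add: ennreal_top_mult)
next
  case MInf
  then show ?thesis using assms by (simp add: e2ennreal_neg)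
qed

lemma measurable_reflect_lebesgue:
  fixes f :: "real \<Rightarrow> ereal"
  assumes [measurable]: "f \<in> borel_measurable lebesgue" shows "(\<lambda>x. f (- x)) \<in> borel_measurable lebesgue"
proof -
  have "(\<lambda>x. f ((-1) *\<^sub>R x)) \<in> borel_measurable lebesgue"
    by (rule measurable_compose[OF lebesgue_measurable_scaling]) measurable
  then show ?thesis by simp
qed

lemma J_R_nonneg_eq:
  assumes "\<And>x. 0 \<le> v x"
  shows "J_R r R v = enn2ereal (\<integral>\<^sup>+x. e2ennreal ((v x + v (- x)) / ereal (x\<^sup>2)) * indicator {r..R} x \<partial>lebesgue) / ereal (2 * pi)"
proof -
  have "e2ennreal (- ((v x + v (- x)) / ereal (x\<^sup>2))) = 0" for x
  proof -
    have "0 \<le> (v x + v (- x)) / ereal (x\<^sup>2)" using assms[of x] assms[of "-x"] by (cases "x = 0") (auto simp: zero_ereal_def[symmetric])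
    then show ?thesis by (intro e2ennreal_neg) simp
  qed
  then show ?thesis unfolding J_R_def ereal_int_def by (simp add: zero_ennreal.rep_eq)
qed

text \<open>Maximum against minimum amounts to nine comparisons, all reducible to the given five.
  Multiplying by 2 pi leaves the \<open>J\<close> term without that factor, and for the other terms
  2 pi \<open>\<ge>\<close> 1 only helps.\<close>

lemma combine_bounds:
  fixes lu lM l1 l2 n1 n2 C1 C2 a b c I J :: real
  assumes "2 * pi * n1 \<le> lu + C1" "2 * pi * n2 \<le> lu + C1" "lM \<le> 2 * pi * l1 + C2" "lM \<le> 2 * pi * l2 + C2"
    and "lu - lM \<le> a + b * I + c * J" and nn: "0 \<le> C1" "0 \<le> C2" "0 \<le> a" "0 \<le> b" "0 \<le> c" "0 \<le> I" "0 \<le> J"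
    and C: "C1 + C2 + a + b + c \<le> C"
  shows "max (max n1 n2) (lu / (2 * pi)) \<le> min l1 (min l2 (lM / (2 * pi))) + C * (J / (2 * pi)) + C * I + C"
proof -
  define P where "P = 2 * pi"
  have P: "1 \<le> P" using pi_ge_two by (simp add: P_def)
  have C0: "C1 + C2 + a \<le> C" "b \<le> C" "c \<le> C" "0 \<le> C" using nn C by auto
  have "b * I \<le> C * I" "c * J \<le> C * J" using C0 nn by (auto intro: mult_right_mono)
  moreover have "1 * (C * I) \<le> P * (C * I)" by (rule mult_right_mono[OF P]) (use C0 nn in simp)
  moreover have "1 * C \<le> P * C" by (rule mult_right_mono[OF P C0(4)])
  ultimately have key: "a + b * I + c * J + C1 + C2 \<le> C * J + P * (C * I) + P * C" using C0 by simp
  have div: "x \<le> y + C * (J / P) + C * I + C" if "P * x \<le> P * y + (a + b * I + c * J + C1 + C2)" for x y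
  proof -
    have "P * x \<le> P * (y + C * (J / P) + C * I + C)" using that key P by (simp add: algebra_simps)
    then show ?thesis using P by (simp add: mult_le_cancel_left)
  qed
  have nn': "0 \<le> b * I" "0 \<le> c * J" using nn by auto
  have cancel: "P * (lu / P) = lu" "P * (lM / P) = lM" using P by auto
  note as = assms(1-5)[folded P_def]
  have "x \<le> y + C * (J / P) + C * I + C" if "x \<in> {n1, n2, lu / P}" "y \<in> {l1, l2, lM / P}" for x y
    by (rule div) (use that as nn' nn cancel in auto)
  then show ?thesis unfolding P_def[symmetric] by (simp add: max_def min_def)
qed

subsection \<open>Comparison of the two functions\<close>

text \<open>Off \<open>E\<close> the hypothesis bounds \<open>u\<close> by circular means of
  \<open>M\<close>, which exceed the values of \<open>M\<close> by potentials of scale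
  \<open>tail_radius\<close>; on \<open>E\<close> the exceptional term takes over. The estimate is
  pointwise at almost every \<open>y\<close>, where the four values involved are finite.\<close>

lemma imaginary_axis_comparison:
  fixes q :: "real \<Rightarrow> real"
  assumes M: "finite_type_subharmonic M \<mu>" and U: "finite_type_subharmonic u \<nu>"
    and q0_nonneg: "\<And>x. q0 x \<ge> 0"
    and q0_meas[measurable]: "q0 \<in> borel_measurable lebesgue"
    and q_nonneg: "\<And>y. q y \<ge> 0"
    and q_cont: "continuous_on UNIV q"
    and q_growth: "Limsup at_infinity (\<lambda>y. ereal (q y / \<bar>y\<bar>)) < 1"
    and E_meas[measurable]: "E \<in> sets lebesgue"
    and main: "\<And>y. 0 \<le> y \<Longrightarrow> y \<notin> E \<Longrightarrow>
        u (Complex 0 y) + u (Complex 0 (- y))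
          \<le> circ_mean M (Complex 0 y) (q y) + circ_mean M (Complex 0 (- y)) (q (- y)) + q0 y + q0 (- y)"
    and r0: "0 < r0" and N: "0 \<le> N"
  obtains a b c where "0 \<le> a" "0 \<le> b" "0 \<le> c"
    "\<And>r R. r0 \<le> r \<Longrightarrow> r < R \<Longrightarrow>
      ennreal (finite_type_subharmonic.line_mean u r R - finite_type_subharmonic.line_mean M r R)
        \<le> ennreal a + ennreal b * (\<integral>\<^sup>+t. ennreal (t powr N) * e2ennreal (tail_sup N q t) * indicator {r..R} t \<partial>lebesgue)
         + ennreal c * (\<integral>\<^sup>+x. e2ennreal ((q0 x + ereal (qE E x) + (q0 (- x) + ereal (qE E (- x)))) / ereal (x\<^sup>2)) * indicator {r..R} x \<partial>lebesgue)"
proof -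
  interpret M: finite_type_subharmonic M \<mu> by fact
  interpret U: finite_type_subharmonic u \<nu> by fact
  obtain A where A: "0 \<le> A" "\<And>z. u z \<le> ereal (A * (1 + cmod z))" using U.upper_growth by blast
  \<comment> \<open>A Borel part of \<open>E\<close> that misses only a subset of a null set
    \<open>Z\<close>; it carries the Borel estimates while \<open>E\<close> itself is merely
    Lebesgue measurable.\<close>
  define S where "S = main_part lborel E"
  have S[measurable]: "S \<in> sets borel" using main_part_sets[OF E_meas] by (simp add: S_def)
  have SE: "S \<subseteq> E" using main_part_null_part_Un[OF E_meas] unfolding S_def by blast
  obtain Z where Z: "Z \<in> null_sets lborel" "null_part lborel E \<subseteq> Z" using null_part[OF E_meas] by blast
  have ES: "y \<in> S" if "y \<in> E" "y \<notin> Z" for y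
    using that Z main_part_null_part_Un[OF E_meas] unfolding S_def by blast
  obtain C3 where C3: "0 \<le> C3" "\<And>r R. r0 \<le> r \<Longrightarrow> r < R \<Longrightarrow>
      (\<integral>\<^sup>+y. M.tail_potential N q y * indicator {r..R} y \<partial>lborel)
        \<le> ennreal C3 + ennreal C3 * (\<integral>\<^sup>+t. ennreal (t powr N) * e2ennreal (tail_sup N q t) * indicator {r..R} t \<partial>lborel)"
    by (rule M.tail_potential_integral[OF q_nonneg q_cont q_growth r0 N]) (rule that)
  obtain C4 where C4: "0 \<le> C4" "\<And>r R. r0 \<le> r \<Longrightarrow> r < R \<Longrightarrow>
      (\<integral>\<^sup>+y. M.exceptional_term A S y * indicator {r..R} y \<partial>lborel)
        \<le> ennreal C4 + ennreal C4 * (\<integral>\<^sup>+t. ennreal (qE E t / t\<^sup>2) * indicator {r..R} t \<partial>lborel)"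
    by (rule M.exceptional_term_integral[OF r0 A(1) E_meas S SE]) (rule that)
  obtain B where B: "0 \<le> B" "\<And>s. r0 \<le> s \<Longrightarrow> q s + q (- s) \<le> B * s"
    by (rule linear_bound_of_Limsup[OF q_cont q_growth r0]) (rule that)
  have tail: "q s + q (- s) \<le> s powr (2 + N) * real_of_ereal (tail_sup N q t)" if "r0 \<le> t" "t \<le> s" for s t
    by (rule tail_sup_facts(4)[OF q_nonneg r0 N B]) (use that in auto)
  define p where "p = pi / c0"
  have p: "0 < p" using c0(2) by (simp add: p_def)
  have pointwise: "ennreal ((U.m (Complex 0 (- y)) + U.m (Complex 0 y)) / y\<^sup>2 - (M.m (Complex 0 (- y)) + M.m (Complex 0 y)) / y\<^sup>2)
      \<le> ennreal p * M.tail_potential N q y + e2ennreal (q0 y + q0 (- y)) * ennreal (1 / y\<^sup>2) + M.exceptional_term A S y"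
    if y: "r0 \<le> y" and yZ: "y \<notin> Z"
      and fM: "M (Complex 0 (- y)) = ereal (M.m (Complex 0 (- y)))" "M (Complex 0 y) = ereal (M.m (Complex 0 y))"
      and fU: "u (Complex 0 (- y)) = ereal (U.m (Complex 0 (- y)))" "u (Complex 0 y) = ereal (U.m (Complex 0 y))" for y
  proof -
    define x1 x2 u1 u2 where defs: "x1 = M.m (Complex 0 y)" "x2 = M.m (Complex 0 (- y))"
      "u1 = U.m (Complex 0 y)" "u2 = U.m (Complex 0 (- y))"
    note f = fM[folded defs] fU[folded defs]
    have "ennreal ((u2 + u1) / y\<^sup>2 - (x2 + x1) / y\<^sup>2) = ennreal ((u1 + u2) - (x1 + x2)) * ennreal (1 / y\<^sup>2)"
      by (subst ennreal_mult''[symmetric]) (simp_all add: diff_divide_distrib add.commute)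
    also have "\<dots> \<le> ennreal p * M.tail_potential N q y + e2ennreal (q0 y + q0 (- y)) * ennreal (1 / y\<^sup>2) + M.exceptional_term A S y"
    proof (cases "y \<in> E")
      case False
      let ?Q = "tail_radius N q y"
      \<comment> \<open>Each radius is at most the sum of the two because \<open>q\<close> is
        nonnegative, so a single scale serves both points.\<close>
      have Q: "q y \<le> ?Q" "q (- y) \<le> ?Q"
        using tail[OF y order_refl] q_nonneg[of y] q_nonneg[of "- y"] by (auto simp: tail_radius_def)
      have "ereal (u1 + u2) \<le> circ_mean M (Complex 0 y) (q y) + circ_mean M (Complex 0 (- y)) (q (- y)) + q0 y + q0 (- y)"
        using main[of y] False y r0 f by simp
      then have "ennreal ((u1 + u2) - (x1 + x2)) \<le> e2ennreal (circ_mean M (Complex 0 y) (q y) - ereal x1)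
        + e2ennreal (circ_mean M (Complex 0 (- y)) (q (- y)) - ereal x2) + e2ennreal (q0 y + q0 (- y))"
        by (rule e2ennreal_excess[OF q0_nonneg q0_nonneg])
      also have "\<dots> \<le> ennreal p * M.log_potential (2 * ?Q) (Complex 0 y)
          + ennreal p * M.log_potential (2 * ?Q) (Complex 0 (- y)) + e2ennreal (q0 y + q0 (- y))"
        unfolding p_def defs by (intro add_mono order_refl M.circ_mean_defect fM Q q_nonneg)
      finally have "ennreal ((u1 + u2) - (x1 + x2)) * ennreal (1 / y\<^sup>2)
        \<le> (ennreal p * M.log_potential (2 * ?Q) (Complex 0 y)
          + ennreal p * M.log_potential (2 * ?Q) (Complex 0 (- y)) + e2ennreal (q0 y + q0 (- y))) * ennreal (1 / y\<^sup>2)"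
        by (rule mult_right_mono) simp
      also have "\<dots> = ennreal p * M.tail_potential N q y + e2ennreal (q0 y + q0 (- y)) * ennreal (1 / y\<^sup>2)"
        unfolding M.tail_potential_def by (simp only: distrib_left distrib_right mult.assoc)
      finally show ?thesis by (simp add: add_increasing2)
    next
      case True
      then have yS: "y \<in> S" using yZ by (rule ES)
      have "ereal u1 \<le> ereal (A * (1 + y))" "ereal u2 \<le> ereal (A * (1 + y))"
        using A(2)[of "Complex 0 y"] A(2)[of "Complex 0 (- y)"] f y r0 by (simp_all add: cmod_def)
      then have "(u1 + u2) - (x1 + x2) \<le> 2 * A * (1 + y) + (- x1) + (- x2)" by simp
      then have "ennreal ((u1 + u2) - (x1 + x2)) \<le> ennreal (2 * A * (1 + y) + (- x1) + (- x2))" by (rule ennreal_leI)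
      also have "\<dots> \<le> ennreal (2 * A * (1 + y) + (- x1)) + ennreal (- x2)" by (rule ennreal_add_le)
      also have "\<dots> \<le> ennreal (2 * A * (1 + y)) + ennreal (- x1) + ennreal (- x2)"
        by (rule add_right_mono) (rule ennreal_add_le)
      finally have "ennreal ((u1 + u2) - (x1 + x2)) * ennreal (1 / y\<^sup>2) \<le> M.exceptional_term A S y"
        unfolding M.exceptional_term_def f using yS by (simp add: mult_right_mono)
      then show ?thesis by (simp add: add_increasing)
    qed
    finally show ?thesis unfolding defs .
  qed
  show ?thesis
  proof (rule that[of "p * C3 + C4" "p * C3" "1 + C4"])
    show "0 \<le> p * C3 + C4" "0 \<le> p * C3" "0 \<le> 1 + C4" using p C3 C4 by auto
    fix r R assume rR: "r0 \<le> r" "r < R"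
    have r: "0 < r" using rR r0 by simp
    let ?I = "\<integral>\<^sup>+t. ennreal (t powr N) * e2ennreal (tail_sup N q t) * indicator {r..R} t \<partial>lebesgue"
    let ?v = "\<lambda>x. q0 x + ereal (qE E x) + (q0 (- x) + ereal (qE E (- x)))"
    let ?J = "\<integral>\<^sup>+x. e2ennreal (?v x / ereal (x\<^sup>2)) * indicator {r..R} x \<partial>lebesgue"
    let ?d = "\<lambda>y. (U.m (Complex 0 (- y)) + U.m (Complex 0 y)) / y\<^sup>2 - (M.m (Complex 0 (- y)) + M.m (Complex 0 y)) / y\<^sup>2"
    have qE0: "0 \<le> ereal (qE E x)" for x using qE_nonneg[OF E_meas] by simp
    have "U.line_mean r R - M.line_mean r R = (\<integral>y. ?d y * indicator {r..R} y \<partial>lborel)"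
      unfolding U.line_mean_fold(2)[OF r rR(2), symmetric] M.line_mean_fold(2)[OF r rR(2), symmetric]
      by (subst Bochner_Integration.integral_diff[OF U.line_mean_fold(1) M.line_mean_fold(1), OF r rR(2) r rR(2), symmetric])
        (simp only: left_diff_distrib)
    then have "ennreal (U.line_mean r R - M.line_mean r R) \<le> (\<integral>\<^sup>+y. ennreal (?d y * indicator {r..R} y) \<partial>lborel)"
      by (simp only: ennreal_integral_le_nn_integral)
    also have "\<dots> = (\<integral>\<^sup>+y. ennreal (?d y * indicator {r..R} y) \<partial>lebesgue)" by (rule nn_integral_completion[symmetric])
    also have "\<dots> \<le> (\<integral>\<^sup>+y. ennreal p * (M.tail_potential N q y * indicator {r..R} y)
        + e2ennreal (?v y / ereal (y\<^sup>2)) * indicator {r..R} y + M.exceptional_term A S y * indicator {r..R} y \<partial>lebesgue)"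
    proof (rule nn_integral_mono_AE)
      have "AE y in lebesgue. y \<notin> Z" by (rule AE_completion) (rule AE_not_in[OF Z(1)])
      moreover note AE_completion[OF M.AE_lines_finite] AE_completion[OF U.AE_lines_finite]
      ultimately show "AE y in lebesgue. ennreal (?d y * indicator {r..R} y) \<le> ennreal p * (M.tail_potential N q y * indicator {r..R} y)
        + e2ennreal (?v y / ereal (y\<^sup>2)) * indicator {r..R} y + M.exceptional_term A S y * indicator {r..R} y"
      proof eventually_elim
        fix y
        assume yZ: "y \<notin> Z"
          and fM: "M (Complex 0 (- y)) = ereal (M.m (Complex 0 (- y))) \<and> M (Complex 0 y) = ereal (M.m (Complex 0 y))"
          and fU: "u (Complex 0 (- y)) = ereal (U.m (Complex 0 (- y))) \<and> u (Complex 0 y) = ereal (U.m (Complex 0 y))"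
        show "ennreal (?d y * indicator {r..R} y) \<le> ennreal p * (M.tail_potential N q y * indicator {r..R} y)
          + e2ennreal (?v y / ereal (y\<^sup>2)) * indicator {r..R} y + M.exceptional_term A S y * indicator {r..R} y"
        proof (cases "y \<in> {r..R}")
          case True
          then have y: "r0 \<le> y" "0 < y" using rR r0 by auto
          \<comment> \<open>Adding the nonnegative values of \<open>qE\<close> lets one integral,
            that of \<open>q0\<close> plus \<open>qE\<close>, serve both inside and outside
            \<open>E\<close>.\<close>
          have "q0 y + q0 (- y) \<le> ?v y" using qE0 by (intro add_mono) (simp_all add: add_increasing2)
          then have "e2ennreal (q0 y + q0 (- y)) * ennreal (1 / y\<^sup>2) \<le> e2ennreal (?v y / ereal (y\<^sup>2))"
            using y by (subst e2ennreal_divide) (auto intro!: mult_right_mono e2ennreal_mono)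
          then have "ennreal (?d y) \<le> ennreal p * M.tail_potential N q y + e2ennreal (?v y / ereal (y\<^sup>2)) + M.exceptional_term A S y"
            using pointwise[OF y(1) yZ conjunct1[OF fM] conjunct2[OF fM] conjunct1[OF fU] conjunct2[OF fU]]
            by (meson add_left_mono add_right_mono order_trans)
          then show ?thesis using True by simp
        qed simp
      qed
    qed
    also have "\<dots> = ennreal p * (\<integral>\<^sup>+y. M.tail_potential N q y * indicator {r..R} y \<partial>lborel) + ?J
        + (\<integral>\<^sup>+y. M.exceptional_term A S y * indicator {r..R} y \<partial>lborel)"
    proof -
      have leb: "f \<in> borel_measurable borel \<Longrightarrow> f \<in> borel_measurable lebesgue" for f :: "real \<Rightarrow> ennreal"
        by (intro measurable_completion) simp
      have 1: "(\<lambda>y. M.tail_potential N q y * indicator {r..R} y) \<in> borel_measurable lebesgue"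
        "(\<lambda>y. M.exceptional_term A S y * indicator {r..R} y) \<in> borel_measurable lebesgue"
        by (rule leb; measurable)+
      have [measurable]: "qE E \<in> borel_measurable borel" by (rule measurable_qE[OF E_meas])
      have [measurable]: "(\<lambda>x. q0 (- x)) \<in> borel_measurable lebesgue" by (rule measurable_reflect_lebesgue[OF q0_meas])
      have [measurable]: "(\<lambda>x. ereal (qE E x)) \<in> borel_measurable lebesgue" "(\<lambda>x. ereal (qE E (- x))) \<in> borel_measurable lebesgue"
        "(\<lambda>x. ereal (x\<^sup>2)) \<in> borel_measurable lebesgue" "indicator {r..R} \<in> borel_measurable lebesgue"
        by (intro measurable_completion; measurable)+
      have 2: "(\<lambda>x. e2ennreal (?v x / ereal (x\<^sup>2)) * indicator {r..R} x) \<in> borel_measurable lebesgue" by measurable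
      have gen: "(\<integral>\<^sup>+y. ennreal p * f y + g y + h y \<partial>lebesgue)
          = ennreal p * (\<integral>\<^sup>+y. f y \<partial>lborel) + (\<integral>\<^sup>+y. g y \<partial>lebesgue) + (\<integral>\<^sup>+y. h y \<partial>lborel)"
        if "f \<in> borel_measurable lebesgue" "g \<in> borel_measurable lebesgue" "h \<in> borel_measurable lebesgue" for f g h :: "real \<Rightarrow> ennreal"
        unfolding nn_integral_completion[of lborel, symmetric] using that
        by (simp add: nn_integral_add nn_integral_cmult del: nn_integral_completion)
      show ?thesis by (rule gen[OF 1(1) 2 1(2)])
    qed
    also have "\<dots> \<le> ennreal p * (ennreal C3 + ennreal C3 * ?I) + ?J + (ennreal C4 + ennreal C4 * ?J)"
    proof (intro add_mono mult_left_mono order_refl)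
      show "(\<integral>\<^sup>+y. M.tail_potential N q y * indicator {r..R} y \<partial>lborel) \<le> ennreal C3 + ennreal C3 * ?I"
        using C3(2)[OF rR] by (simp add: nn_integral_completion)
      have "(\<integral>\<^sup>+t. ennreal (qE E t / t\<^sup>2) * indicator {r..R} t \<partial>lborel) \<le> ?J"
        unfolding nn_integral_completion[of lborel, symmetric]
      proof (rule nn_integral_mono)
        fix t :: real
        show "ennreal (qE E t / t\<^sup>2) * indicator {r..R} t \<le> e2ennreal (?v t / ereal (t\<^sup>2)) * indicator {r..R} t"
        proof (cases "t \<in> {r..R}")
          case True
          then have t: "0 < t\<^sup>2" using r by auto
          have "ereal (qE E t) \<le> ?v t"
            using q0_nonneg[of t] q0_nonneg[of "-t"] qE0[of "-t"] by (intro add_increasing2 add_increasing) auto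
          then have "ereal (qE E t) / ereal (t\<^sup>2) \<le> ?v t / ereal (t\<^sup>2)" using t by (intro ereal_divide_right_mono) auto
          then have "e2ennreal (ereal (qE E t) / ereal (t\<^sup>2)) \<le> e2ennreal (?v t / ereal (t\<^sup>2))" by (rule e2ennreal_mono)
          then show ?thesis using True t by simp
        qed simp
      qed
      then show "(\<integral>\<^sup>+y. M.exceptional_term A S y * indicator {r..R} y \<partial>lborel) \<le> ennreal C4 + ennreal C4 * ?J"
        using C4(2)[OF rR] by (meson add_left_mono mult_left_mono order_trans zero_le)
    qed simp
    also have "\<dots> = ennreal (p * C3 + C4) + ennreal (p * C3) * ?I + ennreal (1 + C4) * ?J"
    proof -
      have gen: "ennreal p * (ennreal C3 + ennreal C3 * I) + J + (ennreal C4 + ennreal C4 * J)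
        = ennreal (p * C3 + C4) + ennreal (p * C3) * I + ennreal (1 + C4) * J" for I J
        using p C3(1) C4(1) by (simp add: ennreal_mult algebra_simps)
      show ?thesis by (rule gen)
    qed
    finally show "ennreal (U.line_mean r R - M.line_mean r R)
      \<le> ennreal (p * C3 + C4) + ennreal (p * C3) * ?I + ennreal (1 + C4) * ?J" .
  qed
qed

theorem theorem1:
  fixes M u :: "complex \<Rightarrow> ereal"
    and \<mu> \<nu> :: "complex measure"
    and q0 :: "real \<Rightarrow> ereal"
    and q :: "real \<Rightarrow> real"
    and E :: "real set"
  assumes subM: "subharmonic M" and subu: "subharmonic u"
    and M_nontriv: "\<exists>z. M z \<noteq> - \<infinity>" and u_nontriv: "\<exists>z. u z \<noteq> - \<infinity>"
    and M_type: "Limsup at_infinity (\<lambda>z. M z / ereal (cmod z)) < \<infinity>"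
    and u_type: "Limsup at_infinity (\<lambda>z. u z / ereal (cmod z)) < \<infinity>"
    and mu: "riesz_measure M \<mu>" and nu: "riesz_measure u \<nu>"
    and q0_nonneg: "\<forall>x. q0 x \<ge> 0"
    and q0_meas: "q0 \<in> borel_measurable lebesgue"
    and q0_locint: "\<forall>a b. (\<integral>\<^sup>+ x. e2ennreal (q0 x) * indicator {a..b} x \<partial>lebesgue) < \<infinity>"
    and q_nonneg: "\<forall>y. q y \<ge> 0"
    and q_cont: "continuous_on UNIV q"
    and q_growth: "Limsup at_infinity (\<lambda>y. ereal (q y / \<bar>y\<bar>)) < 1"
    and E_sub: "E \<subseteq> {0..}" and E_meas: "E \<in> sets lebesgue"
    and main: "\<forall>y \<in> {0..} - E.
        u (\<i> * of_real y) + u (- \<i> * of_real y)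
          \<le> circ_mean M (\<i> * of_real y) (q y) + circ_mean M (- \<i> * of_real y) (q (- y))
             + q0 y + q0 (- y)"
  shows "\<forall>r0 > 0. \<forall>N \<ge> (0::real). \<exists>C \<ge> (0::real). \<forall>r R. r0 \<le> r \<and> r < R \<longrightarrow>
           max (ereal (l_meas \<nu> r R)) (J_iR r R u)
             \<le> min (ereal (l_rh \<mu> r R)) (min (ereal (l_lh \<mu> r R)) (J_iR r R M))
                + ereal C * J_R r R (\<lambda>x. q0 x + ereal (qE E x))
                + ereal C * I_N N r R q + ereal C"
proof (intro allI impI)
  fix r0 N :: real assume r0: "0 < r0" and N: "0 \<le> N"
  have M: "finite_type_subharmonic M \<mu>" by unfold_locales fact+
  have U: "finite_type_subharmonic u \<nu>" by unfold_locales fact+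
  interpret M: finite_type_subharmonic M \<mu> by (rule M)
  interpret U: finite_type_subharmonic u \<nu> by (rule U)
  have axis: "\<i> * complex_of_real y = Complex 0 y" "- \<i> * complex_of_real y = Complex 0 (- y)" for y
    by (simp_all add: complex_eq_iff)
  have main': "u (Complex 0 y) + u (Complex 0 (- y))
      \<le> circ_mean M (Complex 0 y) (q y) + circ_mean M (Complex 0 (- y)) (q (- y)) + q0 y + q0 (- y)"
    if "0 \<le> y" "y \<notin> E" for y using main[unfolded axis] that by simp
  obtain C1 where C1: "0 \<le> C1" "\<And>r R \<eta>. r0 \<le> r \<Longrightarrow> r < R \<Longrightarrow> \<eta> = 1 \<or> \<eta> = -1 \<Longrightarrow>
    2 * pi * half_mass \<nu> \<eta> r R \<le> U.line_mean r R + C1" by (rule U.half_mass_le_line_mean[OF r0]) (rule that)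
  obtain C2 where C2: "0 \<le> C2" "\<And>r R \<eta>. r0 \<le> r \<Longrightarrow> r < R \<Longrightarrow> \<eta> = 1 \<or> \<eta> = -1 \<Longrightarrow>
    M.line_mean r R \<le> 2 * pi * half_mass \<mu> \<eta> r R + C2" by (rule M.line_mean_le_half_mass[OF r0]) (rule that)
  let ?I = "\<lambda>r R. \<integral>\<^sup>+t. ennreal (t powr N) * e2ennreal (tail_sup N q t) * indicator {r..R} t \<partial>lebesgue"
  let ?J = "\<lambda>r R. \<integral>\<^sup>+x. e2ennreal ((q0 x + ereal (qE E x) + (q0 (- x) + ereal (qE E (- x)))) / ereal (x\<^sup>2)) * indicator {r..R} x \<partial>lebesgue"
  obtain a b c where abc: "0 \<le> a" "0 \<le> b" "0 \<le> c" "\<And>r R. r0 \<le> r \<Longrightarrow> r < R \<Longrightarrow>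
      ennreal (U.line_mean r R - M.line_mean r R) \<le> ennreal a + ennreal b * ?I r R + ennreal c * ?J r R"
    by (rule imaginary_axis_comparison[OF M U _ q0_meas _ q_cont q_growth E_meas _ r0 N],
        rule q0_nonneg[rule_format], rule q_nonneg[rule_format], rule main', assumption, assumption) (rule that)
  \<comment> \<open>The summand 1 makes \<open>C\<close> strictly positive, so that an infinite
    integral renders the right-hand side infinite.\<close>
  define C where "C = C1 + C2 + a + b + c + 1"
  have C: "0 < C" using C1(1) C2(1) abc by (simp add: C_def)
  show "\<exists>C\<ge>0. \<forall>r R. r0 \<le> r \<and> r < R \<longrightarrow>
      max (ereal (l_meas \<nu> r R)) (J_iR r R u)
        \<le> min (ereal (l_rh \<mu> r R)) (min (ereal (l_lh \<mu> r R)) (J_iR r R M))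
          + ereal C * J_R r R (\<lambda>x. q0 x + ereal (qE E x)) + ereal C * I_N N r R q + ereal C"
  proof (intro exI[of _ C] conjI allI impI)
    show "0 \<le> C" using C by simp
    fix r R assume "r0 \<le> r \<and> r < R"
    then have rR: "r0 \<le> r" "r < R" and r: "0 < r" using r0 by auto
    have JM: "J_iR r R M = ereal (M.line_mean r R / (2 * pi))" by (rule M.J_iR_eq_line_mean[OF r rR(2)])
    have JU: "J_iR r R u = ereal (U.line_mean r R / (2 * pi))" by (rule U.J_iR_eq_line_mean[OF r rR(2)])
    have "0 \<le> q0 x + ereal (qE E x)" for x using q0_nonneg qE_nonneg[OF E_meas, of x] by simp
    then have JR: "J_R r R (\<lambda>x. q0 x + ereal (qE E x)) = enn2ereal (?J r R) / ereal (2 * pi)" by (rule J_R_nonneg_eq)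
    have IN: "I_N N r R q = enn2ereal (?I r R)" by (simp add: I_N_def tail_sup_def)
    have ereal_lattice: "max (ereal v) (ereal w) = ereal (max v w)" "min (ereal v) (ereal w) = ereal (min v w)" for v w
      by (simp_all add: max_def min_def)
    \<comment> \<open>If \<open>I\<close> or \<open>J\<close> is infinite the inequality is trivial;
      otherwise it concerns real numbers only, which is the form in which the bounds are
      combined.\<close>
    have *: "ereal v \<le> ereal w + ereal C * (enn2ereal J / ereal (2 * pi)) + ereal C * enn2ereal I + ereal C"
      if "\<And>i j. 0 \<le> i \<Longrightarrow> 0 \<le> j \<Longrightarrow> I = ennreal i \<Longrightarrow> J = ennreal j \<Longrightarrow> v \<le> w + C * (j / (2 * pi)) + C * i + C"
      for v w I J
    proof (cases I rule: ennreal_cases)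
      case (real i)
      show ?thesis
      proof (cases J rule: ennreal_cases)
        case j: (real j)
        show ?thesis using that[OF real(1) j(1) real(2) j(2)] real j by simp
      next
        case top
        then show ?thesis using C real by simp
      qed
    next
      case top
      have "0 \<le> enn2ereal J / ereal (2 * pi)" by simp
      then have "ereal C * (enn2ereal J / ereal (2 * pi)) \<noteq> - \<infinity>" using C
        by (cases "enn2ereal J / ereal (2 * pi)") auto
      then show ?thesis using C top by simp
    qed
    show "max (ereal (l_meas \<nu> r R)) (J_iR r R u)
        \<le> min (ereal (l_rh \<mu> r R)) (min (ereal (l_lh \<mu> r R)) (J_iR r R M))
          + ereal C * J_R r R (\<lambda>x. q0 x + ereal (qE E x)) + ereal C * I_N N r R q + ereal C"
      unfolding JM JU JR IN l_meas_def ereal_lattice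
    proof (rule *)
      fix i j :: real assume ij: "0 \<le> i" "0 \<le> j" "?I r R = ennreal i" "?J r R = ennreal j"
      have "ennreal (U.line_mean r R - M.line_mean r R) \<le> ennreal (a + b * i + c * j)"
        using abc(4)[OF rR] abc(1-3) ij by (simp add: ennreal_mult[symmetric])
      then have cmp: "U.line_mean r R - M.line_mean r R \<le> a + b * i + c * j"
        using abc(1-3) ij by (subst (asm) ennreal_le_iff) auto
      show "max (max (l_lh \<nu> r R) (l_rh \<nu> r R)) (U.line_mean r R / (2 * pi))
        \<le> min (l_rh \<mu> r R) (min (l_lh \<mu> r R) (M.line_mean r R / (2 * pi))) + C * (j / (2 * pi)) + C * i + C"
      proof (rule combine_bounds[OF _ _ _ _ cmp C1(1) C2(1) abc(1-3) ij(1,2)])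
        show "C1 + C2 + a + b + c \<le> C" by (simp add: C_def)
      qed (use C1(2)[OF rR] C2(2)[OF rR] in \<open>simp_all add: half_mass_eq_l_rh[symmetric] half_mass_eq_l_lh[symmetric]\<close>)
    qed
  qed
qed

end
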